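(* Let $k$ be an algebraically closed field of characteristic zero, $n$ a positive integer with $4\mid n$, $q\in k$ a primitive $n^2$-th root of unity, and $A=\mathrm{Qu}_q(\mathfrak{sl}_2)$. Let $B(A)$ be the basic algebra of $A$. Then $B(A)$ has a Hopf algebra structure such that $B(A)\cong \mathbf h(-1,1)\otimes k\mathbb Z_{n^2/2}$ as Hopf algebras, where $\mathbf h(-1,1)$ is the book algebra defined in the context and $k\mathbb Z_{n^2/2}$ is the group algebra of the cyclic group of order $\frac{n^2}{2}$.
   Context: Let $\mathfrak q:=q^n$. The associative unital $k$-algebra $A=\mathrm{Qu}_q(\mathfrak{sl}_2)$ is generated by $\kappa,\hat\kappa,E,F$ with relations $\kappa^n=1$, $\hat\kappa^n=\kappa^{-2}$, $\kappa\hat\kappa=\hat\kappa\kappa$, $\kappa E\kappa^{-1}=\mathfrak qE$, $\kappa F\kappa^{-1}=\mathfrak q^{-1}F$, $\hat\kappa E\hat\kappa^{-1}=\mathfrak q q^{-2}E$, $\hat\kappa F\hat\kappa^{-1}=\mathfrak q^{-1}q^2F$, $E^{n^2}=F^{n^2}=0$, $FE-q^{-1}EF=1-\kappa^{-1}\hat\kappa$. It is finite-dimensional. The basic algebra $B(A)$ of a finite-dimensional algebra $A$ is the (unique up to isomorphism) basic algebra Morita equivalent to $A$, i.e. the opposite algebra of the endomorphism algebra of the direct sum of one copy of each indecomposable projective left $A$-module. Book algebra: for $\zeta_l$ a primitive $l$-th root of unity and $m$ a positive integer with $(m,l)=1$, $\mathbf h(\zeta_l,m)=k\langle y,x,g\rangle/(x^l,\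 y^l,\ g^l-1,\ gx-\zeta_lxg,\ gy-\zeta_l^m yg,\ xy-yx)$, with $\Delta(x)=x\otimes g+1\otimes x$, $\Delta(y)=y\otimes1+g^m\otimes y$, $\Delta(g)=g\otimes g$, $S(x)=-xg^{-1}$, $S(y)=-g^{-m}y$, $S(g)=g^{-1}$, $\varepsilon(x)=\varepsilon(y)=0$, $\varepsilon(g)=1$. Thus $\mathbf h(-1,1)$ is the case $l=2$, $\zeta_l=-1$, $m=1$. *)

theory Defs
  imports
    "HOL-Computational_Algebra.Polynomial"
    "HOL-Library.Poly_Mapping"
    "HOL-Algebra.Elementary_Groups"
    "HOL-Algebra.QuotRing"
    "HOL-Algebra.Module"
begin

text \<open>
  The ground field \<open>k\<close> is a type \<open>'k\<close> of class \<^class>\<open>field\<close>; algebras and modules are objects with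
  carriers, i.e. records of the library type \<open>('k, 'a) module\<close> (a ring together with a scalar action).
\<close>

section \<open>Algebras over a field\<close>

definition ground_field :: "('k::field, 'k) module" where
  "ground_field = \<lparr>carrier = UNIV, mult = (*), one = 1, zero = 0, add = (+), smult = (*)\<rparr>"

locale k_algebra = module ground_field A + ring A
  for A :: "('k::field, 'a, 'r) module_scheme" (structure) +
  assumes smult_mult_left:
      "\<lbrakk>x \<in> carrier A; y \<in> carrier A\<rbrakk> \<Longrightarrow> (c \<odot> x) \<otimes> y = c \<odot> (x \<otimes> y)"
    and smult_mult_right:
      "\<lbrakk>x \<in> carrier A; y \<in> carrier A\<rbrakk> \<Longrightarrow> x \<otimes> (c \<odot> y) = c \<odot> (x \<otimes> y)"

definition alg_hom ::
    "('k, 'a, 'r) module_scheme \<Rightarrow> ('k, 'b, 's) module_scheme \<Rightarrow> ('a \<Rightarrow> 'b) set" where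
  "alg_hom A B =
     {f \<in> ring_hom A B. \<forall>c. \<forall>x\<in>carrier A. f (c \<odot>\<^bsub>A\<^esub> x) = c \<odot>\<^bsub>B\<^esub> f x}"

definition alg_iso ::
    "('k, 'a, 'r) module_scheme \<Rightarrow> ('k, 'b, 's) module_scheme \<Rightarrow> ('a \<Rightarrow> 'b) set" where
  "alg_iso A B = {f \<in> alg_hom A B. bij_betw f (carrier A) (carrier B)}"

definition opposite_alg :: "('k, 'a, 'r) module_scheme \<Rightarrow> ('k, 'a) module" where
  "opposite_alg A =
     \<lparr>carrier = carrier A, mult = (\<lambda>x y. y \<otimes>\<^bsub>A\<^esub> x), one = \<one>\<^bsub>A\<^esub>,
      zero = \<zero>\<^bsub>A\<^esub>, add = add A, smult = smult A\<rparr>"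

text \<open>The monoid algebra \<open>k[G]\<close>; the monoid element \<open>x\<close> is \<^term>\<open>Poly_Mapping.single x 1\<close>.\<close>

definition monoid_alg :: "('g, 'r) monoid_scheme \<Rightarrow> ('k::field, 'g \<Rightarrow>\<^sub>0 'k) module" where
  "monoid_alg G =
     \<lparr>carrier = {u. Poly_Mapping.keys u \<subseteq> carrier G},
      mult = (\<lambda>u v. \<Sum>x\<in>Poly_Mapping.keys u. \<Sum>y\<in>Poly_Mapping.keys v.
        Poly_Mapping.single (x \<otimes>\<^bsub>G\<^esub> y) (Poly_Mapping.lookup u x * Poly_Mapping.lookup v y)),
      one = Poly_Mapping.single \<one>\<^bsub>G\<^esub> 1, zero = 0, add = (+),
      smult = (\<lambda>c. Poly_Mapping.map ((*) c))\<rparr>"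

text \<open>
  Quotient of an algebra by the two-sided ideal generated by \<open>l - r\<close> for all pairs
  \<open>(l, r)\<close> in a set of relations \<open>R\<close>. Elements are cosets.
\<close>

definition rel_ideal :: "('k, 'a, 'r) module_scheme \<Rightarrow> ('a \<times> 'a) set \<Rightarrow> 'a set" where
  "rel_ideal A R = Idl\<^bsub>A\<^esub> ((\<lambda>(l, r). l \<ominus>\<^bsub>A\<^esub> r) ` R)"

definition quot_class :: "('k, 'a, 'r) module_scheme \<Rightarrow> ('a \<times> 'a) set \<Rightarrow> 'a \<Rightarrow> 'a set" where
  "quot_class A R x = rel_ideal A R +>\<^bsub>A\<^esub> x"

definition quot_alg ::
    "('k, 'a, 'r) module_scheme \<Rightarrow> ('a \<times> 'a) set \<Rightarrow> ('k, 'a set) module" where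
  "quot_alg A R = ring.extend (A Quot rel_ideal A R)
     (module.fields (\<lambda>c X. \<Union>x\<in>X. quot_class A R (c \<odot>\<^bsub>A\<^esub> x)))"

text \<open>Free algebras: words in the generators, multiplied by concatenation.\<close>

definition word_monoid :: "'x list monoid" where
  "word_monoid = \<lparr>carrier = UNIV, mult = (@), one = []\<rparr>"

definition free_alg :: "('k::field, 'x list \<Rightarrow>\<^sub>0 'k) module" where
  "free_alg = monoid_alg word_monoid"

definition free_gen :: "'x \<Rightarrow> ('x list \<Rightarrow>\<^sub>0 'k::field)" where
  "free_gen x = Poly_Mapping.single [x] 1"

text \<open>
  Linear extension of a map \<open>\<phi>\<close> given on a basis, first to formal linear combinations, then to
  cosets of such. The latter is meaningful when the value does not depend on the
  representative (only then is the image a singleton).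
\<close>

definition lin_ext ::
    "('k::field, 'v, 'r) module_scheme \<Rightarrow> ('x \<Rightarrow> 'v) \<Rightarrow> ('x \<Rightarrow>\<^sub>0 'k) \<Rightarrow> 'v" where
  "lin_ext V \<phi> u =
     (\<Oplus>\<^bsub>V\<^esub>x\<in>Poly_Mapping.keys u. Poly_Mapping.lookup u x \<odot>\<^bsub>V\<^esub> \<phi> x)"

definition quot_lift ::
    "('k::field, 'v, 'r) module_scheme \<Rightarrow> ('x \<Rightarrow> 'v) \<Rightarrow> ('x \<Rightarrow>\<^sub>0 'k) set \<Rightarrow> 'v" where
  "quot_lift V \<phi> X = the_elem (lin_ext V \<phi> ` X)"

text \<open>The value of a word when the generators are sent to \<open>\<phi>\<close>: the algebra map on a quotient of a
  free algebra determined by \<open>\<phi>\<close> is \<open>quot_lift T (word_val T \<phi>)\<close>.\<close>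

definition word_val :: "('v, 'r) monoid_scheme \<Rightarrow> ('x \<Rightarrow> 'v) \<Rightarrow> 'x list \<Rightarrow> 'v" where
  "word_val T \<phi> w = foldr (\<lambda>x t. \<phi> x \<otimes>\<^bsub>T\<^esub> t) w \<one>\<^bsub>T\<^esub>"

section \<open>Tensor products\<close>

text \<open>
  \<open>A \<otimes> B\<close> is the vector space with basis \<open>A \<times> B\<close> modulo bilinearity, with
  \<open>(a \<otimes> b)(a' \<otimes> b') = aa' \<otimes> bb'\<close>. The span of the bilinearity relations
  is stable under multiplication by pairs, so it is the ideal they generate in \<open>k[A \<times> B]\<close>.
\<close>

type_synonym ('k, 'a, 'b) tensor = "(('a \<times> 'b) \<Rightarrow>\<^sub>0 'k) set"

definition bilinear_rels ::
    "('k::field, 'a, 'r) module_scheme \<Rightarrow> ('k, 'b, 's) module_scheme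
       \<Rightarrow> ((('a \<times> 'b) \<Rightarrow>\<^sub>0 'k) \<times> (('a \<times> 'b) \<Rightarrow>\<^sub>0 'k)) set" where
  "bilinear_rels A B =
     (let e = (\<lambda>a b. Poly_Mapping.single (a, b) (1::'k)) in
       {(e (a \<oplus>\<^bsub>A\<^esub> a') b, e a b + e a' b) | a a' b.
          a \<in> carrier A \<and> a' \<in> carrier A \<and> b \<in> carrier B}
     \<union> {(e a (b \<oplus>\<^bsub>B\<^esub> b'), e a b + e a b') | a b b'.
          a \<in> carrier A \<and> b \<in> carrier B \<and> b' \<in> carrier B}
     \<union> {(e (c \<odot>\<^bsub>A\<^esub> a) b, Poly_Mapping.single (a, b) c) | a b c.
          a \<in> carrier A \<and> b \<in> carrier B}
     \<union> {(e a (c \<odot>\<^bsub>B\<^esub> b), Poly_Mapping.single (a, b) c) | a b c.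
          a \<in> carrier A \<and> b \<in> carrier B})"

definition tensor_alg ::
    "('k::field, 'a, 'r) module_scheme \<Rightarrow> ('k, 'b, 's) module_scheme
       \<Rightarrow> ('k, ('k, 'a, 'b) tensor) module" where
  "tensor_alg A B = quot_alg (monoid_alg (A \<times>\<times> B)) (bilinear_rels A B)"

definition pure_tensor ::
    "('k::field, 'a, 'r) module_scheme \<Rightarrow> ('k, 'b, 's) module_scheme
       \<Rightarrow> 'a \<Rightarrow> 'b \<Rightarrow> ('k, 'a, 'b) tensor" where
  "pure_tensor A B a b =
     quot_class (monoid_alg (A \<times>\<times> B)) (bilinear_rels A B) (Poly_Mapping.single (a, b) 1)"

text \<open>The linear map \<open>A \<otimes> B \<rightarrow> V\<close> induced by a bilinear map \<open>\<beta>\<close>.\<close>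

definition tensor_lift ::
    "('k::field, 'v, 'r) module_scheme \<Rightarrow> ('a \<Rightarrow> 'b \<Rightarrow> 'v) \<Rightarrow> ('k, 'a, 'b) tensor \<Rightarrow> 'v" where
  "tensor_lift V \<beta> = quot_lift V (\<lambda>(a, b). \<beta> a b)"

section \<open>Hopf algebras\<close>

record (overloaded) ('k, 'a) hopf = "('k::zero, 'a) module" +
  comult :: "'a \<Rightarrow> ('k, 'a, 'a) tensor"
  counit :: "'a \<Rightarrow> 'k"
  antipode :: "'a \<Rightarrow> 'a"

text \<open>
  Coassociativity is stated in \<open>H \<otimes> (H \<otimes> H)\<close>, with \<open>(H \<otimes> H) \<otimes> H\<close> identified with it
  by the canonical isomorphism.
\<close>

locale hopf_algebra = k_algebra H
  for H :: "('k::field, 'a, 'r) hopf_scheme" (structure) +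
  assumes comult_hom: "comult H \<in> alg_hom H (tensor_alg H H)"
    and counit_hom: "counit H \<in> alg_hom H ground_field"
    and coassoc: "h \<in> carrier H \<Longrightarrow>
      tensor_lift (tensor_alg H (tensor_alg H H))
        (\<lambda>a b. pure_tensor H (tensor_alg H H) a (comult H b)) (comult H h)
      = tensor_lift (tensor_alg H (tensor_alg H H))
          (\<lambda>a b. tensor_lift (tensor_alg H (tensor_alg H H))
             (\<lambda>a\<^sub>1 a\<^sub>2. pure_tensor H (tensor_alg H H) a\<^sub>1 (pure_tensor H H a\<^sub>2 b)) (comult H a))
          (comult H h)"
    and counit_left: "h \<in> carrier H \<Longrightarrow>
      tensor_lift H (\<lambda>a b. counit H a \<odot> b) (comult H h) = h"
    and counit_right: "h \<in> carrier H \<Longrightarrow>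
      tensor_lift H (\<lambda>a b. counit H b \<odot> a) (comult H h) = h"
    and antipode_closed: "h \<in> carrier H \<Longrightarrow> antipode H h \<in> carrier H"
    and antipode_add: "\<lbrakk>h \<in> carrier H; h' \<in> carrier H\<rbrakk> \<Longrightarrow>
      antipode H (h \<oplus> h') = antipode H h \<oplus> antipode H h'"
    and antipode_smult: "h \<in> carrier H \<Longrightarrow> antipode H (c \<odot> h) = c \<odot> antipode H h"
    and antipode_left: "h \<in> carrier H \<Longrightarrow>
      tensor_lift H (\<lambda>a b. antipode H a \<otimes> b) (comult H h) = counit H h \<odot> \<one>"
    and antipode_right: "h \<in> carrier H \<Longrightarrow>
      tensor_lift H (\<lambda>a b. a \<otimes> antipode H b) (comult H h) = counit H h \<odot> \<one>"

definition hopf_isomorphic ::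
    "('k::field, 'a, 'r) hopf_scheme \<Rightarrow> ('k, 'b, 's) hopf_scheme \<Rightarrow> bool" where
  "hopf_isomorphic H K \<longleftrightarrow> hopf_algebra H \<and> hopf_algebra K \<and>
     (\<exists>f\<in>alg_iso H K. \<forall>h\<in>carrier H.
        comult K (f h) = tensor_lift (tensor_alg K K) (\<lambda>a b. pure_tensor K K (f a) (f b)) (comult H h)
        \<and> counit K (f h) = counit H h
        \<and> antipode K (f h) = f (antipode H h))"

definition tensor_hopf ::
    "('k::field, 'a, 'r) hopf_scheme \<Rightarrow> ('k, 'b, 's) hopf_scheme
       \<Rightarrow> ('k, ('k, 'a, 'b) tensor) hopf" where
  "tensor_hopf H K = (let T = tensor_alg H K in
     module.extend T (hopf.fields
       (tensor_lift (tensor_alg T T) (\<lambda>h k.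
          tensor_lift (tensor_alg T T) (\<lambda>h\<^sub>1 h\<^sub>2.
            tensor_lift (tensor_alg T T) (\<lambda>k\<^sub>1 k\<^sub>2.
              pure_tensor T T (pure_tensor H K h\<^sub>1 k\<^sub>1) (pure_tensor H K h\<^sub>2 k\<^sub>2))
            (comult K k))
          (comult H h)))
       (tensor_lift ground_field (\<lambda>h k. counit H h * counit K k))
       (tensor_lift T (\<lambda>h k. pure_tensor H K (antipode H h) (antipode K k)))))"

definition group_hopf :: "('g, 'r) monoid_scheme \<Rightarrow> ('k::field, 'g \<Rightarrow>\<^sub>0 'k) hopf" where
  "group_hopf G =
     (let A = monoid_alg G; \<delta> = (\<lambda>g. Poly_Mapping.single g (1::'k)) in
      module.extend A (hopf.fields
       (lin_ext (tensor_alg A A) (\<lambda>g. pure_tensor A A (\<delta> g) (\<delta> g)))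
       (lin_ext ground_field (\<lambda>g. 1))
       (lin_ext A (\<lambda>g. \<delta> (inv\<^bsub>G\<^esub> g)))))"

section \<open>The book algebra\<close>

datatype book_gen = Book_y | Book_x | Book_g

definition book_rels ::
    "'k::field \<Rightarrow> nat \<Rightarrow> nat \<Rightarrow> ((book_gen list \<Rightarrow>\<^sub>0 'k) \<times> (book_gen list \<Rightarrow>\<^sub>0 'k)) set" where
  "book_rels \<zeta> l m =
     (let L = free_alg; x = free_gen Book_x; y = free_gen Book_y; g = free_gen Book_g in
      {(x [^]\<^bsub>L\<^esub> l, \<zero>\<^bsub>L\<^esub>),
       (y [^]\<^bsub>L\<^esub> l, \<zero>\<^bsub>L\<^esub>),
       (g [^]\<^bsub>L\<^esub> l, \<one>\<^bsub>L\<^esub>),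
       (g \<otimes>\<^bsub>L\<^esub> x, \<zeta> \<odot>\<^bsub>L\<^esub> (x \<otimes>\<^bsub>L\<^esub> g)),
       (g \<otimes>\<^bsub>L\<^esub> y, \<zeta> ^ m \<odot>\<^bsub>L\<^esub> (y \<otimes>\<^bsub>L\<^esub> g)),
       (x \<otimes>\<^bsub>L\<^esub> y, y \<otimes>\<^bsub>L\<^esub> x)})"

definition book_alg :: "'k::field \<Rightarrow> nat \<Rightarrow> nat \<Rightarrow> ('k, (book_gen list \<Rightarrow>\<^sub>0 'k) set) module" where
  "book_alg \<zeta> l m = quot_alg free_alg (book_rels \<zeta> l m)"

text \<open>
  The comultiplication and counit are the algebra maps, and the antipode the algebra map to the
  opposite algebra, with the given values on generators.
\<close>

definition book_hopf :: "'k::field \<Rightarrow> nat \<Rightarrow> nat \<Rightarrow> ('k, (book_gen list \<Rightarrow>\<^sub>0 'k) set) hopf" where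
  "book_hopf \<zeta> l m =
     (let H = book_alg \<zeta> l m;
          T = tensor_alg H H;
          t = pure_tensor H H;
          cls = (\<lambda>z. quot_class free_alg (book_rels \<zeta> l m) (free_gen z));
          x = cls Book_x; y = cls Book_y; g = cls Book_g
      in module.extend H (hopf.fields
        (quot_lift T (word_val T (\<lambda>z. case z of
            Book_x \<Rightarrow> t x g \<oplus>\<^bsub>T\<^esub> t \<one>\<^bsub>H\<^esub> x
          | Book_y \<Rightarrow> t y \<one>\<^bsub>H\<^esub> \<oplus>\<^bsub>T\<^esub> t (g [^]\<^bsub>H\<^esub> m) y
          | Book_g \<Rightarrow> t g g)))
        (quot_lift ground_field (word_val ground_field (\<lambda>z. case z of
            Book_x \<Rightarrow> 0 | Book_y \<Rightarrow> 0 | Book_g \<Rightarrow> 1)))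
        (quot_lift (opposite_alg H) (word_val (opposite_alg H) (\<lambda>z. case z of
            Book_x \<Rightarrow> \<ominus>\<^bsub>H\<^esub> (x \<otimes>\<^bsub>H\<^esub> inv\<^bsub>H\<^esub> g)
          | Book_y \<Rightarrow> \<ominus>\<^bsub>H\<^esub> (inv\<^bsub>H\<^esub> (g [^]\<^bsub>H\<^esub> m) \<otimes>\<^bsub>H\<^esub> y)
          | Book_g \<Rightarrow> inv\<^bsub>H\<^esub> g)))))"

section \<open>The algebra \<open>Qu\<^sub>q(sl\<^sub>2)\<close>\<close>

definition primitive_root_of_unity :: "nat \<Rightarrow> 'k::field \<Rightarrow> bool" where
  "primitive_root_of_unity N z \<longleftrightarrow>
     0 < N \<and> z ^ N = 1 \<and> (\<forall>j. 0 < j \<and> j < N \<longrightarrow> z ^ j \<noteq> 1)"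

datatype qu_gen = Qu_kappa | Qu_kappa_hat | Qu_E | Qu_F

text \<open>
  Since \<open>\<kappa>\<^sup>n = 1\<close>, the inverse of \<open>\<kappa>\<close> is the word \<open>\<kappa>\<^sup>n\<^sup>-\<^sup>1\<close>. By \<open>\<kappa>h\<^sup>n = \<kappa>\<^sup>-\<^sup>2\<close> also
  \<open>\<kappa>h\<close> (the hatted generator) is invertible, so the conjugation relations
  \<open>zEz\<^sup>-\<^sup>1 = cE\<close> may be written \<open>zE = cEz\<close>.
\<close>

definition qu_rels ::
    "nat \<Rightarrow> 'k::field \<Rightarrow> ((qu_gen list \<Rightarrow>\<^sub>0 'k) \<times> (qu_gen list \<Rightarrow>\<^sub>0 'k)) set" where
  "qu_rels n q =
     (let L = free_alg;
          \<kappa> = free_gen Qu_kappa; \<kappa>h = free_gen Qu_kappa_hat; E = free_gen Qu_E; F = free_gen Qu_F;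
          \<kappa>i = \<kappa> [^]\<^bsub>L\<^esub> (n - 1);
          qq = q ^ n
      in
      {(\<kappa> [^]\<^bsub>L\<^esub> n, \<one>\<^bsub>L\<^esub>),
       (\<kappa>h [^]\<^bsub>L\<^esub> n, \<kappa>i [^]\<^bsub>L\<^esub> (2::nat)),
       (\<kappa> \<otimes>\<^bsub>L\<^esub> \<kappa>h, \<kappa>h \<otimes>\<^bsub>L\<^esub> \<kappa>),
       (\<kappa> \<otimes>\<^bsub>L\<^esub> E, qq \<odot>\<^bsub>L\<^esub> (E \<otimes>\<^bsub>L\<^esub> \<kappa>)),
       (\<kappa> \<otimes>\<^bsub>L\<^esub> F, inverse qq \<odot>\<^bsub>L\<^esub> (F \<otimes>\<^bsub>L\<^esub> \<kappa>)),
       (\<kappa>h \<otimes>\<^bsub>L\<^esub> E, (qq * inverse (q ^ 2)) \<odot>\<^bsub>L\<^esub> (E \<otimes>\<^bsub>L\<^esub> \<kappa>h)),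
       (\<kappa>h \<otimes>\<^bsub>L\<^esub> F, (inverse qq * q ^ 2) \<odot>\<^bsub>L\<^esub> (F \<otimes>\<^bsub>L\<^esub> \<kappa>h)),
       (E [^]\<^bsub>L\<^esub> (n ^ 2), \<zero>\<^bsub>L\<^esub>),
       (F [^]\<^bsub>L\<^esub> (n ^ 2), \<zero>\<^bsub>L\<^esub>),
       ((F \<otimes>\<^bsub>L\<^esub> E) \<ominus>\<^bsub>L\<^esub> (inverse q \<odot>\<^bsub>L\<^esub> (E \<otimes>\<^bsub>L\<^esub> F)),
        \<one>\<^bsub>L\<^esub> \<ominus>\<^bsub>L\<^esub> (\<kappa>i \<otimes>\<^bsub>L\<^esub> \<kappa>h))})"

definition Qu_sl2 :: "nat \<Rightarrow> 'k::field \<Rightarrow> ('k, (qu_gen list \<Rightarrow>\<^sub>0 'k) set) module" where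
  "Qu_sl2 n q = quot_alg free_alg (qu_rels n q)"

section \<open>Modules over a noncommutative ring and the basic algebra\<close>

text \<open>
  The library locale \<^locale>\<open>module\<close> requires a commutative base ring. Only the additive structure
  and the action of a \<open>module\<close> record matter when it is used as a left module; its
  ring multiplication and unit are ignored.
\<close>

locale left_module = R?: ring R + M?: abelian_group M
  for R (structure) and M (structure) +
  assumes smult_closed:
      "\<lbrakk>a \<in> carrier R; x \<in> carrier M\<rbrakk> \<Longrightarrow> a \<odot>\<^bsub>M\<^esub> x \<in> carrier M"
    and smult_l_distr: "\<lbrakk>a \<in> carrier R; b \<in> carrier R; x \<in> carrier M\<rbrakk> \<Longrightarrow>
      (a \<oplus> b) \<odot>\<^bsub>M\<^esub> x = a \<odot>\<^bsub>M\<^esub> x \<oplus>\<^bsub>M\<^esub> b \<odot>\<^bsub>M\<^esub> x"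
    and smult_r_distr: "\<lbrakk>a \<in> carrier R; x \<in> carrier M; y \<in> carrier M\<rbrakk> \<Longrightarrow>
      a \<odot>\<^bsub>M\<^esub> (x \<oplus>\<^bsub>M\<^esub> y) = a \<odot>\<^bsub>M\<^esub> x \<oplus>\<^bsub>M\<^esub> a \<odot>\<^bsub>M\<^esub> y"
    and smult_assoc: "\<lbrakk>a \<in> carrier R; b \<in> carrier R; x \<in> carrier M\<rbrakk> \<Longrightarrow>
      (a \<otimes> b) \<odot>\<^bsub>M\<^esub> x = a \<odot>\<^bsub>M\<^esub> (b \<odot>\<^bsub>M\<^esub> x)"
    and smult_one: "x \<in> carrier M \<Longrightarrow> \<one> \<odot>\<^bsub>M\<^esub> x = x"

definition left_hom ::
    "('a, 'r) ring_scheme \<Rightarrow> ('a, 'm, 's) module_scheme \<Rightarrow> ('a, 'n, 't) module_scheme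
       \<Rightarrow> ('m \<Rightarrow> 'n) set" where
  "left_hom R M N =
     {f \<in> carrier M \<rightarrow> carrier N.
        (\<forall>x\<in>carrier M. \<forall>y\<in>carrier M. f (x \<oplus>\<^bsub>M\<^esub> y) = f x \<oplus>\<^bsub>N\<^esub> f y) \<and>
        (\<forall>a\<in>carrier R. \<forall>x\<in>carrier M. f (a \<odot>\<^bsub>M\<^esub> x) = a \<odot>\<^bsub>N\<^esub> f x)}"

definition left_isomorphic ::
    "('a, 'r) ring_scheme \<Rightarrow> ('a, 'm, 's) module_scheme \<Rightarrow> ('a, 'n, 't) module_scheme \<Rightarrow> bool" where
  "left_isomorphic R M N \<longleftrightarrow> (\<exists>f\<in>left_hom R M N. bij_betw f (carrier M) (carrier N))"

text \<open>External direct sum: families of finite support, with dummy ring multiplication and unit.\<close>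

definition direct_sum ::
    "'i set \<Rightarrow> ('i \<Rightarrow> ('a, 'm, 's) module_scheme) \<Rightarrow> ('a, 'i \<Rightarrow> 'm) module" where
  "direct_sum I P =
     \<lparr>carrier = {f \<in> \<Pi>\<^sub>E i\<in>I. carrier (P i). finite {i \<in> I. f i \<noteq> \<zero>\<^bsub>P i\<^esub>}},
      mult = undefined, one = undefined,
      zero = (\<lambda>i\<in>I. \<zero>\<^bsub>P i\<^esub>),
      add = (\<lambda>f g. \<lambda>i\<in>I. f i \<oplus>\<^bsub>P i\<^esub> g i),
      smult = (\<lambda>a f. \<lambda>i\<in>I. a \<odot>\<^bsub>P i\<^esub> f i)\<rparr>"

definition regular_module :: "('a, 'r) ring_scheme \<Rightarrow> ('a, 'a) module" where
  "regular_module R =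
     \<lparr>carrier = carrier R, mult = undefined, one = undefined, zero = \<zero>\<^bsub>R\<^esub>, add = add R,
      smult = mult R\<rparr>"

text \<open>
  Projective: a direct summand (retract) of a free module. Bases indexed by subsets of the element
  type of \<open>P\<close> suffice, because a summand of any free module is a summand of the free module on its
  own carrier.
\<close>

definition projective_module :: "('a, 'r) ring_scheme \<Rightarrow> ('a, 'm, 's) module_scheme \<Rightarrow> bool" where
  "projective_module R P \<longleftrightarrow> left_module R P \<and>
     (\<exists>I :: 'm set. \<exists>\<iota>\<in>left_hom R P (direct_sum I (\<lambda>_. regular_module R)).
        \<exists>\<pi>\<in>left_hom R (direct_sum I (\<lambda>_. regular_module R)) P. \<forall>x\<in>carrier P. \<pi> (\<iota> x) = x)"

definition indecomposable_module ::
    "('a, 'r) ring_scheme \<Rightarrow> ('a, 'm, 's) module_scheme \<Rightarrow> bool" where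
  "indecomposable_module R M \<longleftrightarrow> left_module R M \<and> carrier M \<noteq> {\<zero>\<^bsub>M\<^esub>} \<and>
     (\<forall>U V. submodule U R M \<and> submodule V R M \<and> U \<inter> V = {\<zero>\<^bsub>M\<^esub>} \<and> U <+>\<^bsub>M\<^esub> V = carrier M
        \<longrightarrow> U = {\<zero>\<^bsub>M\<^esub>} \<or> V = {\<zero>\<^bsub>M\<^esub>})"

text \<open>The endomorphism algebra of a left module over a \<open>k\<close>-algebra; maps are normalised to be
  extensional so that equality of elements is equality of maps.\<close>

definition endo_alg ::
    "('k, 'a, 'r) module_scheme \<Rightarrow> ('a, 'm, 's) module_scheme \<Rightarrow> ('k, 'm \<Rightarrow> 'm) module" where
  "endo_alg A M =
     \<lparr>carrier = left_hom A M M \<inter> extensional (carrier M),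
      mult = compose (carrier M),
      one = (\<lambda>x\<in>carrier M. x),
      zero = (\<lambda>x\<in>carrier M. \<zero>\<^bsub>M\<^esub>),
      add = (\<lambda>f g. \<lambda>x\<in>carrier M. f x \<oplus>\<^bsub>M\<^esub> g x),
      smult = (\<lambda>c f. \<lambda>x\<in>carrier M. (c \<odot>\<^bsub>A\<^esub> \<one>\<^bsub>A\<^esub>) \<odot>\<^bsub>M\<^esub> f x)\<rparr>"

text \<open>
  A set containing exactly one copy of each indecomposable projective left \<open>A\<close>-module up to
  isomorphism. It suffices to consider modules whose elements have the same type as those of \<open>A\<close>:
  for finite-dimensional \<open>A\<close> every indecomposable projective module is isomorphic to a left ideal.
\<close>

definition indec_proj_transversal ::
    "('a, 'r) ring_scheme \<Rightarrow> ('a, 'a) module set \<Rightarrow> bool" where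
  "indec_proj_transversal A S \<longleftrightarrow>
     S \<subseteq> {P. indecomposable_module A P \<and> projective_module A P} \<and>
     (\<forall>M :: ('a, 'a) module. indecomposable_module A M \<and> projective_module A M \<longrightarrow>
        (\<exists>!P. P \<in> S \<and> left_isomorphic A M P))"

definition is_basic_algebra ::
    "('k::field, 'a, 'r) module_scheme \<Rightarrow> ('k, 'b, 's) module_scheme \<Rightarrow> bool" where
  "is_basic_algebra A B \<longleftrightarrow> k_algebra B \<and>
     (\<exists>S. indec_proj_transversal A S \<and>
        alg_iso B (opposite_alg (endo_alg A (direct_sum S (\<lambda>P. P)))) \<noteq> {})"

end

theory Submission
  imports Defs
begin

text \<open>
  Let \<open>N = n\<^sup>2\<close>. The algebra \<open>A\<close> is identified with a product of \<open>N/2\<close> algebras of \<open>N \<times> N\<close> matrices over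
  \<open>k[x, y]/(x\<^sup>2, y\<^sup>2)\<close> whose rows and columns carry a parity: entries between positions of equal parity
  lie in the span of \<open>1, xy\<close>, the others in the span of \<open>x, y\<close>. On such a block \<open>F\<close> and \<open>E\<close> act as
  weighted cyclic shifts, with weights \<open>x\<close> and \<open>y\<close> exactly where the parity changes, and \<open>\<kappa>\<close> and the hatted
  generator act diagonally. The two parities correspond to the simple modules of the block, of
  dimensions \<open>r\<close> and \<open>N - r\<close> with \<open>r\<close> odd. The representing matrices generate, and the relations leave
  at most \<open>N\<^sup>3\<close> monomials, so surjectivity and the equality of dimensions give the isomorphism.

  Choosing one position of each parity in every block yields a basic algebra: a product of \<open>N/2\<close> copies
  of the \<open>2 \<times> 2\<close> supermatrices. One such copy is \<open>h(-1, 1)\<close> with \<open>x\<close>, \<open>y\<close> odd and \<open>g\<close> the parity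
  operator, and the product of \<open>N/2\<close> copies of \<open>k\<close> is the group algebra of \<open>\<int>/(N/2)\<close> by the discrete
  Fourier transform. The Hopf structure is transported along the resulting isomorphism; as all maps
  involved are (anti)multiplicative, the Hopf axioms need to be checked only on generators that are
  grouplike or skew primitive.
\<close>

section \<open>Linear maps and algebra homomorphisms\<close>

text \<open>Along a cycle of positions shifted by \<open>F\<close>, let \<open>v_i\<close> be the
  value of \<open>FE\<close> at position \<open>i\<close>. The relation between \<open>E\<close> and
  \<open>F\<close> becomes \<open>v_i - q^(-1) v_(i+1) = 1 - q^(2i - 2s)\<close>. Its solution with
  \<open>v_0 = 0\<close> is a multiple of \<open>(q^i - 1)(1 - q^(i - r))\<close> with
  \<open>r = 2s + 1\<close>; it vanishes exactly at \<open>0\<close> and \<open>r\<close> modulo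
  \<open>N\<close>, which is where the odd dimensions come from. The homogeneous solution
  \<open>q^i\<close> has period \<open>N\<close>, because \<open>q^N = 1\<close>, so it may be added
  with the nilpotent coefficient \<open>xy\<close>. This deformation gives a block its radical: at
  the two zeros \<open>xy\<close> is shared out as \<open>x\<close> for \<open>F\<close> and
  \<open>y\<close> for \<open>E\<close>. Evenness of \<open>n\<close> admits a sign
  \<open>(-1)^b\<close> on \<kappa>, hence two blocks for each \<open>s\<close>.

  The definition of a basic algebra fixes neither the representatives of the projectives nor the
  index sets of the free modules. Therefore every indecomposable projective is compared with the
  left ideal of a primitive idempotent by means of a nilpotent filtration, and \<open>B\<close> is
  reached only through an unspecified isomorphism with a corner \<open>EAE\<close>.\<close>

lemma ground_field_simps [simp]:
  "carrier ground_field = UNIV" "mult ground_field = (*)" "one ground_field = 1"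
  "zero ground_field = 0" "add ground_field = (+)" "smult ground_field = (*)"
  by (simp_all add: ground_field_def)

lemma cring_ground_field: "cring (ground_field :: ('k::field, 'k) module)"
  by unfold_locales
    (auto simp: Units_def algebra_simps intro: exI[of _ "- x" for x])

locale k_space = module ground_field V for V :: "('k::field, 'v, 'r) module_scheme" (structure)
begin

lemma scale_closed [simp, intro]: "x \<in> carrier V \<Longrightarrow> c \<odot> x \<in> carrier V"
  by (rule smult_closed) auto

lemma scale_add_left: "x \<in> carrier V \<Longrightarrow> (c + d) \<odot> x = c \<odot> x \<oplus> d \<odot> x"
  using smult_l_distr[of c d x] by simp

lemma scale_add_right: "x \<in> carrier V \<Longrightarrow> y \<in> carrier V \<Longrightarrow> c \<odot> (x \<oplus> y) = c \<odot> x \<oplus> c \<odot> y"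
  using smult_r_distr[of c x y] by simp

lemma scale_scale [simp]: "x \<in> carrier V \<Longrightarrow> c \<odot> (d \<odot> x) = (c * d) \<odot> x"
  using smult_assoc1[of c d x] by simp

lemma scale_one [simp]: "x \<in> carrier V \<Longrightarrow> 1 \<odot> x = x"
  using smult_one[of x] by simp

lemma scale_zero_left [simp]: "x \<in> carrier V \<Longrightarrow> 0 \<odot> x = \<zero>"
  using smult_l_null[of x] by simp

lemma scale_zero_right [simp]: "c \<odot> \<zero> = \<zero>"
  using smult_r_null[of c] by simp

lemma scale_minus_one: "x \<in> carrier V \<Longrightarrow> (- 1) \<odot> x = \<ominus> x"
proof -
  assume x: "x \<in> carrier V"
  have "(- 1) \<odot> x \<oplus> 1 \<odot> x = (- 1 + 1) \<odot> x"
    by (rule scale_add_left[OF x, symmetric])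
  then have "(- 1) \<odot> x \<oplus> x = \<zero>" using x by simp
  then show ?thesis using x by (metis M.minus_equality scale_closed)
qed

end

lemma k_spaceI:
  fixes V (structure)
  assumes "abelian_group V"
    "\<And>c x. x \<in> carrier V \<Longrightarrow> c \<odot> x \<in> carrier V"
    "\<And>c d x. x \<in> carrier V \<Longrightarrow> (c + d) \<odot> x = c \<odot> x \<oplus> d \<odot> x"
    "\<And>c x y. x \<in> carrier V \<Longrightarrow> y \<in> carrier V \<Longrightarrow> c \<odot> (x \<oplus> y) = c \<odot> x \<oplus> c \<odot> y"
    "\<And>c d x. x \<in> carrier V \<Longrightarrow> (c * d) \<odot> x = c \<odot> (d \<odot> x)"
    "\<And>x. x \<in> carrier V \<Longrightarrow> 1 \<odot> x = x"
  shows "k_space V"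
  unfolding k_space_def by (rule moduleI) (use assms in \<open>auto intro: cring_ground_field\<close>)

sublocale k_algebra \<subseteq> k_space A
  by (simp add: k_space_def module_axioms)

lemma k_algebraI:
  fixes A (structure)
  assumes "k_space A" "ring A"
    "\<And>c x y. \<lbrakk>x \<in> carrier A; y \<in> carrier A\<rbrakk> \<Longrightarrow> (c \<odot> x) \<otimes> y = c \<odot> (x \<otimes> y)"
    "\<And>c x y. \<lbrakk>x \<in> carrier A; y \<in> carrier A\<rbrakk> \<Longrightarrow> x \<otimes> (c \<odot> y) = c \<odot> (x \<otimes> y)"
  shows "k_algebra A"
  using assms by (simp add: k_algebra_def k_space_def k_algebra_axioms_def)

lemma k_algebra_k_space: "k_algebra A \<Longrightarrow> k_space A"
  by (simp add: k_algebra_def k_space_def)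

lemma k_algebra_ground_field: "k_algebra (ground_field :: ('k::field, 'k) module)"
proof -
  interpret cring "ground_field :: ('k, 'k) module" by (rule cring_ground_field)
  show ?thesis
    by (rule k_algebraI, rule k_spaceI) (auto simp: algebra_simps ring_axioms is_abelian_group)
qed

text \<open>The two records may have different types, so they cannot simply be equated. This is how
  a record with Hopf operations inherits the structure of its underlying algebra.\<close>

lemma k_algebra_cong:
  assumes "carrier A' = carrier A" "mult A' = mult A" "one A' = one A" "zero A' = zero A"
    "add A' = add A" "smult A' = smult A" "k_algebra A"
  shows "k_algebra A'"
proof -
  interpret k_algebra A by fact
  have "abelian_group A'"
    by (rule abelian_groupI) (use assms(1-6) a_assoc a_comm l_neg in \<open>auto intro!: bexI[of _ "\<ominus>\<^bsub>A\<^esub> x" for x]\<close>)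
  moreover have "monoid A'"
    by (rule monoidI) (use assms(1-6) m_assoc in auto)
  ultimately have "ring A'"
    by (rule ringI) (use assms(1-6) l_distr r_distr in auto)
  then show ?thesis
    by (intro k_algebraI k_spaceI \<open>abelian_group A'\<close>)
      (use assms(1-6) in \<open>auto simp: scale_add_left scale_add_right smult_mult_left smult_mult_right\<close>)
qed

definition lin_map ::
    "('k, 'v, 'r) module_scheme \<Rightarrow> ('k, 'w, 's) module_scheme \<Rightarrow> ('v \<Rightarrow> 'w) \<Rightarrow> bool" where
  "lin_map V W f \<longleftrightarrow> f \<in> carrier V \<rightarrow> carrier W \<and>
     (\<forall>x\<in>carrier V. \<forall>y\<in>carrier V. f (x \<oplus>\<^bsub>V\<^esub> y) = f x \<oplus>\<^bsub>W\<^esub> f y) \<and>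
     (\<forall>c. \<forall>x\<in>carrier V. f (c \<odot>\<^bsub>V\<^esub> x) = c \<odot>\<^bsub>W\<^esub> f x)"

lemma lin_mapI:
  assumes "\<And>x. x \<in> carrier V \<Longrightarrow> f x \<in> carrier W"
    "\<And>x y. x \<in> carrier V \<Longrightarrow> y \<in> carrier V \<Longrightarrow> f (x \<oplus>\<^bsub>V\<^esub> y) = f x \<oplus>\<^bsub>W\<^esub> f y"
    "\<And>c x. x \<in> carrier V \<Longrightarrow> f (c \<odot>\<^bsub>V\<^esub> x) = c \<odot>\<^bsub>W\<^esub> f x"
  shows "lin_map V W f"
  using assms by (auto simp: lin_map_def)

lemma lin_map_closed: "lin_map V W f \<Longrightarrow> x \<in> carrier V \<Longrightarrow> f x \<in> carrier W"
  by (auto simp: lin_map_def)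

lemma lin_map_add:
  "lin_map V W f \<Longrightarrow> x \<in> carrier V \<Longrightarrow> y \<in> carrier V \<Longrightarrow> f (x \<oplus>\<^bsub>V\<^esub> y) = f x \<oplus>\<^bsub>W\<^esub> f y"
  by (auto simp: lin_map_def)

lemma lin_map_smult: "lin_map V W f \<Longrightarrow> x \<in> carrier V \<Longrightarrow> f (c \<odot>\<^bsub>V\<^esub> x) = c \<odot>\<^bsub>W\<^esub> f x"
  by (auto simp: lin_map_def)

lemma lin_map_zero:
  assumes "k_space V" "k_space W" "lin_map V W f" shows "f \<zero>\<^bsub>V\<^esub> = \<zero>\<^bsub>W\<^esub>"
proof -
  interpret V: k_space V by fact
  interpret W: k_space W by fact
  have "f (0 \<odot>\<^bsub>V\<^esub> \<zero>\<^bsub>V\<^esub>) = 0 \<odot>\<^bsub>W\<^esub> f \<zero>\<^bsub>V\<^esub>" by (rule lin_map_smult[OF assms(3)]) simp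
  then show ?thesis using lin_map_closed[OF assms(3), of "\<zero>\<^bsub>V\<^esub>"] by simp
qed

lemma lin_map_minus:
  assumes "k_space V" "k_space W" "lin_map V W f" "x \<in> carrier V" "y \<in> carrier V"
  shows "f (x \<ominus>\<^bsub>V\<^esub> y) = f x \<ominus>\<^bsub>W\<^esub> f y"
proof -
  interpret V: k_space V by fact
  interpret W: k_space W by fact
  have "f (\<ominus>\<^bsub>V\<^esub> y) = \<ominus>\<^bsub>W\<^esub> f y"
    using assms V.scale_minus_one[of y] W.scale_minus_one[of "f y"]
    by (metis lin_map_closed lin_map_smult)
  then show ?thesis
    using assms by (simp add: a_minus_def lin_map_add)
qed

lemma lin_map_comp: "lin_map V W f \<Longrightarrow> lin_map W X g \<Longrightarrow> lin_map V X (\<lambda>x. g (f x))"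
  by (auto simp: lin_map_def Pi_iff)

lemma alg_homI:
  assumes "\<And>x. x \<in> carrier A \<Longrightarrow> f x \<in> carrier B"
    "\<And>x y. x \<in> carrier A \<Longrightarrow> y \<in> carrier A \<Longrightarrow> f (x \<oplus>\<^bsub>A\<^esub> y) = f x \<oplus>\<^bsub>B\<^esub> f y"
    "\<And>x y. x \<in> carrier A \<Longrightarrow> y \<in> carrier A \<Longrightarrow> f (x \<otimes>\<^bsub>A\<^esub> y) = f x \<otimes>\<^bsub>B\<^esub> f y"
    "f \<one>\<^bsub>A\<^esub> = \<one>\<^bsub>B\<^esub>"
    "\<And>c x. x \<in> carrier A \<Longrightarrow> f (c \<odot>\<^bsub>A\<^esub> x) = c \<odot>\<^bsub>B\<^esub> f x"
  shows "f \<in> alg_hom A B"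
  using assms by (auto simp: alg_hom_def ring_hom_def)

lemma alg_hom_iff:
  "f \<in> alg_hom A B \<longleftrightarrow> lin_map A B f \<and> f \<one>\<^bsub>A\<^esub> = \<one>\<^bsub>B\<^esub> \<and>
     (\<forall>x\<in>carrier A. \<forall>y\<in>carrier A. f (x \<otimes>\<^bsub>A\<^esub> y) = f x \<otimes>\<^bsub>B\<^esub> f y)"
  by (auto simp: alg_hom_def ring_hom_def lin_map_def)

lemma alg_hom_lin: "f \<in> alg_hom A B \<Longrightarrow> lin_map A B f"
  by (simp add: alg_hom_iff)

lemma alg_hom_one: "f \<in> alg_hom A B \<Longrightarrow> f \<one>\<^bsub>A\<^esub> = \<one>\<^bsub>B\<^esub>"
  by (simp add: alg_hom_iff)

lemma alg_hom_mult:
  "f \<in> alg_hom A B \<Longrightarrow> x \<in> carrier A \<Longrightarrow> y \<in> carrier A \<Longrightarrow> f (x \<otimes>\<^bsub>A\<^esub> y) = f x \<otimes>\<^bsub>B\<^esub> f y"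
  by (simp add: alg_hom_iff)

lemmas alg_hom_closed = alg_hom_lin[THEN lin_map_closed]
lemmas alg_hom_add = alg_hom_lin[THEN lin_map_add]
lemmas alg_hom_smult = alg_hom_lin[THEN lin_map_smult]

lemma alg_hom_comp: "f \<in> alg_hom A B \<Longrightarrow> g \<in> alg_hom B C \<Longrightarrow> (\<lambda>x. g (f x)) \<in> alg_hom A C"
  by (auto simp: alg_hom_iff lin_map_comp lin_map_closed)

lemma alg_hom_pow:
  assumes "k_algebra A" "k_algebra B" "f \<in> alg_hom A B" "x \<in> carrier A"
  shows "f (x [^]\<^bsub>A\<^esub> (m::nat)) = f x [^]\<^bsub>B\<^esub> m"
proof -
  interpret A: k_algebra A by fact
  interpret B: k_algebra B by fact
  show ?thesis
    by (induction m) (use assms(4) in \<open>auto simp: alg_hom_one[OF assms(3)] alg_hom_mult[OF assms(3)]\<close>)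
qed

lemma alg_iso_comp: "f \<in> alg_iso A B \<Longrightarrow> g \<in> alg_iso B C \<Longrightarrow> (\<lambda>x. g (f x)) \<in> alg_iso A C"
  using bij_betw_trans[of f "carrier A" "carrier B" g "carrier C"]
  by (auto simp: alg_iso_def alg_hom_comp comp_def)

lemma alg_iso_inv:
  assumes "k_algebra A" "f \<in> alg_iso A B"
  shows "inv_into (carrier A) f \<in> alg_iso B A"
proof -
  interpret A: k_algebra A by fact
  have hom: "f \<in> alg_hom A B" and bij: "bij_betw f (carrier A) (carrier B)"
    using assms(2) by (auto simp: alg_iso_def)
  let ?g = "inv_into (carrier A) f"
  have g: "?g y \<in> carrier A" "f (?g y) = y" if "y \<in> carrier B" for y
    using bij that by (auto simp: bij_betw_def intro: inv_into_into f_inv_into_f)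
  have gI: "?g (f x) = x" if "x \<in> carrier A" for x
    using bij that by (simp add: bij_betw_def inv_into_f_f)
  have "?g \<in> alg_hom B A"
  proof (rule alg_homI)
    show "?g (x \<oplus>\<^bsub>B\<^esub> y) = ?g x \<oplus>\<^bsub>A\<^esub> ?g y" if "x \<in> carrier B" "y \<in> carrier B" for x y
      using g[OF that(1)] g[OF that(2)] gI[of "?g x \<oplus>\<^bsub>A\<^esub> ?g y"] alg_hom_add[OF hom, of "?g x" "?g y"] by simp
    show "?g (x \<otimes>\<^bsub>B\<^esub> y) = ?g x \<otimes>\<^bsub>A\<^esub> ?g y" if "x \<in> carrier B" "y \<in> carrier B" for x y
      using g[OF that(1)] g[OF that(2)] gI[of "?g x \<otimes>\<^bsub>A\<^esub> ?g y"] alg_hom_mult[OF hom, of "?g x" "?g y"] by simp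
    show "?g \<one>\<^bsub>B\<^esub> = \<one>\<^bsub>A\<^esub>"
      using gI[of "\<one>\<^bsub>A\<^esub>"] alg_hom_one[OF hom] by simp
    show "?g (c \<odot>\<^bsub>B\<^esub> x) = c \<odot>\<^bsub>A\<^esub> ?g x" if "x \<in> carrier B" for c x
      using g[OF that] gI[of "c \<odot>\<^bsub>A\<^esub> ?g x"] alg_hom_smult[OF hom, of "?g x" c] by simp
  qed (use g in auto)
  then show ?thesis using bij by (simp add: alg_iso_def bij_betw_inv_into)
qed

lemma opposite_alg_simps [simp]:
  "carrier (opposite_alg A) = carrier A" "x \<otimes>\<^bsub>opposite_alg A\<^esub> y = y \<otimes>\<^bsub>A\<^esub> x"
  "\<one>\<^bsub>opposite_alg A\<^esub> = \<one>\<^bsub>A\<^esub>" "\<zero>\<^bsub>opposite_alg A\<^esub> = \<zero>\<^bsub>A\<^esub>"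
  "add (opposite_alg A) = add A" "smult (opposite_alg A) = smult A"
  by (simp_all add: opposite_alg_def)

lemma k_algebra_opposite: "k_algebra A \<Longrightarrow> k_algebra (opposite_alg A)"
proof -
  assume "k_algebra A"
  then interpret A: k_algebra A .
  have "abelian_group (opposite_alg A)"
    by (rule abelian_groupI) (auto simp: A.a_ac intro: A.l_neg intro!: bexI[of _ "\<ominus>\<^bsub>A\<^esub> x" for x])
  moreover have "monoid (opposite_alg A)"
    by (rule monoidI) (auto simp: A.m_assoc)
  ultimately have "ring (opposite_alg A)"
    by (rule ringI) (auto simp: A.l_distr A.r_distr)
  then show ?thesis
    by (intro k_algebraI k_spaceI \<open>abelian_group (opposite_alg A)\<close>)
      (auto simp: A.scale_add_left A.scale_add_right A.smult_mult_left A.smult_mult_right)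
qed

section \<open>Monoid algebras\<close>

lemma poly_mapping_decomp:
  "(u :: 'a \<Rightarrow>\<^sub>0 'b::comm_monoid_add) = (\<Sum>x\<in>Poly_Mapping.keys u. Poly_Mapping.single x (Poly_Mapping.lookup u x))"
  by (rule poly_mapping_eqI)
    (simp add: lookup_sum lookup_single when_def in_keys_iff)

lemma poly_mapping_keys_induct [consumes 1, case_names zero single add]:
  fixes u :: "'a \<Rightarrow>\<^sub>0 'b::comm_monoid_add"
  assumes "Poly_Mapping.keys u \<subseteq> X" "P 0" "\<And>x c. x \<in> X \<Longrightarrow> P (Poly_Mapping.single x c)"
    "\<And>u v. Poly_Mapping.keys u \<subseteq> X \<Longrightarrow> Poly_Mapping.keys v \<subseteq> X \<Longrightarrow> P u \<Longrightarrow> P v \<Longrightarrow> P (u + v)"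
  shows "P u"
proof -
  have "Poly_Mapping.keys (\<Sum>x\<in>Y. Poly_Mapping.single x (Poly_Mapping.lookup u x)) \<subseteq> X \<and>
      P (\<Sum>x\<in>Y. Poly_Mapping.single x (Poly_Mapping.lookup u x))"
    if "finite Y" "Y \<subseteq> X" for Y
    using that
  proof (induction Y rule: finite_induct)
    case (insert x Y)
    let ?s = "Poly_Mapping.single x (Poly_Mapping.lookup u x)"
    let ?t = "\<Sum>x\<in>Y. Poly_Mapping.single x (Poly_Mapping.lookup u x)"
    have s: "Poly_Mapping.keys ?s \<subseteq> X" using insert by auto
    have "Poly_Mapping.keys (?s + ?t) \<subseteq> X"
      using keys_add[of ?s ?t] insert s by blast
    then show ?case using insert assms(3,4) s by auto
  qed (use assms(2) in auto)
  then show ?thesis using poly_mapping_decomp[of u] assms(1) finite_keys by metis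
qed

lemma monoid_alg_simps:
  "carrier (monoid_alg G) = {u. Poly_Mapping.keys u \<subseteq> carrier G}"
  "\<one>\<^bsub>monoid_alg G\<^esub> = Poly_Mapping.single \<one>\<^bsub>G\<^esub> 1"
  "\<zero>\<^bsub>monoid_alg G\<^esub> = 0" "add (monoid_alg G) = (+)"
  "smult (monoid_alg G) = (\<lambda>c. Poly_Mapping.map ((*) c))"
  by (simp_all add: monoid_alg_def)

lemma lookup_map_times [simp]:
  "Poly_Mapping.lookup (Poly_Mapping.map ((*) (c::'k::field)) u) x = c * Poly_Mapping.lookup u x"
  by (simp add: Poly_Mapping.map.rep_eq when_def)

lemma keys_map_times: "Poly_Mapping.keys (Poly_Mapping.map ((*) (c::'k::field)) u) \<subseteq> Poly_Mapping.keys u"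
  by (auto simp: in_keys_iff)

text \<open>Keys may disappear by cancellation in a sum or under the scalar 0, so distributivity is
  proved after enlarging both index sets to common finite ones.\<close>

lemma monoid_alg_mult_superset:
  fixes u v :: "'g \<Rightarrow>\<^sub>0 'k::field"
  assumes "finite X" "Poly_Mapping.keys u \<subseteq> X" "finite Y" "Poly_Mapping.keys v \<subseteq> Y"
  shows "u \<otimes>\<^bsub>monoid_alg G\<^esub> v =
    (\<Sum>x\<in>X. \<Sum>y\<in>Y. Poly_Mapping.single (x \<otimes>\<^bsub>G\<^esub> y) (Poly_Mapping.lookup u x * Poly_Mapping.lookup v y))"
proof -
  have "(\<Sum>y\<in>Poly_Mapping.keys v. Poly_Mapping.single (x \<otimes>\<^bsub>G\<^esub> y) (Poly_Mapping.lookup u x * Poly_Mapping.lookup v y))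
    = (\<Sum>y\<in>Y. Poly_Mapping.single (x \<otimes>\<^bsub>G\<^esub> y) (Poly_Mapping.lookup u x * Poly_Mapping.lookup v y))" for x
    by (rule sum.mono_neutral_left) (use assms in \<open>auto simp: in_keys_iff\<close>)
  then have "u \<otimes>\<^bsub>monoid_alg G\<^esub> v = (\<Sum>x\<in>Poly_Mapping.keys u. \<Sum>y\<in>Y.
      Poly_Mapping.single (x \<otimes>\<^bsub>G\<^esub> y) (Poly_Mapping.lookup u x * Poly_Mapping.lookup v y))"
    by (simp add: monoid_alg_def)
  also have "\<dots> = (\<Sum>x\<in>X. \<Sum>y\<in>Y. Poly_Mapping.single (x \<otimes>\<^bsub>G\<^esub> y) (Poly_Mapping.lookup u x * Poly_Mapping.lookup v y))"
    by (rule sum.mono_neutral_left) (use assms in \<open>auto simp: in_keys_iff\<close>)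
  finally show ?thesis .
qed

lemma monoid_alg_mult_add_left:
  "(u + u') \<otimes>\<^bsub>monoid_alg G\<^esub> v = u \<otimes>\<^bsub>monoid_alg G\<^esub> v + u' \<otimes>\<^bsub>monoid_alg G\<^esub> v"
proof -
  let ?X = "Poly_Mapping.keys u \<union> Poly_Mapping.keys u'" and ?Y = "Poly_Mapping.keys v"
  have k: "Poly_Mapping.keys (u + u') \<subseteq> ?X" by (rule keys_add)
  show ?thesis
    by (subst (1 2 3) monoid_alg_mult_superset[of ?X _ ?Y])
      (use k in \<open>auto simp: lookup_add ring_distribs single_add sum.distrib\<close>)
qed

lemma monoid_alg_mult_add_right:
  "v \<otimes>\<^bsub>monoid_alg G\<^esub> (u + u') = v \<otimes>\<^bsub>monoid_alg G\<^esub> u + v \<otimes>\<^bsub>monoid_alg G\<^esub> u'"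
proof -
  let ?X = "Poly_Mapping.keys u \<union> Poly_Mapping.keys u'" and ?Y = "Poly_Mapping.keys v"
  have k: "Poly_Mapping.keys (u + u') \<subseteq> ?X" by (rule keys_add)
  show ?thesis
    by (subst (1 2 3) monoid_alg_mult_superset[of ?Y _ ?X])
      (use k in \<open>auto simp: lookup_add ring_distribs single_add sum.distrib\<close>)
qed

lemma monoid_alg_mult_single:
  "Poly_Mapping.single x a \<otimes>\<^bsub>monoid_alg G\<^esub> Poly_Mapping.single y b = Poly_Mapping.single (x \<otimes>\<^bsub>G\<^esub> y) (a * b)"
  by (subst monoid_alg_mult_superset[of "{x}" _ "{y}"]) auto

lemma monoid_alg_mult_zero:
  "0 \<otimes>\<^bsub>monoid_alg G\<^esub> u = 0" "u \<otimes>\<^bsub>monoid_alg G\<^esub> 0 = 0"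
  by (simp_all add: monoid_alg_def)

lemma map_times_add:
  "Poly_Mapping.map ((*) (c::'k::field)) (u + v) = Poly_Mapping.map ((*) c) u + Poly_Mapping.map ((*) c) v"
  by (rule poly_mapping_eqI) (simp add: lookup_add ring_distribs)

context monoid
begin

lemma monoid_alg_mult_closed:
  assumes "Poly_Mapping.keys u \<subseteq> carrier G" "Poly_Mapping.keys v \<subseteq> carrier G"
  shows "Poly_Mapping.keys (u \<otimes>\<^bsub>monoid_alg G\<^esub> v) \<subseteq> carrier G"
  using assms(1)
proof (induction u rule: poly_mapping_keys_induct)
  case (single x c)
  from assms(2) show ?case
  proof (induction v rule: poly_mapping_keys_induct)
    case (add u v)
    then show ?case
      using keys_add[of "Poly_Mapping.single x c \<otimes>\<^bsub>monoid_alg G\<^esub> u" "Poly_Mapping.single x c \<otimes>\<^bsub>monoid_alg G\<^esub> v"]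
      by (auto simp: monoid_alg_mult_add_right)
  qed (use single in \<open>auto simp: monoid_alg_mult_zero monoid_alg_mult_single\<close>)
next
  case (add u u')
  then show ?case
    using keys_add[of "u \<otimes>\<^bsub>monoid_alg G\<^esub> v" "u' \<otimes>\<^bsub>monoid_alg G\<^esub> v"]
    by (auto simp: monoid_alg_mult_add_left)
qed (auto simp: monoid_alg_mult_zero)

lemma monoid_alg_mult_assoc:
  assumes "Poly_Mapping.keys u \<subseteq> carrier G" "Poly_Mapping.keys v \<subseteq> carrier G" "Poly_Mapping.keys w \<subseteq> carrier G"
  shows "(u \<otimes>\<^bsub>monoid_alg G\<^esub> v) \<otimes>\<^bsub>monoid_alg G\<^esub> w = u \<otimes>\<^bsub>monoid_alg G\<^esub> (v \<otimes>\<^bsub>monoid_alg G\<^esub> w)"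
  using assms(1)
proof (induction u rule: poly_mapping_keys_induct)
  case (single x a)
  note x = this
  from assms(2) show ?case
  proof (induction v rule: poly_mapping_keys_induct)
    case (single y b)
    from assms(3) show ?case
      by (induction w rule: poly_mapping_keys_induct)
        (use x single in \<open>auto simp: monoid_alg_mult_zero monoid_alg_mult_single monoid_alg_mult_add_right m_assoc mult.assoc\<close>)
  qed (auto simp: monoid_alg_mult_zero monoid_alg_mult_add_right monoid_alg_mult_add_left)
qed (auto simp: monoid_alg_mult_zero monoid_alg_mult_add_left)

lemma k_algebra_monoid_alg: "k_algebra (monoid_alg G :: ('k::field, 'a \<Rightarrow>\<^sub>0 'k) module)"
proof -
  let ?A = "monoid_alg G :: ('k::field, 'a \<Rightarrow>\<^sub>0 'k) module"
  note simps = monoid_alg_simps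
  have ab: "abelian_group ?A"
  proof (rule abelian_groupI)
    show "\<exists>y\<in>carrier ?A. y \<oplus>\<^bsub>?A\<^esub> x = \<zero>\<^bsub>?A\<^esub>" if "x \<in> carrier ?A" for x
      by (rule bexI[of _ "- x"]) (use that in \<open>auto simp: simps in_keys_iff\<close>)
    show "x \<oplus>\<^bsub>?A\<^esub> y \<in> carrier ?A" if "x \<in> carrier ?A" "y \<in> carrier ?A" for x y
      using that keys_add[of x y] by (auto simp: simps)
  qed (auto simp: simps algebra_simps)
  have one: "\<one>\<^bsub>?A\<^esub> \<otimes>\<^bsub>?A\<^esub> u = u \<and> u \<otimes>\<^bsub>?A\<^esub> \<one>\<^bsub>?A\<^esub> = u" if "Poly_Mapping.keys u \<subseteq> carrier G" for u
    using that by (induction u rule: poly_mapping_keys_induct)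
      (auto simp: simps monoid_alg_mult_zero monoid_alg_mult_single monoid_alg_mult_add_right monoid_alg_mult_add_left)
  have mon: "monoid ?A"
    by (rule monoidI) (use one in \<open>simp_all add: monoid_alg_mult_closed monoid_alg_mult_assoc simps(1,2)\<close>)
  have ring: "ring ?A"
    by (rule ringI[OF ab mon]) (auto simp: simps monoid_alg_mult_add_right monoid_alg_mult_add_left)
  have sp: "k_space ?A"
  proof (rule k_spaceI[OF ab])
    show "c \<odot>\<^bsub>?A\<^esub> x \<in> carrier ?A" if "x \<in> carrier ?A" for c x
      using that keys_map_times[of c x] by (auto simp: simps)
  qed (auto simp: simps map_times_add intro!: poly_mapping_eqI simp: lookup_add algebra_simps)
  show ?thesis
  proof (rule k_algebraI[OF sp ring])
    fix c u v assume u: "u \<in> carrier ?A" and v: "v \<in> carrier ?A"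
    let ?X = "Poly_Mapping.keys u" and ?Y = "Poly_Mapping.keys v"
    have s: "Poly_Mapping.map ((*) c) (\<Sum>x\<in>?X. \<Sum>y\<in>?Y. Poly_Mapping.single (x \<otimes> y) (Poly_Mapping.lookup u x * Poly_Mapping.lookup v y))
      = (\<Sum>x\<in>?X. \<Sum>y\<in>?Y. Poly_Mapping.single (x \<otimes> y) (c * (Poly_Mapping.lookup u x * Poly_Mapping.lookup v y)))"
      by (rule poly_mapping_eqI) (simp add: lookup_sum lookup_single sum_distrib_left when_def if_distrib cong: if_cong)
    show "c \<odot>\<^bsub>?A\<^esub> u \<otimes>\<^bsub>?A\<^esub> v = c \<odot>\<^bsub>?A\<^esub> (u \<otimes>\<^bsub>?A\<^esub> v)"
      using keys_map_times[of c u]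
      by (simp add: simps monoid_alg_mult_superset[of ?X _ ?Y] s mult.assoc)
    show "u \<otimes>\<^bsub>?A\<^esub> (c \<odot>\<^bsub>?A\<^esub> v) = c \<odot>\<^bsub>?A\<^esub> (u \<otimes>\<^bsub>?A\<^esub> v)"
      using keys_map_times[of c v]
      by (simp add: simps monoid_alg_mult_superset[of ?X _ ?Y] s mult.left_commute)
  qed
qed

end

lemma single_in_monoid_alg: "x \<in> carrier G \<Longrightarrow> Poly_Mapping.single x c \<in> carrier (monoid_alg G)"
  by (simp add: monoid_alg_simps)

section \<open>Linear extension from a basis\<close>

context k_space
begin

lemma lin_ext_superset:
  assumes "finite X" "Poly_Mapping.keys u \<subseteq> X" "\<And>x. x \<in> X \<Longrightarrow> \<phi> x \<in> carrier V"
  shows "lin_ext V \<phi> u = (\<Oplus>x\<in>X. Poly_Mapping.lookup u x \<odot> \<phi> x)"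
  unfolding lin_ext_def
  by (rule M.add.finprod_mono_neutral_cong_left) (use assms in \<open>auto simp: in_keys_iff\<close>)

lemma lin_ext_single: "\<phi> x \<in> carrier V \<Longrightarrow> lin_ext V \<phi> (Poly_Mapping.single x c) = c \<odot> \<phi> x"
  by (subst lin_ext_superset[of "{x}"]) auto

lemma lin_ext_add:
  assumes "\<And>x. x \<in> X \<Longrightarrow> \<phi> x \<in> carrier V" "Poly_Mapping.keys u \<subseteq> X" "Poly_Mapping.keys v \<subseteq> X"
  shows "lin_ext V \<phi> (u + v) = lin_ext V \<phi> u \<oplus> lin_ext V \<phi> v"
proof -
  let ?X = "Poly_Mapping.keys u \<union> Poly_Mapping.keys v"
  have *: "lin_ext V \<phi> w = (\<Oplus>x\<in>?X. Poly_Mapping.lookup w x \<odot> \<phi> x)" if "Poly_Mapping.keys w \<subseteq> ?X" for w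
    by (rule lin_ext_superset) (use assms that in auto)
  have "(\<Oplus>x\<in>?X. Poly_Mapping.lookup (u + v) x \<odot> \<phi> x)
      = (\<Oplus>x\<in>?X. Poly_Mapping.lookup u x \<odot> \<phi> x \<oplus> Poly_Mapping.lookup v x \<odot> \<phi> x)"
    by (rule M.finsum_cong') (use assms in \<open>auto simp: lookup_add scale_add_left\<close>)
  also have "\<dots> = (\<Oplus>x\<in>?X. Poly_Mapping.lookup u x \<odot> \<phi> x) \<oplus> (\<Oplus>x\<in>?X. Poly_Mapping.lookup v x \<odot> \<phi> x)"
    by (rule M.finsum_addf) (use assms in auto)
  finally show ?thesis using keys_add[of u v] by (simp add: *)
qed

lemma lin_ext_lin:
  fixes G :: "('g, 'm) monoid_scheme"
  assumes "\<And>x. x \<in> carrier G \<Longrightarrow> \<phi> x \<in> carrier V"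
  shows "lin_map (monoid_alg G) V (lin_ext V \<phi>)"
proof (rule lin_mapI)
  fix u :: "'g \<Rightarrow>\<^sub>0 'k" assume u: "u \<in> carrier (monoid_alg G)"
  show "lin_ext V \<phi> u \<in> carrier V"
    unfolding lin_ext_def using u assms by (intro M.finsum_closed) (auto simp: monoid_alg_simps)
  show "lin_ext V \<phi> (c \<odot>\<^bsub>monoid_alg G\<^esub> u) = c \<odot> lin_ext V \<phi> u" for c
  proof -
    have "lin_ext V \<phi> (c \<odot>\<^bsub>monoid_alg G\<^esub> u)
        = (\<Oplus>x\<in>Poly_Mapping.keys u. Poly_Mapping.lookup (c \<odot>\<^bsub>monoid_alg G\<^esub> u) x \<odot> \<phi> x)"
      by (rule lin_ext_superset) (use u assms keys_map_times[of c u] in \<open>auto simp: monoid_alg_simps\<close>)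
    also have "\<dots> = (\<Oplus>x\<in>Poly_Mapping.keys u. c \<odot> (Poly_Mapping.lookup u x \<odot> \<phi> x))"
      by (rule M.finsum_cong') (use u assms in \<open>auto simp: monoid_alg_simps subset_iff\<close>)
    also have "\<dots> = c \<odot> lin_ext V \<phi> u"
      unfolding lin_ext_def
      by (rule finsum_smult_ldistr[symmetric]) (use u assms in \<open>auto simp: monoid_alg_simps\<close>)
    finally show ?thesis .
  qed
next
  show "lin_ext V \<phi> (u \<oplus>\<^bsub>monoid_alg G\<^esub> v) = lin_ext V \<phi> u \<oplus> lin_ext V \<phi> v"
    if "u \<in> carrier (monoid_alg G)" "v \<in> carrier (monoid_alg G)" for u v
    using lin_ext_add[of "carrier G" \<phi> u v] that assms by (auto simp: monoid_alg_simps)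
qed

end

lemma lin_map_monoid_alg_eq:
  fixes u :: "'g \<Rightarrow>\<^sub>0 'k::field"
  assumes "k_space V" "monoid G" "lin_map (monoid_alg G) V f" "lin_map (monoid_alg G) V g"
    "\<And>x. x \<in> carrier G \<Longrightarrow> f (Poly_Mapping.single x 1) = g (Poly_Mapping.single x 1)"
    "u \<in> carrier (monoid_alg G)"
  shows "f u = g u"
proof -
  interpret V: k_space V by fact
  interpret A: k_algebra "monoid_alg G :: ('k, _) module" by (rule monoid.k_algebra_monoid_alg) fact
  from assms(6) have "Poly_Mapping.keys u \<subseteq> carrier G" by (simp add: monoid_alg_simps)
  then show ?thesis
  proof (induction u rule: poly_mapping_keys_induct)
    case zero
    then show ?case
      using lin_map_zero[OF A.k_space_axioms V.k_space_axioms assms(3)]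
        lin_map_zero[OF A.k_space_axioms V.k_space_axioms assms(4)] by (simp add: monoid_alg_simps)
  next
    case (single x c)
    have "Poly_Mapping.single x c = c \<odot>\<^bsub>monoid_alg G\<^esub> Poly_Mapping.single x 1"
      by (simp add: monoid_alg_simps)
    then show ?case
      using single lin_map_smult[OF assms(3), of "Poly_Mapping.single x 1" c]
        lin_map_smult[OF assms(4), of "Poly_Mapping.single x 1" c] assms(5)
      by (simp add: single_in_monoid_alg)
  next
    case (add u v)
    then show ?case
      using lin_map_add[OF assms(3), of u v] lin_map_add[OF assms(4), of u v] by (simp add: monoid_alg_simps)
  qed
qed

text \<open>Both sides of multiplicativity are linear in each factor, so two applications of
  \<open>lin_map_monoid_alg_eq\<close> reduce it to basis elements.\<close>

lemma lin_ext_alg_hom: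
  fixes T :: "('k::field, 'v, 'r) module_scheme"
  assumes "k_algebra T" "monoid G" "\<And>x. x \<in> carrier G \<Longrightarrow> \<phi> x \<in> carrier T" "\<phi> \<one>\<^bsub>G\<^esub> = \<one>\<^bsub>T\<^esub>"
    "\<And>x y. x \<in> carrier G \<Longrightarrow> y \<in> carrier G \<Longrightarrow> \<phi> (x \<otimes>\<^bsub>G\<^esub> y) = \<phi> x \<otimes>\<^bsub>T\<^esub> \<phi> y"
  shows "lin_ext T \<phi> \<in> alg_hom (monoid_alg G) T"
proof -
  interpret T: k_algebra T by fact
  interpret G: monoid G by fact
  interpret A: k_algebra "monoid_alg G :: ('k, _) module" by (rule G.k_algebra_monoid_alg)
  let ?f = "lin_ext T \<phi>"
  have lin: "lin_map (monoid_alg G) T ?f" by (rule T.lin_ext_lin) fact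
  note lin_simps = lin_map_closed[OF lin] lin_map_add[OF lin] lin_map_smult[OF lin]
  have s: "?f (Poly_Mapping.single x c) = c \<odot>\<^bsub>T\<^esub> \<phi> x" if "x \<in> carrier G" for x c
    by (rule T.lin_ext_single) (use assms(3) that in auto)
  have mult: "?f (u \<otimes>\<^bsub>monoid_alg G\<^esub> v) = ?f u \<otimes>\<^bsub>T\<^esub> ?f v"
    if u: "u \<in> carrier (monoid_alg G)" and v: "v \<in> carrier (monoid_alg G)" for u v
  proof (rule lin_map_monoid_alg_eq[OF T.k_space_axioms assms(2) _ _ _ u])
    show "lin_map (monoid_alg G) T (\<lambda>u. ?f (u \<otimes>\<^bsub>monoid_alg G\<^esub> v))"
      by (rule lin_mapI) (use v in \<open>auto simp: lin_simps A.l_distr A.smult_mult_left\<close>)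
    show "lin_map (monoid_alg G) T (\<lambda>u. ?f u \<otimes>\<^bsub>T\<^esub> ?f v)"
      by (rule lin_mapI) (use v in \<open>auto simp: lin_simps T.l_distr T.smult_mult_left\<close>)
    fix x assume x: "x \<in> carrier G"
    let ?x = "Poly_Mapping.single x (1::'k)"
    have xc: "?x \<in> carrier (monoid_alg G)" using x by (rule single_in_monoid_alg)
    show "?f (?x \<otimes>\<^bsub>monoid_alg G\<^esub> v) = ?f ?x \<otimes>\<^bsub>T\<^esub> ?f v"
    proof (rule lin_map_monoid_alg_eq[OF T.k_space_axioms assms(2) _ _ _ v])
      show "lin_map (monoid_alg G) T (\<lambda>u. ?f (?x \<otimes>\<^bsub>monoid_alg G\<^esub> u))"
        by (rule lin_mapI) (use xc in \<open>auto simp: lin_simps A.r_distr A.smult_mult_right\<close>)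
      show "lin_map (monoid_alg G) T (\<lambda>u. ?f ?x \<otimes>\<^bsub>T\<^esub> ?f u)"
        by (rule lin_mapI) (use xc in \<open>auto simp: lin_simps T.r_distr T.smult_mult_right\<close>)
      show "?f (?x \<otimes>\<^bsub>monoid_alg G\<^esub> Poly_Mapping.single y 1) = ?f ?x \<otimes>\<^bsub>T\<^esub> ?f (Poly_Mapping.single y 1)"
        if "y \<in> carrier G" for y
        using that x assms(3,5) by (simp add: monoid_alg_mult_single s)
    qed
  qed
  show ?thesis
    using lin mult assms(3,4) G.one_closed s[of "\<one>\<^bsub>G\<^esub>" 1]
    by (simp add: alg_hom_iff monoid_alg_simps)
qed

section \<open>Quotient algebras\<close>

text \<open>Closure under negation follows from multiplication by
  \<open>\<ominus> \<one>\<close>.\<close>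

lemma (in k_algebra) ideal_from_closure:
  assumes "I \<subseteq> carrier A" "\<zero> \<in> I" "\<And>a b. a \<in> I \<Longrightarrow> b \<in> I \<Longrightarrow> a \<oplus> b \<in> I"
    "\<And>a x. a \<in> I \<Longrightarrow> x \<in> carrier A \<Longrightarrow> x \<otimes> a \<in> I" "\<And>a x. a \<in> I \<Longrightarrow> x \<in> carrier A \<Longrightarrow> a \<otimes> x \<in> I"
  shows "ideal I A"
proof (rule idealI[OF ring_axioms])
  show "subgroup I (add_monoid A)"
  proof (rule add.subgroupI)
    fix a assume a: "a \<in> I"
    then have "(\<ominus> \<one>) \<otimes> a \<in> I" using assms(4) by blast
    then show "\<ominus> a \<in> I" using a assms(1) l_minus[of \<one> a] by auto
  qed (use assms in auto)
qed (use assms in auto)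

lemma alg_hom_kernel_ideal:
  assumes "k_algebra A" "k_algebra B" "f \<in> alg_hom A B"
  shows "ideal {x \<in> carrier A. f x = \<zero>\<^bsub>B\<^esub>} A"
proof -
  interpret A: k_algebra A by fact
  interpret B: k_algebra B by fact
  note f = alg_hom_closed[OF assms(3)] alg_hom_add[OF assms(3)] alg_hom_mult[OF assms(3)]
    lin_map_zero[OF A.k_space_axioms B.k_space_axioms alg_hom_lin[OF assms(3)]]
  show ?thesis by (rule A.ideal_from_closure) (auto simp: f)
qed

locale k_algebra_rels = k_algebra A for A :: "('k::field, 'a, 'r) module_scheme" (structure) +
  fixes R :: "('a \<times> 'a) set"
  assumes rels_carrier: "R \<subseteq> carrier A \<times> carrier A"
begin

abbreviation "rI \<equiv> rel_ideal A R"
abbreviation "cls \<equiv> quot_class A R"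
abbreviation "Q \<equiv> quot_alg A R"

lemma ideal_rI: "ideal rI A"
  unfolding rel_ideal_def by (rule genideal_ideal) (use rels_carrier in auto)

lemma rI_carrier: "x \<in> rI \<Longrightarrow> x \<in> carrier A"
  using ideal.Icarr[OF ideal_rI] .

lemma rI_minimal:
  assumes "ideal J A" "\<And>l r. (l, r) \<in> R \<Longrightarrow> l \<ominus> r \<in> J" shows "rI \<subseteq> J"
  unfolding rel_ideal_def by (rule genideal_minimal) (use assms in auto)

lemma cls_eq_iff: "x \<in> carrier A \<Longrightarrow> y \<in> carrier A \<Longrightarrow> cls x = cls y \<longleftrightarrow> x \<ominus> y \<in> rI"
  using quotient_eq_iff_same_a_r_cos[OF ideal_rI] by (simp add: quot_class_def)

lemma cls_rel: assumes "(l, r) \<in> R" shows "cls l = cls r"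
proof -
  have "l \<in> carrier A" "r \<in> carrier A" using assms rels_carrier by auto
  moreover have "l \<ominus> r \<in> rI"
    unfolding rel_ideal_def using genideal_self[of "(\<lambda>(l, r). l \<ominus> r) ` R"] rels_carrier assms by (force simp: subset_iff)
  ultimately show ?thesis by (simp add: cls_eq_iff)
qed

lemma mem_clsE:
  assumes "x \<in> carrier A" "y \<in> cls x" obtains "y \<in> carrier A" "cls y = cls x"
proof -
  obtain h where h: "h \<in> rI" "y = h \<oplus> x"
    using assms(2) by (auto simp: quot_class_def a_r_coset_def')
  have hc: "h \<in> carrier A" using h rI_carrier by auto
  have "y \<ominus> x = h" using h hc assms(1) by (simp add: a_minus_def a_assoc r_neg)
  then show ?thesis using that h hc assms(1) by (simp add: cls_eq_iff)
qed

lemma mem_cls_self: "x \<in> carrier A \<Longrightarrow> x \<in> cls x"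
  using abelian_subgroup.a_rcos_self[OF abelian_subgroupI3[OF ideal.axioms(1)[OF ideal_rI] is_abelian_group]]
  by (simp add: quot_class_def)

lemma Q_simps:
  "carrier Q = cls ` carrier A" "\<one>\<^bsub>Q\<^esub> = cls \<one>" "\<zero>\<^bsub>Q\<^esub> = cls \<zero>"
  "x \<in> carrier A \<Longrightarrow> y \<in> carrier A \<Longrightarrow> cls x \<oplus>\<^bsub>Q\<^esub> cls y = cls (x \<oplus> y)"
  "x \<in> carrier A \<Longrightarrow> y \<in> carrier A \<Longrightarrow> cls x \<otimes>\<^bsub>Q\<^esub> cls y = cls (x \<otimes> y)"
  "x \<in> carrier A \<Longrightarrow> c \<odot>\<^bsub>Q\<^esub> cls x = cls (c \<odot> x)"
proof -
  interpret I: ideal rI A by (rule ideal_rI)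
  note hom = I.rcos_ring_hom
  show "carrier Q = cls ` carrier A"
    by (auto simp: quot_alg_def ring.defs FactRing_def A_RCOSETS_def' quot_class_def)
  show "\<one>\<^bsub>Q\<^esub> = cls \<one>" by (simp add: quot_alg_def ring.defs FactRing_def quot_class_def)
  show "\<zero>\<^bsub>Q\<^esub> = cls \<zero>"
    using a_rcos_zero[OF ideal_rI I.zero_closed] by (simp add: quot_alg_def ring.defs FactRing_def quot_class_def)
  show "cls x \<oplus>\<^bsub>Q\<^esub> cls y = cls (x \<oplus> y)" if "x \<in> carrier A" "y \<in> carrier A"
    using ring_hom_add[OF hom that] by (simp add: quot_alg_def ring.defs quot_class_def)
  show "cls x \<otimes>\<^bsub>Q\<^esub> cls y = cls (x \<otimes> y)" if "x \<in> carrier A" "y \<in> carrier A"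
    using ring_hom_mult[OF hom that] by (simp add: quot_alg_def ring.defs quot_class_def)
  assume x: "x \<in> carrier A"
  \<comment> \<open>The scalar action on cosets is a union over all representatives. They agree
    because \<open>c \<odot> (y \<ominus> x)\<close> is the product of
    \<open>c \<odot> \<one>\<close> with a member of the ideal.\<close>
  have "cls (c \<odot> y) = cls (c \<odot> x)" if y: "y \<in> cls x" for y
  proof -
    from y x have yc: "y \<in> carrier A" "cls y = cls x" by (auto elim: mem_clsE)
    then have "y \<ominus> x \<in> rI" using x by (simp add: cls_eq_iff)
    then have "(c \<odot> \<one>) \<otimes> (y \<ominus> x) \<in> rI" by (rule I.I_l_closed) simp
    moreover have "(c \<odot> \<one>) \<otimes> (y \<ominus> x) = c \<odot> y \<ominus> c \<odot> x"
      using yc(1) x by (simp add: smult_mult_left a_minus_def scale_add_right flip: scale_minus_one)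
    ultimately show ?thesis using yc x by (simp add: cls_eq_iff)
  qed
  then have "(\<Union>y\<in>cls x. cls (c \<odot> y)) = cls (c \<odot> x)" using mem_cls_self[OF x] by blast
  then show "c \<odot>\<^bsub>Q\<^esub> cls x = cls (c \<odot> x)"
    by (simp add: quot_alg_def ring.defs module.defs)
qed

lemma k_algebra_Q: "k_algebra Q"
proof -
  interpret I: ideal rI A by (rule ideal_rI)
  have r: "ring (A Quot rI)" by (rule I.quotient_is_ring)
  interpret F: ring "A Quot rI" by fact
  have eqs: "carrier Q = carrier (A Quot rI)" "mult Q = mult (A Quot rI)" "add Q = add (A Quot rI)"
     "one Q = one (A Quot rI)" "zero Q = zero (A Quot rI)"
    by (simp_all add: quot_alg_def ring.defs)
  have ab: "abelian_group Q"
    by (rule abelian_groupI) (auto simp: eqs F.a_ac intro: F.l_neg intro!: bexI[of _ "\<ominus>\<^bsub>A Quot rI\<^esub> x" for x])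
  have "monoid Q" by (rule monoidI) (auto simp: eqs F.m_assoc)
  then have ring: "ring Q" by (intro ringI ab) (auto simp: eqs F.l_distr F.r_distr)
  show ?thesis
    by (rule k_algebraI[OF k_spaceI[OF ab] ring])
      (auto simp: Q_simps scale_add_left scale_add_right smult_mult_left smult_mult_right)
qed

lemma cls_hom: "cls \<in> alg_hom A Q"
  by (rule alg_homI) (auto simp: Q_simps)

lemma quot_lift_cls:
  assumes "k_space V" "lin_map A V f" "\<And>x. x \<in> rI \<Longrightarrow> f x = \<zero>\<^bsub>V\<^esub>" "x \<in> carrier A"
  shows "the_elem (f ` cls x) = f x"
proof -
  interpret V: k_space V by fact
  have "f y = f x" if y: "y \<in> cls x" for y
  proof -
    have yc: "y \<in> carrier A" "cls y = cls x" using y assms(4) by (auto elim: mem_clsE)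
    then have "y \<ominus> x \<in> rI" using assms(4) by (simp add: cls_eq_iff)
    then have "f y \<oplus>\<^bsub>V\<^esub> (\<ominus>\<^bsub>V\<^esub> f x) = \<zero>\<^bsub>V\<^esub>"
      using assms(3) lin_map_minus[OF k_space_axioms assms(1,2) yc(1) assms(4)] by (metis a_minus_def)
    then show ?thesis
      using lin_map_closed[OF assms(2)] yc(1) assms(4) V.M.minus_equality[of "f y" "\<ominus>\<^bsub>V\<^esub> f x"] by simp
  qed
  then have "f ` cls x = {f x}" using mem_cls_self[OF assms(4)] by blast
  then show ?thesis by simp
qed

end

section \<open>Subalgebras and generation\<close>

definition k_subalgebra :: "('k, 'a, 'r) module_scheme \<Rightarrow> 'a set \<Rightarrow> bool" where
  "k_subalgebra A Y \<longleftrightarrow> Y \<subseteq> carrier A \<and> \<one>\<^bsub>A\<^esub> \<in> Y \<and> (\<forall>x\<in>Y. \<forall>y\<in>Y. x \<oplus>\<^bsub>A\<^esub> y \<in> Y \<and> x \<otimes>\<^bsub>A\<^esub> y \<in> Y) \<and>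
     (\<forall>c. \<forall>x\<in>Y. c \<odot>\<^bsub>A\<^esub> x \<in> Y)"

text \<open>Quantifying over subalgebras, instead of forming a closure, turns each argument on
  generators into the check that some solution set is a subalgebra.\<close>

definition alg_generates :: "('k, 'a, 'r) module_scheme \<Rightarrow> 'a set \<Rightarrow> bool" where
  "alg_generates A X \<longleftrightarrow> X \<subseteq> carrier A \<and> (\<forall>Y. k_subalgebra A Y \<and> X \<subseteq> Y \<longrightarrow> carrier A \<subseteq> Y)"

lemma alg_generates_image:
  assumes "k_algebra A" "alg_generates A X" "f \<in> alg_hom A B" "carrier B \<subseteq> f ` carrier A"
  shows "alg_generates B (f ` X)"
proof -
  interpret A: k_algebra A by fact
  note f = alg_hom_closed[OF assms(3)] alg_hom_add[OF assms(3)] alg_hom_mult[OF assms(3)]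
    alg_hom_smult[OF assms(3)] alg_hom_one[OF assms(3)]
  have "carrier B \<subseteq> Y" if Y: "k_subalgebra B Y" "f ` X \<subseteq> Y" for Y
  proof -
    have "k_subalgebra A {x \<in> carrier A. f x \<in> Y}"
      using Y(1) by (auto simp: k_subalgebra_def f)
    moreover have "X \<subseteq> {x \<in> carrier A. f x \<in> Y}" using assms(2) Y(2) by (auto simp: alg_generates_def)
    ultimately have "carrier A \<subseteq> {x \<in> carrier A. f x \<in> Y}" using assms(2) by (auto simp: alg_generates_def)
    then show ?thesis using assms(4) by auto
  qed
  then show ?thesis using assms(2) f(1) by (auto simp: alg_generates_def)
qed

lemma alg_hom_eq_on_generators:
  assumes "k_algebra A" "alg_generates A X" "f \<in> alg_hom A B" "g \<in> alg_hom A B"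
    "\<And>x. x \<in> X \<Longrightarrow> f x = g x" "x \<in> carrier A"
  shows "f x = g x"
proof -
  interpret A: k_algebra A by fact
  note f = alg_hom_add[OF assms(3)] alg_hom_mult[OF assms(3)] alg_hom_smult[OF assms(3)] alg_hom_one[OF assms(3)]
  note g = alg_hom_add[OF assms(4)] alg_hom_mult[OF assms(4)] alg_hom_smult[OF assms(4)] alg_hom_one[OF assms(4)]
  have "k_subalgebra A {x \<in> carrier A. f x = g x}" by (auto simp: k_subalgebra_def f g)
  then show ?thesis using assms(2,5,6) by (auto simp: alg_generates_def)
qed

section \<open>Free algebras\<close>

lemma word_monoid_simps [simp]:
  "carrier word_monoid = UNIV" "mult word_monoid = (@)" "one word_monoid = []"
  by (simp_all add: word_monoid_def)

lemma monoid_word_monoid: "monoid word_monoid"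
  by (rule monoidI) auto

lemma k_algebra_free_alg: "k_algebra (free_alg :: ('k::field, 'x list \<Rightarrow>\<^sub>0 'k) module)"
  unfolding free_alg_def by (rule monoid.k_algebra_monoid_alg[OF monoid_word_monoid])

lemma carrier_free_alg [simp]: "carrier free_alg = UNIV"
  by (simp add: free_alg_def monoid_alg_simps)

lemma k_algebra_rels_free: "k_algebra_rels (free_alg :: ('k::field, 'x list \<Rightarrow>\<^sub>0 'k) module) R"
  by (intro k_algebra_rels.intro k_algebra_free_alg k_algebra_rels_axioms.intro) auto

lemma word_val_closed:
  assumes "monoid T" "\<And>z. \<phi> z \<in> carrier T" shows "word_val T \<phi> w \<in> carrier T"
proof -
  interpret monoid T by fact
  show ?thesis by (induction w) (use assms(2) in \<open>auto simp: word_val_def\<close>)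
qed

lemma word_val_append:
  assumes "monoid T" "\<And>z. \<phi> z \<in> carrier T"
  shows "word_val T \<phi> (v @ w) = word_val T \<phi> v \<otimes>\<^bsub>T\<^esub> word_val T \<phi> w"
proof -
  interpret monoid T by fact
  have Cons: "word_val T \<phi> (z # u) = \<phi> z \<otimes>\<^bsub>T\<^esub> word_val T \<phi> u" for z u
    by (simp add: word_val_def)
  have Nil: "word_val T \<phi> [] = \<one>\<^bsub>T\<^esub>" by (simp add: word_val_def)
  show ?thesis
    by (induction v) (simp_all add: Cons Nil m_assoc assms(2) word_val_closed[OF assms])
qed

definition free_eval :: "('k::field, 'v, 'r) module_scheme \<Rightarrow> ('x \<Rightarrow> 'v) \<Rightarrow> ('x list \<Rightarrow>\<^sub>0 'k) \<Rightarrow> 'v" where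
  "free_eval T \<phi> = lin_ext T (word_val T \<phi>)"

lemma free_eval_hom:
  assumes "k_algebra T" "\<And>z. \<phi> z \<in> carrier T"
  shows "free_eval T \<phi> \<in> alg_hom free_alg T"
proof -
  interpret T: k_algebra T by fact
  show ?thesis unfolding free_alg_def free_eval_def
    by (rule lin_ext_alg_hom[OF assms(1) monoid_word_monoid])
      (use word_val_closed[OF T.monoid_axioms assms(2)] word_val_append[OF T.monoid_axioms assms(2)]
        in \<open>auto simp: word_val_def[of _ _ "[]"]\<close>)
qed

lemma free_eval_gen:
  assumes "k_algebra T" "\<And>z. \<phi> z \<in> carrier T"
  shows "free_eval T \<phi> (free_gen z) = \<phi> z"
proof -
  interpret T: k_algebra T by fact
  show ?thesis unfolding free_gen_def free_eval_def
    by (subst T.lin_ext_single) (use assms(2) in \<open>auto simp: word_val_def\<close>)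
qed

text \<open>The universal property of a presentation: the kernel of evaluation is an ideal
  containing every \<open>l - r\<close>, hence the ideal they generate, so evaluation is constant on
  cosets.\<close>

lemma quot_lift_free:
  assumes "k_algebra T" "\<And>z. \<phi> z \<in> carrier T" "\<And>l r. (l, r) \<in> R \<Longrightarrow> free_eval T \<phi> l = free_eval T \<phi> r"
  shows "quot_lift T (word_val T \<phi>) \<in> alg_hom (quot_alg free_alg R) T"
    and "quot_lift T (word_val T \<phi>) (quot_class free_alg R (free_gen z)) = \<phi> z"
proof -
  interpret T: k_algebra T by fact
  interpret R: k_algebra_rels free_alg R by (rule k_algebra_rels_free)
  let ?f = "free_eval T \<phi>" and ?q = "quot_lift T (word_val T \<phi>)"
  have hom: "?f \<in> alg_hom free_alg T" by (rule free_eval_hom) fact+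
  have "R.rI \<subseteq> {x \<in> carrier free_alg. ?f x = \<zero>\<^bsub>T\<^esub>}"
  proof (rule R.rI_minimal[OF alg_hom_kernel_ideal[OF R.k_algebra_axioms assms(1) hom]])
    fix l r assume "(l, r) \<in> R"
    then have "?f (l \<ominus>\<^bsub>free_alg\<^esub> r) = \<zero>\<^bsub>T\<^esub>"
      using assms(3) lin_map_minus[OF R.k_space_axioms T.k_space_axioms alg_hom_lin[OF hom], of l r]
        alg_hom_closed[OF hom, of r] by (simp add: a_minus_def T.r_neg)
    then show "l \<ominus>\<^bsub>free_alg\<^esub> r \<in> {x \<in> carrier free_alg. ?f x = \<zero>\<^bsub>T\<^esub>}" by simp
  qed
  then have q: "?q (R.cls u) = ?f u" for u
    using R.quot_lift_cls[OF T.k_space_axioms alg_hom_lin[OF hom], of u]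
    by (auto simp: quot_lift_def free_eval_def)
  show "?q \<in> alg_hom (quot_alg free_alg R) T"
    by (rule alg_homI)
      (use alg_hom_closed[OF hom] in \<open>auto simp: R.Q_simps q alg_hom_add[OF hom] alg_hom_mult[OF hom]
        alg_hom_one[OF hom] alg_hom_smult[OF hom]\<close>)
  show "?q (R.cls (free_gen z)) = \<phi> z"
    using free_eval_gen[OF assms(1,2)] by (simp add: q)
qed

lemma k_algebra_quot_free: "k_algebra (quot_alg free_alg R)"
proof -
  interpret R: k_algebra_rels free_alg R by (rule k_algebra_rels_free)
  show ?thesis by (rule R.k_algebra_Q)
qed

lemma quot_class_free_hom: "quot_class free_alg R \<in> alg_hom free_alg (quot_alg free_alg R)"
proof -
  interpret R: k_algebra_rels free_alg R by (rule k_algebra_rels_free)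
  show ?thesis by (rule R.cls_hom)
qed

lemma quot_class_free_rel: "(l, r) \<in> R \<Longrightarrow> quot_class free_alg R l = quot_class free_alg R r"
proof -
  interpret R: k_algebra_rels free_alg R by (rule k_algebra_rels_free)
  show "(l, r) \<in> R \<Longrightarrow> ?thesis" by (rule R.cls_rel)
qed

lemma alg_generates_free_alg: "alg_generates (free_alg :: ('k::field, 'x list \<Rightarrow>\<^sub>0 'k) module) (range free_gen)"
proof -
  interpret F: k_algebra "free_alg :: ('k, 'x list \<Rightarrow>\<^sub>0 'k) module" by (rule k_algebra_free_alg)
  have "u \<in> Y" if Y: "k_subalgebra (free_alg :: ('k, 'x list \<Rightarrow>\<^sub>0 'k) module) Y" "range free_gen \<subseteq> Y" for u Y
  proof -
    have w: "Poly_Mapping.single w 1 \<in> Y" for w :: "'x list"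
    proof (induction w)
      case Nil
      then show ?case using Y(1) by (simp add: k_subalgebra_def free_alg_def monoid_alg_simps)
    next
      case (Cons z w)
      have "free_gen z \<otimes>\<^bsub>free_alg\<^esub> Poly_Mapping.single w 1 \<in> Y"
        using Y Cons by (auto simp: k_subalgebra_def)
      then show ?case by (simp add: free_gen_def free_alg_def monoid_alg_mult_single)
    qed
    have s: "Poly_Mapping.single w c \<in> Y" for w :: "'x list" and c
    proof -
      have "c \<odot>\<^bsub>free_alg\<^esub> Poly_Mapping.single w 1 \<in> Y" using Y w by (auto simp: k_subalgebra_def)
      then show ?thesis by (simp add: free_alg_def monoid_alg_simps)
    qed
    have "Poly_Mapping.keys u \<subseteq> UNIV" by simp
    then show ?thesis
    proof (induction u rule: poly_mapping_keys_induct)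
      case zero
      show ?case using s[of undefined 0] by simp
    next
      case (add u v)
      then have "u \<oplus>\<^bsub>free_alg\<^esub> v \<in> Y" using Y(1) by (auto simp: k_subalgebra_def)
      then show ?case by (simp add: free_alg_def monoid_alg_simps)
    qed (rule s)
  qed
  then show ?thesis by (auto simp: alg_generates_def)
qed

lemma alg_generates_quot_free:
  "alg_generates (quot_alg free_alg R) (range (\<lambda>z. quot_class free_alg R (free_gen z)))"
proof -
  interpret R: k_algebra_rels free_alg R by (rule k_algebra_rels_free)
  show ?thesis
    using alg_generates_image[OF R.k_algebra_axioms alg_generates_free_alg R.cls_hom]
    by (simp add: R.Q_simps image_image)
qed

section \<open>Tensor products\<close>

definition bilinear_map :: "('k, 'a, 'r) module_scheme \<Rightarrow> ('k, 'b, 's) module_scheme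
    \<Rightarrow> ('k, 'v, 't) module_scheme \<Rightarrow> ('a \<Rightarrow> 'b \<Rightarrow> 'v) \<Rightarrow> bool" where
  "bilinear_map A B V \<beta> \<longleftrightarrow>
     (\<forall>a\<in>carrier A. lin_map B V (\<beta> a)) \<and> (\<forall>b\<in>carrier B. lin_map A V (\<lambda>a. \<beta> a b))"

lemma bilinear_mapI:
  assumes "\<And>a b. a \<in> carrier A \<Longrightarrow> b \<in> carrier B \<Longrightarrow> \<beta> a b \<in> carrier V"
    "\<And>a a' b. a \<in> carrier A \<Longrightarrow> a' \<in> carrier A \<Longrightarrow> b \<in> carrier B \<Longrightarrow> \<beta> (a \<oplus>\<^bsub>A\<^esub> a') b = \<beta> a b \<oplus>\<^bsub>V\<^esub> \<beta> a' b"
    "\<And>a b b'. a \<in> carrier A \<Longrightarrow> b \<in> carrier B \<Longrightarrow> b' \<in> carrier B \<Longrightarrow> \<beta> a (b \<oplus>\<^bsub>B\<^esub> b') = \<beta> a b \<oplus>\<^bsub>V\<^esub> \<beta> a b'"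
    "\<And>c a b. a \<in> carrier A \<Longrightarrow> b \<in> carrier B \<Longrightarrow> \<beta> (c \<odot>\<^bsub>A\<^esub> a) b = c \<odot>\<^bsub>V\<^esub> \<beta> a b"
    "\<And>c a b. a \<in> carrier A \<Longrightarrow> b \<in> carrier B \<Longrightarrow> \<beta> a (c \<odot>\<^bsub>B\<^esub> b) = c \<odot>\<^bsub>V\<^esub> \<beta> a b"
  shows "bilinear_map A B V \<beta>"
  using assms by (auto simp: bilinear_map_def intro!: lin_mapI)

lemma bilinear_map_simps:
  assumes "bilinear_map A B V \<beta>"
  shows "a \<in> carrier A \<Longrightarrow> b \<in> carrier B \<Longrightarrow> \<beta> a b \<in> carrier V"
    "a \<in> carrier A \<Longrightarrow> a' \<in> carrier A \<Longrightarrow> b \<in> carrier B \<Longrightarrow> \<beta> (a \<oplus>\<^bsub>A\<^esub> a') b = \<beta> a b \<oplus>\<^bsub>V\<^esub> \<beta> a' b"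
    "a \<in> carrier A \<Longrightarrow> b \<in> carrier B \<Longrightarrow> b' \<in> carrier B \<Longrightarrow> \<beta> a (b \<oplus>\<^bsub>B\<^esub> b') = \<beta> a b \<oplus>\<^bsub>V\<^esub> \<beta> a b'"
    "a \<in> carrier A \<Longrightarrow> b \<in> carrier B \<Longrightarrow> \<beta> (c \<odot>\<^bsub>A\<^esub> a) b = c \<odot>\<^bsub>V\<^esub> \<beta> a b"
    "a \<in> carrier A \<Longrightarrow> b \<in> carrier B \<Longrightarrow> \<beta> a (c \<odot>\<^bsub>B\<^esub> b) = c \<odot>\<^bsub>V\<^esub> \<beta> a b"
  using assms unfolding bilinear_map_def
  by (auto dest!: bspec simp: lin_map_def)

locale alg_pair = A: k_algebra A + B: k_algebra B
  for A :: "('k::field, 'a, 'r) module_scheme" and B :: "('k, 'b, 's) module_scheme"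
begin

abbreviation "D \<equiv> monoid_alg (A \<times>\<times> B) :: ('k, ('a \<times> 'b) \<Rightarrow>\<^sub>0 'k) module"
abbreviation "T \<equiv> tensor_alg A B"
abbreviation "t \<equiv> pure_tensor A B"
abbreviation "e a b \<equiv> Poly_Mapping.single (a, b) (1::'k)"

lemma monoid_D: "monoid (A \<times>\<times> B)"
  by (rule DirProd_monoid) (rule A.monoid_axioms B.monoid_axioms)+

sublocale D: k_algebra D
  by (rule monoid.k_algebra_monoid_alg[OF monoid_D])

lemma single_D: "a \<in> carrier A \<Longrightarrow> b \<in> carrier B \<Longrightarrow> Poly_Mapping.single (a, b) c \<in> carrier D"
  by (rule single_in_monoid_alg) simp

sublocale R: k_algebra_rels D "bilinear_rels A B"
proof
  have add: "x + y \<in> carrier D" if "x \<in> carrier D" "y \<in> carrier D" for x y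
    using D.M.a_closed[OF that] by (simp add: monoid_alg_simps)
  show "bilinear_rels A B \<subseteq> carrier D \<times> carrier D"
    unfolding bilinear_rels_def Let_def by (auto intro!: add single_D)
qed

lemma k_algebra_T: "k_algebra T"
  unfolding tensor_alg_def by (rule R.k_algebra_Q)

sublocale T: k_algebra T by (rule k_algebra_T)

lemma e_smult: "Poly_Mapping.single (a, b) c = c \<odot>\<^bsub>D\<^esub> e a b"
  by (simp add: monoid_alg_simps)

lemma pure_closed [simp]: "a \<in> carrier A \<Longrightarrow> b \<in> carrier B \<Longrightarrow> t a b \<in> carrier T"
  unfolding pure_tensor_def tensor_alg_def by (rule alg_hom_closed[OF R.cls_hom]) (rule single_D)

lemma cls_add: "x \<in> carrier D \<Longrightarrow> y \<in> carrier D \<Longrightarrow> R.cls (x + y) = R.cls x \<oplus>\<^bsub>T\<^esub> R.cls y"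
  unfolding tensor_alg_def using R.Q_simps(4)[of x y] by (simp add: monoid_alg_simps)

lemma cls_single: "a \<in> carrier A \<Longrightarrow> b \<in> carrier B \<Longrightarrow> R.cls (Poly_Mapping.single (a, b) c) = c \<odot>\<^bsub>T\<^esub> t a b"
  unfolding tensor_alg_def pure_tensor_def e_smult[of a b c] using R.Q_simps(6)[OF single_D[of a b]] by simp

lemma pure_bilinear: "bilinear_map A B T t"
proof (rule bilinear_mapI)
  have rel: "R.cls l = R.cls r" if "(l, r) \<in> bilinear_rels A B" for l r using that by (rule R.cls_rel)
  show "t (a \<oplus>\<^bsub>A\<^esub> a') b = t a b \<oplus>\<^bsub>T\<^esub> t a' b" if "a \<in> carrier A" "a' \<in> carrier A" "b \<in> carrier B" for a a' b
  proof -
    have "R.cls (e (a \<oplus>\<^bsub>A\<^esub> a') b) = R.cls (e a b + e a' b)"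
      by (rule rel) (use that in \<open>auto simp: bilinear_rels_def Let_def\<close>)
    then show ?thesis using that by (simp add: pure_tensor_def cls_add single_D)
  qed
  show "t a (b \<oplus>\<^bsub>B\<^esub> b') = t a b \<oplus>\<^bsub>T\<^esub> t a b'" if "a \<in> carrier A" "b \<in> carrier B" "b' \<in> carrier B" for a b b'
  proof -
    have "R.cls (e a (b \<oplus>\<^bsub>B\<^esub> b')) = R.cls (e a b + e a b')"
      by (rule rel) (use that in \<open>auto simp: bilinear_rels_def Let_def\<close>)
    then show ?thesis using that by (simp add: pure_tensor_def cls_add single_D)
  qed
  show "t (c \<odot>\<^bsub>A\<^esub> a) b = c \<odot>\<^bsub>T\<^esub> t a b" if "a \<in> carrier A" "b \<in> carrier B" for a b c
  proof -
    have "R.cls (e (c \<odot>\<^bsub>A\<^esub> a) b) = R.cls (Poly_Mapping.single (a, b) c)"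
      by (rule rel) (use that in \<open>auto simp: bilinear_rels_def Let_def\<close>)
    then show ?thesis using that by (simp add: cls_single)
  qed
  show "t a (c \<odot>\<^bsub>B\<^esub> b) = c \<odot>\<^bsub>T\<^esub> t a b" if "a \<in> carrier A" "b \<in> carrier B" for a b c
  proof -
    have "R.cls (e a (c \<odot>\<^bsub>B\<^esub> b)) = R.cls (Poly_Mapping.single (a, b) c)"
      by (rule rel) (use that in \<open>unfold bilinear_rels_def Let_def, intro UnI2, blast\<close>)
    then show ?thesis using that by (simp add: cls_single)
  qed
qed simp

lemmas pure_simps = bilinear_map_simps(2-5)[OF pure_bilinear]

lemma pure_mult:
  assumes "a \<in> carrier A" "b \<in> carrier B" "a' \<in> carrier A" "b' \<in> carrier B"
  shows "t a b \<otimes>\<^bsub>T\<^esub> t a' b' = t (a \<otimes>\<^bsub>A\<^esub> a') (b \<otimes>\<^bsub>B\<^esub> b')"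
  using R.Q_simps(5)[OF single_D[OF assms(1,2)] single_D[OF assms(3,4)], of 1 1] assms
  by (simp add: tensor_alg_def pure_tensor_def monoid_alg_mult_single)

lemma one_T: "\<one>\<^bsub>T\<^esub> = t \<one>\<^bsub>A\<^esub> \<one>\<^bsub>B\<^esub>"
  by (simp add: tensor_alg_def pure_tensor_def R.Q_simps monoid_alg_simps)

lemma zero_T: "\<zero>\<^bsub>T\<^esub> = t \<zero>\<^bsub>A\<^esub> \<zero>\<^bsub>B\<^esub>"
  using pure_simps(3)[of "\<zero>\<^bsub>A\<^esub>" "\<zero>\<^bsub>B\<^esub>" 0] by simp

text \<open>A scalar can be absorbed into the left factor of a pure tensor, so sums of pure tensors
  already exhaust the tensor product.\<close>

lemma tensor_induct [consumes 1, case_names pure add]: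
  assumes "x \<in> carrier T" "\<And>a b. a \<in> carrier A \<Longrightarrow> b \<in> carrier B \<Longrightarrow> P (t a b)"
    "\<And>x y. x \<in> carrier T \<Longrightarrow> y \<in> carrier T \<Longrightarrow> P x \<Longrightarrow> P y \<Longrightarrow> P (x \<oplus>\<^bsub>T\<^esub> y)"
  shows "P x"
proof -
  obtain u where u: "u \<in> carrier D" "x = R.cls u"
    using assms(1) by (auto simp: tensor_alg_def R.Q_simps)
  have "Poly_Mapping.keys u \<subseteq> carrier (A \<times>\<times> B)" using u by (simp add: monoid_alg_simps)
  then have "P (R.cls u)"
  proof (induction u rule: poly_mapping_keys_induct)
    case zero
    have "R.cls 0 = \<zero>\<^bsub>T\<^esub>" by (simp add: tensor_alg_def R.Q_simps monoid_alg_simps)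
    then show ?case using assms(2)[of "\<zero>\<^bsub>A\<^esub>" "\<zero>\<^bsub>B\<^esub>"] by (simp add: zero_T)
  next
    case (single x c)
    then obtain a b where ab: "x = (a, b)" "a \<in> carrier A" "b \<in> carrier B" by (cases x) auto
    then show ?case using assms(2)[of "c \<odot>\<^bsub>A\<^esub> a" b] by (simp add: cls_single pure_simps)
  next
    case (add u v)
    then have "u \<in> carrier D" "v \<in> carrier D" by (auto simp: monoid_alg_simps)
    moreover from this have "R.cls u \<in> carrier T" "R.cls v \<in> carrier T"
      unfolding tensor_alg_def using alg_hom_closed[OF R.cls_hom] by auto
    ultimately show ?case using add assms(3) by (simp add: cls_add)
  qed
  then show ?thesis using u by simp
qed

lemma tensor_lin_eq:
  assumes "lin_map T V f" "lin_map T V g" "\<And>a b. a \<in> carrier A \<Longrightarrow> b \<in> carrier B \<Longrightarrow> f (t a b) = g (t a b)"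
    "x \<in> carrier T"
  shows "f x = g x"
  using assms(4) by (induction x rule: tensor_induct)
    (auto simp: assms(3) lin_map_add[OF assms(1)] lin_map_add[OF assms(2)])

text \<open>The relations generate a two-sided ideal, but the extension of a bilinear map is not
  multiplicative and its kernel need not be an ideal. The kernel is therefore replaced by the set
  \<open>?Z\<close> of those \<open>u\<close> for which the extension kills every product of
  \<open>u\<close> with basis elements on both sides. This is an ideal; it contains the relations
  because multiplying a bilinearity relation by pairs gives another one. Taking units on both sides
  returns to \<open>u\<close> itself.\<close>

lemma tensor_lift_aux:
  assumes "k_space V" "bilinear_map A B V \<beta>" "u \<in> R.rI"
  shows "lin_ext V (\<lambda>(a, b). \<beta> a b) u = \<zero>\<^bsub>V\<^esub>"
proof -
  interpret V: k_space V by fact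
  note b = bilinear_map_simps[OF assms(2)]
  let ?f = "lin_ext V (\<lambda>(a, b). \<beta> a b)"
  have lin: "lin_map D V ?f" by (rule V.lin_ext_lin) (use b(1) in auto)
  note f = lin_map_closed[OF lin] lin_map_add[OF lin] lin_map_smult[OF lin]
    lin_map_zero[OF D.k_space_axioms V.k_space_axioms lin]
  have fs: "?f (Poly_Mapping.single (a, b) c) = c \<odot>\<^bsub>V\<^esub> \<beta> a b" if "a \<in> carrier A" "b \<in> carrier B" for a b c
    by (subst V.lin_ext_single) (use b(1) that in auto)
  let ?h = "\<lambda>a b a' b' u. ?f (e a b \<otimes>\<^bsub>D\<^esub> u \<otimes>\<^bsub>D\<^esub> e a' b')"
  let ?Z = "{u \<in> carrier D. \<forall>a\<in>carrier A. \<forall>b\<in>carrier B. \<forall>a'\<in>carrier A. \<forall>b'\<in>carrier B. ?h a b a' b' u = \<zero>\<^bsub>V\<^esub>}"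
  have h: "lin_map D V (?h a b a' b')"
    if "a \<in> carrier A" "b \<in> carrier B" "a' \<in> carrier A" "b' \<in> carrier B" for a b a' b'
    by (rule lin_mapI) (use single_D that in
      \<open>auto simp: f D.l_distr D.r_distr D.smult_mult_left D.smult_mult_right\<close>)
  have zero: "lin_map D V (\<lambda>_. \<zero>\<^bsub>V\<^esub>)" by (rule lin_mapI) auto
  have "ideal ?Z D"
  proof (rule D.ideal_from_closure)
    fix u x assume u: "u \<in> ?Z" and x: "x \<in> carrier D"
    have "?h a b a' b' (x \<otimes>\<^bsub>D\<^esub> u) = \<zero>\<^bsub>V\<^esub>"
      if ab: "a \<in> carrier A" "b \<in> carrier B" "a' \<in> carrier A" "b' \<in> carrier B" for a b a' b'
    proof (rule lin_map_monoid_alg_eq[OF assms(1) monoid_D _ zero _ x])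
      show "lin_map D V (\<lambda>x. ?h a b a' b' (x \<otimes>\<^bsub>D\<^esub> u))"
        by (rule lin_map_comp[OF _ h[OF ab]], rule lin_mapI) (use u in \<open>auto simp: D.l_distr D.smult_mult_left\<close>)
      fix y assume "y \<in> carrier (A \<times>\<times> B)"
      then obtain c d where y: "y = (c, d)" "c \<in> carrier A" "d \<in> carrier B" by (cases y) auto
      have "e a b \<otimes>\<^bsub>D\<^esub> (e c d \<otimes>\<^bsub>D\<^esub> u) = e (a \<otimes>\<^bsub>A\<^esub> c) (b \<otimes>\<^bsub>B\<^esub> d) \<otimes>\<^bsub>D\<^esub> u"
        using D.m_assoc[of "e a b" "e c d" u] single_D y ab u by (simp add: monoid_alg_mult_single)
      then show "?h a b a' b' (Poly_Mapping.single y 1 \<otimes>\<^bsub>D\<^esub> u) = \<zero>\<^bsub>V\<^esub>"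
        using u ab y by simp
    qed
    then show "x \<otimes>\<^bsub>D\<^esub> u \<in> ?Z" using u x by simp
    have "?h a b a' b' (u \<otimes>\<^bsub>D\<^esub> x) = \<zero>\<^bsub>V\<^esub>"
      if ab: "a \<in> carrier A" "b \<in> carrier B" "a' \<in> carrier A" "b' \<in> carrier B" for a b a' b'
    proof (rule lin_map_monoid_alg_eq[OF assms(1) monoid_D _ zero _ x])
      show "lin_map D V (\<lambda>x. ?h a b a' b' (u \<otimes>\<^bsub>D\<^esub> x))"
        by (rule lin_map_comp[OF _ h[OF ab]], rule lin_mapI) (use u in \<open>auto simp: D.r_distr D.smult_mult_right\<close>)
      fix y assume "y \<in> carrier (A \<times>\<times> B)"
      then obtain c d where y: "y = (c, d)" "c \<in> carrier A" "d \<in> carrier B" by (cases y) auto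
      have "e a b \<otimes>\<^bsub>D\<^esub> (u \<otimes>\<^bsub>D\<^esub> e c d) \<otimes>\<^bsub>D\<^esub> e a' b' = e a b \<otimes>\<^bsub>D\<^esub> u \<otimes>\<^bsub>D\<^esub> (e c d \<otimes>\<^bsub>D\<^esub> e a' b')"
        using single_D y ab u by (simp add: D.m_assoc)
      also have "e c d \<otimes>\<^bsub>D\<^esub> e a' b' = e (c \<otimes>\<^bsub>A\<^esub> a') (d \<otimes>\<^bsub>B\<^esub> b')" by (simp add: monoid_alg_mult_single)
      finally show "?h a b a' b' (u \<otimes>\<^bsub>D\<^esub> Poly_Mapping.single y 1) = \<zero>\<^bsub>V\<^esub>"
        using u ab y by simp
    qed
    then show "u \<otimes>\<^bsub>D\<^esub> x \<in> ?Z" using u x by simp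
  next
    fix u v assume "u \<in> ?Z" "v \<in> ?Z"
    then show "u \<oplus>\<^bsub>D\<^esub> v \<in> ?Z" using h by (auto simp: lin_map_add[OF h])
  qed (use h lin_map_zero[OF D.k_space_axioms V.k_space_axioms h] in auto)
  moreover have "l \<ominus>\<^bsub>D\<^esub> r \<in> ?Z" if lr: "(l, r) \<in> bilinear_rels A B" for l r
  proof -
    have c: "l \<in> carrier D" "r \<in> carrier D" using lr R.rels_carrier by auto
    have "?h a b a' b' (l \<ominus>\<^bsub>D\<^esub> r) = \<zero>\<^bsub>V\<^esub>"
      if ab: "a \<in> carrier A" "b \<in> carrier B" "a' \<in> carrier A" "b' \<in> carrier B" for a b a' b'
    proof -
      have hs: "?h a b a' b' (Poly_Mapping.single (c, d) k) = k \<odot>\<^bsub>V\<^esub> \<beta> (a \<otimes>\<^bsub>A\<^esub> c \<otimes>\<^bsub>A\<^esub> a') (b \<otimes>\<^bsub>B\<^esub> d \<otimes>\<^bsub>B\<^esub> b')"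
        if "c \<in> carrier A" "d \<in> carrier B" for c d k
        using that ab by (simp add: monoid_alg_mult_single fs)
      have ha: "?h a b a' b' (x + y) = ?h a b a' b' x \<oplus>\<^bsub>V\<^esub> ?h a b a' b' y" if "x \<in> carrier D" "y \<in> carrier D" for x y
        using lin_map_add[OF h[OF ab] that] by (simp add: monoid_alg_simps)
      have "?h a b a' b' l = ?h a b a' b' r"
        using lr ab b(1) unfolding bilinear_rels_def Let_def
        by (auto simp: hs ha single_D b(2-5) A.l_distr A.r_distr B.l_distr B.r_distr
            A.smult_mult_left A.smult_mult_right B.smult_mult_left B.smult_mult_right)
      then show ?thesis
        using lin_map_minus[OF D.k_space_axioms assms(1) h[OF ab] c] lin_map_closed[OF h[OF ab] c(2)]
        by (simp add: a_minus_def V.M.r_neg)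
    qed
    then show ?thesis using c by simp
  qed
  ultimately have "u \<in> ?Z" using R.rI_minimal assms(3) by blast
  then have "?h \<one>\<^bsub>A\<^esub> \<one>\<^bsub>B\<^esub> \<one>\<^bsub>A\<^esub> \<one>\<^bsub>B\<^esub> u = \<zero>\<^bsub>V\<^esub>" "u \<in> carrier D" by auto
  moreover have "e \<one>\<^bsub>A\<^esub> \<one>\<^bsub>B\<^esub> = \<one>\<^bsub>D\<^esub>" by (simp add: monoid_alg_simps)
  ultimately show ?thesis by simp
qed

lemma
  assumes "k_space V" "bilinear_map A B V \<beta>"
  shows tensor_lift_lin: "lin_map T V (tensor_lift V \<beta>)"
    and tensor_lift_pure: "\<And>a b. a \<in> carrier A \<Longrightarrow> b \<in> carrier B \<Longrightarrow> tensor_lift V \<beta> (t a b) = \<beta> a b"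
proof -
  interpret V: k_space V by fact
  note b = bilinear_map_simps[OF assms(2)]
  let ?f = "lin_ext V (\<lambda>(a, b). \<beta> a b)"
  have lin: "lin_map D V ?f" by (rule V.lin_ext_lin) (use b(1) in auto)
  have q: "tensor_lift V \<beta> (R.cls u) = ?f u" if "u \<in> carrier D" for u
    unfolding tensor_lift_def quot_lift_def
    by (rule R.quot_lift_cls[OF assms(1) lin tensor_lift_aux[OF assms] that])
  show "tensor_lift V \<beta> (t a b) = \<beta> a b" if "a \<in> carrier A" "b \<in> carrier B" for a b
    using that b(1) by (simp add: pure_tensor_def q single_D V.lin_ext_single)
  show "lin_map T V (tensor_lift V \<beta>)" unfolding tensor_alg_def
    by (rule lin_mapI) (auto simp: R.Q_simps q lin_map_closed[OF lin] lin_map_add[OF lin] lin_map_smult[OF lin])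
qed

lemma tensor_lift_hom:
  assumes "k_algebra V" "bilinear_map A B V \<beta>" "\<beta> \<one>\<^bsub>A\<^esub> \<one>\<^bsub>B\<^esub> = \<one>\<^bsub>V\<^esub>"
    "\<And>a b a' b'. a \<in> carrier A \<Longrightarrow> b \<in> carrier B \<Longrightarrow> a' \<in> carrier A \<Longrightarrow> b' \<in> carrier B \<Longrightarrow>
       \<beta> (a \<otimes>\<^bsub>A\<^esub> a') (b \<otimes>\<^bsub>B\<^esub> b') = \<beta> a b \<otimes>\<^bsub>V\<^esub> \<beta> a' b'"
  shows "tensor_lift V \<beta> \<in> alg_hom T V"
proof -
  interpret V: k_algebra V by fact
  note b = bilinear_map_simps[OF assms(2)]
  note lin = tensor_lift_lin[OF V.k_space_axioms assms(2)] and lp = tensor_lift_pure[OF V.k_space_axioms assms(2)]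
  note l = lin_map_closed[OF lin] lin_map_add[OF lin]
  have "tensor_lift V \<beta> (x \<otimes>\<^bsub>T\<^esub> y) = tensor_lift V \<beta> x \<otimes>\<^bsub>V\<^esub> tensor_lift V \<beta> y"
    if x: "x \<in> carrier T" and y: "y \<in> carrier T" for x y
    using x
  proof (induction x rule: tensor_induct)
    case (pure a b)
    from y show ?case
      by (induction y rule: tensor_induct) (use pure in \<open>auto simp: T.r_distr V.r_distr l pure_mult lp assms(4) b(1)\<close>)
  qed (use y in \<open>auto simp: T.l_distr V.l_distr l\<close>)
  then show ?thesis using lin assms(3) by (simp add: alg_hom_iff one_T lp)
qed

end

lemma (in k_space) add_scale_minus_one [simp]: "x \<in> carrier V \<Longrightarrow> x \<oplus> (- 1) \<odot> x = \<zero>"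
  by (simp add: scale_minus_one M.r_neg)

text \<open>Maps such as \<open>coass_l\<close> and \<open>mix\<close> nest one lift inside another.
  For the outer map to be bilinear, the value of the inner lift must depend linearly on its
  parameter.\<close>

lemma (in alg_pair) tensor_lift_param:
  assumes "k_space V" "\<And>f. f \<in> carrier F \<Longrightarrow> bilinear_map A B V (\<beta> f)" "k_space F"
    "\<And>a b. a \<in> carrier A \<Longrightarrow> b \<in> carrier B \<Longrightarrow> lin_map F V (\<lambda>f. \<beta> f a b)" "x \<in> carrier T"
  shows "lin_map F V (\<lambda>f. tensor_lift V (\<beta> f) x)"
proof -
  interpret V: k_space V by fact
  interpret F: k_space F by fact
  note lin = tensor_lift_lin[OF assms(1) assms(2)] and lp = tensor_lift_pure[OF assms(1) assms(2)]
  note l = lin_map_closed[OF lin] lin_map_add[OF lin]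
  note q = lin_map_add[OF assms(4)] lin_map_smult[OF assms(4)]
  from assms(5) show ?thesis
  proof (induction x rule: tensor_induct)
    case (pure a b)
    then show ?case by (intro lin_mapI) (auto simp: lp q intro: lin_map_closed[OF assms(4)])
  next
    case (add x y)
    note i = lin_map_add[OF add(3)] lin_map_add[OF add(4)] lin_map_smult[OF add(3)] lin_map_smult[OF add(4)]
    show ?case
      by (rule lin_mapI) (use add(1,2) in \<open>simp_all add: l i V.M.a_ac V.scale_add_right\<close>)
  qed
qed

text \<open>Three bilinear maps occur because in a nested lift the parameters are multiplied along
  with the arguments, so the two factors and the product belong to different maps.\<close>

lemma (in alg_pair) tensor_lift_mult:
  assumes "k_algebra V" "bilinear_map A B V \<beta>" "bilinear_map A B V \<beta>'" "bilinear_map A B V \<beta>''"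
    "\<And>a b a' b'. a \<in> carrier A \<Longrightarrow> b \<in> carrier B \<Longrightarrow> a' \<in> carrier A \<Longrightarrow> b' \<in> carrier B \<Longrightarrow>
       \<beta>'' (a \<otimes>\<^bsub>A\<^esub> a') (b \<otimes>\<^bsub>B\<^esub> b') = \<beta> a b \<otimes>\<^bsub>V\<^esub> \<beta>' a' b'"
    "x \<in> carrier T" "y \<in> carrier T"
  shows "tensor_lift V \<beta>'' (x \<otimes>\<^bsub>T\<^esub> y) = tensor_lift V \<beta> x \<otimes>\<^bsub>V\<^esub> tensor_lift V \<beta>' y"
proof -
  interpret V: k_algebra V by fact
  note lin = tensor_lift_lin[OF V.k_space_axioms assms(2)] tensor_lift_lin[OF V.k_space_axioms assms(3)]
    tensor_lift_lin[OF V.k_space_axioms assms(4)]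
  note lp = tensor_lift_pure[OF V.k_space_axioms assms(2)] tensor_lift_pure[OF V.k_space_axioms assms(3)]
    tensor_lift_pure[OF V.k_space_axioms assms(4)]
  note l = lin[THEN lin_map_closed] lin[THEN lin_map_add]
  note b = bilinear_map_simps(1)[OF assms(2)] bilinear_map_simps(1)[OF assms(3)]
  from assms(6) show ?thesis
  proof (induction x rule: tensor_induct)
    case (pure a b)
    from assms(7) show ?case
      by (induction y rule: tensor_induct) (use pure in \<open>auto simp: T.r_distr V.r_distr l pure_mult lp assms(5) b\<close>)
  qed (use assms(7) in \<open>auto simp: T.l_distr V.l_distr l\<close>)
qed

section \<open>Hopf algebras from generators\<close>

text \<open>Invertibility with inverse given by the antipode is built in, because the notion is
  applied before the antipode law is known.\<close>

definition grouplike :: "('k::field, 'a, 'r) hopf_scheme \<Rightarrow> 'a \<Rightarrow> bool" where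
  "grouplike H h \<longleftrightarrow> h \<in> carrier H \<and> comult H h = pure_tensor H H h h \<and> counit H h = 1 \<and>
     antipode H h \<otimes>\<^bsub>H\<^esub> h = \<one>\<^bsub>H\<^esub> \<and> h \<otimes>\<^bsub>H\<^esub> antipode H h = \<one>\<^bsub>H\<^esub>"

text \<open>The value of the antipode is the one forced by its law:
  \<open>S(x) a + S(b) x = 0\<close>, and \<open>S(a)\<close> is the inverse of
  \<open>a\<close>.\<close>

definition skew_primitive :: "('k::field, 'a, 'r) hopf_scheme \<Rightarrow> 'a \<Rightarrow> 'a \<Rightarrow> 'a \<Rightarrow> bool" where
  "skew_primitive H a b x \<longleftrightarrow> grouplike H a \<and> grouplike H b \<and> x \<in> carrier H \<and>
     comult H x = pure_tensor H H x a \<oplus>\<^bsub>tensor_alg H H\<^esub> pure_tensor H H b x \<and> counit H x = 0 \<and>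
     antipode H x = (- 1) \<odot>\<^bsub>H\<^esub> (antipode H b \<otimes>\<^bsub>H\<^esub> x \<otimes>\<^bsub>H\<^esub> antipode H a)"

text \<open>Only the operations and their (anti)multiplicativity. The coalgebra and antipode laws
  are what \<open>hopf_algebra_from_generators\<close> adds.\<close>

locale hopf_data = k_algebra H for H :: "('k::field, 'a, 'r) hopf_scheme" (structure) +
  assumes comult_alg_hom: "comult H \<in> alg_hom H (tensor_alg H H)"
    and counit_alg_hom: "counit H \<in> alg_hom H ground_field"
    and antipode_anti_hom: "antipode H \<in> alg_hom H (opposite_alg H)"
begin

sublocale HH: alg_pair H H by unfold_locales
sublocale HHH: alg_pair H "tensor_alg H H" by unfold_locales

abbreviation "S \<equiv> antipode H"
abbreviation "\<epsilon> \<equiv> counit H"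
abbreviation "\<Delta> \<equiv> comult H"
abbreviation "T2 \<equiv> tensor_alg H H"
abbreviation "T3 \<equiv> tensor_alg H (tensor_alg H H)"

lemma S_simps:
  "x \<in> carrier H \<Longrightarrow> S x \<in> carrier H" "S \<one> = \<one>"
  "x \<in> carrier H \<Longrightarrow> y \<in> carrier H \<Longrightarrow> S (x \<oplus> y) = S x \<oplus> S y"
  "x \<in> carrier H \<Longrightarrow> y \<in> carrier H \<Longrightarrow> S (x \<otimes> y) = S y \<otimes> S x"
  "x \<in> carrier H \<Longrightarrow> S (c \<odot> x) = c \<odot> S x"
  using alg_hom_closed[OF antipode_anti_hom, of x] alg_hom_one[OF antipode_anti_hom]
    alg_hom_add[OF antipode_anti_hom, of x y] alg_hom_mult[OF antipode_anti_hom, of x y]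
    alg_hom_smult[OF antipode_anti_hom, of x c] by simp_all

lemma eps_simps:
  "\<epsilon> \<one> = 1" "x \<in> carrier H \<Longrightarrow> y \<in> carrier H \<Longrightarrow> \<epsilon> (x \<oplus> y) = \<epsilon> x + \<epsilon> y"
  "x \<in> carrier H \<Longrightarrow> y \<in> carrier H \<Longrightarrow> \<epsilon> (x \<otimes> y) = \<epsilon> x * \<epsilon> y"
  "x \<in> carrier H \<Longrightarrow> \<epsilon> (c \<odot> x) = c * \<epsilon> x"
  using alg_hom_one[OF counit_alg_hom]
    alg_hom_add[OF counit_alg_hom, of x y] alg_hom_mult[OF counit_alg_hom, of x y]
    alg_hom_smult[OF counit_alg_hom, of x c] by simp_all

lemmas comult_simps = alg_hom_closed[OF comult_alg_hom] alg_hom_one[OF comult_alg_hom]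
  alg_hom_add[OF comult_alg_hom] alg_hom_mult[OF comult_alg_hom] alg_hom_smult[OF comult_alg_hom]

lemma grouplike_one: "grouplike H \<one>"
  using comult_simps(2) by (simp add: grouplike_def S_simps eps_simps HH.one_T)

definition coass_r :: "'a \<Rightarrow> 'a \<Rightarrow> ('k, 'a, ('k, 'a, 'a) tensor) tensor" where
  "coass_r a b = pure_tensor H T2 a (\<Delta> b)"

text \<open>This is \<open>\<Delta> \<otimes> id\<close>, where the inner lift also moves the
  brackets from \<open>(H \<otimes> H) \<otimes> H\<close> to
  \<open>H \<otimes> (H \<otimes> H)\<close>; its partner \<open>coass_r\<close> is
  \<open>id \<otimes> \<Delta>\<close>.\<close>

definition coass_l :: "'a \<Rightarrow> 'a \<Rightarrow> ('k, 'a, ('k, 'a, 'a) tensor) tensor" where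
  "coass_l a b = tensor_lift T3 (\<lambda>a\<^sub>1 a\<^sub>2. pure_tensor H T2 a\<^sub>1 (pure_tensor H H a\<^sub>2 b)) (\<Delta> a)"

lemma coass_r_bilinear: "bilinear_map H H T3 coass_r"
  unfolding coass_r_def by (rule bilinear_mapI) (simp_all add: comult_simps HHH.pure_simps)

lemma coass_r_hom: "tensor_lift T3 coass_r \<in> alg_hom T2 T3"
  by (rule HH.tensor_lift_hom[OF HHH.k_algebra_T coass_r_bilinear])
    (simp_all add: coass_r_def comult_simps HHH.pure_mult HHH.one_T)

lemma coass_l_aux: "b \<in> carrier H \<Longrightarrow> bilinear_map H H T3 (\<lambda>a\<^sub>1 a\<^sub>2. pure_tensor H T2 a\<^sub>1 (pure_tensor H H a\<^sub>2 b))"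
  by (rule bilinear_mapI) (simp_all add: HHH.pure_simps HH.pure_simps)

lemmas coass_l_aux_lin = HH.tensor_lift_lin[OF HHH.T.k_space_axioms coass_l_aux]
lemmas coass_l_aux_pure = HH.tensor_lift_pure[OF HHH.T.k_space_axioms coass_l_aux]

lemma coass_l_bilinear: "bilinear_map H H T3 coass_l"
proof -
  have p: "lin_map H T3 (\<lambda>b. tensor_lift T3 (\<lambda>a\<^sub>1 a\<^sub>2. pure_tensor H T2 a\<^sub>1 (pure_tensor H H a\<^sub>2 b)) x)"
    if "x \<in> carrier T2" for x
    by (rule HH.tensor_lift_param[OF HHH.T.k_space_axioms coass_l_aux k_space_axioms _ that], assumption,
      rule lin_mapI) (simp_all add: HHH.pure_simps HH.pure_simps)
  show ?thesis unfolding coass_l_def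
    by (rule bilinear_mapI)
      (simp_all add: comult_simps lin_map_closed[OF coass_l_aux_lin] lin_map_add[OF coass_l_aux_lin]
        lin_map_smult[OF coass_l_aux_lin] lin_map_add[OF p] lin_map_smult[OF p])
qed

lemma coass_l_hom: "tensor_lift T3 coass_l \<in> alg_hom T2 T3"
proof (rule HH.tensor_lift_hom[OF HHH.k_algebra_T coass_l_bilinear])
  show "coass_l \<one> \<one> = \<one>\<^bsub>T3\<^esub>"
    by (simp add: coass_l_def comult_simps(2) HH.one_T HHH.one_T coass_l_aux_pure)
  fix a b a' b' assume ab: "a \<in> carrier H" "b \<in> carrier H" "a' \<in> carrier H" "b' \<in> carrier H"
  show "coass_l (a \<otimes> a') (b \<otimes> b') = coass_l a b \<otimes>\<^bsub>T3\<^esub> coass_l a' b'"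
    unfolding coass_l_def comult_simps(4)[OF ab(1,3)]
    by (rule HH.tensor_lift_mult[OF HHH.k_algebra_T])
      (use ab in \<open>auto intro!: coass_l_aux simp: comult_simps HH.pure_mult HHH.pure_mult\<close>)
qed

lemma counit_left_bilinear: "bilinear_map H H H (\<lambda>a b. \<epsilon> a \<odot> b)"
  by (rule bilinear_mapI) (simp_all add: eps_simps scale_add_left scale_add_right mult.commute)

lemma counit_right_bilinear: "bilinear_map H H H (\<lambda>a b. \<epsilon> b \<odot> a)"
  by (rule bilinear_mapI) (simp_all add: eps_simps scale_add_left scale_add_right mult.commute)

lemma antipode_left_bilinear: "bilinear_map H H H (\<lambda>a b. S a \<otimes> b)"
  by (rule bilinear_mapI) (simp_all add: S_simps l_distr r_distr smult_mult_left smult_mult_right)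

lemma antipode_right_bilinear: "bilinear_map H H H (\<lambda>a b. a \<otimes> S b)"
  by (rule bilinear_mapI) (simp_all add: S_simps l_distr r_distr smult_mult_left smult_mult_right)

text \<open>The map \<open>h \<mapsto> S(h1) h2\<close> is not multiplicative, so generators cannot
  be used through equality of homomorphisms. As \<open>S\<close> reverses products,
  \<open>L(x (a \<otimes> b)) = S(a) L(x) b\<close>. If \<open>L(x)\<close> is a scalar
  \<open>c\<close>, it can be pulled out, giving \<open>L(x y) = c L(y)\<close>; this is closure
  under products.\<close>

lemma antipode_left_subalgebra:
  "k_subalgebra H {h \<in> carrier H. tensor_lift H (\<lambda>a b. S a \<otimes> b) (\<Delta> h) = \<epsilon> h \<odot> \<one>}"
proof -
  let ?L = "tensor_lift H (\<lambda>a b. S a \<otimes> b)"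
  note lin = HH.tensor_lift_lin[OF k_space_axioms antipode_left_bilinear]
  note lp = HH.tensor_lift_pure[OF k_space_axioms antipode_left_bilinear]
  note l = lin_map_closed[OF lin] lin_map_add[OF lin] lin_map_smult[OF lin]
  have p: "?L (x \<otimes>\<^bsub>T2\<^esub> HH.t a b) = S a \<otimes> ?L x \<otimes> b" if "x \<in> carrier T2" "a \<in> carrier H" "b \<in> carrier H" for x a b
    using that(1) by (induction x rule: HH.tensor_induct)
      (use that(2,3) in \<open>simp_all add: HH.pure_mult lp S_simps m_assoc HH.T.l_distr l_distr r_distr l\<close>)
  have m: "?L (x \<otimes>\<^bsub>T2\<^esub> y) = c \<odot> ?L y" if "y \<in> carrier T2" "x \<in> carrier T2" "?L x = c \<odot> \<one>" for x y c
    using that(1) by (induction y rule: HH.tensor_induct)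
      (use that(2,3) in \<open>simp_all add: p lp S_simps HH.T.r_distr l smult_mult_left smult_mult_right scale_add_right\<close>)
  show ?thesis unfolding k_subalgebra_def
    by (auto simp: comult_simps eps_simps l HH.one_T lp S_simps m scale_add_left)
qed

text \<open>The mirror image of the previous argument: now
  \<open>L((a \<otimes> b) x) = a L(x) S(b)\<close>, so a scalar value of the right factor is pulled
  out.\<close>

lemma antipode_right_subalgebra:
  "k_subalgebra H {h \<in> carrier H. tensor_lift H (\<lambda>a b. a \<otimes> S b) (\<Delta> h) = \<epsilon> h \<odot> \<one>}"
proof -
  let ?L = "tensor_lift H (\<lambda>a b. a \<otimes> S b)"
  note lin = HH.tensor_lift_lin[OF k_space_axioms antipode_right_bilinear]
  note lp = HH.tensor_lift_pure[OF k_space_axioms antipode_right_bilinear]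
  note l = lin_map_closed[OF lin] lin_map_add[OF lin] lin_map_smult[OF lin]
  have p: "?L (HH.t a b \<otimes>\<^bsub>T2\<^esub> x) = a \<otimes> ?L x \<otimes> S b" if "x \<in> carrier T2" "a \<in> carrier H" "b \<in> carrier H" for x a b
    using that(1) by (induction x rule: HH.tensor_induct)
      (use that(2,3) in \<open>simp_all add: HH.pure_mult lp S_simps m_assoc HH.T.r_distr l_distr r_distr l\<close>)
  have m: "?L (y \<otimes>\<^bsub>T2\<^esub> x) = c \<odot> ?L y" if "y \<in> carrier T2" "x \<in> carrier T2" "?L x = c \<odot> \<one>" for x y c
    using that(1) by (induction y rule: HH.tensor_induct)
      (use that(2,3) in \<open>simp_all add: p lp S_simps HH.T.l_distr l smult_mult_left smult_mult_right scale_add_right\<close>)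
  show ?thesis unfolding k_subalgebra_def
    by (auto simp: comult_simps eps_simps l HH.one_T lp S_simps m scale_add_left mult.commute)
qed

lemma grouplike_axioms:
  assumes "grouplike H h"
  shows "tensor_lift T3 coass_r (\<Delta> h) = tensor_lift T3 coass_l (\<Delta> h)"
    "tensor_lift H (\<lambda>a b. \<epsilon> a \<odot> b) (\<Delta> h) = h" "tensor_lift H (\<lambda>a b. \<epsilon> b \<odot> a) (\<Delta> h) = h"
    "tensor_lift H (\<lambda>a b. S a \<otimes> b) (\<Delta> h) = \<epsilon> h \<odot> \<one>" "tensor_lift H (\<lambda>a b. a \<otimes> S b) (\<Delta> h) = \<epsilon> h \<odot> \<one>"
  using assms
  by (simp_all add: grouplike_def HH.tensor_lift_pure[OF HHH.T.k_space_axioms coass_r_bilinear]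
      HH.tensor_lift_pure[OF HHH.T.k_space_axioms coass_l_bilinear] coass_r_def coass_l_def coass_l_aux_pure
      HH.tensor_lift_pure[OF k_space_axioms counit_left_bilinear]
      HH.tensor_lift_pure[OF k_space_axioms counit_right_bilinear]
      HH.tensor_lift_pure[OF k_space_axioms antipode_left_bilinear]
      HH.tensor_lift_pure[OF k_space_axioms antipode_right_bilinear])

lemma skew_primitive_axioms:
  assumes "skew_primitive H a b x"
  shows "tensor_lift T3 coass_r (\<Delta> x) = tensor_lift T3 coass_l (\<Delta> x)"
    "tensor_lift H (\<lambda>a b. \<epsilon> a \<odot> b) (\<Delta> x) = x" "tensor_lift H (\<lambda>a b. \<epsilon> b \<odot> a) (\<Delta> x) = x"
    "tensor_lift H (\<lambda>a b. S a \<otimes> b) (\<Delta> x) = \<epsilon> x \<odot> \<one>" "tensor_lift H (\<lambda>a b. a \<otimes> S b) (\<Delta> x) = \<epsilon> x \<odot> \<one>"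
proof -
  have c: "a \<in> carrier H" "b \<in> carrier H" "x \<in> carrier H" "S a \<in> carrier H" "S b \<in> carrier H"
    and d: "\<Delta> x = HH.t x a \<oplus>\<^bsub>T2\<^esub> HH.t b x" "\<Delta> a = HH.t a a" "\<Delta> b = HH.t b b"
    and e: "\<epsilon> a = 1" "\<epsilon> b = 1" "\<epsilon> x = 0"
    and s: "S x = (- 1) \<odot> (S b \<otimes> x \<otimes> S a)" "S a \<otimes> a = \<one>" "S b \<otimes> b = \<one>" "a \<otimes> S a = \<one>" "b \<otimes> S b = \<one>"
    using assms by (auto simp: skew_primitive_def grouplike_def S_simps)
  show "tensor_lift T3 coass_r (\<Delta> x) = tensor_lift T3 coass_l (\<Delta> x)"
    using c by (simp add: d lin_map_add[OF alg_hom_lin[OF coass_r_hom]] lin_map_add[OF alg_hom_lin[OF coass_l_hom]]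
        HH.tensor_lift_pure[OF HHH.T.k_space_axioms coass_r_bilinear]
        HH.tensor_lift_pure[OF HHH.T.k_space_axioms coass_l_bilinear] coass_r_def coass_l_def
        lin_map_add[OF coass_l_aux_lin] coass_l_aux_pure HHH.pure_simps HHH.T.a_assoc)
  note lin = HH.tensor_lift_lin[OF k_space_axioms counit_left_bilinear]
    HH.tensor_lift_lin[OF k_space_axioms counit_right_bilinear]
    HH.tensor_lift_lin[OF k_space_axioms antipode_left_bilinear]
    HH.tensor_lift_lin[OF k_space_axioms antipode_right_bilinear]
  note lp = HH.tensor_lift_pure[OF k_space_axioms counit_left_bilinear]
    HH.tensor_lift_pure[OF k_space_axioms counit_right_bilinear]
    HH.tensor_lift_pure[OF k_space_axioms antipode_left_bilinear]
    HH.tensor_lift_pure[OF k_space_axioms antipode_right_bilinear]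
  show "tensor_lift H (\<lambda>a b. \<epsilon> a \<odot> b) (\<Delta> x) = x" "tensor_lift H (\<lambda>a b. \<epsilon> b \<odot> a) (\<Delta> x) = x"
    using c by (simp_all add: d lin[THEN lin_map_add] lp e)
  have "S x \<otimes> a = (- 1) \<odot> (S b \<otimes> x)"
    using c by (simp add: s(1,2) smult_mult_left m_assoc)
  moreover have "b \<otimes> S x = (- 1) \<odot> (x \<otimes> S a)"
    using c m_assoc[of b "S b" "x \<otimes> S a", symmetric] by (simp add: s(1,5) smult_mult_right m_assoc)
  ultimately show "tensor_lift H (\<lambda>a b. S a \<otimes> b) (\<Delta> x) = \<epsilon> x \<odot> \<one>" "tensor_lift H (\<lambda>a b. a \<otimes> S b) (\<Delta> x) = \<epsilon> x \<odot> \<one>"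
    using c a_comm[of "(- 1) \<odot> (S b \<otimes> x)" "S b \<otimes> x"] by (simp_all add: d lin[THEN lin_map_add] lp e)
qed

text \<open>Two mechanisms are at work. Coassociativity and the counit laws compare algebra
  homomorphisms, which agree once they agree on generators. The antipode laws hold on a
  subalgebra.\<close>

theorem hopf_algebra_from_generators:
  assumes "alg_generates H X" "\<And>h. h \<in> X \<Longrightarrow> grouplike H h \<or> (\<exists>a b. skew_primitive H a b h)"
  shows "hopf_algebra H"
proof
  have gen: "tensor_lift T3 coass_r (\<Delta> x) = tensor_lift T3 coass_l (\<Delta> x)"
    "tensor_lift H (\<lambda>a b. \<epsilon> a \<odot> b) (\<Delta> x) = x" "tensor_lift H (\<lambda>a b. \<epsilon> b \<odot> a) (\<Delta> x) = x"
    "tensor_lift H (\<lambda>a b. S a \<otimes> b) (\<Delta> x) = \<epsilon> x \<odot> \<one>" "tensor_lift H (\<lambda>a b. a \<otimes> S b) (\<Delta> x) = \<epsilon> x \<odot> \<one>"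
    if "x \<in> X" for x
    using assms(2)[OF that] grouplike_axioms[of x] skew_primitive_axioms[of _ _ x] by metis+
  have id: "(\<lambda>x. x) \<in> alg_hom H H" by (rule alg_homI) auto
  show "\<Delta> \<in> alg_hom H T2" "\<epsilon> \<in> alg_hom H ground_field"
    by (rule comult_alg_hom counit_alg_hom)+
  fix h h' c assume h: "h \<in> carrier H"
  show "S h \<in> carrier H" "S (c \<odot> h) = c \<odot> S h" using h by (simp_all add: S_simps)
  show "S (h \<oplus> h') = S h \<oplus> S h'" if "h' \<in> carrier H" using h that by (simp add: S_simps)
  have "tensor_lift T3 coass_r (\<Delta> h) = tensor_lift T3 coass_l (\<Delta> h)"
    by (rule alg_hom_eq_on_generators[OF k_algebra_axioms assms(1) alg_hom_comp[OF comult_alg_hom coass_r_hom]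
          alg_hom_comp[OF comult_alg_hom coass_l_hom] gen(1) h])
  then show "tensor_lift T3 (\<lambda>a b. pure_tensor H T2 a (\<Delta> b)) (\<Delta> h) = tensor_lift T3 (\<lambda>a b. tensor_lift T3
      (\<lambda>a\<^sub>1 a\<^sub>2. pure_tensor H T2 a\<^sub>1 (pure_tensor H H a\<^sub>2 b)) (\<Delta> a)) (\<Delta> h)"
    by (simp add: coass_r_def[abs_def] coass_l_def[abs_def])
  have counits: "tensor_lift H (\<lambda>a b. \<epsilon> a \<odot> b) \<in> alg_hom T2 H" "tensor_lift H (\<lambda>a b. \<epsilon> b \<odot> a) \<in> alg_hom T2 H"
    by (rule HH.tensor_lift_hom[OF k_algebra_axioms counit_left_bilinear],
        simp_all add: eps_simps smult_mult_left smult_mult_right mult.commute)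
      (rule HH.tensor_lift_hom[OF k_algebra_axioms counit_right_bilinear],
        simp_all add: eps_simps smult_mult_left smult_mult_right mult.commute)
  note counits = counits[THEN alg_hom_comp[OF comult_alg_hom]]
  show "tensor_lift H (\<lambda>a b. \<epsilon> a \<odot> b) (\<Delta> h) = h"
    by (rule alg_hom_eq_on_generators[OF k_algebra_axioms assms(1) counits(1) id gen(2) h])
  show "tensor_lift H (\<lambda>a b. \<epsilon> b \<odot> a) (\<Delta> h) = h"
    by (rule alg_hom_eq_on_generators[OF k_algebra_axioms assms(1) counits(2) id gen(3) h])
  have X: "X \<subseteq> carrier H" using assms(1) by (simp add: alg_generates_def)
  show "tensor_lift H (\<lambda>a b. S a \<otimes> b) (\<Delta> h) = \<epsilon> h \<odot> \<one>"
    using antipode_left_subalgebra gen(4) assms(1) X h unfolding alg_generates_def by blast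
  show "tensor_lift H (\<lambda>a b. a \<otimes> S b) (\<Delta> h) = \<epsilon> h \<odot> \<one>"
    using antipode_right_subalgebra gen(5) assms(1) X h unfolding alg_generates_def by blast
qed

end

section \<open>Attaching Hopf data to an algebra\<close>

lemma module_extend_simps [simp]:
  "carrier (module.extend A m) = carrier A" "mult (module.extend A m) = mult A" "one (module.extend A m) = one A"
  "zero (module.extend A m) = zero A" "add (module.extend A m) = add A" "smult (module.extend A m) = smult A"
  "module.truncate (module.extend A m) = A"
  by (simp_all add: module.defs)

lemma hopf_extend_simps [simp]:
  "comult (module.extend A (hopf.fields c e s)) = c" "counit (module.extend A (hopf.fields c e s)) = e"
  "antipode (module.extend A (hopf.fields c e s)) = s"
  by (simp_all add: module.defs hopf.defs)

lemma monoid_alg_DirProd_extend: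
  "module.extend A m \<times>\<times> module.extend B m' = A \<times>\<times> B"
  by (simp add: DirProd_def)

lemma tensor_extend [simp]:
  "tensor_alg (module.extend A m) (module.extend B m') = tensor_alg A B"
  "pure_tensor (module.extend A m) (module.extend B m') = pure_tensor A B"
  by (simp_all add: tensor_alg_def pure_tensor_def[abs_def] monoid_alg_DirProd_extend bilinear_rels_def)

lemma k_algebra_extend [simp]: "k_algebra (module.extend A m) \<longleftrightarrow> k_algebra A"
  using k_algebra_cong[of "module.extend A m" A] k_algebra_cong[of A "module.extend A m"] by auto

lemma alg_hom_extend [simp]:
  "alg_hom (module.extend A m) B = alg_hom A B" "alg_hom A (module.extend C m') = alg_hom A C"
  by (auto simp: alg_hom_def ring_hom_def)

lemma alg_iso_extend [simp]:
  "alg_iso (module.extend A m) B = alg_iso A B" "alg_iso A (module.extend C m') = alg_iso A C"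
  by (simp_all add: alg_iso_def)

lemma opposite_alg_extend [simp]: "opposite_alg (module.extend A m) = opposite_alg A"
  by (simp add: opposite_alg_def)

lemma alg_generates_extend [simp]: "alg_generates (module.extend A m) X = alg_generates A X"
  by (simp add: alg_generates_def k_subalgebra_def)

section \<open>Tensor products of Hopf algebras\<close>

locale hopf_pair = H: hopf_data H + G: hopf_data G
  for H :: "('k::field, 'a, 'r) hopf_scheme" and G :: "('k, 'b, 's) hopf_scheme"
begin

sublocale HG: alg_pair H G by unfold_locales
sublocale TT: alg_pair "tensor_alg H G" "tensor_alg H G" by unfold_locales

abbreviation "TT \<equiv> tensor_alg (tensor_alg H G) (tensor_alg H G)"
abbreviation "p \<equiv> pure_tensor H G"
abbreviation "pp \<equiv> pure_tensor (tensor_alg H G) (tensor_alg H G)"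
abbreviation "K \<equiv> tensor_hopf H G"

definition inner where
  "inner h\<^sub>1 h\<^sub>2 Y = tensor_lift TT (\<lambda>k\<^sub>1 k\<^sub>2. pp (p h\<^sub>1 k\<^sub>1) (p h\<^sub>2 k\<^sub>2)) Y"

text \<open>The interchange of the two middle factors of
  \<open>(H \<otimes> H) \<otimes> (G \<otimes> G)\<close>, kept as a function of two tensors
  because this is the nesting of lifts inside \<open>tensor_hopf\<close>.\<close>

definition mix where
  "mix X Y = tensor_lift TT (\<lambda>h\<^sub>1 h\<^sub>2. inner h\<^sub>1 h\<^sub>2 Y) X"

lemma inner_aux: "h\<^sub>1 \<in> carrier H \<Longrightarrow> h\<^sub>2 \<in> carrier H \<Longrightarrow>
    bilinear_map G G TT (\<lambda>k\<^sub>1 k\<^sub>2. pp (p h\<^sub>1 k\<^sub>1) (p h\<^sub>2 k\<^sub>2))"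
  by (rule bilinear_mapI) (simp_all add: TT.pure_simps HG.pure_simps)

lemma inner_lin: "h\<^sub>1 \<in> carrier H \<Longrightarrow> h\<^sub>2 \<in> carrier H \<Longrightarrow> lin_map G.T2 TT (inner h\<^sub>1 h\<^sub>2)"
  unfolding inner_def by (rule G.HH.tensor_lift_lin[OF TT.T.k_space_axioms inner_aux])

lemma inner_pure: "h\<^sub>1 \<in> carrier H \<Longrightarrow> h\<^sub>2 \<in> carrier H \<Longrightarrow> k\<^sub>1 \<in> carrier G \<Longrightarrow> k\<^sub>2 \<in> carrier G \<Longrightarrow>
    inner h\<^sub>1 h\<^sub>2 (G.HH.t k\<^sub>1 k\<^sub>2) = pp (p h\<^sub>1 k\<^sub>1) (p h\<^sub>2 k\<^sub>2)"
  unfolding inner_def by (rule G.HH.tensor_lift_pure[OF TT.T.k_space_axioms inner_aux])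

lemma inner_bilinear:
  assumes "Y \<in> carrier G.T2" shows "bilinear_map H H TT (\<lambda>h\<^sub>1 h\<^sub>2. inner h\<^sub>1 h\<^sub>2 Y)"
  unfolding bilinear_map_def inner_def
  by (intro conjI ballI;
      rule G.HH.tensor_lift_param[OF TT.T.k_space_axioms inner_aux H.k_space_axioms _ assms])
    (auto intro!: lin_mapI simp: TT.pure_simps HG.pure_simps)

lemma inner_mult:
  assumes "h\<^sub>1 \<in> carrier H" "h\<^sub>2 \<in> carrier H" "h\<^sub>1' \<in> carrier H" "h\<^sub>2' \<in> carrier H"
    "Y \<in> carrier G.T2" "Y' \<in> carrier G.T2"
  shows "inner (h\<^sub>1 \<otimes>\<^bsub>H\<^esub> h\<^sub>1') (h\<^sub>2 \<otimes>\<^bsub>H\<^esub> h\<^sub>2') (Y \<otimes>\<^bsub>G.T2\<^esub> Y') = inner h\<^sub>1 h\<^sub>2 Y \<otimes>\<^bsub>TT\<^esub> inner h\<^sub>1' h\<^sub>2' Y'"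
  unfolding inner_def
  by (rule G.HH.tensor_lift_mult[OF TT.k_algebra_T])
    (use assms in \<open>auto intro!: inner_aux simp: TT.pure_mult HG.pure_mult\<close>)

lemma mix_lin_left: "Y \<in> carrier G.T2 \<Longrightarrow> lin_map H.T2 TT (\<lambda>X. mix X Y)"
  unfolding mix_def by (rule H.HH.tensor_lift_lin[OF TT.T.k_space_axioms inner_bilinear])

lemma mix_lin_right: "X \<in> carrier H.T2 \<Longrightarrow> lin_map G.T2 TT (\<lambda>Y. mix X Y)"
  unfolding mix_def
  by (rule H.HH.tensor_lift_param[OF TT.T.k_space_axioms inner_bilinear G.HH.T.k_space_axioms inner_lin])

lemma mix_pure: "h\<^sub>1 \<in> carrier H \<Longrightarrow> h\<^sub>2 \<in> carrier H \<Longrightarrow> k\<^sub>1 \<in> carrier G \<Longrightarrow> k\<^sub>2 \<in> carrier G \<Longrightarrow>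
    mix (H.HH.t h\<^sub>1 h\<^sub>2) (G.HH.t k\<^sub>1 k\<^sub>2) = pp (p h\<^sub>1 k\<^sub>1) (p h\<^sub>2 k\<^sub>2)"
  unfolding mix_def by (simp add: H.HH.tensor_lift_pure[OF TT.T.k_space_axioms inner_bilinear] inner_pure)

lemma mix_mult:
  assumes "X \<in> carrier H.T2" "X' \<in> carrier H.T2" "Y \<in> carrier G.T2" "Y' \<in> carrier G.T2"
  shows "mix (X \<otimes>\<^bsub>H.T2\<^esub> X') (Y \<otimes>\<^bsub>G.T2\<^esub> Y') = mix X Y \<otimes>\<^bsub>TT\<^esub> mix X' Y'"
  unfolding mix_def
  by (rule H.HH.tensor_lift_mult[OF TT.k_algebra_T])
    (use assms in \<open>auto intro!: inner_bilinear simp: inner_mult\<close>)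

definition "comultK = tensor_lift TT (\<lambda>h k. mix (H.\<Delta> h) (G.\<Delta> k))"
definition "counitK = tensor_lift ground_field (\<lambda>h k. H.\<epsilon> h * G.\<epsilon> k)"
definition "antipodeK = tensor_lift (tensor_alg H G) (\<lambda>h k. p (H.S h) (G.S k))"

lemma tensor_hopf_eq: "K = module.extend (tensor_alg H G) (hopf.fields comultK counitK antipodeK)"
  unfolding tensor_hopf_def Let_def comultK_def counitK_def antipodeK_def mix_def inner_def ..

lemma comultK_bilinear: "bilinear_map H G TT (\<lambda>h k. mix (H.\<Delta> h) (G.\<Delta> k))"
  by (rule bilinear_mapI)
    (simp_all add: H.comult_simps G.comult_simps lin_map_closed[OF mix_lin_left] lin_map_add[OF mix_lin_left]
      lin_map_smult[OF mix_lin_left] lin_map_add[OF mix_lin_right] lin_map_smult[OF mix_lin_right])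

lemma comultK_pure: "h \<in> carrier H \<Longrightarrow> k \<in> carrier G \<Longrightarrow> comultK (p h k) = mix (H.\<Delta> h) (G.\<Delta> k)"
  unfolding comultK_def by (rule HG.tensor_lift_pure[OF TT.T.k_space_axioms comultK_bilinear])

lemma comultK_hom: "comultK \<in> alg_hom (tensor_alg H G) TT"
  unfolding comultK_def
  by (rule HG.tensor_lift_hom[OF TT.k_algebra_T comultK_bilinear])
    (simp_all add: H.comult_simps G.comult_simps mix_mult H.HH.one_T G.HH.one_T mix_pure TT.one_T HG.one_T)

lemma counitK_bilinear: "bilinear_map H G ground_field (\<lambda>h k. H.\<epsilon> h * G.\<epsilon> k)"
  by (rule bilinear_mapI) (simp_all add: H.eps_simps G.eps_simps algebra_simps)

lemma counitK_pure: "h \<in> carrier H \<Longrightarrow> k \<in> carrier G \<Longrightarrow> counitK (p h k) = H.\<epsilon> h * G.\<epsilon> k"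
  unfolding counitK_def
  by (rule HG.tensor_lift_pure[OF k_algebra_k_space[OF k_algebra_ground_field] counitK_bilinear])

lemma counitK_hom: "counitK \<in> alg_hom (tensor_alg H G) ground_field"
  unfolding counitK_def
  by (rule HG.tensor_lift_hom[OF k_algebra_ground_field counitK_bilinear])
    (simp_all add: H.eps_simps G.eps_simps)

lemma antipodeK_bilinear: "bilinear_map H G (opposite_alg (tensor_alg H G)) (\<lambda>h k. p (H.S h) (G.S k))"
  by (rule bilinear_mapI) (simp_all add: H.S_simps G.S_simps HG.pure_simps)

text \<open>A lift uses only the additive structure of its target, which the opposite algebra
  shares. The antipode can thus be treated as a lift of homomorphisms into the opposite
  algebra.\<close>

lemma tensor_lift_opposite: "tensor_lift (opposite_alg V) = tensor_lift V"
  by (simp add: tensor_lift_def[abs_def] quot_lift_def[abs_def] lin_ext_def[abs_def] finsum_def finprod_def)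

lemma antipodeK_opposite: "antipodeK = tensor_lift (opposite_alg (tensor_alg H G)) (\<lambda>h k. p (H.S h) (G.S k))"
  unfolding tensor_lift_opposite by (rule antipodeK_def)

lemma antipodeK_pure: "h \<in> carrier H \<Longrightarrow> k \<in> carrier G \<Longrightarrow> antipodeK (p h k) = p (H.S h) (G.S k)"
  unfolding antipodeK_opposite
  by (rule HG.tensor_lift_pure[OF k_algebra_k_space[OF k_algebra_opposite[OF HG.k_algebra_T]] antipodeK_bilinear])

lemma antipodeK_hom: "antipodeK \<in> alg_hom (tensor_alg H G) (opposite_alg (tensor_alg H G))"
  unfolding antipodeK_opposite
  by (rule HG.tensor_lift_hom[OF k_algebra_opposite[OF HG.k_algebra_T] antipodeK_bilinear])
    (simp_all add: H.S_simps G.S_simps HG.pure_mult HG.one_T)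

lemma hopf_data_tensor: "hopf_data K"
  unfolding tensor_hopf_eq hopf_data_def hopf_data_axioms_def
  by (simp add: HG.k_algebra_T comultK_hom counitK_hom antipodeK_hom)

lemma grouplike_tensor:
  assumes "grouplike H a" "grouplike G b" shows "grouplike K (p a b)"
  using assms unfolding tensor_hopf_eq grouplike_def
  by (simp add: comultK_pure counitK_pure antipodeK_pure mix_pure H.S_simps G.S_simps HG.pure_mult HG.one_T)

lemma skew_primitive_tensor:
  assumes "skew_primitive H a b x"
  shows "skew_primitive K (p a \<one>\<^bsub>G\<^esub>) (p b \<one>\<^bsub>G\<^esub>) (p x \<one>\<^bsub>G\<^esub>)"
proof -
  have g: "grouplike K (p a \<one>\<^bsub>G\<^esub>)" "grouplike K (p b \<one>\<^bsub>G\<^esub>)"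
    using assms G.grouplike_one by (auto simp: skew_primitive_def intro: grouplike_tensor)
  have c: "a \<in> carrier H" "b \<in> carrier H" "x \<in> carrier H"
    using assms by (auto simp: skew_primitive_def grouplike_def)
  have one: "G.\<Delta> \<one>\<^bsub>G\<^esub> = G.HH.t \<one>\<^bsub>G\<^esub> \<one>\<^bsub>G\<^esub>" using G.comult_simps(2) by (simp add: G.HH.one_T)
  have "comultK (p x \<one>\<^bsub>G\<^esub>) = pp (p x \<one>\<^bsub>G\<^esub>) (p a \<one>\<^bsub>G\<^esub>) \<oplus>\<^bsub>TT\<^esub> pp (p b \<one>\<^bsub>G\<^esub>) (p x \<one>\<^bsub>G\<^esub>)"
    using assms c by (simp add: skew_primitive_def comultK_pure one lin_map_add[OF mix_lin_left] mix_pure)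
  moreover have "antipodeK (p x \<one>\<^bsub>G\<^esub>) = (- 1) \<odot>\<^bsub>tensor_alg H G\<^esub> (antipodeK (p b \<one>\<^bsub>G\<^esub>) \<otimes>\<^bsub>tensor_alg H G\<^esub>
      p x \<one>\<^bsub>G\<^esub> \<otimes>\<^bsub>tensor_alg H G\<^esub> antipodeK (p a \<one>\<^bsub>G\<^esub>))"
    using assms c by (simp add: skew_primitive_def antipodeK_pure G.S_simps H.S_simps HG.pure_mult HG.pure_simps)
  ultimately show ?thesis
    using g assms c unfolding skew_primitive_def by (simp add: tensor_hopf_eq counitK_pure)
qed

text \<open>For a subalgebra \<open>Z\<close>, the elements \<open>x\<close> with
  \<open>x \<otimes> 1\<close> in \<open>Z\<close> form a subalgebra of the first factor, and
  likewise for the second. Every pure tensor is the product of \<open>x \<otimes> 1\<close> and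
  \<open>1 \<otimes> y\<close>.\<close>

lemma alg_generates_tensor:
  assumes "alg_generates H X" "alg_generates G Y"
  shows "alg_generates K ((\<lambda>x. p x \<one>\<^bsub>G\<^esub>) ` X \<union> (\<lambda>y. p \<one>\<^bsub>H\<^esub> y) ` Y)"
  unfolding tensor_hopf_eq alg_generates_extend unfolding alg_generates_def
proof (rule conjI; (intro allI impI; elim conjE)?)
  show "(\<lambda>x. p x \<one>\<^bsub>G\<^esub>) ` X \<union> (\<lambda>y. p \<one>\<^bsub>H\<^esub> y) ` Y \<subseteq> carrier HG.T"
    using assms by (auto simp: alg_generates_def)
  fix Z assume Z: "k_subalgebra HG.T Z" "(\<lambda>x. p x \<one>\<^bsub>G\<^esub>) ` X \<union> (\<lambda>y. p \<one>\<^bsub>H\<^esub> y) ` Y \<subseteq> Z"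
  have one: "p \<one>\<^bsub>H\<^esub> \<one>\<^bsub>G\<^esub> \<in> Z" using Z(1) by (simp add: k_subalgebra_def HG.one_T)
  have Zm: "u \<otimes>\<^bsub>HG.T\<^esub> v \<in> Z" "u \<oplus>\<^bsub>HG.T\<^esub> v \<in> Z" "c \<odot>\<^bsub>HG.T\<^esub> u \<in> Z" if "u \<in> Z" "v \<in> Z" for u v c
    using Z(1) that by (auto simp: k_subalgebra_def)
  have m: "p (x \<otimes>\<^bsub>H\<^esub> x') (y \<otimes>\<^bsub>G\<^esub> y') \<in> Z"
    if "x \<in> carrier H" "x' \<in> carrier H" "y \<in> carrier G" "y' \<in> carrier G" "p x y \<in> Z" "p x' y' \<in> Z" for x x' y y'
    using Zm(1)[OF that(5,6)] that by (simp add: HG.pure_mult)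
  have "k_subalgebra H {x \<in> carrier H. p x \<one>\<^bsub>G\<^esub> \<in> Z}"
    unfolding k_subalgebra_def
    using one m[of _ _ "\<one>\<^bsub>G\<^esub>" "\<one>\<^bsub>G\<^esub>"] by (auto simp: HG.pure_simps Zm(2,3))
  then have h: "p x \<one>\<^bsub>G\<^esub> \<in> Z" if "x \<in> carrier H" for x
    using assms(1) Z(2) that unfolding alg_generates_def by blast
  have "k_subalgebra G {x \<in> carrier G. p \<one>\<^bsub>H\<^esub> x \<in> Z}"
    unfolding k_subalgebra_def
    using one m[of "\<one>\<^bsub>H\<^esub>" "\<one>\<^bsub>H\<^esub>"] by (auto simp: HG.pure_simps Zm(2,3))
  then have g: "p \<one>\<^bsub>H\<^esub> x \<in> Z" if "x \<in> carrier G" for x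
    using assms(2) Z(2) that unfolding alg_generates_def by blast
  have "z \<in> Z" if "z \<in> carrier HG.T" for z
    using that
  proof (induction z rule: HG.tensor_induct)
    case (pure a b)
    then show ?case using Zm(1)[OF h g, of a b] by (simp add: HG.pure_mult)
  qed (rule Zm(2))
  then show "carrier HG.T \<subseteq> Z" by blast
qed

end

section \<open>Group algebras as Hopf algebras\<close>

lemma alg_generates_monoid_alg:
  assumes "monoid G"
  shows "alg_generates (monoid_alg G :: ('k::field, _) module) ((\<lambda>g. Poly_Mapping.single g 1) ` carrier G)"
proof -
  have "u \<in> Y" if Y: "k_subalgebra (monoid_alg G :: ('k, _) module) Y"
      "(\<lambda>g. Poly_Mapping.single g 1) ` carrier G \<subseteq> Y" and u: "Poly_Mapping.keys u \<subseteq> carrier G" for u Y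
  proof -
    have s: "Poly_Mapping.single g c \<in> Y" if "g \<in> carrier G" for g and c :: 'k
    proof -
      have "c \<odot>\<^bsub>monoid_alg G\<^esub> Poly_Mapping.single g 1 \<in> Y" using Y that by (auto simp: k_subalgebra_def)
      then show ?thesis by (simp add: monoid_alg_simps)
    qed
    interpret monoid G by fact
    from u show ?thesis
    proof (induction u rule: poly_mapping_keys_induct)
      case zero
      show ?case using s[of "\<one>\<^bsub>G\<^esub>" 0] by simp
    next
      case (add u v)
      then have "u \<oplus>\<^bsub>monoid_alg G\<^esub> v \<in> Y" using Y(1) by (auto simp: k_subalgebra_def)
      then show ?case by (simp add: monoid_alg_simps)
    qed (rule s)
  qed
  then show ?thesis by (auto simp: alg_generates_def monoid_alg_simps)
qed

lemma
  fixes G :: "('g, 'm) monoid_scheme"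
  assumes "group G"
  shows hopf_data_group_hopf: "hopf_data (group_hopf G :: ('k::field, _) hopf)"
    and grouplike_group_hopf: "\<And>g. g \<in> carrier G \<Longrightarrow> grouplike (group_hopf G :: ('k, _) hopf) (Poly_Mapping.single g 1)"
proof -
  interpret G: group G by fact
  let ?A = "monoid_alg G :: ('k, _) module" and ?d = "\<lambda>g. Poly_Mapping.single g (1::'k)"
  interpret A: k_algebra ?A by (rule G.k_algebra_monoid_alg)
  interpret AA: alg_pair ?A ?A by unfold_locales
  have d: "?d g \<in> carrier ?A" if "g \<in> carrier G" for g using that by (rule single_in_monoid_alg)
  have dm: "?d (g \<otimes>\<^bsub>G\<^esub> h) = ?d g \<otimes>\<^bsub>?A\<^esub> ?d h" for g h by (simp add: monoid_alg_mult_single)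
  have d1: "?d \<one>\<^bsub>G\<^esub> = \<one>\<^bsub>?A\<^esub>" by (simp add: monoid_alg_simps)
  let ?c = "lin_ext AA.T (\<lambda>g. AA.t (?d g) (?d g))" and ?e = "lin_ext ground_field (\<lambda>g. 1::'k)"
    and ?s = "lin_ext ?A (\<lambda>g. ?d (inv\<^bsub>G\<^esub> g))"
  have eq: "group_hopf G = module.extend ?A (hopf.fields ?c ?e ?s)"
    by (simp add: group_hopf_def Let_def)
  have s_op: "?s = lin_ext (opposite_alg ?A) (\<lambda>g. ?d (inv\<^bsub>G\<^esub> g))"
    by (simp add: lin_ext_def[abs_def] finsum_def finprod_def)
  have c: "?c \<in> alg_hom ?A AA.T"
    by (rule lin_ext_alg_hom[OF AA.k_algebra_T G.monoid_axioms])
      (simp_all add: d AA.pure_mult AA.one_T dm d1)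
  have e: "?e \<in> alg_hom ?A ground_field"
    by (rule lin_ext_alg_hom[OF k_algebra_ground_field G.monoid_axioms]) simp_all
  have s: "?s \<in> alg_hom ?A (opposite_alg ?A)" unfolding s_op
    by (rule lin_ext_alg_hom[OF k_algebra_opposite[OF A.k_algebra_axioms] G.monoid_axioms])
      (simp_all add: d d1 G.inv_mult_group dm)
  show "hopf_data (group_hopf G :: ('k, _) hopf)"
    unfolding eq hopf_data_def hopf_data_axioms_def by (simp add: A.k_algebra_axioms c e s)
  show "grouplike (group_hopf G :: ('k, _) hopf) (?d g)" if g: "g \<in> carrier G" for g
  proof -
    interpret E: k_space "ground_field :: ('k, 'k) module" by (rule k_algebra_k_space[OF k_algebra_ground_field])
    have "?c (?d g) = AA.t (?d g) (?d g)" "?e (?d g) = 1" "?s (?d g) = ?d (inv\<^bsub>G\<^esub> g)"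
      using g d by (simp_all add: AA.T.lin_ext_single E.lin_ext_single A.lin_ext_single)
    then show ?thesis using g d by (simp add: eq grouplike_def dm[symmetric] d1)
  qed
qed

section \<open>The book algebra\<close>

abbreviation "book_gens \<equiv> (\<lambda>z. quot_class free_alg (book_rels (-1) 2 1) (free_gen z))"

lemma
  fixes T :: "('k::field, 'v, 'r) module_scheme"
  assumes "k_algebra T" "X \<in> carrier T" "Y \<in> carrier T" "G \<in> carrier T"
    "X \<otimes>\<^bsub>T\<^esub> X = \<zero>\<^bsub>T\<^esub>" "Y \<otimes>\<^bsub>T\<^esub> Y = \<zero>\<^bsub>T\<^esub>" "G \<otimes>\<^bsub>T\<^esub> G = \<one>\<^bsub>T\<^esub>"
    "G \<otimes>\<^bsub>T\<^esub> X = (- 1) \<odot>\<^bsub>T\<^esub> (X \<otimes>\<^bsub>T\<^esub> G)" "G \<otimes>\<^bsub>T\<^esub> Y = (- 1) \<odot>\<^bsub>T\<^esub> (Y \<otimes>\<^bsub>T\<^esub> G)" "X \<otimes>\<^bsub>T\<^esub> Y = Y \<otimes>\<^bsub>T\<^esub> X"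
  defines "f \<equiv> quot_lift T (word_val T (\<lambda>z. case z of Book_x \<Rightarrow> X | Book_y \<Rightarrow> Y | Book_g \<Rightarrow> G))"
  shows book_lift_hom: "f \<in> alg_hom (book_alg (-1) 2 1) T"
    and book_lift_gens: "f (book_gens Book_x) = X" "f (book_gens Book_y) = Y" "f (book_gens Book_g) = G"
proof -
  interpret T: k_algebra T by fact
  let ?\<phi> = "\<lambda>z. case z of Book_x \<Rightarrow> X | Book_y \<Rightarrow> Y | Book_g \<Rightarrow> G"
  have c: "?\<phi> z \<in> carrier T" for z using assms by (cases z) auto
  interpret F: k_algebra "free_alg :: ('k, book_gen list \<Rightarrow>\<^sub>0 'k) module" by (rule k_algebra_free_alg)
  have hom: "free_eval T ?\<phi> \<in> alg_hom free_alg T" by (rule free_eval_hom[OF assms(1) c])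
  note h = alg_hom_mult[OF hom] alg_hom_smult[OF hom] alg_hom_one[OF hom]
    lin_map_zero[OF F.k_space_axioms T.k_space_axioms alg_hom_lin[OF hom]]
    alg_hom_pow[OF F.k_algebra_axioms assms(1) hom] free_eval_gen[OF assms(1) c]
  have r: "free_eval T ?\<phi> l = free_eval T ?\<phi> r" if "(l, r) \<in> book_rels (-1) 2 1" for l r
    using that unfolding book_rels_def Let_def
    by (auto simp: h assms(2-10) numeral_2_eq_2)
  show "f \<in> alg_hom (book_alg (-1) 2 1) T" unfolding f_def book_alg_def by (rule quot_lift_free[OF assms(1) c r])
  show "f (book_gens Book_x) = X" "f (book_gens Book_y) = Y" "f (book_gens Book_g) = G"
    unfolding f_def using quot_lift_free(2)[where \<phi> = ?\<phi>, OF assms(1) c r] by simp_all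
qed

context
  fixes H :: "('k::field, (book_gen list \<Rightarrow>\<^sub>0 'k) set) module" and x y g :: "(book_gen list \<Rightarrow>\<^sub>0 'k) set"
  defines "H \<equiv> book_alg (-1) 2 1" and "x \<equiv> book_gens Book_x" and "y \<equiv> book_gens Book_y" and "g \<equiv> book_gens Book_g"
begin

lemma k_algebra_book: "k_algebra H"
  unfolding H_def book_alg_def by (rule k_algebra_quot_free)

interpretation H: k_algebra H by (rule k_algebra_book)
interpretation HH: alg_pair H H by unfold_locales

lemma book_generates: "alg_generates H {x, y, g}"
proof -
  have UNIV: "(UNIV :: book_gen set) = {Book_x, Book_y, Book_g}" by (auto intro: book_gen.exhaust)
  have "range book_gens = {x, y, g}" unfolding UNIV x_def y_def g_def by simp
  then show ?thesis
    using alg_generates_quot_free[of "book_rels (-1::'k) 2 1"] by (simp add: H_def book_alg_def)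
qed

lemma book_carrier [simp]: "x \<in> carrier H" "y \<in> carrier H" "g \<in> carrier H"
  using book_generates by (auto simp: alg_generates_def)

lemma book_relations:
  "x \<otimes>\<^bsub>H\<^esub> x = \<zero>\<^bsub>H\<^esub>" "y \<otimes>\<^bsub>H\<^esub> y = \<zero>\<^bsub>H\<^esub>" "g \<otimes>\<^bsub>H\<^esub> g = \<one>\<^bsub>H\<^esub>"
  "g \<otimes>\<^bsub>H\<^esub> x = (- 1) \<odot>\<^bsub>H\<^esub> (x \<otimes>\<^bsub>H\<^esub> g)" "g \<otimes>\<^bsub>H\<^esub> y = (- 1) \<odot>\<^bsub>H\<^esub> (y \<otimes>\<^bsub>H\<^esub> g)" "x \<otimes>\<^bsub>H\<^esub> y = y \<otimes>\<^bsub>H\<^esub> x"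
proof -
  define cl where "cl = quot_class free_alg (book_rels (-1::'k) 2 1)"
  interpret F: k_algebra "free_alg :: ('k, book_gen list \<Rightarrow>\<^sub>0 'k) module" by (rule k_algebra_free_alg)
  have hom: "cl \<in> alg_hom free_alg H"
    unfolding H_def book_alg_def cl_def by (rule quot_class_free_hom)
  note h = alg_hom_mult[OF hom] alg_hom_smult[OF hom] alg_hom_one[OF hom] alg_hom_closed[OF hom]
    lin_map_zero[OF F.k_space_axioms H.k_space_axioms alg_hom_lin[OF hom]]
    alg_hom_pow[OF F.k_algebra_axioms H.k_algebra_axioms hom]
  let ?x = "free_gen Book_x :: book_gen list \<Rightarrow>\<^sub>0 'k" and ?y = "free_gen Book_y :: book_gen list \<Rightarrow>\<^sub>0 'k"
    and ?g = "free_gen Book_g :: book_gen list \<Rightarrow>\<^sub>0 'k"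
  have gens: "x = cl ?x" "y = cl ?y" "g = cl ?g"
    by (simp_all only: x_def y_def g_def cl_def)
  have "cl l = cl r" if "(l, r) \<in> book_rels (-1) 2 1" for l r
    using that unfolding cl_def by (rule quot_class_free_rel)
  then have "cl (?x [^]\<^bsub>free_alg\<^esub> (2::nat)) = cl \<zero>\<^bsub>free_alg\<^esub>" "cl (?y [^]\<^bsub>free_alg\<^esub> (2::nat)) = cl \<zero>\<^bsub>free_alg\<^esub>"
    "cl (?g [^]\<^bsub>free_alg\<^esub> (2::nat)) = cl \<one>\<^bsub>free_alg\<^esub>"
    "cl (?g \<otimes>\<^bsub>free_alg\<^esub> ?x) = cl ((- 1) \<odot>\<^bsub>free_alg\<^esub> (?x \<otimes>\<^bsub>free_alg\<^esub> ?g))"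
    "cl (?g \<otimes>\<^bsub>free_alg\<^esub> ?y) = cl ((- 1) ^ 1 \<odot>\<^bsub>free_alg\<^esub> (?y \<otimes>\<^bsub>free_alg\<^esub> ?g))"
    "cl (?x \<otimes>\<^bsub>free_alg\<^esub> ?y) = cl (?y \<otimes>\<^bsub>free_alg\<^esub> ?x)"
    unfolding book_rels_def Let_def by blast+
  then show "x \<otimes>\<^bsub>H\<^esub> x = \<zero>\<^bsub>H\<^esub>" "y \<otimes>\<^bsub>H\<^esub> y = \<zero>\<^bsub>H\<^esub>" "g \<otimes>\<^bsub>H\<^esub> g = \<one>\<^bsub>H\<^esub>"
    "g \<otimes>\<^bsub>H\<^esub> x = (- 1) \<odot>\<^bsub>H\<^esub> (x \<otimes>\<^bsub>H\<^esub> g)" "g \<otimes>\<^bsub>H\<^esub> y = (- 1) \<odot>\<^bsub>H\<^esub> (y \<otimes>\<^bsub>H\<^esub> g)" "x \<otimes>\<^bsub>H\<^esub> y = y \<otimes>\<^bsub>H\<^esub> x"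
    by (simp_all add: h gens numeral_2_eq_2)
qed

lemma book_inv_g: "inv\<^bsub>H\<^esub> g = g"
  by (rule H.inv_char) (simp_all add: book_relations)

definition "book_comult = quot_lift HH.T (word_val HH.T (\<lambda>z. case z of
    Book_x \<Rightarrow> HH.t x g \<oplus>\<^bsub>HH.T\<^esub> HH.t \<one>\<^bsub>H\<^esub> x | Book_y \<Rightarrow> HH.t y \<one>\<^bsub>H\<^esub> \<oplus>\<^bsub>HH.T\<^esub> HH.t g y | Book_g \<Rightarrow> HH.t g g))"

definition "book_counit = quot_lift ground_field (word_val ground_field (\<lambda>z. case z of
    Book_x \<Rightarrow> 0 | Book_y \<Rightarrow> 0 | Book_g \<Rightarrow> (1::'k)))"

definition "book_antipode = quot_lift (opposite_alg H) (word_val (opposite_alg H) (\<lambda>z. case z of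
    Book_x \<Rightarrow> (- 1) \<odot>\<^bsub>H\<^esub> (x \<otimes>\<^bsub>H\<^esub> g) | Book_y \<Rightarrow> (- 1) \<odot>\<^bsub>H\<^esub> (g \<otimes>\<^bsub>H\<^esub> y) | Book_g \<Rightarrow> g))"

lemma book_hopf_eq: "book_hopf (-1) 2 1 = module.extend H (hopf.fields book_comult book_counit book_antipode)"
  unfolding book_hopf_def Let_def H_def[symmetric] x_def[symmetric] y_def[symmetric] g_def[symmetric]
    book_comult_def book_counit_def book_antipode_def
  by (simp add: book_inv_g H.scale_minus_one)

text \<open>The proposed images have to satisfy the six relations. In the squares of
  \<open>?X\<close> and \<open>?Y\<close> the cross terms cancel because \<open>g\<close>
  anticommutes with \<open>x\<close> and \<open>y\<close>; in \<open>?X ?Y = ?Y ?X\<close> two such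
  signs compensate each other.\<close>

lemma
  shows book_comult_hom: "book_comult \<in> alg_hom H HH.T"
    and book_comult_gens: "book_comult x = HH.t x g \<oplus>\<^bsub>HH.T\<^esub> HH.t \<one>\<^bsub>H\<^esub> x"
      "book_comult y = HH.t y \<one>\<^bsub>H\<^esub> \<oplus>\<^bsub>HH.T\<^esub> HH.t g y" "book_comult g = HH.t g g"
proof -
  let ?X = "HH.t x g \<oplus>\<^bsub>HH.T\<^esub> HH.t \<one>\<^bsub>H\<^esub> x" and ?Y = "HH.t y \<one>\<^bsub>H\<^esub> \<oplus>\<^bsub>HH.T\<^esub> HH.t g y" and ?G = "HH.t g g"
  have z: "HH.t a \<zero>\<^bsub>H\<^esub> = \<zero>\<^bsub>HH.T\<^esub>" "HH.t \<zero>\<^bsub>H\<^esub> a = \<zero>\<^bsub>HH.T\<^esub>" if "a \<in> carrier H" for a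
    using that HH.pure_simps(3)[of "\<zero>\<^bsub>H\<^esub>" a 0] HH.pure_simps(4)[of a "\<zero>\<^bsub>H\<^esub>" 0] by simp_all
  note s = HH.T.l_distr HH.T.r_distr HH.pure_mult book_relations HH.pure_simps z HH.one_T HH.T.scale_add_right
  have "?X \<in> carrier HH.T" "?Y \<in> carrier HH.T" "?G \<in> carrier HH.T" by simp_all
  moreover have "?X \<otimes>\<^bsub>HH.T\<^esub> ?X = \<zero>\<^bsub>HH.T\<^esub>" "?Y \<otimes>\<^bsub>HH.T\<^esub> ?Y = \<zero>\<^bsub>HH.T\<^esub>" "?G \<otimes>\<^bsub>HH.T\<^esub> ?G = \<one>\<^bsub>HH.T\<^esub>"
    "?G \<otimes>\<^bsub>HH.T\<^esub> ?X = (- 1) \<odot>\<^bsub>HH.T\<^esub> (?X \<otimes>\<^bsub>HH.T\<^esub> ?G)" "?G \<otimes>\<^bsub>HH.T\<^esub> ?Y = (- 1) \<odot>\<^bsub>HH.T\<^esub> (?Y \<otimes>\<^bsub>HH.T\<^esub> ?G)"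
    "?X \<otimes>\<^bsub>HH.T\<^esub> ?Y = ?Y \<otimes>\<^bsub>HH.T\<^esub> ?X"
    by (simp_all add: s HH.T.a_ac)
  ultimately show "book_comult \<in> alg_hom H HH.T" "book_comult x = ?X" "book_comult y = ?Y" "book_comult g = ?G"
    unfolding book_comult_def H_def x_def y_def g_def
    by (rule book_lift_hom[OF HH.k_algebra_T[unfolded H_def]] book_lift_gens[OF HH.k_algebra_T[unfolded H_def]];
      simp only: H_def x_def y_def g_def)+
qed

lemma
  shows book_counit_hom: "book_counit \<in> alg_hom H ground_field"
    and book_counit_gens: "book_counit x = 0" "book_counit y = 0" "book_counit g = 1"
  unfolding book_counit_def H_def x_def y_def g_def
  by (rule book_lift_hom[OF k_algebra_ground_field] book_lift_gens[OF k_algebra_ground_field]; simp)+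

lemma
  shows book_antipode_hom: "book_antipode \<in> alg_hom H (opposite_alg H)"
    and book_antipode_gens: "book_antipode x = (- 1) \<odot>\<^bsub>H\<^esub> (x \<otimes>\<^bsub>H\<^esub> g)"
      "book_antipode y = (- 1) \<odot>\<^bsub>H\<^esub> (g \<otimes>\<^bsub>H\<^esub> y)" "book_antipode g = g"
proof -
  let ?O = "opposite_alg H"
  note O = k_algebra_opposite[OF k_algebra_book]
  let ?X = "(- 1) \<odot>\<^bsub>H\<^esub> (x \<otimes>\<^bsub>H\<^esub> g)" and ?Y = "(- 1) \<odot>\<^bsub>H\<^esub> (g \<otimes>\<^bsub>H\<^esub> y)"
  note a = H.smult_mult_left H.smult_mult_right
  \<comment> \<open>Each rule carries a trailing factor \<open>z\<close>, so it applies inside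
    right-nested products. Together they square away repeated letters and move \<open>g\<close> to
    the right.\<close>
  have gx: "g \<otimes>\<^bsub>H\<^esub> (x \<otimes>\<^bsub>H\<^esub> z) = (- 1) \<odot>\<^bsub>H\<^esub> (x \<otimes>\<^bsub>H\<^esub> (g \<otimes>\<^bsub>H\<^esub> z))" if "z \<in> carrier H" for z
    using H.m_assoc[of g x z] H.m_assoc[of x g z] that by (simp add: book_relations a)
  have gy: "g \<otimes>\<^bsub>H\<^esub> (y \<otimes>\<^bsub>H\<^esub> z) = (- 1) \<odot>\<^bsub>H\<^esub> (y \<otimes>\<^bsub>H\<^esub> (g \<otimes>\<^bsub>H\<^esub> z))" if "z \<in> carrier H" for z
    using H.m_assoc[of g y z] H.m_assoc[of y g z] that by (simp add: book_relations a)
  have gg: "g \<otimes>\<^bsub>H\<^esub> (g \<otimes>\<^bsub>H\<^esub> z) = z" if "z \<in> carrier H" for z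
    using H.m_assoc[of g g z] that by (simp add: book_relations)
  have xx: "x \<otimes>\<^bsub>H\<^esub> (x \<otimes>\<^bsub>H\<^esub> z) = \<zero>\<^bsub>H\<^esub>" "y \<otimes>\<^bsub>H\<^esub> (y \<otimes>\<^bsub>H\<^esub> z) = \<zero>\<^bsub>H\<^esub>" if "z \<in> carrier H" for z
    using H.m_assoc[of x x z, symmetric] H.m_assoc[of y y z, symmetric] that by (simp_all add: book_relations(1,2))
  have xy: "x \<otimes>\<^bsub>H\<^esub> (y \<otimes>\<^bsub>H\<^esub> z) = y \<otimes>\<^bsub>H\<^esub> (x \<otimes>\<^bsub>H\<^esub> z)" if "z \<in> carrier H" for z
    using H.m_assoc[of x y z] H.m_assoc[of y x z] that by (simp add: book_relations)
  have e: "x \<otimes>\<^bsub>H\<^esub> g \<otimes>\<^bsub>H\<^esub> (x \<otimes>\<^bsub>H\<^esub> g) = \<zero>\<^bsub>H\<^esub>" "g \<otimes>\<^bsub>H\<^esub> y \<otimes>\<^bsub>H\<^esub> (g \<otimes>\<^bsub>H\<^esub> y) = \<zero>\<^bsub>H\<^esub>"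
    "x \<otimes>\<^bsub>H\<^esub> g \<otimes>\<^bsub>H\<^esub> g = x" "g \<otimes>\<^bsub>H\<^esub> (x \<otimes>\<^bsub>H\<^esub> g) = (- 1) \<odot>\<^bsub>H\<^esub> x" "g \<otimes>\<^bsub>H\<^esub> y \<otimes>\<^bsub>H\<^esub> g = (- 1) \<odot>\<^bsub>H\<^esub> y"
    "g \<otimes>\<^bsub>H\<^esub> (g \<otimes>\<^bsub>H\<^esub> y) = y" "g \<otimes>\<^bsub>H\<^esub> y \<otimes>\<^bsub>H\<^esub> (x \<otimes>\<^bsub>H\<^esub> g) = x \<otimes>\<^bsub>H\<^esub> g \<otimes>\<^bsub>H\<^esub> (g \<otimes>\<^bsub>H\<^esub> y)"
    by (simp_all add: H.m_assoc gx gy gg xx xy book_relations a)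
  have "?X \<in> carrier ?O" "?Y \<in> carrier ?O" "g \<in> carrier ?O" by simp_all
  moreover have "?X \<otimes>\<^bsub>?O\<^esub> ?X = \<zero>\<^bsub>?O\<^esub>" "?Y \<otimes>\<^bsub>?O\<^esub> ?Y = \<zero>\<^bsub>?O\<^esub>" "g \<otimes>\<^bsub>?O\<^esub> g = \<one>\<^bsub>?O\<^esub>"
    "g \<otimes>\<^bsub>?O\<^esub> ?X = (- 1) \<odot>\<^bsub>?O\<^esub> (?X \<otimes>\<^bsub>?O\<^esub> g)" "g \<otimes>\<^bsub>?O\<^esub> ?Y = (- 1) \<odot>\<^bsub>?O\<^esub> (?Y \<otimes>\<^bsub>?O\<^esub> g)"
    "?X \<otimes>\<^bsub>?O\<^esub> ?Y = ?Y \<otimes>\<^bsub>?O\<^esub> ?X"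
    by (simp_all add: H.smult_mult_left H.smult_mult_right e book_relations(3))
  ultimately show "book_antipode \<in> alg_hom H ?O" "book_antipode x = ?X" "book_antipode y = ?Y" "book_antipode g = g"
    unfolding book_antipode_def H_def x_def y_def g_def
    by (rule book_lift_hom[OF O[unfolded H_def]] book_lift_gens[OF O[unfolded H_def]];
      simp only: H_def x_def y_def g_def)+
qed

lemma hopf_data_book: "hopf_data (book_hopf (-1::'k) 2 1)"
  unfolding book_hopf_eq hopf_data_def hopf_data_axioms_def
  by (simp add: k_algebra_book book_comult_hom book_counit_hom book_antipode_hom)

lemma book_grouplike: "grouplike (book_hopf (-1) 2 1) g"
  unfolding book_hopf_eq by (simp add: grouplike_def book_comult_gens book_counit_gens book_antipode_gens book_relations)

lemma book_skew: "skew_primitive (book_hopf (-1) 2 1) g \<one>\<^bsub>H\<^esub> x" "skew_primitive (book_hopf (-1) 2 1) \<one>\<^bsub>H\<^esub> g y"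
proof -
  interpret D: hopf_data "book_hopf (-1::'k) 2 1" by (rule hopf_data_book)
  have one: "grouplike (book_hopf (-1) 2 1) \<one>\<^bsub>H\<^esub>" using D.grouplike_one unfolding book_hopf_eq by simp
  have s1: "book_antipode \<one>\<^bsub>H\<^esub> = \<one>\<^bsub>H\<^esub>" using D.S_simps(2) unfolding book_hopf_eq by simp
  show "skew_primitive (book_hopf (-1) 2 1) g \<one>\<^bsub>H\<^esub> x" "skew_primitive (book_hopf (-1) 2 1) \<one>\<^bsub>H\<^esub> g y"
    using one book_grouplike s1 unfolding skew_primitive_def book_hopf_eq
    by (simp_all add: book_comult_gens book_counit_gens book_antipode_gens)
qed

end

section \<open>Transport of Hopf structures\<close>

text \<open>The laws are not transported one by one. Conjugation by \<open>f\<close> yields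
  (anti)multiplicative operations on \<open>B\<close> for which the images of the generators are
  again grouplike or skew primitive, so the criterion on generators applies to \<open>B\<close>
  directly.\<close>

lemma hopf_transport:
  fixes B :: "('k::field, 'b) module"
  assumes "hopf_data K" "alg_generates K X"
    "\<And>h. h \<in> X \<Longrightarrow> grouplike K h \<or> (\<exists>a b. skew_primitive K a b h)"
    "k_algebra B" "f \<in> alg_iso K B"
  shows "\<exists>H :: ('k, 'b) hopf. module.truncate H = B \<and> hopf_algebra H \<and> hopf_isomorphic H K"
proof -
  interpret K: hopf_data K by fact
  interpret B: k_algebra B by fact
  interpret BB: alg_pair B B by unfold_locales
  let ?g = "inv_into (carrier K) f"
  have gi: "?g \<in> alg_iso B K" by (rule alg_iso_inv[OF K.k_algebra_axioms assms(5)])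
  then have g: "?g \<in> alg_hom B K" and f: "f \<in> alg_hom K B" using assms(5) by (auto simp: alg_iso_def)
  have bij: "bij_betw f (carrier K) (carrier B)" using assms(5) by (simp add: alg_iso_def)
  have gf: "?g (f x) = x" if "x \<in> carrier K" for x using bij that by (simp add: bij_betw_def inv_into_f_f)
  have fg: "f (?g x) = x" if "x \<in> carrier B" for x using bij that by (simp add: bij_betw_def f_inv_into_f)
  let ?F = "tensor_lift BB.T (\<lambda>a b. BB.t (f a) (f b))"
  let ?G = "tensor_lift K.T2 (\<lambda>a b. K.HH.t (?g a) (?g b))"
  note fs = alg_hom_closed[OF f] alg_hom_add[OF f] alg_hom_mult[OF f] alg_hom_smult[OF f] alg_hom_one[OF f]
  note gs = alg_hom_closed[OF g] alg_hom_add[OF g] alg_hom_mult[OF g] alg_hom_smult[OF g] alg_hom_one[OF g]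
  have Fb: "bilinear_map K K BB.T (\<lambda>a b. BB.t (f a) (f b))"
    by (rule bilinear_mapI) (simp_all add: fs BB.pure_simps)
  have Gb: "bilinear_map B B K.T2 (\<lambda>a b. K.HH.t (?g a) (?g b))"
    by (rule bilinear_mapI) (simp_all add: gs K.HH.pure_simps)
  have F: "?F \<in> alg_hom K.T2 BB.T"
    by (rule K.HH.tensor_lift_hom[OF BB.k_algebra_T Fb]) (simp_all add: fs BB.pure_mult BB.one_T)
  note Fp = K.HH.tensor_lift_pure[OF BB.T.k_space_axioms Fb]
  note Gp = BB.tensor_lift_pure[OF K.HH.T.k_space_axioms Gb]
  note Gl = BB.tensor_lift_lin[OF K.HH.T.k_space_axioms Gb]
  \<comment> \<open>The comultiplication of \<open>B\<close> is pushed through \<open>?F\<close>.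
    That \<open>?G\<close> undoes \<open>?F\<close> is precisely the compatibility of the inverse of
    \<open>f\<close> with comultiplication.\<close>
  have GF: "?G (?F x) = x" if "x \<in> carrier K.T2" for x
  proof (rule K.HH.tensor_lin_eq[OF lin_map_comp[OF alg_hom_lin[OF F] Gl] _ _ that])
    show "lin_map K.T2 K.T2 (\<lambda>x. x)" by (rule lin_mapI) auto
  qed (simp add: Fp Gp fs gf)
  let ?c = "\<lambda>b. ?F (K.\<Delta> (?g b))" and ?e = "\<lambda>b. K.\<epsilon> (?g b)" and ?s = "\<lambda>b. f (K.S (?g b))"
  let ?H = "module.extend B (hopf.fields ?c ?e ?s)"
  have c: "?c \<in> alg_hom B BB.T" by (rule alg_hom_comp[OF alg_hom_comp[OF g K.comult_alg_hom] F])
  have e: "?e \<in> alg_hom B ground_field" by (rule alg_hom_comp[OF g K.counit_alg_hom])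
  have s: "?s \<in> alg_hom B (opposite_alg B)"
    by (rule alg_homI) (simp_all add: fs gs K.S_simps)
  have H: "hopf_data ?H" unfolding hopf_data_def hopf_data_axioms_def
    by (simp add: B.k_algebra_axioms c e s)
  have gr: "grouplike ?H (f h)" if "grouplike K h" for h
    using that unfolding grouplike_def
    by (simp add: fs gf Fp K.S_simps fs(3)[symmetric])
  have sk: "skew_primitive ?H (f a) (f b) (f x)" if h: "skew_primitive K a b x" for a b x
  proof -
    have c: "a \<in> carrier K" "b \<in> carrier K" "x \<in> carrier K" "K.S a \<in> carrier K" "K.S b \<in> carrier K"
      using h by (auto simp: skew_primitive_def grouplike_def K.S_simps)
    have "?c (f x) = BB.t (f x) (f a) \<oplus>\<^bsub>BB.T\<^esub> BB.t (f b) (f x)"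
      using h c by (simp add: gf skew_primitive_def alg_hom_add[OF F] Fp)
    moreover have "?s (f x) = (- 1) \<odot>\<^bsub>B\<^esub> (?s (f b) \<otimes>\<^bsub>B\<^esub> f x \<otimes>\<^bsub>B\<^esub> ?s (f a))"
      using h c by (simp add: gf skew_primitive_def fs)
    ultimately show ?thesis
      using h gr c unfolding skew_primitive_def by (simp add: fs gf)
  qed
  have "alg_generates B (f ` X)"
    by (rule alg_generates_image[OF K.k_algebra_axioms assms(2) f]) (use bij in \<open>simp add: bij_betw_def\<close>)
  then have H': "hopf_algebra ?H"
    by (intro hopf_data.hopf_algebra_from_generators[OF H, of "f ` X"]) (use assms(3) gr sk in \<open>simp, blast\<close>)
  have "hopf_algebra K" by (rule K.hopf_algebra_from_generators[OF assms(2,3)])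
  then have "hopf_isomorphic ?H K"
    unfolding hopf_isomorphic_def using H'
    by (intro conjI bexI[of _ ?g])
      (simp_all add: gi GF gs K.comult_simps(1) gf K.S_simps)
  then show ?thesis using H' by (intro exI[of _ ?H]) simp
qed

section \<open>Left modules and indecomposable projectives\<close>

lemma (in left_module) zero_smult: "x \<in> carrier M \<Longrightarrow> \<zero> \<odot>\<^bsub>M\<^esub> x = \<zero>\<^bsub>M\<^esub>"
  using smult_l_distr[of \<zero> \<zero> x] M.add.l_cancel_one[of "\<zero> \<odot>\<^bsub>M\<^esub> x" "\<zero> \<odot>\<^bsub>M\<^esub> x"]
  by (simp add: smult_closed)

lemma (in left_module) smult_zero: "a \<in> carrier R \<Longrightarrow> a \<odot>\<^bsub>M\<^esub> \<zero>\<^bsub>M\<^esub> = \<zero>\<^bsub>M\<^esub>"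
  using smult_r_distr[of a "\<zero>\<^bsub>M\<^esub>" "\<zero>\<^bsub>M\<^esub>"] M.add.l_cancel_one[of "a \<odot>\<^bsub>M\<^esub> \<zero>\<^bsub>M\<^esub>" "a \<odot>\<^bsub>M\<^esub> \<zero>\<^bsub>M\<^esub>"]
  by (simp add: smult_closed)

lemma (in left_module) minus_smult: "x \<in> carrier M \<Longrightarrow> (\<ominus> \<one>) \<odot>\<^bsub>M\<^esub> x = \<ominus>\<^bsub>M\<^esub> x"
  using smult_l_distr[of "\<ominus> \<one>" \<one> x] M.minus_equality[of "(\<ominus> \<one>) \<odot>\<^bsub>M\<^esub> x" x]
  by (simp add: smult_closed R.l_neg zero_smult smult_one)

lemma left_homI:
  assumes "\<And>x. x \<in> carrier M \<Longrightarrow> f x \<in> carrier N"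
    "\<And>x y. x \<in> carrier M \<Longrightarrow> y \<in> carrier M \<Longrightarrow> f (x \<oplus>\<^bsub>M\<^esub> y) = f x \<oplus>\<^bsub>N\<^esub> f y"
    "\<And>a x. a \<in> carrier R \<Longrightarrow> x \<in> carrier M \<Longrightarrow> f (a \<odot>\<^bsub>M\<^esub> x) = a \<odot>\<^bsub>N\<^esub> f x"
  shows "f \<in> left_hom R M N"
  using assms by (auto simp: left_hom_def)

lemma left_hom_simps:
  assumes "f \<in> left_hom R M N"
  shows "x \<in> carrier M \<Longrightarrow> f x \<in> carrier N"
    "x \<in> carrier M \<Longrightarrow> y \<in> carrier M \<Longrightarrow> f (x \<oplus>\<^bsub>M\<^esub> y) = f x \<oplus>\<^bsub>N\<^esub> f y"
    "a \<in> carrier R \<Longrightarrow> x \<in> carrier M \<Longrightarrow> f (a \<odot>\<^bsub>M\<^esub> x) = a \<odot>\<^bsub>N\<^esub> f x"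
  using assms by (auto simp: left_hom_def)

lemma left_hom_comp: "f \<in> left_hom R M N \<Longrightarrow> g \<in> left_hom R N P \<Longrightarrow> (\<lambda>x. g (f x)) \<in> left_hom R M P"
  by (auto simp: left_hom_def Pi_iff)

lemma left_hom_inv:
  assumes "f \<in> left_hom R M N" "bij_betw f (carrier M) (carrier N)"
    "\<And>x y. x \<in> carrier M \<Longrightarrow> y \<in> carrier M \<Longrightarrow> x \<oplus>\<^bsub>M\<^esub> y \<in> carrier M"
    "\<And>a x. a \<in> carrier R \<Longrightarrow> x \<in> carrier M \<Longrightarrow> a \<odot>\<^bsub>M\<^esub> x \<in> carrier M"
  shows "inv_into (carrier M) f \<in> left_hom R N M"
proof -
  let ?g = "inv_into (carrier M) f"
  have g: "?g y \<in> carrier M" "f (?g y) = y" if "y \<in> carrier N" for y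
    using assms(2) that by (auto simp: bij_betw_def intro: inv_into_into f_inv_into_f)
  have gI: "?g (f x) = x" if "x \<in> carrier M" for x
    using assms(2) that by (simp add: bij_betw_def inv_into_f_f)
  note f = left_hom_simps[OF assms(1)]
  show ?thesis
  proof (rule left_homI)
    show "?g (x \<oplus>\<^bsub>N\<^esub> y) = ?g x \<oplus>\<^bsub>M\<^esub> ?g y" if "x \<in> carrier N" "y \<in> carrier N" for x y
      using g[OF that(1)] g[OF that(2)] gI[of "?g x \<oplus>\<^bsub>M\<^esub> ?g y"] f(2)[of "?g x" "?g y"] assms(3) by simp
    show "?g (a \<odot>\<^bsub>N\<^esub> x) = a \<odot>\<^bsub>M\<^esub> ?g x" if "a \<in> carrier R" "x \<in> carrier N" for a x
      using g[OF that(2)] gI[of "a \<odot>\<^bsub>M\<^esub> ?g x"] f(3)[of a "?g x"] that assms(4) by simp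
  qed (use g in auto)
qed

lemma left_isomorphic_sym:
  assumes "left_module R M" "left_isomorphic R M N" shows "left_isomorphic R N M"
proof -
  interpret left_module R M by fact
  obtain f where f: "f \<in> left_hom R M N" "bij_betw f (carrier M) (carrier N)"
    using assms(2) by (auto simp: left_isomorphic_def)
  show ?thesis unfolding left_isomorphic_def
    using left_hom_inv[OF f] smult_closed bij_betw_inv_into[OF f(2)] by blast
qed

lemma left_isomorphic_trans:
  assumes "left_isomorphic R M N" "left_isomorphic R N P" shows "left_isomorphic R M P"
proof -
  obtain f g where "f \<in> left_hom R M N" "bij_betw f (carrier M) (carrier N)"
    "g \<in> left_hom R N P" "bij_betw g (carrier N) (carrier P)"
    using assms by (auto simp: left_isomorphic_def)
  then show ?thesis
    unfolding left_isomorphic_def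
    using left_hom_comp[of f R M N g P] bij_betw_trans[of f "carrier M" "carrier N" g "carrier P"]
    by (auto simp: comp_def)
qed

lemma left_isomorphic_refl: "left_isomorphic R M M"
  unfolding left_isomorphic_def by (rule bexI[of _ "\<lambda>x. x"]) (auto intro: left_homI simp: bij_betw_def)

lemma (in left_module) left_submoduleI:
  assumes "H \<subseteq> carrier M" "\<zero>\<^bsub>M\<^esub> \<in> H" "\<And>x y. x \<in> H \<Longrightarrow> y \<in> H \<Longrightarrow> x \<oplus>\<^bsub>M\<^esub> y \<in> H"
    "\<And>a x. a \<in> carrier R \<Longrightarrow> x \<in> H \<Longrightarrow> a \<odot>\<^bsub>M\<^esub> x \<in> H"
  shows "submodule H R M"
proof (intro submodule.intro submodule_axioms.intro M.add.subgroupI)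
  fix x assume "x \<in> H"
  then show "\<ominus>\<^bsub>M\<^esub> x \<in> H" using assms(4)[of "\<ominus> \<one>" x] assms(1) minus_smult[of x] by auto
qed (use assms in auto)

text \<open>A retraction splits \<open>M\<close> into the image of \<open>\<beta>\<close> and the
  kernel of \<open>\<alpha>\<close>. The image is nonzero, so indecomposability leaves no
  kernel.\<close>

lemma indecomposable_retract_isomorphic:
  assumes "indecomposable_module R M" "left_module R N" "\<alpha> \<in> left_hom R M N" "\<beta> \<in> left_hom R N M"
    "\<And>y. y \<in> carrier N \<Longrightarrow> \<alpha> (\<beta> y) = y" "carrier N \<noteq> {\<zero>\<^bsub>N\<^esub>}"
  shows "left_isomorphic R M N"
proof -
  interpret M: left_module R M using assms(1) by (simp add: indecomposable_module_def)
  interpret N: left_module R N by fact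
  note a = left_hom_simps[OF assms(3)] and b = left_hom_simps[OF assms(4)]
  have a0: "\<alpha> \<zero>\<^bsub>M\<^esub> = \<zero>\<^bsub>N\<^esub>"
    using a(3)[of "\<zero>\<^bsub>R\<^esub>" "\<zero>\<^bsub>M\<^esub>"] a(1)[of "\<zero>\<^bsub>M\<^esub>"] by (simp add: M.zero_smult N.zero_smult)
  have b0: "\<beta> \<zero>\<^bsub>N\<^esub> = \<zero>\<^bsub>M\<^esub>"
    using b(3)[of "\<zero>\<^bsub>R\<^esub>" "\<zero>\<^bsub>N\<^esub>"] b(1)[of "\<zero>\<^bsub>N\<^esub>"] by (simp add: M.zero_smult N.zero_smult)
  have am: "\<alpha> (\<ominus>\<^bsub>M\<^esub> x) = \<ominus>\<^bsub>N\<^esub> \<alpha> x" if "x \<in> carrier M" for x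
    using a(3)[of "\<ominus>\<^bsub>R\<^esub> \<one>\<^bsub>R\<^esub>" x] a(1)[of x] that by (simp add: M.minus_smult N.minus_smult)
  let ?U = "\<beta> ` carrier N" and ?V = "{x \<in> carrier M. \<alpha> x = \<zero>\<^bsub>N\<^esub>}"
  have U: "submodule ?U R M"
  proof (rule M.left_submoduleI)
    show "x \<oplus>\<^bsub>M\<^esub> y \<in> ?U" if "x \<in> ?U" "y \<in> ?U" for x y
      using that by (auto simp: b(2)[symmetric])
    show "r \<odot>\<^bsub>M\<^esub> x \<in> ?U" if "r \<in> carrier R" "x \<in> ?U" for r x
      using that by (auto simp: b(3)[symmetric] N.smult_closed)
  qed (use b(1) b0 in \<open>auto intro!: image_eqI[of _ _ "\<zero>\<^bsub>N\<^esub>"]\<close>)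
  have V: "submodule ?V R M"
    by (rule M.left_submoduleI) (auto simp: a a0 M.smult_closed N.smult_zero)
  have int: "?U \<inter> ?V = {\<zero>\<^bsub>M\<^esub>}"
    using assms(5) a0 b0 b(1) by (auto intro!: image_eqI[of _ _ "\<zero>\<^bsub>N\<^esub>"])
  have sum: "?U <+>\<^bsub>M\<^esub> ?V = carrier M"
  proof
    show "?U <+>\<^bsub>M\<^esub> ?V \<subseteq> carrier M" using b(1) by (auto simp: set_add_defs)
    show "carrier M \<subseteq> ?U <+>\<^bsub>M\<^esub> ?V"
    proof
      fix x assume x: "x \<in> carrier M"
      let ?u = "\<beta> (\<alpha> x)"
      have u: "?u \<in> carrier M" "?u \<in> ?U" using x a(1) b(1) by auto
      have "\<alpha> (x \<oplus>\<^bsub>M\<^esub> \<ominus>\<^bsub>M\<^esub> ?u) = \<zero>\<^bsub>N\<^esub>" using x u a(1) by (simp add: a(2) am assms(5) N.r_neg)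
      then have "x \<oplus>\<^bsub>M\<^esub> \<ominus>\<^bsub>M\<^esub> ?u \<in> ?V" using x u by simp
      moreover have "?u \<oplus>\<^bsub>M\<^esub> (x \<oplus>\<^bsub>M\<^esub> \<ominus>\<^bsub>M\<^esub> ?u) = x" using x u(1)
        by (metis M.a_comm M.a_assoc M.l_neg M.r_zero M.a_inv_closed)
      ultimately show "x \<in> ?U <+>\<^bsub>M\<^esub> ?V" using u(2) unfolding set_add_defs by force
    qed
  qed
  have "?U = {\<zero>\<^bsub>M\<^esub>} \<or> ?V = {\<zero>\<^bsub>M\<^esub>}"
    using assms(1) U V int sum unfolding indecomposable_module_def by blast
  moreover have "?U \<noteq> {\<zero>\<^bsub>M\<^esub>}"
  proof
    assume "?U = {\<zero>\<^bsub>M\<^esub>}"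
    then have "y = \<zero>\<^bsub>N\<^esub>" if "y \<in> carrier N" for y using assms(5)[OF that] that a0 by (metis image_eqI singletonD)
    then show False using assms(6) by auto
  qed
  ultimately have ker: "x = \<zero>\<^bsub>M\<^esub>" if "x \<in> carrier M" "\<alpha> x = \<zero>\<^bsub>N\<^esub>" for x using that by blast
  have "inj_on \<alpha> (carrier M)"
  proof (rule inj_onI)
    fix x y assume xy: "x \<in> carrier M" "y \<in> carrier M" "\<alpha> x = \<alpha> y"
    have "\<alpha> (x \<oplus>\<^bsub>M\<^esub> \<ominus>\<^bsub>M\<^esub> y) = \<zero>\<^bsub>N\<^esub>" using xy a(1)[of y] by (simp add: a(2) am N.r_neg)
    then have "x \<oplus>\<^bsub>M\<^esub> \<ominus>\<^bsub>M\<^esub> y = \<zero>\<^bsub>M\<^esub>" using ker xy by simp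
    then show "x = y" using xy M.minus_equality[of x "\<ominus>\<^bsub>M\<^esub> y"] by simp
  qed
  moreover have "\<alpha> ` carrier M = carrier N"
  proof
    show "carrier N \<subseteq> \<alpha> ` carrier M" using b(1) assms(5) by (metis image_eqI subsetI)
  qed (use a(1) in auto)
  ultimately show ?thesis
    unfolding left_isomorphic_def bij_betw_def using assms(3) by blast
qed

section \<open>Free modules, left ideals and corners of idempotents\<close>

lemma regular_module_simps [simp]:
  "carrier (regular_module R) = carrier R" "zero (regular_module R) = zero R" "add (regular_module R) = add R"
  "smult (regular_module R) = mult R"
  by (simp_all add: regular_module_def)

lemma direct_sum_simps:
  "f \<in> carrier (direct_sum I P) \<longleftrightarrow> f \<in> (\<Pi>\<^sub>E i\<in>I. carrier (P i)) \<and> finite {i \<in> I. f i \<noteq> \<zero>\<^bsub>P i\<^esub>}"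
  "\<zero>\<^bsub>direct_sum I P\<^esub> = (\<lambda>i\<in>I. \<zero>\<^bsub>P i\<^esub>)"
  "f \<oplus>\<^bsub>direct_sum I P\<^esub> g = (\<lambda>i\<in>I. f i \<oplus>\<^bsub>P i\<^esub> g i)"
  "a \<odot>\<^bsub>direct_sum I P\<^esub> f = (\<lambda>i\<in>I. a \<odot>\<^bsub>P i\<^esub> f i)"
  by (simp_all add: direct_sum_def)

text \<open>For idempotent \<open>e\<close> this is the left ideal \<open>R e\<close>, described by
  an equation so that membership can be computed with.\<close>

definition left_ideal :: "('a, 'r) ring_scheme \<Rightarrow> 'a \<Rightarrow> ('a, 'a) module" where
  "left_ideal R e = (regular_module R)\<lparr>carrier := {x \<in> carrier R. x \<otimes>\<^bsub>R\<^esub> e = x}\<rparr>"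

lemma left_ideal_simps [simp]:
  "x \<in> carrier (left_ideal R e) \<longleftrightarrow> x \<in> carrier R \<and> x \<otimes>\<^bsub>R\<^esub> e = x" "zero (left_ideal R e) = zero R"
  "add (left_ideal R e) = add R" "smult (left_ideal R e) = mult R"
  by (simp_all add: left_ideal_def)

text \<open>For idempotent \<open>e\<close> this is the algebra \<open>e A e\<close>, whose unit is
  \<open>e\<close>.\<close>

definition corner_alg :: "('k, 'a, 'r) module_scheme \<Rightarrow> 'a \<Rightarrow> ('k, 'a) module" where
  "corner_alg A e = \<lparr>carrier = {x \<in> carrier A. e \<otimes>\<^bsub>A\<^esub> x = x \<and> x \<otimes>\<^bsub>A\<^esub> e = x}, mult = mult A, one = e,
     zero = zero A, add = add A, smult = smult A\<rparr>"

lemma corner_alg_simps [simp]: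
  "x \<in> carrier (corner_alg A e) \<longleftrightarrow> x \<in> carrier A \<and> e \<otimes>\<^bsub>A\<^esub> x = x \<and> x \<otimes>\<^bsub>A\<^esub> e = x"
  "mult (corner_alg A e) = mult A" "one (corner_alg A e) = e" "zero (corner_alg A e) = zero A"
  "add (corner_alg A e) = add A" "smult (corner_alg A e) = smult A"
  by (simp_all add: corner_alg_def)

context ring
begin

lemma left_module_left_ideal:
  assumes e: "e \<in> carrier R" shows "left_module R (left_ideal R e)"
proof -
  have "abelian_group (left_ideal R e)"
    by (rule abelian_groupI)
      (use e l_minus[of _ e] in \<open>auto simp: a_ac l_distr r_neg intro!: bexI[of _ "\<ominus> x" for x]\<close>)
  then show ?thesis
    unfolding left_module_def left_module_axioms_def
    using e by (auto simp: ring_axioms m_assoc l_distr r_distr)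
qed

text \<open>A decomposition of \<open>R e\<close> splits \<open>e\<close> as \<open>u + v\<close>,
  and \<open>u\<close> turns out to be an idempotent of \<open>e R e\<close>. If
  \<open>e R e\<close> has only the trivial idempotents, one of the summands contains
  \<open>e\<close> and is everything.\<close>

lemma indecomposable_left_ideal:
  assumes e: "e \<in> carrier R" "e \<otimes> e = e" "e \<noteq> \<zero>"
    and local: "\<And>u. u \<in> carrier R \<Longrightarrow> u \<otimes> u = u \<Longrightarrow> e \<otimes> u = u \<Longrightarrow> u \<otimes> e = u \<Longrightarrow> u = \<zero> \<or> u = e"
  shows "indecomposable_module R (left_ideal R e)"
  unfolding indecomposable_module_def
proof (intro conjI allI impI; (elim conjE)?)
  interpret L: left_module R "left_ideal R e" by (rule left_module_left_ideal) fact
  show "left_module R (left_ideal R e)" by (rule L.left_module_axioms)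
  show "carrier (left_ideal R e) \<noteq> {\<zero>\<^bsub>left_ideal R e\<^esub>}"
    using e left_ideal_simps(1)[of e R e] by (metis left_ideal_simps(2) singletonD)
  fix U V assume U: "submodule U R (left_ideal R e)" and V: "submodule V R (left_ideal R e)"
    and int: "U \<inter> V = {\<zero>\<^bsub>left_ideal R e\<^esub>}" and sum: "U <+>\<^bsub>left_ideal R e\<^esub> V = carrier (left_ideal R e)"
  have cl: "X \<subseteq> carrier (left_ideal R e)" "\<And>x y. x \<in> X \<Longrightarrow> y \<in> X \<Longrightarrow> x \<oplus> y \<in> X" "\<And>a x. a \<in> carrier R \<Longrightarrow> x \<in> X \<Longrightarrow> a \<otimes> x \<in> X"
    if "submodule X R (left_ideal R e)" for X
    using subgroup.subset[OF submodule.axioms(1)[OF that]] subgroup.m_closed[OF submodule.axioms(1)[OF that]]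
      submodule.smult_closed[OF that] by auto
  obtain u v where uv: "u \<in> U" "v \<in> V" "e = u \<oplus> v"
    using sum e left_ideal_simps(1)[of e R e] unfolding set_add_defs by (auto simp: set_eq_iff) metis
  have c: "u \<in> carrier R" "v \<in> carrier R" "u \<otimes> e = u" "v \<otimes> e = v"
    using cl(1)[OF U] cl(1)[OF V] uv by auto
  \<comment> \<open>The product \<open>x y\<close> lies in \<open>Y\<close> as a left multiple of
    \<open>y\<close>, and in \<open>X\<close> because it equals \<open>x e - x x\<close>.\<close>
  have zero: "x \<otimes> y = \<zero>" if "x \<in> X" "y \<in> Y" "x \<oplus> y = e" "X \<inter> Y = {\<zero>}" "submodule X R (left_ideal R e)"
    "submodule Y R (left_ideal R e)" for x y X Y
  proof -
    have xy: "x \<in> carrier R" "y \<in> carrier R" "x \<otimes> e = x" using that cl(1)[OF that(5)] cl(1)[OF that(6)] by auto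
    have "x \<otimes> y = \<ominus> (x \<otimes> x) \<oplus> (x \<otimes> x \<oplus> x \<otimes> y)"
      using xy by (simp add: a_assoc[symmetric] l_neg)
    also have "x \<otimes> x \<oplus> x \<otimes> y = x \<otimes> e"
      using xy(1,2) by (simp only: that(3)[symmetric] r_distr)
    also have "\<ominus> (x \<otimes> x) = (\<ominus> \<one>) \<otimes> (x \<otimes> x)" using xy by (simp add: l_minus)
    finally have "x \<otimes> y = (\<ominus> \<one>) \<otimes> (x \<otimes> x) \<oplus> x \<otimes> e" .
    moreover have "x \<otimes> e \<in> X" using xy that by simp
    ultimately have "x \<otimes> y \<in> X"
      using cl(2,3)[OF that(5)] xy that(1) by simp
    moreover have "x \<otimes> y \<in> Y" using cl(3)[OF that(6)] xy that(2) by simp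
    ultimately show ?thesis using that(4) by blast
  qed
  have uv0: "u \<otimes> v = \<zero>" by (rule zero[OF uv(1,2) uv(3)[symmetric] _ U V]) (use int in simp)
  have vu0: "v \<otimes> u = \<zero>"
    by (rule zero[OF uv(2,1) _ _ V U]) (use int uv c in \<open>auto simp: a_comm\<close>)
  have uu: "u \<otimes> u = u" using c uv0 by (metis uv(3) r_distr r_zero m_closed)
  have eu: "e \<otimes> u = u" using c vu0 uu by (simp add: uv(3) l_distr)
  have gen: "X = carrier (left_ideal R e)" if "e \<in> X" "submodule X R (left_ideal R e)" for X
    using cl(1,3)[OF that(2)] that(1) by fastforce
  show "U = {\<zero>\<^bsub>left_ideal R e\<^esub>} \<or> V = {\<zero>\<^bsub>left_ideal R e\<^esub>}"
  proof (cases "u = \<zero>")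
    case True
    then have "V = carrier (left_ideal R e)" using gen[OF _ V] uv c by simp
    then show ?thesis using int cl(1)[OF U] by auto
  next
    case False
    then have "u = e" using local[OF c(1) uu eu c(3)] by blast
    then have "U = carrier (left_ideal R e)" using gen[OF _ U] uv by simp
    then show ?thesis using int cl(1)[OF V] by auto
  qed
qed

lemma projective_left_ideal:
  assumes e: "e \<in> carrier R" "e \<otimes> e = e" shows "projective_module R (left_ideal R e)"
  unfolding projective_module_def
proof (intro conjI exI bexI ballI)
  \<comment> \<open>The basis of the free module has to be indexed by elements of the ideal's own
    type; the singleton of \<open>\<zero>\<close> serves for rank one.\<close>
  let ?D = "direct_sum {\<zero>} (\<lambda>_. regular_module R)"
  let ?i = "\<lambda>x. \<lambda>_\<in>{\<zero>}. x" and ?p = "\<lambda>f. f \<zero> \<otimes> e"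
  show "left_module R (left_ideal R e)" by (rule left_module_left_ideal) fact
  show "?i \<in> left_hom R (left_ideal R e) ?D"
    by (rule left_homI) (auto simp: direct_sum_simps fun_eq_iff)
  show "?p \<in> left_hom R ?D (left_ideal R e)"
    by (rule left_homI) (use e in \<open>auto simp: direct_sum_simps PiE_iff m_assoc l_distr\<close>)
qed (use e in auto)

lemma left_ideal_hom_eval:
  assumes "f \<in> left_hom R (left_ideal R e) N" "e \<in> carrier R" "e \<otimes> e = e" "x \<in> carrier R" "x \<otimes> e = x"
  shows "f x = x \<odot>\<^bsub>N\<^esub> f e"
  using left_hom_simps(3)[OF assms(1), of x e] assms by simp

end

text \<open>The sets \<open>J k\<close> imitate the powers of a nilpotent radical.
  \<open>e_local\<close> makes each \<open>e i\<close> primitive, \<open>e_noniso\<close> makes the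
  left ideals \<open>A e_i\<close> pairwise non-isomorphic, and \<open>J_detect\<close> guarantees
  that enough idempotents are listed: every element outside the radical has some \<open>e i\<close>
  among its two-sided multiples.\<close>

locale basic_idempotents = k_algebra A for A :: "('k::field, 'a, 'r) module_scheme" (structure) +
  fixes I :: "'i set" and e :: "'i \<Rightarrow> 'a" and J :: "nat \<Rightarrow> 'a set" and L :: nat
  assumes finite_I: "finite I"
    and e_carrier: "i \<in> I \<Longrightarrow> e i \<in> carrier A"
    and e_nonzero: "i \<in> I \<Longrightarrow> e i \<noteq> \<zero>"
    and e_idem: "i \<in> I \<Longrightarrow> e i \<otimes> e i = e i"
    and e_orth: "i \<in> I \<Longrightarrow> j \<in> I \<Longrightarrow> i \<noteq> j \<Longrightarrow> e i \<otimes> e j = \<zero>"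
    and e_local: "\<lbrakk>i \<in> I; u \<in> carrier A; u \<otimes> u = u; e i \<otimes> u = u; u \<otimes> e i = u\<rbrakk> \<Longrightarrow> u = \<zero> \<or> u = e i"
    and e_noniso: "\<lbrakk>i \<in> I; j \<in> I; a \<in> carrier A; b \<in> carrier A; a \<otimes> e j = a; e j \<otimes> b = b; a \<otimes> b = e i\<rbrakk> \<Longrightarrow> i = j"
    and J_carrier: "J k \<subseteq> carrier A" and J_zero: "\<zero> \<in> J k"
    and J_add: "a \<in> J k \<Longrightarrow> b \<in> J k \<Longrightarrow> a \<oplus> b \<in> J k"
    and J_mult: "a \<in> J 1 \<Longrightarrow> b \<in> J k \<Longrightarrow> a \<otimes> b \<in> J (Suc k)"
    and J_nilpotent: "J (Suc L) = {\<zero>}"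
    and J_detect: "\<lbrakk>a \<in> carrier A; a \<notin> J 1\<rbrakk> \<Longrightarrow>
      \<exists>i\<in>I. \<exists>c\<in>carrier A. \<exists>d\<in>carrier A. e i \<otimes> c \<otimes> a \<otimes> d \<otimes> e i = e i"
begin

text \<open>Suppose all homomorphisms from \<open>M\<close> to \<open>A\<close> take values in
  \<open>J 1\<close>. Then so do the coordinates of the embedding \<open>\<iota>\<close>, and
  writing \<open>x\<close> as \<open>\<pi> (\<iota> x)\<close> pushes the values into
  \<open>J 2\<close>, \<open>J 3\<close> and so on, until all vanish and \<open>M = 0\<close>. Hence
  some value lies outside \<open>J 1\<close>, and \<open>J_detect\<close> makes some
  \<open>A e_i\<close> a retract of the indecomposable \<open>M\<close>.\<close>

lemma projective_iso_left_ideal: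
  fixes M :: "('a, 'm) module"
  assumes "indecomposable_module A M" "projective_module A M"
  shows "\<exists>i\<in>I. left_isomorphic A M (left_ideal A (e i))"
proof -
  interpret M: left_module A M using assms(1) by (simp add: indecomposable_module_def)
  obtain X :: "'m set" and \<iota> \<pi> where \<iota>: "\<iota> \<in> left_hom A M (direct_sum X (\<lambda>_. regular_module A))"
    and \<pi>: "\<pi> \<in> left_hom A (direct_sum X (\<lambda>_. regular_module A)) M"
    and \<pi>\<iota>: "\<And>x. x \<in> carrier M \<Longrightarrow> \<pi> (\<iota> x) = x"
    using assms(2) unfolding projective_module_def by blast
  let ?D = "direct_sum X (\<lambda>_. regular_module A)"
  note i = left_hom_simps[OF \<iota>] and p = left_hom_simps[OF \<pi>]
  have D: "f \<in> carrier ?D \<longleftrightarrow> f \<in> (\<Pi>\<^sub>E s\<in>X. carrier A) \<and> finite {s \<in> X. f s \<noteq> \<zero>}" for f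
    by (simp add: direct_sum_simps)
  have coord: "(\<lambda>x. \<iota> x s) \<in> left_hom A M (regular_module A)" if "s \<in> X" for s
    by (rule left_homI) (use that i in \<open>auto simp: D PiE_iff direct_sum_simps\<close>)
  have "\<exists>\<phi>\<in>left_hom A M (regular_module A). \<exists>x\<in>carrier M. \<phi> x \<notin> J 1"
  proof (rule ccontr)
    assume "\<not> ?thesis"
    then have J1: "\<phi> x \<in> J 1" if "\<phi> \<in> left_hom A M (regular_module A)" "x \<in> carrier M" for \<phi> x
      using that by blast
    \<comment> \<open>Expanding \<open>\<iota> x\<close> in the basis makes \<open>\<phi> x\<close>
      a sum of products of a coordinate, which lies in \<open>J 1\<close>, with a value of
      \<open>\<phi>\<close>, which lies in \<open>J k\<close>.\<close>
    have step: "\<phi> x \<in> J (Suc k)"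
      if IH: "\<And>\<phi> x. \<phi> \<in> left_hom A M (regular_module A) \<Longrightarrow> x \<in> carrier M \<Longrightarrow> \<phi> x \<in> J k"
        and \<phi>: "\<phi> \<in> left_hom A M (regular_module A)" and x: "x \<in> carrier M" for k \<phi> x
    proof -
      note f = left_hom_simps[OF left_hom_comp[OF \<pi> \<phi>]]
      have "\<phi> (\<pi> z) \<in> J (Suc k)"
        \<comment> \<open>The induction runs over a finite set containing the support of
          \<open>z\<close>, since the index set \<open>X\<close> itself may be infinite.\<close>
        if "finite Y" "z \<in> carrier ?D" "\<And>s. s \<in> X \<Longrightarrow> z s \<in> J 1" "{s \<in> X. z s \<noteq> \<zero>} \<subseteq> Y" for Y z
        using that
      proof (induction Y arbitrary: z rule: finite_induct)
        case empty
        then have "z = \<zero> \<odot>\<^bsub>?D\<^esub> z" by (auto simp: direct_sum_simps fun_eq_iff PiE_iff extensional_def)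
        then have "\<phi> (\<pi> z) = \<zero>" using f(3)[of \<zero> z] f(1)[of z] empty(1) by simp
        then show ?case using J_zero by simp
      next
        case (insert s Y)
        show ?case
        proof (cases "s \<in> X")
          case False
          then show ?thesis using insert by blast
        next
          case True
          let ?u = "\<lambda>i\<in>X. if i = s then \<one> else \<zero>" and ?z = "z(s := \<zero>)"
          have zc: "\<And>r. r \<in> X \<Longrightarrow> z r \<in> carrier A" "finite {s \<in> X. z s \<noteq> \<zero>}" "\<And>r. r \<notin> X \<Longrightarrow> z r = undefined"
            using insert(4) by (auto simp: D PiE_iff extensional_def)
          have u: "?u \<in> carrier ?D" by (auto simp: D intro: finite_subset[of _ "{s}"])
          have z: "?z \<in> carrier ?D"
            using zc True by (auto simp: D PiE_iff extensional_def intro: finite_subset[OF _ zc(2)])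
          have eq: "z = ?z \<oplus>\<^bsub>?D\<^esub> (z s \<odot>\<^bsub>?D\<^esub> ?u)"
            using zc True by (auto simp: direct_sum_simps fun_eq_iff)
          have su: "z s \<odot>\<^bsub>?D\<^esub> ?u \<in> carrier ?D"
            using zc(1)[OF True] by (auto simp: D direct_sum_simps intro: finite_subset[of _ "{s}"])
          have "\<phi> (\<pi> ?z) \<in> J (Suc k)"
            by (rule insert(3)[OF z]) (use insert J_zero in auto)
          moreover have "z s \<otimes> \<phi> (\<pi> ?u) \<in> J (Suc k)"
            by (rule J_mult[OF insert(5)[OF True] IH[OF \<phi> p(1)[OF u]]])
          moreover have "\<phi> (\<pi> z) = \<phi> (\<pi> ?z) \<oplus> z s \<otimes> \<phi> (\<pi> ?u)"
            by (subst eq) (use f(2)[OF z su] f(3)[OF zc(1)[OF True] u] in simp)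
          ultimately show ?thesis using J_add by simp
        qed
      qed
      from this[of "{s \<in> X. \<iota> x s \<noteq> \<zero>}" "\<iota> x"] show ?thesis
        using i(1)[OF x] J1[OF coord x] by (simp add: D \<pi>\<iota>[OF x])
    qed
    have all: "\<phi> x \<in> J (Suc k)" if "\<phi> \<in> left_hom A M (regular_module A)" "x \<in> carrier M" for k \<phi> x
      using that
    proof (induction k arbitrary: \<phi> x)
      case 0
      then show ?case using J1 by simp
    next
      case (Suc k)
      show ?case by (rule step[of "Suc k" \<phi> x]) (use Suc in auto)
    qed
    have "x = \<zero>\<^bsub>M\<^esub>" if x: "x \<in> carrier M" for x
    proof -
      have "\<iota> x s = \<zero>" if "s \<in> X" for s using all[OF coord[OF that] x, of L] J_nilpotent by simp
      then have "\<iota> x = \<zero> \<odot>\<^bsub>?D\<^esub> \<iota> x"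
        using i(1)[OF x] by (auto simp: direct_sum_simps fun_eq_iff PiE_iff extensional_def)
      then show ?thesis using p(3)[of \<zero> "\<iota> x"] i(1)[OF x] x by (simp add: \<pi>\<iota> M.zero_smult)
    qed
    then show False using assms(1) by (auto simp: indecomposable_module_def)
  qed
  then obtain \<phi> x where \<phi>: "\<phi> \<in> left_hom A M (regular_module A)" and x: "x \<in> carrier M" and "\<phi> x \<notin> J 1" by blast
  note f = left_hom_simps[OF \<phi>]
  obtain i c d where i: "i \<in> I" and cd: "c \<in> carrier A" "d \<in> carrier A" "e i \<otimes> c \<otimes> \<phi> x \<otimes> d \<otimes> e i = e i"
    using J_detect[of "\<phi> x"] f(1)[OF x] \<open>\<phi> x \<notin> J 1\<close> by auto
  note ei = e_carrier[OF i] e_idem[OF i]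
  \<comment> \<open>The retraction is \<open>y \<mapsto> \<phi>(y) d e_i\<close> with section
    \<open>r \<mapsto> (r c) x\<close>. Their composite sends \<open>r = r e_i\<close> to
    \<open>r (e_i c \<phi>(x) d e_i) = r e_i = r\<close>.\<close>
  have "left_isomorphic A M (left_ideal A (e i))"
  proof (rule indecomposable_retract_isomorphic[OF assms(1) left_module_left_ideal[OF ei(1)],
        of "\<lambda>y. \<phi> y \<otimes> d \<otimes> e i" "\<lambda>r. (r \<otimes> c) \<odot>\<^bsub>M\<^esub> x"])
    show "(\<lambda>y. \<phi> y \<otimes> d \<otimes> e i) \<in> left_hom A M (left_ideal A (e i))"
      by (rule left_homI) (use f ei cd in \<open>auto simp: m_assoc l_distr\<close>)
    show "(\<lambda>r. (r \<otimes> c) \<odot>\<^bsub>M\<^esub> x) \<in> left_hom A (left_ideal A (e i)) M"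
      by (rule left_homI) (use cd x in \<open>auto simp: M.smult_closed M.smult_l_distr l_distr m_assoc M.smult_assoc\<close>)
    show "\<phi> ((r \<otimes> c) \<odot>\<^bsub>M\<^esub> x) \<otimes> d \<otimes> e i = r" if "r \<in> carrier (left_ideal A (e i))" for r
    proof -
      have r: "r \<in> carrier A" "r \<otimes> e i = r" using that by auto
      have "\<phi> ((r \<otimes> c) \<odot>\<^bsub>M\<^esub> x) \<otimes> d \<otimes> e i = r \<otimes> (c \<otimes> \<phi> x \<otimes> d \<otimes> e i)"
        using r cd x f ei by (simp add: m_assoc)
      also have "\<dots> = r \<otimes> e i \<otimes> (c \<otimes> \<phi> x \<otimes> d \<otimes> e i)" using r by simp
      also have "\<dots> = r \<otimes> (e i \<otimes> c \<otimes> \<phi> x \<otimes> d \<otimes> e i)"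
        using r(1) cd(1,2) f(1)[OF x] ei by (simp add: m_assoc)
      finally show ?thesis using cd r by simp
    qed
    show "carrier (left_ideal A (e i)) \<noteq> {\<zero>\<^bsub>left_ideal A (e i)\<^esub>}"
      using ei e_nonzero[OF i] left_ideal_simps(1)[of "e i" A "e i"] by (metis left_ideal_simps(2) singletonD)
  qed
  then show ?thesis using i by blast
qed

text \<open>A homomorphism out of \<open>A e_i\<close> is right multiplication by the image of
  \<open>e_i\<close>. An isomorphism therefore factors \<open>e_j\<close> through
  \<open>e_i\<close>, contrary to \<open>e_noniso\<close> unless the indices agree.\<close>

lemma left_ideal_noniso:
  assumes "i \<in> I" "j \<in> I" "left_isomorphic A (left_ideal A (e i)) (left_ideal A (e j))" shows "i = j"
proof -
  obtain f where f: "f \<in> left_hom A (left_ideal A (e i)) (left_ideal A (e j))"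
    "bij_betw f (carrier (left_ideal A (e i))) (carrier (left_ideal A (e j)))"
    using assms(3) by (auto simp: left_isomorphic_def)
  note ei = e_carrier[OF assms(1)] e_idem[OF assms(1)] and ej = e_carrier[OF assms(2)] e_idem[OF assms(2)]
  have "e j \<in> f ` carrier (left_ideal A (e i))" using f(2) ej by (simp add: bij_betw_def)
  then obtain b where b: "b \<in> carrier A" "b \<otimes> e i = b" "f b = e j" by auto
  have a: "f (e i) \<in> carrier A" using left_hom_simps(1)[OF f(1), of "e i"] ei by simp
  have "e i \<otimes> f (e i) = f (e i)" using left_ideal_hom_eval[OF f(1) ei ei] by simp
  moreover have "b \<otimes> f (e i) = e j" using left_ideal_hom_eval[OF f(1) ei b(1,2)] b(3) by simp
  ultimately show ?thesis using e_noniso[OF assms(2,1) b(1) a b(2)] by simp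
qed

definition "E = (\<Oplus>i\<in>I. e i)"

lemma E_carrier: "E \<in> carrier A"
  unfolding E_def using e_carrier by (intro finsum_closed) auto

lemma e_E: assumes "i \<in> I" shows "e i \<otimes> E = e i" "E \<otimes> e i = e i"
proof -
  have "e i \<otimes> E = (\<Oplus>j\<in>I. e i \<otimes> e j)"
    unfolding E_def by (rule finsum_rdistr) (use finite_I e_carrier assms in auto)
  also have "\<dots> = (\<Oplus>j\<in>I. if i = j then e j else \<zero>)"
    by (rule finsum_cong') (use e_carrier e_orth e_idem assms in auto)
  also have "\<dots> = e i" by (rule finsum_singleton) (use finite_I e_carrier assms in auto)
  finally show "e i \<otimes> E = e i" .
  have "E \<otimes> e i = (\<Oplus>j\<in>I. e j \<otimes> e i)"
    unfolding E_def by (rule finsum_ldistr) (use finite_I e_carrier assms in auto)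
  also have "\<dots> = (\<Oplus>j\<in>I. if i = j then e j else \<zero>)"
    by (rule finsum_cong') (use e_carrier e_orth e_idem assms in auto)
  also have "\<dots> = e i" by (rule finsum_singleton) (use finite_I e_carrier assms in auto)
  finally show "E \<otimes> e i = e i" .
qed

lemma E_idem: "E \<otimes> E = E"
proof -
  have "E \<otimes> E = (\<Oplus>j\<in>I. e j \<otimes> E)"
    unfolding E_def[symmetric] by (subst (1) E_def, rule finsum_ldistr) (use finite_I e_carrier E_carrier in auto)
  also have "\<dots> = E" unfolding E_def[symmetric]
    by (subst E_def, rule finsum_cong') (use e_carrier e_E in \<open>auto simp: E_def[symmetric]\<close>)
  finally show ?thesis .
qed

text \<open>Whatever representatives \<open>S\<close> contains, sending each to its idempotent is a
  bijection onto \<open>I\<close>, so the direct sum over \<open>S\<close> is the sum of the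
  \<open>A e_i\<close>, that is \<open>A E\<close>. The closure properties in the conclusion are
  what the inversion of \<open>T\<close> needs.\<close>

lemma transversal_sum_iso:
  assumes "indec_proj_transversal A S"
  shows "\<exists>T\<in>left_hom A (direct_sum S (\<lambda>P. P)) (left_ideal A E).
      bij_betw T (carrier (direct_sum S (\<lambda>P. P))) (carrier (left_ideal A E)) \<and>
      (\<forall>x\<in>carrier (direct_sum S (\<lambda>P. P)). \<forall>y\<in>carrier (direct_sum S (\<lambda>P. P)).
         x \<oplus>\<^bsub>direct_sum S (\<lambda>P. P)\<^esub> y \<in> carrier (direct_sum S (\<lambda>P. P))) \<and>
      (\<forall>a\<in>carrier A. \<forall>x\<in>carrier (direct_sum S (\<lambda>P. P)).
         a \<odot>\<^bsub>direct_sum S (\<lambda>P. P)\<^esub> x \<in> carrier (direct_sum S (\<lambda>P. P)))"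
proof -
  let ?D = "direct_sum S (\<lambda>P. P)"
  have S: "indecomposable_module A P" "projective_module A P" "left_module A P" if "P \<in> S" for P
    using assms that by (auto simp: indec_proj_transversal_def indecomposable_module_def)
  have ex1: "\<exists>!P. P \<in> S \<and> left_isomorphic A M P"
    if "indecomposable_module A M" "projective_module A M" for M :: "('a, 'a) module"
    using assms that by (auto simp: indec_proj_transversal_def)
  have "\<forall>P\<in>S. \<exists>i. i \<in> I \<and> left_isomorphic A P (left_ideal A (e i))"
    using projective_iso_left_ideal S by blast
  then obtain idx where idx: "\<And>P. P \<in> S \<Longrightarrow> idx P \<in> I"
    and iso: "\<And>P. P \<in> S \<Longrightarrow> left_isomorphic A P (left_ideal A (e (idx P)))" by metis
  then have "\<forall>P\<in>S. \<exists>f. f \<in> left_hom A P (left_ideal A (e (idx P))) \<and>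
      bij_betw f (carrier P) (carrier (left_ideal A (e (idx P))))"
    by (auto simp: left_isomorphic_def)
  then obtain \<psi> where \<psi>: "\<And>P. P \<in> S \<Longrightarrow> \<psi> P \<in> left_hom A P (left_ideal A (e (idx P)))"
    and \<psi>_bij: "\<And>P. P \<in> S \<Longrightarrow> bij_betw (\<psi> P) (carrier P) (carrier (left_ideal A (e (idx P))))" by metis
  have inj: "inj_on idx S"
  proof (rule inj_onI)
    fix P Q assume PQ: "P \<in> S" "Q \<in> S" "idx P = idx Q"
    then have "left_isomorphic A P Q"
      using left_isomorphic_trans[OF iso[OF PQ(1)]] left_isomorphic_sym[OF S(3)[OF PQ(2)] iso[OF PQ(2)]] by simp
    then show "P = Q" using ex1[OF S(1,2)[OF PQ(1)]] PQ left_isomorphic_refl[of A P] by blast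
  qed
  have surj: "idx ` S = I"
  proof
    show "I \<subseteq> idx ` S"
    proof
      fix i assume i: "i \<in> I"
      note ei = e_carrier[OF i] e_idem[OF i]
      obtain P where P: "P \<in> S" "left_isomorphic A (left_ideal A (e i)) P"
        using ex1[OF indecomposable_left_ideal[OF ei e_nonzero[OF i] e_local[OF i]] projective_left_ideal[OF ei]]
        by blast
      have "i = idx P"
        by (rule left_ideal_noniso[OF i idx[OF P(1)] left_isomorphic_trans[OF P(2) iso[OF P(1)]]])
      then show "i \<in> idx ` S" using P(1) by blast
    qed
  qed (use idx in auto)
  have fin: "finite S" using finite_I inj surj finite_image_iff by metis
  have D: "z \<in> carrier ?D \<longleftrightarrow> z \<in> (\<Pi>\<^sub>E P\<in>S. carrier P)" for z using fin by (simp add: direct_sum_simps)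
  have \<psi>c: "\<psi> P x \<in> carrier A" "\<psi> P x \<otimes> e (idx P) = \<psi> P x" if "P \<in> S" "x \<in> carrier P" for P x
    using left_hom_simps(1)[OF \<psi>[OF that(1)] that(2)] by auto
  note eidx = e_carrier[OF idx]
  have \<psi>E: "\<psi> P x \<otimes> E = \<psi> P x" if "P \<in> S" "x \<in> carrier P" for P x
    using \<psi>c[OF that] m_assoc[of "\<psi> P x" "e (idx P)" E] E_carrier eidx[OF that(1)] e_E(1)[OF idx[OF that(1)]] by simp
  have \<psi>e: "\<psi> Q x \<otimes> e (idx P) = (if P = Q then \<psi> P x else \<zero>)" if "P \<in> S" "Q \<in> S" "x \<in> carrier Q" for P Q x
  proof (cases "P = Q")
    case False
    then have "e (idx Q) \<otimes> e (idx P) = \<zero>" using e_orth[OF idx idx] that inj by (metis inj_onD)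
    then show ?thesis
      using \<psi>c[OF that(2,3)] m_assoc[of "\<psi> Q x" "e (idx Q)" "e (idx P)"] eidx that False by simp
  qed (use \<psi>c that in simp)
  define T where "T z = (\<Oplus>P\<in>S. \<psi> P (z P))" for z
  have zP: "z P \<in> carrier P" if "z \<in> carrier ?D" "P \<in> S" for z P using that by (auto simp: D)
  have Tc: "T z \<in> carrier A" if "z \<in> carrier ?D" for z
    unfolding T_def using \<psi>c(1) zP[OF that] by (intro finsum_closed) auto
  have TE: "T z \<otimes> E = T z" if z: "z \<in> carrier ?D" for z
  proof -
    have "T z \<otimes> E = (\<Oplus>P\<in>S. \<psi> P (z P) \<otimes> E)"
      unfolding T_def by (rule finsum_ldistr) (use fin E_carrier \<psi>c(1) zP[OF z] in auto)
    also have "\<dots> = T z" unfolding T_def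
      by (rule finsum_cong') (use \<psi>E \<psi>c(1) zP[OF z] in auto)
    finally show ?thesis .
  qed
  \<comment> \<open>Right multiplication by one idempotent isolates one component. This gives
    injectivity and also dictates the preimage of an element \<open>y\<close>.\<close>
  have Te: "T z \<otimes> e (idx P) = \<psi> P (z P)" if z: "z \<in> carrier ?D" and P: "P \<in> S" for z P
  proof -
    have "T z \<otimes> e (idx P) = (\<Oplus>Q\<in>S. \<psi> Q (z Q) \<otimes> e (idx P))"
      unfolding T_def by (rule finsum_ldistr) (use fin eidx[OF P] \<psi>c(1) zP[OF z] in auto)
    also have "\<dots> = (\<Oplus>Q\<in>S. if P = Q then \<psi> Q (z Q) else \<zero>)"
      by (rule finsum_cong') (use \<psi>e[OF P] \<psi>c(1) zP[OF z] in auto)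
    also have "\<dots> = \<psi> P (z P)" by (rule finsum_singleton) (use fin P \<psi>c(1) zP[OF z] in auto)
    finally show ?thesis .
  qed
  have Dadd: "x \<oplus>\<^bsub>?D\<^esub> y \<in> carrier ?D" if "x \<in> carrier ?D" "y \<in> carrier ?D" for x y
    unfolding D using that zP S(3)
    by (auto simp: direct_sum_simps(3) intro!: abelian_monoid.a_closed abelian_group.axioms(1) left_module.axioms(2))
  have Dsm: "a \<odot>\<^bsub>?D\<^esub> x \<in> carrier ?D" if "a \<in> carrier A" "x \<in> carrier ?D" for a x
    unfolding D using that zP S(3) by (auto simp: direct_sum_simps(4) intro!: left_module.smult_closed)
  have "T \<in> left_hom A ?D (left_ideal A E)"
  proof (rule left_homI)
    show "T x \<in> carrier (left_ideal A E)" if "x \<in> carrier ?D" for x using Tc TE that by simp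
    show "T (x \<oplus>\<^bsub>?D\<^esub> y) = T x \<oplus>\<^bsub>left_ideal A E\<^esub> T y" if "x \<in> carrier ?D" "y \<in> carrier ?D" for x y
    proof -
      have "T (x \<oplus>\<^bsub>?D\<^esub> y) = (\<Oplus>P\<in>S. \<psi> P (x P) \<oplus> \<psi> P (y P))"
        unfolding T_def
        by (rule finsum_cong') (use left_hom_simps(2)[OF \<psi>] \<psi>c(1) zP that in \<open>auto simp: direct_sum_simps(3)\<close>)
      also have "\<dots> = T x \<oplus> T y" unfolding T_def by (rule finsum_addf) (use \<psi>c(1) zP that in auto)
      finally show ?thesis by simp
    qed
    show "T (a \<odot>\<^bsub>?D\<^esub> x) = a \<odot>\<^bsub>left_ideal A E\<^esub> T x" if "a \<in> carrier A" "x \<in> carrier ?D" for a x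
    proof -
      have "T (a \<odot>\<^bsub>?D\<^esub> x) = (\<Oplus>P\<in>S. a \<otimes> \<psi> P (x P))"
        unfolding T_def
        by (rule finsum_cong') (use left_hom_simps(3)[OF \<psi>] \<psi>c(1) zP that in \<open>auto simp: direct_sum_simps(4)\<close>)
      also have "\<dots> = a \<otimes> T x" unfolding T_def by (rule finsum_rdistr[symmetric]) (use fin \<psi>c(1) zP that in auto)
      finally show ?thesis by simp
    qed
  qed
  moreover have "bij_betw T (carrier ?D) (carrier (left_ideal A E))"
  proof (rule bij_betw_imageI)
    show "inj_on T (carrier ?D)"
    proof (rule inj_onI)
      fix x y assume xy: "x \<in> carrier ?D" "y \<in> carrier ?D" "T x = T y"
      have "x P = y P" if P: "P \<in> S" for P
        using Te[OF xy(1) P] Te[OF xy(2) P] xy(3) \<psi>_bij[OF P] zP[OF xy(1) P] zP[OF xy(2) P]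
        by (auto simp: bij_betw_def dest: inj_onD)
      then show "x = y" using xy(1,2) unfolding D by (metis PiE_ext)
    qed
    show "T ` carrier ?D = carrier (left_ideal A E)"
    proof
      show "T ` carrier ?D \<subseteq> carrier (left_ideal A E)" using Tc TE by auto
      show "carrier (left_ideal A E) \<subseteq> T ` carrier ?D"
      proof
        fix y assume "y \<in> carrier (left_ideal A E)"
        then have y: "y \<in> carrier A" "y \<otimes> E = y" by auto
        have ye: "y \<otimes> e (idx P) \<in> carrier (left_ideal A (e (idx P)))" if "P \<in> S" for P
          using y eidx[OF that] e_idem[OF idx[OF that]] by (simp add: m_assoc)
        define z where "z = (\<lambda>P\<in>S. inv_into (carrier P) (\<psi> P) (y \<otimes> e (idx P)))"
        have z: "z P \<in> carrier P" "\<psi> P (z P) = y \<otimes> e (idx P)" if "P \<in> S" for P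
          using ye[OF that] \<psi>_bij[OF that] that
          by (auto simp: z_def bij_betw_def simp del: left_ideal_simps intro: inv_into_into f_inv_into_f)
        then have zD: "z \<in> carrier ?D" unfolding D by (auto simp: z_def)
        have "T z = (\<Oplus>P\<in>S. y \<otimes> e (idx P))" unfolding T_def
          by (rule finsum_cong') (use z y eidx in auto)
        also have "\<dots> = y \<otimes> (\<Oplus>P\<in>S. e (idx P))"
          by (rule finsum_rdistr[symmetric]) (use fin y eidx in auto)
        also have "(\<Oplus>P\<in>S. e (idx P)) = E"
          unfolding E_def by (subst surj[symmetric], rule finsum_reindex[symmetric]) (use inj eidx in auto)
        finally show "y \<in> T ` carrier ?D" using y zD by (metis image_eqI)
      qed
    qed
  qed
  ultimately show ?thesis using Dadd Dsm by blast
qed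

text \<open>Endomorphisms of \<open>A E\<close> are right multiplications by elements of
  \<open>E A E\<close>; right multiplications compose in reverse order, which the opposite algebra
  undoes.\<close>

theorem basic_algebra_corner:
  fixes B :: "('k, 'b, 's) module_scheme"
  assumes "is_basic_algebra A B"
  shows "alg_iso (corner_alg A E) B \<noteq> {}"
proof -
  obtain S where S: "indec_proj_transversal A S"
    and "alg_iso B (opposite_alg (endo_alg A (direct_sum S (\<lambda>P. P)))) \<noteq> {}" and B: "k_algebra B"
    using assms by (auto simp: is_basic_algebra_def)
  then obtain h where h: "h \<in> alg_iso B (opposite_alg (endo_alg A (direct_sum S (\<lambda>P. P))))" by blast
  let ?D = "direct_sum S (\<lambda>P. P)"
  obtain T where T: "T \<in> left_hom A ?D (left_ideal A E)" "bij_betw T (carrier ?D) (carrier (left_ideal A E))"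
    and Dadd: "\<And>x y. x \<in> carrier ?D \<Longrightarrow> y \<in> carrier ?D \<Longrightarrow> x \<oplus>\<^bsub>?D\<^esub> y \<in> carrier ?D"
    and Dsm: "\<And>a x. a \<in> carrier A \<Longrightarrow> x \<in> carrier ?D \<Longrightarrow> a \<odot>\<^bsub>?D\<^esub> x \<in> carrier ?D"
    using transversal_sum_iso[OF S] by blast
  define T' where "T' = inv_into (carrier ?D) T"
  have T': "T' \<in> left_hom A (left_ideal A E) ?D"
    unfolding T'_def by (rule left_hom_inv[OF T]) (use Dadd Dsm in auto)
  have TT': "T (T' y) = y" if "y \<in> carrier A" "y \<otimes> E = y" for y
    using T(2) that unfolding T'_def by (simp add: bij_betw_def f_inv_into_f)
  have T'T: "T' (T z) = z" if "z \<in> carrier ?D" for z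
    using T(2) that unfolding T'_def by (simp add: bij_betw_def inv_into_f_f)
  have Tc: "T z \<in> carrier A" "T z \<otimes> E = T z" if "z \<in> carrier ?D" for z
    using left_hom_simps(1)[OF T(1) that] by auto
  note Ts = left_hom_simps(2,3)[OF T(1), simplified]
  note T's = left_hom_simps[OF T', simplified]
  let ?O = "opposite_alg (endo_alg A ?D)"
  define \<Phi> where "\<Phi> a = (\<lambda>z\<in>carrier ?D. T' (T z \<otimes> a))" for a
  have xE: "x \<otimes> a \<otimes> E = x \<otimes> a" if "x \<in> carrier A" "a \<in> carrier A" "a \<otimes> E = a" for x a
    using that E_carrier by (simp add: m_assoc)
  have cl: "\<Phi> a \<in> carrier ?O" if a: "a \<in> carrier (corner_alg A E)" for a
  proof -
    have "\<Phi> a \<in> left_hom A ?D ?D"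
      by (rule left_homI)
        (use a Tc Dadd Dsm in \<open>auto simp: \<Phi>_def Ts T's xE l_distr m_assoc E_carrier\<close>)
    then show ?thesis by (simp add: endo_alg_def \<Phi>_def)
  qed
  have "\<Phi> \<in> alg_iso (corner_alg A E) ?O"
    unfolding alg_iso_def
  proof (intro CollectI conjI bij_betw_imageI)
    show "\<Phi> \<in> alg_hom (corner_alg A E) ?O"
    proof (rule alg_homI[OF cl])
      fix a b assume a: "a \<in> carrier (corner_alg A E)" and b: "b \<in> carrier (corner_alg A E)"
      show "\<Phi> (a \<oplus>\<^bsub>corner_alg A E\<^esub> b) = \<Phi> a \<oplus>\<^bsub>?O\<^esub> \<Phi> b"
        using a b Tc by (auto simp: endo_alg_def \<Phi>_def r_distr T's(1,2) xE intro!: restrict_ext)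
      show "\<Phi> (a \<otimes>\<^bsub>corner_alg A E\<^esub> b) = \<Phi> a \<otimes>\<^bsub>?O\<^esub> \<Phi> b"
        using a b Tc by (auto simp: endo_alg_def \<Phi>_def compose_def T's(1,2) xE TT' m_assoc intro!: restrict_ext)
    next
      show "\<Phi> \<one>\<^bsub>corner_alg A E\<^esub> = \<one>\<^bsub>?O\<^esub>"
        using Tc T'T by (auto simp: endo_alg_def \<Phi>_def intro!: restrict_ext)
    next
      fix c a assume a: "a \<in> carrier (corner_alg A E)"
      have "T' (x \<otimes> (c \<odot> a)) = (c \<odot> \<one>) \<odot>\<^bsub>?D\<^esub> T' (x \<otimes> a)" if "x \<in> carrier A" for x
        using a that T's(3)[of "c \<odot> \<one>" "x \<otimes> a"] by (simp add: xE smult_mult_left smult_mult_right)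
      then show "\<Phi> (c \<odot>\<^bsub>corner_alg A E\<^esub> a) = c \<odot>\<^bsub>?O\<^esub> \<Phi> a"
        using Tc by (auto simp: endo_alg_def \<Phi>_def intro!: restrict_ext)
    qed
    show "inj_on \<Phi> (carrier (corner_alg A E))"
    proof (rule inj_onI)
      fix a b assume a: "a \<in> carrier (corner_alg A E)" and b: "b \<in> carrier (corner_alg A E)" and eq: "\<Phi> a = \<Phi> b"
      have "T' E \<in> carrier ?D" using T's(1) E_carrier E_idem by simp
      then have "T' (E \<otimes> a) = T' (E \<otimes> b)"
        using fun_cong[OF eq, of "T' E"] E_carrier E_idem by (simp add: \<Phi>_def TT')
      then have "T (T' a) = T (T' b)" using a b by simp
      moreover have "T (T' a) = a" "T (T' b) = b" using a b by (auto intro: TT')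
      ultimately show "a = b" by simp
    qed
    show "\<Phi> ` carrier (corner_alg A E) = carrier ?O"
    proof
      show "\<Phi> ` carrier (corner_alg A E) \<subseteq> carrier ?O" using cl by blast
      show "carrier ?O \<subseteq> \<Phi> ` carrier (corner_alg A E)"
      proof
        fix F assume "F \<in> carrier ?O"
        then have F: "F \<in> left_hom A ?D ?D" "F \<in> extensional (carrier ?D)" by (auto simp: endo_alg_def)
        note Fs = left_hom_simps[OF F(1)]
        let ?a = "T (F (T' E))"
        have TE: "T' E \<in> carrier ?D" using T's(1) E_carrier E_idem by simp
        \<comment> \<open>As \<open>E\<close> generates \<open>A E\<close>, the endomorphism is
          determined by its value at \<open>E\<close>; carried over by \<open>T\<close>, it is right
          multiplication by \<open>?a\<close>.\<close>
        have key: "x \<otimes> ?a = T (F (T' x))" if "x \<in> carrier A" "x \<otimes> E = x" for x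
        proof -
          have "T' x = x \<odot>\<^bsub>?D\<^esub> T' E" using T's(3)[of x E] that E_carrier E_idem by simp
          then show ?thesis using that TE Fs(1) by (simp add: Ts Fs)
        qed
        have "?a \<in> carrier (corner_alg A E)"
          using key[of E] Tc Fs(1) TE E_carrier E_idem by simp
        moreover have "\<Phi> ?a = F"
          using F(2) by (auto simp: \<Phi>_def key Tc T'T Fs(1) fun_eq_iff extensional_def)
        ultimately show "F \<in> \<Phi> ` carrier (corner_alg A E)" by (metis image_eqI)
      qed
    qed
  qed
  then show ?thesis using alg_iso_comp alg_iso_inv[OF B h] by blast
qed

end

section \<open>Spanning sets and dimension counting\<close>

inductive_set k_span :: "('k, 'v, 'r) module_scheme \<Rightarrow> 'v set \<Rightarrow> 'v set" for V X where
  zero: "\<zero>\<^bsub>V\<^esub> \<in> k_span V X"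
| base: "x \<in> X \<Longrightarrow> x \<in> k_span V X"
| add: "x \<in> k_span V X \<Longrightarrow> y \<in> k_span V X \<Longrightarrow> x \<oplus>\<^bsub>V\<^esub> y \<in> k_span V X"
| scale: "x \<in> k_span V X \<Longrightarrow> c \<odot>\<^bsub>V\<^esub> x \<in> k_span V X"

lemma (in k_space) k_span_closed: assumes "X \<subseteq> carrier V" "x \<in> k_span V X" shows "x \<in> carrier V"
  using assms(2) by (induction rule: k_span.induct) (use assms(1) in auto)

lemma k_span_subset:
  assumes "x \<in> k_span V X" "X \<subseteq> k_span V Y" shows "x \<in> k_span V Y"
  using assms(1) by (induction rule: k_span.induct) (use assms(2) in \<open>auto intro: k_span.intros\<close>)

lemma lin_map_k_span:
  assumes "k_space V" "k_space W" "lin_map V W f" "X \<subseteq> carrier V" "\<And>x. x \<in> X \<Longrightarrow> f x \<in> k_span W Y" "x \<in> k_span V X"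
  shows "f x \<in> k_span W Y"
proof -
  interpret V: k_space V by fact
  interpret W: k_space W by fact
  from assms(6) have "x \<in> carrier V \<and> f x \<in> k_span W Y"
    by (induction rule: k_span.induct)
      (use assms(4,5) in \<open>auto intro: k_span.intros simp: lin_map_zero[OF assms(1-3)] lin_map_add[OF assms(3)] lin_map_smult[OF assms(3)]\<close>)
  then show ?thesis by simp
qed

text \<open>The elements whose left multiplication preserves the span form a subalgebra containing
  the generators, hence everything; apply each of them to \<open>\<one>\<close>.\<close>

lemma (in k_algebra) alg_generates_span:
  assumes "alg_generates A G" "X \<subseteq> carrier A" "\<one> \<in> k_span A X"
    "\<And>g x. g \<in> G \<Longrightarrow> x \<in> X \<Longrightarrow> g \<otimes> x \<in> k_span A X"
  shows "carrier A \<subseteq> k_span A X"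
proof
  fix z assume z: "z \<in> carrier A"
  let ?Y = "{z \<in> carrier A. \<forall>y\<in>k_span A X. z \<otimes> y \<in> k_span A X}"
  have c: "y \<in> carrier A" if "y \<in> k_span A X" for y using k_span_closed[OF assms(2) that] .
  have "k_subalgebra A ?Y"
    unfolding k_subalgebra_def
    using c by (auto simp: l_distr smult_mult_left m_assoc intro: k_span.intros)
  moreover have "G \<subseteq> ?Y"
  proof
    fix g assume g: "g \<in> G"
    then have gc: "g \<in> carrier A" using assms(1) by (auto simp: alg_generates_def)
    have lin: "lin_map A A (\<lambda>y. g \<otimes> y)" by (rule lin_mapI) (use gc in \<open>auto simp: r_distr smult_mult_right\<close>)
    show "g \<in> ?Y"
      using gc lin_map_k_span[OF k_space_axioms k_space_axioms lin assms(2) assms(4)[OF g]] by blast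
  qed
  ultimately have "z \<in> ?Y" using assms(1) z unfolding alg_generates_def by blast
  then have "z \<otimes> \<one> \<in> k_span A X" using assms(3) by blast
  then show "z \<in> k_span A X" using z by simp
qed

lemma (in k_space) k_span_coefficients:
  assumes "finite X" "X \<subseteq> carrier V" "x \<in> k_span V X"
  shows "\<exists>c. x = (\<Oplus>y\<in>X. c y \<odot> y)"
  using assms(3)
proof (induction rule: k_span.induct)
  case zero
  have "(\<Oplus>y\<in>X. 0 \<odot> y) = (\<Oplus>y\<in>X. \<zero>)" by (rule M.finsum_cong') (use assms in auto)
  then show ?case by (intro exI[of _ "\<lambda>_. 0"]) simp
next
  case (base x)
  have "(\<Oplus>y\<in>X. (if x = y then 1 else 0) \<odot> y) = (\<Oplus>y\<in>X. if x = y then y else \<zero>)"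
    by (rule M.finsum_cong') (use assms in auto)
  also have "\<dots> = x" by (rule M.finsum_singleton) (use assms base in auto)
  finally show ?case by (intro exI[of _ "\<lambda>y. if x = y then 1 else 0"]) simp
next
  case (add x y)
  then obtain c d where cd: "x = (\<Oplus>y\<in>X. c y \<odot> y)" "y = (\<Oplus>y\<in>X. d y \<odot> y)" by blast
  have "x \<oplus> y = (\<Oplus>y\<in>X. c y \<odot> y \<oplus> d y \<odot> y)"
    unfolding cd by (rule M.finsum_addf[symmetric]) (use assms in auto)
  also have "\<dots> = (\<Oplus>y\<in>X. (c y + d y) \<odot> y)"
    by (rule M.finsum_cong') (use assms in \<open>auto simp: scale_add_left\<close>)
  finally show ?case by (intro exI[of _ "\<lambda>y. c y + d y"]) simp
next
  case (scale x a)
  then obtain c where c: "x = (\<Oplus>y\<in>X. c y \<odot> y)" by blast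
  have "a \<odot> x = (\<Oplus>y\<in>X. a \<odot> (c y \<odot> y))"
    unfolding c by (rule finsum_smult_ldistr) (use assms in auto)
  also have "\<dots> = (\<Oplus>y\<in>X. (a * c y) \<odot> y)"
    by (rule M.finsum_cong') (use assms in auto)
  finally show ?case by (intro exI[of _ "\<lambda>y. a * c y"]) simp
qed

interpretation pm: vector_space "\<lambda>(c::'k::field) (u :: 'd \<Rightarrow>\<^sub>0 'k). Poly_Mapping.map ((*) c) u"
  by unfold_locales (auto intro!: poly_mapping_eqI simp: lookup_add algebra_simps)

text \<open>A nonzero \<open>x\<close> in the kernel would express the image of one spanning vector
  through the others. Then fewer than \<open>card X\<close> vectors would span the
  \<open>card D\<close> independent unit vectors, although
  \<open>card X \<le> card D\<close>.\<close>

lemma dimension_count: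
  fixes V (structure) and f :: "'v \<Rightarrow> ('d \<Rightarrow>\<^sub>0 'k::field)"
  assumes "k_space V" "finite X" "X \<subseteq> carrier V" "carrier V \<subseteq> k_span V X"
    "\<And>x y. x \<in> carrier V \<Longrightarrow> y \<in> carrier V \<Longrightarrow> f (x \<oplus> y) = f x + f y"
    "\<And>c x. x \<in> carrier V \<Longrightarrow> f (c \<odot> x) = Poly_Mapping.map ((*) c) (f x)"
    "finite D" "\<And>d. d \<in> D \<Longrightarrow> \<exists>x\<in>carrier V. f x = Poly_Mapping.single d 1" "card X \<le> card D"
    "x \<in> carrier V" "f x = 0"
  shows "x = \<zero>"
proof (rule ccontr)
  assume x0: "x \<noteq> \<zero>"
  interpret k_space V by fact
  let ?s = "\<lambda>d. Poly_Mapping.single d (1::'k)"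
  have f0: "f \<zero> = 0" using assms(6)[of \<zero> 0] by (simp add: poly_mapping_eq_iff fun_eq_iff)
  have fsum: "f (\<Oplus>y\<in>Y. c y \<odot> y) = (\<Sum>y\<in>Y. Poly_Mapping.map ((*) (c y)) (f y))"
    if "finite Y" "Y \<subseteq> carrier V" for Y and c :: "'v \<Rightarrow> 'k"
    using that by (induction Y rule: finite_induct) (auto simp: f0 assms(5,6) Pi_iff subset_iff)
  obtain c where c: "x = (\<Oplus>y\<in>X. c y \<odot> y)" using k_span_coefficients assms by blast
  have "\<exists>y0\<in>X. c y0 \<noteq> 0"
  proof (rule ccontr)
    assume "\<not> ?thesis"
    then have "x = (\<Oplus>y\<in>X. \<zero>)" unfolding c by (intro M.finsum_cong') (use assms(3) in auto)
    then show False using x0 by simp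
  qed
  then obtain y0 where y0: "y0 \<in> X" "c y0 \<noteq> 0" by blast
  have "(\<Sum>y\<in>X. Poly_Mapping.map ((*) (c y)) (f y)) = 0" using fsum[OF assms(2,3), of c] c assms(11) by simp
  then have "Poly_Mapping.map ((*) (c y0)) (f y0) + (\<Sum>y\<in>X - {y0}. Poly_Mapping.map ((*) (c y)) (f y)) = 0"
    using sum.remove[OF assms(2) y0(1), of "\<lambda>y. Poly_Mapping.map ((*) (c y)) (f y)"] by simp
  then have e: "Poly_Mapping.map ((*) (c y0)) (f y0) = - (\<Sum>y\<in>X - {y0}. Poly_Mapping.map ((*) (c y)) (f y))"
    by (simp add: eq_neg_iff_add_eq_0)
  let ?S = "f ` (X - {y0})"
  have "Poly_Mapping.map ((*) (c y0)) (f y0) \<in> pm.span ?S"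
    unfolding e by (intro pm.span_neg pm.span_sum pm.span_scale pm.span_base) auto
  then have "Poly_Mapping.map ((*) (inverse (c y0))) (Poly_Mapping.map ((*) (c y0)) (f y0)) \<in> pm.span ?S"
    by (rule pm.span_scale)
  then have fy0: "f y0 \<in> pm.span ?S" using y0(2) by (simp add: pm.scale_scale)
  have "?s ` D \<subseteq> pm.span ?S"
  proof
    fix v assume "v \<in> ?s ` D"
    then obtain z where z: "z \<in> carrier V" "f z = v" using assms(8) by blast
    obtain a where "z = (\<Oplus>y\<in>X. a y \<odot> y)" using k_span_coefficients assms z(1) by blast
    then have v: "v = (\<Sum>y\<in>X. Poly_Mapping.map ((*) (a y)) (f y))" using fsum[OF assms(2,3), of a] z(2) by simp
    have "f y \<in> pm.span ?S" if "y \<in> X" for y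
      using fy0 that by (cases "y = y0") (auto intro: pm.span_base)
    then show "v \<in> pm.span ?S" unfolding v by (intro pm.span_sum pm.span_scale) auto
  qed
  moreover have "pm.independent (?s ` D)"
    unfolding pm.dependent_finite[OF finite_imageI[OF assms(7)]]
  proof (intro notI, elim exE conjE bexE)
    fix u v assume v: "v \<in> ?s ` D" "u v \<noteq> 0" and s: "(\<Sum>v\<in>?s ` D. Poly_Mapping.map ((*) (u v)) v) = 0"
    obtain d where d: "d \<in> D" "v = ?s d" using v(1) by blast
    have inj: "inj_on ?s D" by (rule inj_onI) (metis lookup_single_eq lookup_single_not_eq zero_neq_one)
    have "0 = Poly_Mapping.lookup (\<Sum>v\<in>?s ` D. Poly_Mapping.map ((*) (u v)) v) d" by (simp only: s) simp
    also have "\<dots> = (\<Sum>d'\<in>D. if d = d' then u (?s d') else 0)"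
      unfolding sum.reindex[OF inj] lookup_sum o_def
      by (rule sum.cong) (auto simp: lookup_single when_def)
    also have "\<dots> = u v" using d assms(7) by simp
    finally show False using v(2) by simp
  qed
  ultimately have "card (?s ` D) \<le> card ?S"
    using pm.independent_span_bound[of ?S "?s ` D"] assms(2) by simp
  moreover have "inj_on ?s D" by (rule inj_onI) (metis lookup_single_eq lookup_single_not_eq zero_neq_one)
  ultimately have "card D \<le> card ?S" by (simp add: card_image)
  also have "\<dots> \<le> card (X - {y0})" by (rule card_image_le) (use assms(2) in simp)
  also have "\<dots> < card X" by (rule card_Diff1_less) (use y0(1) assms(2) in auto)
  finally show False using assms(9) by simp
qed

section \<open>The ring \<open>k[x, y]/(x\<^sup>2, y\<^sup>2)\<close>\<close>

datatype 'a bidual = Bidual (c1: 'a) (cx: 'a) (cy: 'a) (cxy: 'a)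

instantiation bidual :: (comm_ring_1) comm_ring_1
begin

definition "0 = Bidual 0 0 0 0"
definition "1 = Bidual 1 0 0 0"
definition "a + b = Bidual (c1 a + c1 b) (cx a + cx b) (cy a + cy b) (cxy a + cxy b)"
definition "- a = Bidual (- c1 a) (- cx a) (- cy a) (- cxy a)"
definition "a - b = Bidual (c1 a - c1 b) (cx a - cx b) (cy a - cy b) (cxy a - cxy b)"
definition "a * b = Bidual (c1 a * c1 b) (c1 a * cx b + cx a * c1 b) (c1 a * cy b + cy a * c1 b)
  (c1 a * cxy b + cx a * cy b + cy a * cx b + cxy a * c1 b)"

instance
  by standard (auto simp: zero_bidual_def one_bidual_def plus_bidual_def uminus_bidual_def minus_bidual_def
      times_bidual_def algebra_simps)

end

lemmas bidual_defs = zero_bidual_def one_bidual_def plus_bidual_def uminus_bidual_def minus_bidual_def times_bidual_def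

lemma bidual_sel [simp]:
  "c1 0 = 0" "cx 0 = 0" "cy 0 = 0" "cxy 0 = 0" "c1 1 = 1" "cx 1 = 0" "cy 1 = 0" "cxy 1 = 0"
  "c1 (a + b) = c1 a + c1 b" "cx (a + b) = cx a + cx b" "cy (a + b) = cy a + cy b" "cxy (a + b) = cxy a + cxy b"
  "c1 (- a) = - c1 a" "cx (- a) = - cx a" "cy (- a) = - cy a" "cxy (- a) = - cxy a"
  "c1 (a - b) = c1 a - c1 b" "cx (a - b) = cx a - cx b" "cy (a - b) = cy a - cy b" "cxy (a - b) = cxy a - cxy b"
  "c1 (a * b) = c1 a * c1 b" "cx (a * b) = c1 a * cx b + cx a * c1 b" "cy (a * b) = c1 a * cy b + cy a * c1 b"
  "cxy (a * b) = c1 a * cxy b + cx a * cy b + cy a * cx b + cxy a * c1 b"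
  by (simp_all add: bidual_defs)

lemma bidual_eq_iff: "a = b \<longleftrightarrow> c1 a = c1 b \<and> cx a = cx b \<and> cy a = cy b \<and> cxy a = cxy b"
  by (cases a; cases b) auto

definition scal :: "'a::comm_ring_1 \<Rightarrow> 'a bidual" where "scal c = Bidual c 0 0 0"
definition dx :: "'a::comm_ring_1 bidual" where "dx = Bidual 0 1 0 0"
definition dy :: "'a::comm_ring_1 bidual" where "dy = Bidual 0 0 1 0"

lemma scal_sel [simp]: "c1 (scal c) = c" "cx (scal c) = 0" "cy (scal c) = 0" "cxy (scal c) = 0"
  by (simp_all add: scal_def)

lemma dx_sel [simp]: "c1 dx = 0" "cx dx = 1" "cy dx = 0" "cxy dx = 0" "c1 dy = 0" "cx dy = 0" "cy dy = 1" "cxy dy = 0"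
  by (simp_all add: dx_def dy_def)

lemma scal_simps: "scal 1 = 1" "scal 0 = 0" "scal (a + b) = scal a + scal b" "scal (a * b) = scal a * scal b"
  "scal (- a) = - scal a" "scal (a - b) = scal a - scal b"
  by (simp_all add: bidual_eq_iff)

lemma dx_squared [simp]: "dx * dx = 0" "dy * dy = 0" "dx * (dx * a) = 0" "dy * (dy * a) = 0"
  by (simp_all add: bidual_eq_iff)

section \<open>Block supermatrices\<close>

definition entry :: "('p \<Rightarrow> nat) \<Rightarrow> ('p \<Rightarrow> bool) \<Rightarrow> 'p \<Rightarrow> 'p \<Rightarrow> 'k::comm_ring_1 bidual set" where
  "entry blk par p q = (if blk p \<noteq> blk q then {0} else if par p = par q then {r. cx r = 0 \<and> cy r = 0}
     else {r. c1 r = 0 \<and> cxy r = 0})"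

text \<open>Entries outside \<open>P\<close> must vanish, so equality of elements is equality of
  functions and the algebra on a subset of \<open>P\<close> is literally a corner of the larger one,
  as used in \<open>corner_mat\<close>.\<close>

definition mat_alg :: "'p set \<Rightarrow> ('p \<Rightarrow> nat) \<Rightarrow> ('p \<Rightarrow> bool) \<Rightarrow> ('k::field, 'p \<Rightarrow> 'p \<Rightarrow> 'k bidual) module" where
  "mat_alg P blk par =
     \<lparr>carrier = {M. (\<forall>p\<in>P. \<forall>q\<in>P. M p q \<in> entry blk par p q) \<and> (\<forall>p q. p \<notin> P \<or> q \<notin> P \<longrightarrow> M p q = 0)},
      mult = (\<lambda>M N p q. \<Sum>l\<in>P. M p l * N l q), one = (\<lambda>p q. if p = q \<and> p \<in> P then 1 else 0),
      zero = (\<lambda>p q. 0), add = (\<lambda>M N p q. M p q + N p q), smult = (\<lambda>c M p q. scal c * M p q)\<rparr>"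

text \<open>The operator sending the basis vector at \<open>p\<close> to \<open>f p\<close> times
  the basis vector at \<open>\<sigma> p\<close>; the weight is indexed by the source.\<close>

definition shift_mat :: "'p set \<Rightarrow> ('p \<Rightarrow> 'p) \<Rightarrow> ('p \<Rightarrow> 'k::comm_ring_1 bidual) \<Rightarrow> 'p \<Rightarrow> 'p \<Rightarrow> 'k bidual" where
  "shift_mat P \<sigma> f p' p = (if p \<in> P \<and> p' = \<sigma> p then f p else 0)"

definition munit :: "'p \<Rightarrow> 'p \<Rightarrow> 'k::comm_ring_1 bidual \<Rightarrow> 'p \<Rightarrow> 'p \<Rightarrow> 'k bidual" where
  "munit p q r a b = (if a = p \<and> b = q then r else 0)"

lemma entry_add: "r \<in> entry blk par p q \<Longrightarrow> s \<in> entry blk par p q \<Longrightarrow> r + s \<in> entry blk par p q"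
  by (auto simp: entry_def split: if_splits)

lemma entry_minus: "r \<in> entry blk par p q \<Longrightarrow> s \<in> entry blk par p q \<Longrightarrow> r - s \<in> entry blk par p q"
  by (auto simp: entry_def split: if_splits)

lemma entry_uminus: "r \<in> entry blk par p q \<Longrightarrow> - r \<in> entry blk par p q"
  by (auto simp: entry_def split: if_splits)

lemma entry_zero [simp]: "0 \<in> entry blk par p q"
  by (auto simp: entry_def)

lemma entry_scal: "r \<in> entry blk par p q \<Longrightarrow> scal c * r \<in> entry blk par p q"
  by (auto simp: entry_def split: if_splits)

lemma entry_one [simp]: "1 \<in> entry blk par p p" "scal c \<in> entry blk par p p"
  by (auto simp: entry_def)

lemma entry_mult: "r \<in> entry blk par p l \<Longrightarrow> s \<in> entry blk par l q \<Longrightarrow> r * s \<in> entry blk par p q"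
  by (auto simp: entry_def split: if_splits)

lemma entry_sum: "(\<And>l. l \<in> S \<Longrightarrow> f l \<in> entry blk par p q) \<Longrightarrow> (\<Sum>l\<in>S. f l) \<in> entry blk par p q"
  by (induction S rule: infinite_finite_induct) (auto intro: entry_add)

lemma entry_cong: "blk p = blk p' \<Longrightarrow> par p = par p' \<Longrightarrow> blk q = blk q' \<Longrightarrow> par q = par q' \<Longrightarrow>
    entry blk par p q = entry blk par p' q'"
  by (simp add: entry_def)

locale supermatrix =
  fixes P :: "'p set" and blk :: "'p \<Rightarrow> nat" and par :: "'p \<Rightarrow> bool"
  assumes finite_P: "finite P"
begin

abbreviation mat :: "('k::field, 'p \<Rightarrow> 'p \<Rightarrow> 'k bidual) module" where "mat \<equiv> mat_alg P blk par"
abbreviation W :: "'p \<Rightarrow> 'p \<Rightarrow> 'k::comm_ring_1 bidual set" where "W \<equiv> entry blk par"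
abbreviation sh :: "('p \<Rightarrow> 'p) \<Rightarrow> ('p \<Rightarrow> 'k::comm_ring_1 bidual) \<Rightarrow> 'p \<Rightarrow> 'p \<Rightarrow> 'k bidual" where "sh \<equiv> shift_mat P"

lemma mat_simps [simp]:
  "M \<otimes>\<^bsub>mat\<^esub> N = (\<lambda>p q. \<Sum>l\<in>P. M p l * N l q)" "\<one>\<^bsub>mat\<^esub> = (\<lambda>p q. if p = q \<and> p \<in> P then 1 else 0)"
  "\<zero>\<^bsub>mat\<^esub> = (\<lambda>p q. 0)" "M \<oplus>\<^bsub>mat\<^esub> N = (\<lambda>p q. M p q + N p q)" "c \<odot>\<^bsub>mat\<^esub> M = (\<lambda>p q. scal c * M p q)"
  by (simp_all add: mat_alg_def)

lemma carrier_mat: "M \<in> carrier mat \<longleftrightarrow>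
    (\<forall>p\<in>P. \<forall>q\<in>P. M p q \<in> W p q) \<and> (\<forall>p q. p \<notin> P \<or> q \<notin> P \<longrightarrow> M p q = 0)"
  by (simp add: mat_alg_def)

lemma k_algebra_mat: "k_algebra (mat :: ('k::field, _) module)"
proof -
  let ?M = "mat :: ('k, _) module"
  have ab: "abelian_group ?M"
  proof (rule abelian_groupI)
    show "\<exists>N\<in>carrier ?M. N \<oplus>\<^bsub>?M\<^esub> M = \<zero>\<^bsub>?M\<^esub>" if "M \<in> carrier ?M" for M
      by (rule bexI[of _ "\<lambda>p q. - M p q"]) (use that in \<open>auto simp: carrier_mat intro!: entry_uminus\<close>)
  qed (auto simp: carrier_mat algebra_simps intro: entry_add)
  have mon: "monoid ?M"
  proof (rule monoidI)
    fix A B C assume M: "A \<in> carrier ?M" "B \<in> carrier ?M" "C \<in> carrier ?M"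
    show "A \<otimes>\<^bsub>?M\<^esub> B \<in> carrier ?M"
    proof -
      have "A p l * B l q \<in> W p q" if "p \<in> P" "q \<in> P" "l \<in> P" for p q l
        by (rule entry_mult[of _ _ _ _ l]) (use M that carrier_mat in blast)+
      then show ?thesis using M(1,2) by (auto simp: carrier_mat intro!: entry_sum)
    qed
    show "A \<otimes>\<^bsub>?M\<^esub> B \<otimes>\<^bsub>?M\<^esub> C = A \<otimes>\<^bsub>?M\<^esub> (B \<otimes>\<^bsub>?M\<^esub> C)"
      by (intro ext, simp add: sum_distrib_left sum_distrib_right mult.assoc, rule sum.swap)
    have "(\<Sum>l\<in>P. (if p = l \<and> p \<in> P then 1 else 0) * A l q) = A p q" for p q
      using M(1) finite_P by (cases "p \<in> P") (auto simp: carrier_mat if_distrib if_distribR sum.delta cong: if_cong)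
    then show "\<one>\<^bsub>?M\<^esub> \<otimes>\<^bsub>?M\<^esub> A = A" by simp
    have "(\<Sum>l\<in>P. A p l * (if l = q \<and> l \<in> P then 1 else 0)) = A p q" for p q
    proof -
      have "(\<Sum>l\<in>P. A p l * (if l = q \<and> l \<in> P then 1 else 0)) = (\<Sum>l\<in>P. if l = q then A p l else 0)"
        by (rule sum.cong) auto
      then show ?thesis using M(1) finite_P by (auto simp: carrier_mat)
    qed
    then show "A \<otimes>\<^bsub>?M\<^esub> \<one>\<^bsub>?M\<^esub> = A" by simp
  qed (auto simp: carrier_mat)
  have ring: "ring ?M"
    by (rule ringI[OF ab mon]) (simp_all add: fun_eq_iff algebra_simps sum.distrib)
  show ?thesis
    by (rule k_algebraI[OF k_spaceI[OF ab] ring])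
      (auto simp: carrier_mat scal_simps algebra_simps sum_distrib_left intro: entry_scal)
qed

sublocale M: k_algebra mat by (rule k_algebra_mat)

lemma sh_mem: "(\<And>p. p \<in> P \<Longrightarrow> \<sigma> p \<in> P) \<Longrightarrow> (\<And>p. p \<in> P \<Longrightarrow> f p \<in> W (\<sigma> p) p) \<Longrightarrow> sh \<sigma> f \<in> carrier mat"
  by (auto simp: carrier_mat shift_mat_def)

lemma sh_mult:
  assumes "\<And>p. p \<in> P \<Longrightarrow> \<tau> p \<in> P"
  shows "sh \<sigma> f \<otimes>\<^bsub>mat\<^esub> sh \<tau> g = sh (\<lambda>p. \<sigma> (\<tau> p)) (\<lambda>p. f (\<tau> p) * g p)"
proof (intro ext)
  fix a b
  have "(\<Sum>l\<in>P. sh \<sigma> f a l * sh \<tau> g l b) = (\<Sum>l\<in>P. if l = \<tau> b then sh \<sigma> f a l * sh \<tau> g l b else 0)"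
    by (rule sum.cong) (auto simp: shift_mat_def)
  then show "(sh \<sigma> f \<otimes>\<^bsub>mat\<^esub> sh \<tau> g) a b = sh (\<lambda>p. \<sigma> (\<tau> p)) (\<lambda>p. f (\<tau> p) * g p) a b"
    using finite_P assms[of b] by (auto simp: shift_mat_def)
qed

lemma sh_add: "sh \<sigma> f \<oplus>\<^bsub>mat\<^esub> sh \<sigma> g = sh \<sigma> (\<lambda>p. f p + g p)"
  by (auto simp: shift_mat_def fun_eq_iff)

lemma sh_smult: "c \<odot>\<^bsub>mat\<^esub> sh \<sigma> f = sh \<sigma> (\<lambda>p. scal c * f p)"
  by (auto simp: shift_mat_def fun_eq_iff)

lemma sh_one: "\<one>\<^bsub>mat\<^esub> = sh (\<lambda>p. p) (\<lambda>p. 1)"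
  by (auto simp: shift_mat_def fun_eq_iff)

lemma sh_zero: "\<zero>\<^bsub>mat\<^esub> = sh \<sigma> (\<lambda>p. 0)"
  by (auto simp: shift_mat_def fun_eq_iff)

lemma sh_cong: "(\<And>p. p \<in> P \<Longrightarrow> \<sigma> p = \<tau> p) \<Longrightarrow> (\<And>p. p \<in> P \<Longrightarrow> f p = g p) \<Longrightarrow> sh \<sigma> f = sh \<tau> g"
  by (auto simp: shift_mat_def fun_eq_iff)

lemma sh_minus:
  assumes "sh \<sigma> f \<in> carrier mat" "sh \<sigma> g \<in> carrier mat"
  shows "sh \<sigma> f \<ominus>\<^bsub>mat\<^esub> sh \<sigma> g = sh \<sigma> (\<lambda>p. f p - g p)"
proof -
  have "\<ominus>\<^bsub>mat\<^esub> sh \<sigma> g = (- 1) \<odot>\<^bsub>mat\<^esub> sh \<sigma> g" using assms M.scale_minus_one by metis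
  also have "\<dots> = sh \<sigma> (\<lambda>p. - g p)" unfolding sh_smult by (simp add: scal_simps)
  finally show ?thesis unfolding a_minus_def by (simp only: sh_add) simp
qed

lemma sh_pow:
  assumes "\<And>p. p \<in> P \<Longrightarrow> \<sigma> p \<in> P"
  shows "sh \<sigma> f [^]\<^bsub>mat\<^esub> (k::nat) = sh (\<sigma> ^^ k) (\<lambda>p. \<Prod>j<k. f ((\<sigma> ^^ j) p))"
proof (induction k)
  case (Suc k)
  have "sh \<sigma> f [^]\<^bsub>mat\<^esub> Suc k = sh (\<sigma> ^^ k) (\<lambda>p. \<Prod>j<k. f ((\<sigma> ^^ j) p)) \<otimes>\<^bsub>mat\<^esub> sh \<sigma> f"
    by (simp only: nat_pow_Suc Suc)
  also have "\<dots> = sh (\<lambda>p. (\<sigma> ^^ k) (\<sigma> p)) (\<lambda>p. (\<Prod>j<k. f ((\<sigma> ^^ j) (\<sigma> p))) * f p)"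
    by (rule sh_mult) (rule assms)
  also have "\<dots> = sh (\<sigma> ^^ Suc k) (\<lambda>p. \<Prod>j<Suc k. f ((\<sigma> ^^ j) p))"
    by (rule sh_cong) (simp_all add: funpow_swap1 prod.lessThan_Suc_shift mult.commute del: prod.lessThan_Suc)
  finally show ?case .
qed (simp only: nat_pow_0 sh_one funpow_0, simp)

lemma munit_mem: "p \<in> P \<Longrightarrow> q \<in> P \<Longrightarrow> r \<in> W p q \<Longrightarrow> munit p q r \<in> carrier mat"
  by (auto simp: carrier_mat munit_def)

lemma munit_mult: "q \<in> P \<Longrightarrow> munit p q r \<otimes>\<^bsub>mat\<^esub> munit q' s t = (if q = q' then munit p s (r * t) else \<zero>\<^bsub>mat\<^esub>)"
proof (intro ext)
  fix a b assume q: "q \<in> P"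
  have "(\<Sum>l\<in>P. munit p q r a l * munit q' s t l b) = (\<Sum>l\<in>P. if l = q then munit p q r a l * munit q' s t l b else 0)"
    by (rule sum.cong) (auto simp: munit_def)
  then show "(munit p q r \<otimes>\<^bsub>mat\<^esub> munit q' s t) a b = (if q = q' then munit p s (r * t) else \<zero>\<^bsub>mat\<^esub>) a b"
    using q finite_P by (auto simp: munit_def)
qed

lemma sh_munit: "p \<in> P \<Longrightarrow> sh \<sigma> f \<otimes>\<^bsub>mat\<^esub> munit p q r = munit (\<sigma> p) q (f p * r)"
proof (intro ext)
  fix a b assume p: "p \<in> P"
  have "(\<Sum>l\<in>P. sh \<sigma> f a l * munit p q r l b) = (\<Sum>l\<in>P. if l = p then sh \<sigma> f a l * munit p q r l b else 0)"
    by (rule sum.cong) (auto simp: munit_def)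
  then show "(sh \<sigma> f \<otimes>\<^bsub>mat\<^esub> munit p q r) a b = munit (\<sigma> p) q (f p * r) a b"
    using p finite_P by (auto simp: munit_def shift_mat_def)
qed

lemma munit_add: "munit p q r \<oplus>\<^bsub>mat\<^esub> munit p q s = munit p q (r + s)"
  by (auto simp: munit_def fun_eq_iff)

lemma munit_smult: "c \<odot>\<^bsub>mat\<^esub> munit p q r = munit p q (scal c * r)"
  by (auto simp: munit_def fun_eq_iff)

lemma munit_mat: "M \<in> carrier mat \<Longrightarrow> p \<in> P \<Longrightarrow> munit q p r \<otimes>\<^bsub>mat\<^esub> M = (\<lambda>a b. if a = q then r * M p b else 0)"
proof (intro ext)
  fix a b assume p: "p \<in> P"
  have "(\<Sum>l\<in>P. munit q p r a l * M l b) = (\<Sum>l\<in>P. if l = p then munit q p r a l * M l b else 0)"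
    by (rule sum.cong) (auto simp: munit_def)
  then show "(munit q p r \<otimes>\<^bsub>mat\<^esub> M) a b = (if a = q then r * M p b else 0)"
    using p finite_P by (auto simp: munit_def)
qed

lemma mat_munit: "M \<in> carrier mat \<Longrightarrow> p \<in> P \<Longrightarrow> M \<otimes>\<^bsub>mat\<^esub> munit p q r = (\<lambda>a b. if b = q then M a p * r else 0)"
proof (intro ext)
  fix a b assume p: "p \<in> P"
  have "(\<Sum>l\<in>P. M a l * munit p q r l b) = (\<Sum>l\<in>P. if l = p then M a l * munit p q r l b else 0)"
    by (rule sum.cong) (auto simp: munit_def)
  then show "(M \<otimes>\<^bsub>mat\<^esub> munit p q r) a b = (if b = q then M a p * r else 0)"
    using p finite_P by (auto simp: munit_def)
qed

lemma mat_in_subalgebra: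
  assumes "k_subalgebra mat Y" "\<And>p q r. p \<in> P \<Longrightarrow> q \<in> P \<Longrightarrow> r \<in> W p q \<Longrightarrow> munit p q r \<in> Y" "M \<in> carrier mat"
  shows "M \<in> Y"
proof -
  have "0 \<odot>\<^bsub>mat\<^esub> \<one>\<^bsub>mat\<^esub> \<in> Y" using assms(1) unfolding k_subalgebra_def by blast
  then have zero: "\<zero>\<^bsub>mat\<^esub> \<in> Y" using M.scale_zero_left[OF M.one_closed] by metis
  have "(\<lambda>p q. if (p, q) \<in> S then M p q else 0) \<in> Y" if "finite S" "S \<subseteq> P \<times> P" for S
    using that
  proof (induction S rule: finite_induct)
    case empty
    then show ?case using zero by simp
  next
    case (insert s S)
    obtain p q where s: "s = (p, q)" "p \<in> P" "q \<in> P" using insert by auto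
    let ?N = "\<lambda>p q. if (p, q) \<in> S then M p q else 0"
    have "munit p q (M p q) \<oplus>\<^bsub>mat\<^esub> ?N \<in> Y"
      using assms(1) assms(2)[OF s(2,3)] insert assms(3) s
      unfolding k_subalgebra_def by (simp add: carrier_mat del: mat_simps)
    moreover have "munit p q (M p q) \<oplus>\<^bsub>mat\<^esub> ?N = (\<lambda>p q. if (p, q) \<in> insert s S then M p q else 0)"
      using insert(2) s by (auto simp: fun_eq_iff munit_def)
    ultimately show ?case by simp
  qed
  from this[of "P \<times> P"] have "(\<lambda>p q. if (p, q) \<in> P \<times> P then M p q else 0) \<in> Y" using finite_P by simp
  moreover have "(\<lambda>p q. if (p, q) \<in> P \<times> P then M p q else 0) = M"
    using assms(3) by (auto simp: fun_eq_iff carrier_mat)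
  ultimately show ?thesis by simp
qed

end

section \<open>Subalgebras that contain all matrix units\<close>

locale supermatrix_subalgebra = supermatrix P blk par
  for P :: "'p set" and blk :: "'p \<Rightarrow> nat" and par :: "'p \<Rightarrow> bool" +
  fixes Y :: "('p \<Rightarrow> 'p \<Rightarrow> 'k::field bidual) set"
  assumes Y: "k_subalgebra mat Y"
begin

lemma Y_closed: "A \<in> Y \<Longrightarrow> B \<in> Y \<Longrightarrow> A \<oplus>\<^bsub>mat\<^esub> B \<in> Y" "A \<in> Y \<Longrightarrow> B \<in> Y \<Longrightarrow> A \<otimes>\<^bsub>mat\<^esub> B \<in> Y"
  "A \<in> Y \<Longrightarrow> c \<odot>\<^bsub>mat\<^esub> A \<in> Y" "\<one>\<^bsub>mat\<^esub> \<in> Y"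
  using Y unfolding k_subalgebra_def by auto

lemma munit_Y:
  "q \<in> P \<Longrightarrow> munit p q r \<in> Y \<Longrightarrow> munit q s t \<in> Y \<Longrightarrow> munit p s (r * t) \<in> Y"
  "munit p q r \<in> Y \<Longrightarrow> munit p q r' \<in> Y \<Longrightarrow> munit p q (r + r') \<in> Y"
  "munit p q r \<in> Y \<Longrightarrow> munit p q (scal c * r) \<in> Y"
  "p \<in> P \<Longrightarrow> sh \<sigma> f \<in> Y \<Longrightarrow> munit p q r \<in> Y \<Longrightarrow> munit (\<sigma> p) q (f p * r) \<in> Y"
  using Y_closed(2)[of "munit p q r" "munit q s t"] munit_mult[of q p r q s t]
    Y_closed(1)[of "munit p q r" "munit p q r'"] munit_add[of p q r r']
    Y_closed(3)[of "munit p q r" c] munit_smult[of c p q r]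
    Y_closed(2)[of "sh \<sigma> f" "munit p q r"] sh_munit[of p \<sigma> f q r] by metis+

text \<open>
  Diagonal matrices with distinguishable constant terms separate the positions, up to a nilpotent
  error that is killed by squaring.
\<close>

lemma diagonal_munit:
  assumes p: "p \<in> P"
    and sep: "\<And>q. q \<in> P \<Longrightarrow> q \<noteq> p \<Longrightarrow> \<exists>d. sh (\<lambda>p. p) d \<in> Y \<and> (\<forall>a\<in>P. d a \<in> W a a) \<and> c1 (d p) \<noteq> c1 (d q)"
    and t: "sh (\<lambda>p. p) t \<in> Y" "t p \<in> W p p" "cxy (t p) \<noteq> 0"
    and r: "r \<in> W p p"
  shows "munit p p r \<in> Y"
proof -
  let ?D = "sh (\<lambda>p. p)"
  have Dm: "?D (\<lambda>a. f a * g a) \<in> Y" if "?D f \<in> Y" "?D g \<in> Y" for f g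
    using Y_closed(2)[OF that] by (simp only: sh_mult)
  have Dc: "?D (\<lambda>a. f a - scal c) \<in> Y" if "?D f \<in> Y" for f c
  proof -
    have "?D f \<oplus>\<^bsub>mat\<^esub> (- c) \<odot>\<^bsub>mat\<^esub> \<one>\<^bsub>mat\<^esub> \<in> Y" using that Y_closed by blast
    then show ?thesis by (simp only: sh_one sh_smult sh_add) (simp add: scal_simps)
  qed
  \<comment> \<open>Each \<open>q\<close> different from \<open>p\<close> contributes the square of
    \<open>d - c1 (d q)\<close>. At \<open>q\<close> the difference is a multiple of
    \<open>xy\<close>, so its square is 0; at \<open>p\<close> the constant term stays
    nonzero.\<close>
  have "\<exists>s. ?D s \<in> Y \<and> (\<forall>a\<in>P. s a \<in> W a a) \<and> (\<forall>q\<in>Q. s q = 0) \<and> c1 (s p) \<noteq> 0"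
    if "finite Q" "Q \<subseteq> P - {p}" for Q
    using that
  proof (induction Q rule: finite_induct)
    case empty
    then show ?case using Y_closed(4) unfolding sh_one by (intro exI[of _ "\<lambda>_. 1"]) auto
  next
    case (insert q Q)
    then obtain s where s: "?D s \<in> Y" "\<forall>a\<in>P. s a \<in> W a a" "\<forall>q\<in>Q. s q = 0" "c1 (s p) \<noteq> 0" by auto
    obtain d where d: "?D d \<in> Y" "\<forall>a\<in>P. d a \<in> W a a" "c1 (d p) \<noteq> c1 (d q)" using sep[of q] insert by auto
    let ?d = "\<lambda>a. d a - scal (c1 (d q))"
    let ?s = "\<lambda>a. s a * (?d a * ?d a)"
    have "?D ?s \<in> Y" by (intro Dm s(1) Dc d(1))
    moreover have "?s a \<in> W a a" if "a \<in> P" for a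
      using s(2) d(2) that by (intro entry_mult[where l = a] entry_minus) auto
    moreover have "?d q * ?d q = 0"
      using d(2) insert by (auto simp: bidual_eq_iff entry_def)
    then have "\<forall>a\<in>insert q Q. ?s a = 0" using s(3) by auto
    moreover have "c1 (?s p) \<noteq> 0" using s(4) d(3) by simp
    ultimately show ?case by (intro exI[of _ ?s] conjI) auto
  qed
  from this[of "P - {p}"] obtain s where s: "?D s \<in> Y" "\<forall>a\<in>P. s a \<in> W a a" "\<forall>q\<in>P - {p}. s q = 0" "c1 (s p) \<noteq> 0"
    using finite_P by auto
  have "?D s = munit p p (s p)"
    using s(3) p by (auto simp: fun_eq_iff shift_mat_def munit_def)
  then have sp: "munit p p (s p) \<in> Y" using s(1) by simp
  \<comment> \<open>This is \<open>xy\<close>. It is obtained from \<open>t\<close>: removing the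
    constant term of \<open>t p\<close> and multiplying by \<open>s p\<close> leaves a nonzero
    multiple of it.\<close>
  define n where "n = Bidual 0 0 0 (1::'k)"
  have "munit p p ((t p - scal (c1 (t p))) * s p) \<in> Y"
    using munit_Y(4)[OF p Dc[OF t(1), of "c1 (t p)"] sp] by simp
  moreover have "(t p - scal (c1 (t p))) * s p = scal (cxy (t p) * c1 (s p)) * n"
    using t(2) s(2) p by (auto simp: bidual_eq_iff entry_def n_def)
  ultimately have "munit p p (scal (inverse (cxy (t p) * c1 (s p))) * (scal (cxy (t p) * c1 (s p)) * n)) \<in> Y"
    using munit_Y(3) by metis
  moreover have "scal (inverse (cxy (t p) * c1 (s p))) * (scal (cxy (t p) * c1 (s p)) * n) = n"
    using t(3) s(4) by (simp add: bidual_eq_iff n_def field_simps)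
  ultimately have n: "munit p p n \<in> Y" by simp
  \<comment> \<open>Since \<open>c1 (s p)\<close> is nonzero, \<open>s p\<close> and
    \<open>n\<close> together span the two-dimensional space of diagonal entries.\<close>
  let ?c = "inverse (c1 (s p))"
  have "munit p p (scal (c1 r * ?c) * s p + scal (cxy r - c1 r * ?c * cxy (s p)) * n) \<in> Y"
    by (intro munit_Y(2,3) sp n)
  moreover have "scal (c1 r * ?c) * s p + scal (cxy r - c1 r * ?c * cxy (s p)) * n = r"
    using s(2,4) r p by (auto simp: bidual_eq_iff entry_def n_def)
  ultimately show ?thesis by simp
qed

text \<open>Inside a block, an entry between positions of equal parity is a diagonal entry times a
  unit entry, and any other entry is a combination of \<open>x\<close> and \<open>y\<close>.\<close>

lemma all_munits:
  assumes "\<And>p r. p \<in> P \<Longrightarrow> r \<in> W p p \<Longrightarrow> munit p p r \<in> Y"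
    and same: "\<And>p q. p \<in> P \<Longrightarrow> q \<in> P \<Longrightarrow> blk p = blk q \<Longrightarrow> par p = par q \<Longrightarrow> munit p q 1 \<in> Y"
    and diff: "\<And>p q. p \<in> P \<Longrightarrow> q \<in> P \<Longrightarrow> blk p = blk q \<Longrightarrow> par p \<noteq> par q \<Longrightarrow> munit p q dx \<in> Y \<and> munit p q dy \<in> Y"
  shows "carrier mat \<subseteq> Y"
proof
  fix M :: "'p \<Rightarrow> 'p \<Rightarrow> 'k bidual" assume M: "M \<in> carrier mat"
  show "M \<in> Y"
  proof (rule mat_in_subalgebra[OF Y _ M])
    fix p q and r :: "'k bidual" assume pq: "p \<in> P" "q \<in> P" and r: "r \<in> W p q"
    show "munit p q r \<in> Y"
    proof (cases "blk p = blk q")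
      case b: True
      show ?thesis
      proof (cases "par p = par q")
        case True
        have "entry blk par p q = (entry blk par p p :: 'k bidual set)" by (rule entry_cong) (use b True in auto)
        then have "r \<in> W p p" using r by blast
        then have "munit p q (r * 1) \<in> Y" using munit_Y(1)[OF pq(1) assms(1)[OF pq(1)] same[OF pq b True]] by blast
        then show ?thesis by simp
      next
        case False
        then have "munit p q (scal (cx r) * dx + scal (cy r) * dy) \<in> Y"
          using diff[OF pq b] by (intro munit_Y(2,3)) auto
        moreover have "scal (cx r) * dx + scal (cy r) * dy = r"
          using r b False by (auto simp: entry_def bidual_eq_iff)
        ultimately show ?thesis by simp
      qed
    next
      case False
      then have "r = 0" using r by (simp add: entry_def)
      then have "munit p q r = 0 \<odot>\<^bsub>mat\<^esub> \<one>\<^bsub>mat\<^esub>" by (auto simp: munit_def fun_eq_iff scal_simps)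
      then show ?thesis using Y_closed(3)[OF Y_closed(4)] by metis
    qed
  qed
qed

end

section \<open>Coordinates and dimension of the block algebra\<close>

context supermatrix
begin

definition coord_set :: "('p \<times> 'p \<times> bool) set" where
  "coord_set = {(p, q, t). p \<in> P \<and> q \<in> P \<and> blk p = blk q}"

text \<open>Each entry inside a block has two coordinates, selected by the Boolean: those of
  \<open>1\<close> and \<open>xy\<close> for equal parity, those of \<open>x\<close> and
  \<open>y\<close> otherwise.\<close>

definition coord_val :: "('p \<Rightarrow> 'p \<Rightarrow> 'k::field bidual) \<Rightarrow> 'p \<times> 'p \<times> bool \<Rightarrow> 'k" where
  "coord_val M = (\<lambda>(p, q, t). if par p = par q then (if t then cxy (M p q) else c1 (M p q))
     else (if t then cy (M p q) else cx (M p q)))"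

definition coords :: "('p \<Rightarrow> 'p \<Rightarrow> 'k::field bidual) \<Rightarrow> ('p \<times> 'p \<times> bool) \<Rightarrow>\<^sub>0 'k" where
  "coords M = (\<Sum>d\<in>coord_set. Poly_Mapping.single d (coord_val M d))"

lemma finite_coord_set: "finite coord_set"
  by (rule finite_subset[of _ "P \<times> P \<times> UNIV"]) (auto simp: coord_set_def finite_P)

lemma lookup_coords: "Poly_Mapping.lookup (coords M) d = (if d \<in> coord_set then coord_val M d else 0)"
  using finite_coord_set by (simp add: coords_def lookup_sum lookup_single when_def)

lemma coords_add: "coords (M \<oplus>\<^bsub>mat\<^esub> N) = coords M + coords N"
  by (rule poly_mapping_eqI) (auto simp: lookup_coords lookup_add coord_val_def split: prod.splits)

lemma coords_smult: "coords (c \<odot>\<^bsub>mat\<^esub> M) = Poly_Mapping.map ((*) c) (coords M)"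
  by (rule poly_mapping_eqI) (auto simp: lookup_coords coord_val_def split: prod.splits)

lemma coords_surj:
  assumes "d \<in> coord_set" shows "\<exists>M\<in>carrier mat. coords M = Poly_Mapping.single d (1::'k::field)"
proof -
  obtain p q t where d: "d = (p, q, t)" by (cases d)
  let ?r = "if par p = par q then (if t then Bidual 0 0 0 1 else 1) else (if t then dy else dx) :: 'k bidual"
  have "?r \<in> W p q" using assms by (auto simp: d coord_set_def entry_def)
  then have "munit p q ?r \<in> carrier mat" using assms by (intro munit_mem) (auto simp: d coord_set_def)
  moreover have "coords (munit p q ?r) = Poly_Mapping.single d 1"
    using assms
    by (cases t; intro poly_mapping_eqI; auto simp: lookup_coords coord_val_def d munit_def lookup_single when_def
        coord_set_def split: prod.splits)
  ultimately show ?thesis by blast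
qed

lemma surj_imp_alg_iso:
  fixes A :: "('k::field, 'a, 'r) module_scheme"
  assumes "k_algebra A" "f \<in> alg_hom A mat" "carrier mat \<subseteq> f ` carrier A"
    "finite X" "X \<subseteq> carrier A" "carrier A \<subseteq> k_span A X" "card X \<le> card coord_set"
  shows "f \<in> alg_iso A mat"
proof -
  interpret A: k_algebra A by fact
  note f = alg_hom_closed[OF assms(2)] alg_hom_add[OF assms(2)] alg_hom_smult[OF assms(2)]
  have ker: "x = \<zero>\<^bsub>A\<^esub>" if "x \<in> carrier A" "f x = \<zero>\<^bsub>mat\<^esub>" for x
  proof (rule dimension_count[OF A.k_space_axioms assms(4-6) _ _ finite_coord_set _ assms(7) that(1)])
    show "coords (f x) = 0"
      using that(2) by (intro poly_mapping_eqI) (auto simp: lookup_coords coord_val_def split: prod.splits)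
    show "coords (f (x \<oplus>\<^bsub>A\<^esub> y)) = coords (f x) + coords (f y)" if "x \<in> carrier A" "y \<in> carrier A" for x y
      using that by (simp only: f coords_add)
    show "coords (f (c \<odot>\<^bsub>A\<^esub> x)) = Poly_Mapping.map ((*) c) (coords (f x))" if "x \<in> carrier A" for c x
      using that by (simp only: f coords_smult)
    show "\<exists>x\<in>carrier A. coords (f x) = Poly_Mapping.single d 1" if "d \<in> coord_set" for d
      using coords_surj[OF that] assms(3) by (metis imageE subsetD)
  qed
  have "inj_on f (carrier A)"
  proof (rule inj_onI)
    fix x y assume xy: "x \<in> carrier A" "y \<in> carrier A" "f x = f y"
    have "f (x \<oplus>\<^bsub>A\<^esub> (- 1) \<odot>\<^bsub>A\<^esub> y) = f x \<oplus>\<^bsub>mat\<^esub> (- 1) \<odot>\<^bsub>mat\<^esub> f y"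
      using xy(1,2) by (simp only: f(2)[OF xy(1) A.scale_closed[OF xy(2)]] f(3)[OF xy(2)])
    also have "\<dots> = \<zero>\<^bsub>mat\<^esub>" unfolding xy(3) by (rule M.add_scale_minus_one[OF f(1)[OF xy(2)]])
    finally have "x \<oplus>\<^bsub>A\<^esub> (- 1) \<odot>\<^bsub>A\<^esub> y = \<zero>\<^bsub>A\<^esub>" using ker xy(1,2) by simp
    then have "x \<oplus>\<^bsub>A\<^esub> (\<ominus>\<^bsub>A\<^esub> y) = \<zero>\<^bsub>A\<^esub>" using xy by (simp add: A.scale_minus_one)
    then show "x = y" using A.minus_equality[of x "\<ominus>\<^bsub>A\<^esub> y"] xy by simp
  qed
  then show ?thesis using assms(2,3) f(1) by (auto simp: alg_iso_def bij_betw_def)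
qed

end

section \<open>Transport of basic idempotents along an isomorphism\<close>

lemma lin_map_finsum:
  assumes "k_space V" "k_space W" "lin_map V W f" "finite I" "\<And>i. i \<in> I \<Longrightarrow> x i \<in> carrier V"
  shows "f (\<Oplus>\<^bsub>V\<^esub>i\<in>I. x i) = (\<Oplus>\<^bsub>W\<^esub>i\<in>I. f (x i))"
proof -
  interpret V: k_space V by fact
  interpret W: k_space W by fact
  from assms(4,5) show ?thesis
  proof (induction I rule: finite_induct)
    case empty
    then show ?case by (simp add: lin_map_zero[OF assms(1-3)])
  next
    case (insert i I)
    have "(\<Oplus>\<^bsub>V\<^esub>i\<in>I. x i) \<in> carrier V" using insert by (intro V.M.finsum_closed) auto
    then show ?case using insert
      by (simp add: Pi_iff lin_map_add[OF assms(3)] lin_map_closed[OF assms(3)])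
  qed
qed

text \<open>The idempotents are easy to study among matrices, whereas
  \<open>is_basic_algebra\<close> speaks about modules over \<open>A\<close> itself. So the whole
  package of idempotents and filtration is moved to \<open>A\<close>, and the resulting corner is
  moved back.\<close>

lemma basic_algebra_corner_iso:
  fixes M :: "('k::field, 'm, 'r) module_scheme" and A :: "('k, 'a, 's) module_scheme" and B :: "('k, 'b, 't) module_scheme"
  assumes "basic_idempotents M I e J L" "k_algebra A" "s \<in> alg_iso M A" "is_basic_algebra A B"
  shows "alg_iso (corner_alg M (\<Oplus>\<^bsub>M\<^esub>i\<in>I. e i)) B \<noteq> {}"
proof -
  interpret M: basic_idempotents M I e J L by fact
  interpret A: k_algebra A by fact
  let ?t = "inv_into (carrier M) s"
  have s: "s \<in> alg_hom M A" and bij: "bij_betw s (carrier M) (carrier A)" using assms(3) by (auto simp: alg_iso_def)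
  have t: "?t \<in> alg_hom A M" using alg_iso_inv[OF M.k_algebra_axioms assms(3)] by (auto simp: alg_iso_def)
  note ss = alg_hom_closed[OF s] alg_hom_add[OF s] alg_hom_mult[OF s] alg_hom_smult[OF s] alg_hom_one[OF s]
    lin_map_zero[OF M.k_space_axioms A.k_space_axioms alg_hom_lin[OF s]]
  note ts = alg_hom_closed[OF t] alg_hom_add[OF t] alg_hom_mult[OF t]
    lin_map_zero[OF A.k_space_axioms M.k_space_axioms alg_hom_lin[OF t]]
  have st: "s (?t y) = y" if "y \<in> carrier A" for y using bij that by (simp add: bij_betw_def f_inv_into_f)
  have tts: "?t (s x) = x" if "x \<in> carrier M" for x using bij that by (simp add: bij_betw_def inv_into_f_f)
  have inj: "s x = s y \<longleftrightarrow> x = y" if "x \<in> carrier M" "y \<in> carrier M" for x y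
    using bij that by (auto simp: bij_betw_def dest: inj_onD)
  have ex: "\<exists>y\<in>carrier M. x = s y" if "x \<in> carrier A" for x using st[OF that] ts(1)[OF that] by metis
  note e = M.e_carrier
  have Jc: "x \<in> J k \<Longrightarrow> x \<in> carrier M" for x k using M.J_carrier by blast
  interpret A: basic_idempotents A I "\<lambda>i. s (e i)" "\<lambda>k. s ` J k" L
  proof
    show "s (e i) \<noteq> \<zero>\<^bsub>A\<^esub>" if "i \<in> I" for i
      using inj[of "e i" "\<zero>\<^bsub>M\<^esub>"] M.e_nonzero[OF that] e[OF that] by (simp add: ss)
    show "s (e i) \<otimes>\<^bsub>A\<^esub> s (e i) = s (e i)" if "i \<in> I" for i
      using M.e_idem[OF that] e[OF that] by (simp add: ss(3)[symmetric])
    show "s (e i) \<otimes>\<^bsub>A\<^esub> s (e j) = \<zero>\<^bsub>A\<^esub>" if "i \<in> I" "j \<in> I" "i \<noteq> j" for i j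
      using M.e_orth[OF that] e that by (simp add: ss(3)[symmetric] ss(6))
    show "u = \<zero>\<^bsub>A\<^esub> \<or> u = s (e i)"
      if i: "i \<in> I" and u: "u \<in> carrier A" "u \<otimes>\<^bsub>A\<^esub> u = u" "s (e i) \<otimes>\<^bsub>A\<^esub> u = u" "u \<otimes>\<^bsub>A\<^esub> s (e i) = u" for i u
    proof -
      obtain v where v: "v \<in> carrier M" "u = s v" using ex u(1) by blast
      then have "v \<otimes>\<^bsub>M\<^esub> v = v" "e i \<otimes>\<^bsub>M\<^esub> v = v" "v \<otimes>\<^bsub>M\<^esub> e i = v"
        using u(2-4) e[OF i] inj[of "v \<otimes>\<^bsub>M\<^esub> v" v] inj[of "e i \<otimes>\<^bsub>M\<^esub> v" v] inj[of "v \<otimes>\<^bsub>M\<^esub> e i" v]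
        by (simp_all add: ss(3))
      then show ?thesis using M.e_local[OF i v(1)] v(2) ss(6) by auto
    qed
    show "i = j" if i: "i \<in> I" "j \<in> I" and ab: "a \<in> carrier A" "b \<in> carrier A" "a \<otimes>\<^bsub>A\<^esub> s (e j) = a"
      "s (e j) \<otimes>\<^bsub>A\<^esub> b = b" "a \<otimes>\<^bsub>A\<^esub> b = s (e i)" for i j a b
    proof -
      obtain a' b' where v: "a' \<in> carrier M" "a = s a'" "b' \<in> carrier M" "b = s b'" using ex ab(1,2) by blast
      then have "a' \<otimes>\<^bsub>M\<^esub> e j = a'" "e j \<otimes>\<^bsub>M\<^esub> b' = b'" "a' \<otimes>\<^bsub>M\<^esub> b' = e i"
        using ab(3-5) e[OF i(1)] e[OF i(2)] inj[of "a' \<otimes>\<^bsub>M\<^esub> e j" a'] inj[of "e j \<otimes>\<^bsub>M\<^esub> b'" b'] inj[of "a' \<otimes>\<^bsub>M\<^esub> b'" "e i"]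
        by (simp_all add: ss(3))
      then show ?thesis using M.e_noniso[OF i v(1,3)] by blast
    qed
    show "a \<oplus>\<^bsub>A\<^esub> b \<in> s ` J k" if "a \<in> s ` J k" "b \<in> s ` J k" for a b k
      using that M.J_add Jc by (auto simp: ss(2)[symmetric])
    show "a \<otimes>\<^bsub>A\<^esub> b \<in> s ` J (Suc k)" if "a \<in> s ` J 1" "b \<in> s ` J k" for a b k
    proof -
      from that(1) obtain a' where a': "a = s a'" "a' \<in> J 1" by (rule imageE)
      from that(2) obtain b' where b': "b = s b'" "b' \<in> J k" by (rule imageE)
      from a' b' show ?thesis using M.J_mult[of a' b' k] Jc by (auto simp: ss(3)[symmetric])
    qed
    show "\<exists>i\<in>I. \<exists>c\<in>carrier A. \<exists>d\<in>carrier A. s (e i) \<otimes>\<^bsub>A\<^esub> c \<otimes>\<^bsub>A\<^esub> a \<otimes>\<^bsub>A\<^esub> d \<otimes>\<^bsub>A\<^esub> s (e i) = s (e i)"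
      if a: "a \<in> carrier A" "a \<notin> s ` J 1" for a
    proof -
      obtain a' where v: "a' \<in> carrier M" "a = s a'" using ex a(1) by blast
      then obtain i c d where "i \<in> I" "c \<in> carrier M" "d \<in> carrier M" "e i \<otimes>\<^bsub>M\<^esub> c \<otimes>\<^bsub>M\<^esub> a' \<otimes>\<^bsub>M\<^esub> d \<otimes>\<^bsub>M\<^esub> e i = e i"
        using M.J_detect[OF v(1)] a(2) by blast
      then show ?thesis using v e
        by (intro bexI[of _ i] bexI[of _ "s c"] bexI[of _ "s d"]) (simp_all add: ss(1) ss(3)[symmetric])
    qed
  qed (use M.finite_I e M.J_carrier M.J_zero M.J_nilpotent in
      \<open>auto simp: ss(1,6) Jc intro!: image_eqI[of "\<zero>\<^bsub>A\<^esub>" s "\<zero>\<^bsub>M\<^esub>"]\<close>)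
  let ?E = "\<Oplus>\<^bsub>M\<^esub>i\<in>I. e i"
  have Ec: "?E \<in> carrier M" using e by (intro M.finsum_closed) auto
  have E: "A.E = s ?E"
    unfolding A.E_def
    by (rule lin_map_finsum[symmetric, OF M.k_space_axioms A.k_space_axioms alg_hom_lin[OF s] M.finite_I e])
  have "s \<in> alg_iso (corner_alg M ?E) (corner_alg A (s ?E))"
    unfolding alg_iso_def
  proof (intro CollectI conjI bij_betw_imageI)
    show "s \<in> alg_hom (corner_alg M ?E) (corner_alg A (s ?E))"
    proof (rule alg_homI)
      show "s x \<in> carrier (corner_alg A (s ?E))" if "x \<in> carrier (corner_alg M ?E)" for x
        using that Ec by (simp add: ss(1) ss(3)[symmetric])
    qed (use Ec in \<open>auto simp: ss\<close>)
    show "inj_on s (carrier (corner_alg M ?E))" by (rule inj_onI) (simp add: inj)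
    show "s ` carrier (corner_alg M ?E) = carrier (corner_alg A (s ?E))"
    proof
      show "carrier (corner_alg A (s ?E)) \<subseteq> s ` carrier (corner_alg M ?E)"
      proof
        fix y assume "y \<in> carrier (corner_alg A (s ?E))"
        then have y: "y \<in> carrier A" "s ?E \<otimes>\<^bsub>A\<^esub> y = y" "y \<otimes>\<^bsub>A\<^esub> s ?E = y" by auto
        obtain x where x: "x \<in> carrier M" "y = s x" using ex y(1) by blast
        then have "?E \<otimes>\<^bsub>M\<^esub> x = x" "x \<otimes>\<^bsub>M\<^esub> ?E = x"
          using y(2,3) Ec inj[of "?E \<otimes>\<^bsub>M\<^esub> x" x] inj[of "x \<otimes>\<^bsub>M\<^esub> ?E" x] by (simp_all add: ss(3))
        then show "y \<in> s ` carrier (corner_alg M ?E)" using x by (intro image_eqI[of _ _ x]) auto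
      qed
    qed (use Ec in \<open>auto simp: ss(1) ss(3)[symmetric]\<close>)
  qed
  then show ?thesis
    using A.basic_algebra_corner[OF assms(4)] alg_iso_comp unfolding E by blast
qed

text \<open>Membership in the \<open>k\<close>-th power of the maximal ideal \<open>(x, y)\<close>,
  whose third power is zero.\<close>

definition ord_ge :: "nat \<Rightarrow> 'k::comm_ring_1 bidual \<Rightarrow> bool" where
  "ord_ge k r \<longleftrightarrow> (k \<ge> 1 \<longrightarrow> c1 r = 0) \<and> (k \<ge> 2 \<longrightarrow> cx r = 0 \<and> cy r = 0) \<and> (k \<ge> 3 \<longrightarrow> cxy r = 0)"

lemma ord_ge_zero [simp]: "ord_ge k 0"
  by (simp add: ord_ge_def)

lemma ord_ge_add: "ord_ge k r \<Longrightarrow> ord_ge k s \<Longrightarrow> ord_ge k (r + s)"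
  by (auto simp: ord_ge_def)

lemma ord_ge_mult: "ord_ge 1 r \<Longrightarrow> ord_ge k s \<Longrightarrow> ord_ge (Suc k) (r * s)"
  by (auto simp: ord_ge_def)

lemma ord_ge_sum: "(\<And>i. i \<in> S \<Longrightarrow> ord_ge k (f i)) \<Longrightarrow> ord_ge k (\<Sum>i\<in>S. f i)"
  by (induction S rule: infinite_finite_induct) (auto intro: ord_ge_add)

locale supermatrix_reps = supermatrix P blk par for P :: "'p set" and blk par +
  fixes I :: "'p set"
  assumes I_P: "I \<subseteq> P"
    and rep_ex: "p \<in> P \<Longrightarrow> \<exists>i\<in>I. blk i = blk p \<and> par i = par p"
    and rep_unique: "i \<in> I \<Longrightarrow> j \<in> I \<Longrightarrow> blk i = blk j \<Longrightarrow> par i = par j \<Longrightarrow> i = j"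
begin

definition mat_ord :: "nat \<Rightarrow> ('p \<Rightarrow> 'p \<Rightarrow> 'k::field bidual) set" where
  "mat_ord k = {M \<in> carrier mat. \<forall>p q. ord_ge k (M p q)}"

lemma finite_I: "finite I"
  using I_P finite_P finite_subset by blast

text \<open>Only constant terms matter. They occur only between positions of the same block and
  parity, so distinct representatives cannot be linked by an invertible entry, while any matrix with
  a nonzero constant term can be compressed to the representative of its position. The corner at one
  position is spanned by \<open>1\<close> and \<open>xy\<close>, which is local.\<close>

lemma basic_idempotents_mat:
  "basic_idempotents (mat :: ('k::field, _) module) I (\<lambda>i. munit i i 1) mat_ord 2"
proof -
  let ?M = "mat :: ('k, _) module"
  have IP: "i \<in> I \<Longrightarrow> i \<in> P" for i using I_P by blast
  have mem: "munit i i 1 \<in> carrier ?M" if "i \<in> I" for i using that IP by (intro munit_mem) auto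
  show ?thesis
  proof (intro basic_idempotents.intro k_algebra_mat basic_idempotents_axioms.intro)
    show "munit i i 1 \<noteq> \<zero>\<^bsub>?M\<^esub>" if "i \<in> I" for i
      by (auto simp: munit_def fun_eq_iff intro!: exI[of _ i])
    show "munit i i 1 \<otimes>\<^bsub>?M\<^esub> munit i i 1 = munit i i 1" if "i \<in> I" for i
      using munit_mult[OF IP[OF that], of i 1 i i 1] by (simp del: mat_simps)
    show "munit i i 1 \<otimes>\<^bsub>?M\<^esub> munit j j 1 = \<zero>\<^bsub>?M\<^esub>" if "i \<in> I" "j \<in> I" "i \<noteq> j" for i j
      using munit_mult[OF IP[OF that(1)], of i 1 j j 1] that by (simp del: mat_simps)
    show "u = \<zero>\<^bsub>?M\<^esub> \<or> u = munit i i 1"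
      if i: "i \<in> I" and u: "u \<in> carrier ?M" "u \<otimes>\<^bsub>?M\<^esub> u = u" "munit i i 1 \<otimes>\<^bsub>?M\<^esub> u = u" "u \<otimes>\<^bsub>?M\<^esub> munit i i 1 = u" for i u
    proof -
      have "u a b = 0" if "a \<noteq> i \<or> b \<noteq> i" for a b
        using fun_cong[OF fun_cong[OF u(3), of a], of b] fun_cong[OF fun_cong[OF u(4), of a], of b] that
        unfolding munit_mat[OF u(1) IP[OF i]] mat_munit[OF u(1) IP[OF i]] by (auto split: if_splits)
      then have eq: "u = munit i i (u i i)" by (auto simp: munit_def fun_eq_iff)
      let ?r = "u i i"
      have "munit i i (?r * ?r) = munit i i ?r"
        using u(2) munit_mult[OF IP[OF i], of i ?r i i ?r] eq by (metis (full_types))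
      then have rr: "?r * ?r = ?r" by (metis munit_def)
      have "?r \<in> W i i" using u(1) IP[OF i] carrier_mat by blast
      then have c: "cx ?r = 0" "cy ?r = 0" by (auto simp: entry_def)
      have "c1 ?r * c1 ?r = c1 ?r" "c1 ?r * cxy ?r + cxy ?r * c1 ?r = cxy ?r"
        using rr c by (auto simp: bidual_eq_iff)
      then have "c1 ?r = 0 \<and> cxy ?r = 0 \<or> c1 ?r = 1 \<and> cxy ?r + cxy ?r = cxy ?r" by auto
      then have "c1 ?r = 0 \<and> cxy ?r = 0 \<or> c1 ?r = 1 \<and> cxy ?r = 0" by (simp only: add_cancel_left_right)
      then have "?r = 0 \<or> ?r = 1" using c by (auto simp: bidual_eq_iff)
      moreover have "munit i i 0 = \<zero>\<^bsub>?M\<^esub>" by (auto simp: munit_def fun_eq_iff)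
      ultimately show ?thesis using eq by metis
    qed
    show "i = j" if i: "i \<in> I" "j \<in> I" and ab: "a \<in> carrier ?M" "b \<in> carrier ?M" "a \<otimes>\<^bsub>?M\<^esub> munit j j 1 = a"
      "munit j j 1 \<otimes>\<^bsub>?M\<^esub> b = b" "a \<otimes>\<^bsub>?M\<^esub> b = munit i i 1" for i j a b
    proof (rule ccontr)
      assume ij: "i \<noteq> j"
      note j = IP[OF i(2)]
      have "a \<otimes>\<^bsub>?M\<^esub> b = (\<lambda>p q. a p j * b j q)"
      proof (intro ext)
        fix p q
        have az: "a p l = 0" if "l \<noteq> j" for l
          using fun_cong[OF fun_cong[OF ab(3), of p], of l] that unfolding mat_munit[OF ab(1) j] by simp
        have "(\<Sum>l\<in>P. a p l * b l q) = (\<Sum>l\<in>P. if l = j then a p l * b l q else 0)"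
          by (rule sum.cong) (auto simp: az)
        then show "(a \<otimes>\<^bsub>?M\<^esub> b) p q = a p j * b j q" using finite_P j by simp
      qed
      then have one: "a i j * b j i = 1" using ab(5) by (metis munit_def)
      \<comment> \<open>Distinct representatives differ in block or parity, so the entry between
        them has no constant term and cannot divide 1.\<close>
      have "c1 (a i j) = 0"
      proof -
        have "a i j \<in> W i j" using ab(1) IP[OF i(1)] j carrier_mat by blast
        then show ?thesis using rep_unique[OF i] ij by (auto simp: entry_def split: if_splits)
      qed
      then have "c1 (a i j * b j i) = 0" by simp
      then show False unfolding one by simp
    qed
    show "a \<oplus>\<^bsub>?M\<^esub> b \<in> mat_ord k" if "a \<in> mat_ord k" "b \<in> mat_ord k" for a b k
    proof -
      have "a \<oplus>\<^bsub>?M\<^esub> b \<in> carrier ?M" using that by (auto simp: mat_ord_def simp del: mat_simps)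
      then show ?thesis using that by (auto simp: mat_ord_def intro: ord_ge_add)
    qed
    show "a \<otimes>\<^bsub>?M\<^esub> b \<in> mat_ord (Suc k)" if "a \<in> mat_ord 1" "b \<in> mat_ord k" for a b k
    proof -
      have "a \<otimes>\<^bsub>?M\<^esub> b \<in> carrier ?M" using that by (auto simp: mat_ord_def simp del: mat_simps)
      moreover have "ord_ge (Suc k) (\<Sum>l\<in>P. a p l * b l q)" for p q
        by (rule ord_ge_sum, rule ord_ge_mult) (use that in \<open>auto simp: mat_ord_def\<close>)
      ultimately show ?thesis by (simp add: mat_ord_def)
    qed
    show "mat_ord (Suc 2) = {\<zero>\<^bsub>?M\<^esub>}"
      by (auto simp: mat_ord_def ord_ge_def carrier_mat bidual_eq_iff fun_eq_iff)
    show "\<exists>i\<in>I. \<exists>c\<in>carrier ?M. \<exists>d\<in>carrier ?M. munit i i 1 \<otimes>\<^bsub>?M\<^esub> c \<otimes>\<^bsub>?M\<^esub> a \<otimes>\<^bsub>?M\<^esub> d \<otimes>\<^bsub>?M\<^esub> munit i i 1 = munit i i 1"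
      if a: "a \<in> carrier ?M" "a \<notin> mat_ord 1" for a
    proof -
      obtain p q where pq: "c1 (a p q) \<noteq> 0" using a by (auto simp: mat_ord_def ord_ge_def)
      then have "a p q \<noteq> 0" by auto
      then have P: "p \<in> P" "q \<in> P" using a(1) carrier_mat by blast+
      then have "a p q \<in> W p q" using a(1) carrier_mat by blast
      then have e: "blk p = blk q" "par p = par q" "cx (a p q) = 0" "cy (a p q) = 0"
        using pq by (auto simp: entry_def split: if_splits)
      obtain i where i: "i \<in> I" "blk i = blk p" "par i = par p" using rep_ex[OF P(1)] by blast
      \<comment> \<open>The inverse of \<open>c + d xy\<close> is
        \<open>c^(-1) - d c^(-2) xy\<close>.\<close>
      let ?r = "Bidual (inverse (c1 (a p q))) 0 0 (- cxy (a p q) * inverse (c1 (a p q)) ^ 2)"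
      have r: "a p q * ?r = 1" using e pq by (auto simp: bidual_eq_iff power2_eq_square)
      let ?c = "munit i p 1 :: 'p \<Rightarrow> 'p \<Rightarrow> 'k bidual" and ?d = "munit q i ?r"
      have c: "?c \<in> carrier ?M" by (rule munit_mem) (use i IP P in \<open>auto simp: entry_def\<close>)
      have d: "?d \<in> carrier ?M" by (rule munit_mem) (use i IP P e in \<open>auto simp: entry_def\<close>)
      note iP = IP[OF i(1)]
      have 1: "munit i i 1 \<otimes>\<^bsub>?M\<^esub> ?c = munit i p 1"
        using munit_mult[OF iP, of i 1 i p 1] by (simp del: mat_simps)
      have 2: "?d \<otimes>\<^bsub>?M\<^esub> munit i i 1 = munit q i ?r"
        using munit_mult[OF iP, of q ?r i i 1] by (simp del: mat_simps)
      have 3: "munit i p 1 \<otimes>\<^bsub>?M\<^esub> a = (\<lambda>s t. if s = i then a p t else 0)"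
        unfolding munit_mat[OF a(1) P(1)] by (simp add: fun_eq_iff)
      have "munit i i 1 \<otimes>\<^bsub>?M\<^esub> ?c \<otimes>\<^bsub>?M\<^esub> a \<otimes>\<^bsub>?M\<^esub> ?d \<otimes>\<^bsub>?M\<^esub> munit i i 1 = munit i p 1 \<otimes>\<^bsub>?M\<^esub> a \<otimes>\<^bsub>?M\<^esub> munit q i ?r"
        using M.m_assoc[of "munit i i 1 \<otimes>\<^bsub>?M\<^esub> ?c \<otimes>\<^bsub>?M\<^esub> a" ?d "munit i i 1"] mem[OF i(1)] c d a(1)
        by (simp only: 1 2 M.m_closed)
      also have "\<dots> = (\<lambda>s t. if t = i then (munit i p 1 \<otimes>\<^bsub>?M\<^esub> a) s q * ?r else 0)"
        by (rule mat_munit[OF M.m_closed[OF c a(1)] P(2)])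
      also have "\<dots> = munit i i 1" unfolding 3 using r by (auto simp: fun_eq_iff munit_def)
      finally show ?thesis using i(1) c d by blast
    qed
  qed (use finite_I mem in \<open>auto simp: mat_ord_def carrier_mat\<close>)
qed

lemma rep_idempotent:
  "(\<Oplus>\<^bsub>mat :: ('k::field, _) module\<^esub>i\<in>I. munit i i 1) = (\<lambda>p q. if p = q \<and> p \<in> I then 1 else 0)"
proof -
  let ?M = "mat :: ('k, _) module"
  have "(\<Oplus>\<^bsub>?M\<^esub>i\<in>S. munit i i 1) = (\<lambda>p q. if p = q \<and> p \<in> S then 1 else 0)" if "finite S" "S \<subseteq> P" for S
    using that
  proof (induction S rule: finite_induct)
    case (insert i S)
    have "(\<Oplus>\<^bsub>?M\<^esub>i\<in>insert i S. munit i i 1) = munit i i 1 \<oplus>\<^bsub>?M\<^esub> (\<Oplus>\<^bsub>?M\<^esub>i\<in>S. munit i i 1)"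
      using insert by (intro M.finsum_insert) (auto intro!: munit_mem simp del: mat_simps)
    also have "\<dots> = munit i i 1 \<oplus>\<^bsub>?M\<^esub> (\<lambda>p q. if p = q \<and> p \<in> S then 1 else 0)"
      using insert by (simp only: insert_subset)
    also have "\<dots> = (\<lambda>p q. if p = q \<and> p \<in> insert i S then 1 else 0)"
      using insert(2) by (auto simp: fun_eq_iff munit_def)
    finally show ?case .
  qed simp
  then show ?thesis using finite_I I_P by blast
qed

lemma corner_mat:
  "(\<lambda>M. M) \<in> alg_iso (mat_alg I blk par :: ('k::field, _) module)
     (corner_alg (mat :: ('k, _) module) (\<lambda>p q. if p = q \<and> p \<in> I then 1 else 0))"
proof -
  let ?M = "mat :: ('k, _) module" and ?N = "mat_alg I blk par :: ('k, _) module"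
  let ?E = "\<lambda>p q. if p = q \<and> p \<in> I then 1 else 0 :: 'k bidual"
  interpret N: supermatrix I blk par by unfold_locales (rule finite_I)
  have EM: "?E \<otimes>\<^bsub>?M\<^esub> M = (\<lambda>p q. if p \<in> I then M p q else 0)" for M
  proof (intro ext)
    fix p q
    have "(\<Sum>l\<in>P. ?E p l * M l q) = (\<Sum>l\<in>P. if l = p then (if p \<in> I then M p q else 0) else 0)"
      by (rule sum.cong) auto
    then show "(?E \<otimes>\<^bsub>?M\<^esub> M) p q = (if p \<in> I then M p q else 0)" using finite_P I_P by auto
  qed
  have ME: "M \<otimes>\<^bsub>?M\<^esub> ?E = (\<lambda>p q. if q \<in> I then M p q else 0)" for M
  proof (intro ext)
    fix p q
    have "(\<Sum>l\<in>P. M p l * ?E l q) = (\<Sum>l\<in>P. if l = q then (if q \<in> I then M p q else 0) else 0)"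
      by (rule sum.cong) auto
    then show "(M \<otimes>\<^bsub>?M\<^esub> ?E) p q = (if q \<in> I then M p q else 0)" using finite_P I_P by auto
  qed
  have "M \<in> carrier ?N \<longleftrightarrow> M \<in> carrier (corner_alg ?M ?E)" for M
    unfolding corner_alg_simps EM ME
    using I_P by (auto simp: carrier_mat N.carrier_mat fun_eq_iff subset_iff; metis entry_zero)
  then have car: "carrier ?N = carrier (corner_alg ?M ?E)" by blast
  have "(\<lambda>M. M) \<in> alg_hom ?N (corner_alg ?M ?E)"
  proof (rule alg_homI)
    show "A \<otimes>\<^bsub>?N\<^esub> B = A \<otimes>\<^bsub>corner_alg ?M ?E\<^esub> B" if "A \<in> carrier ?N" "B \<in> carrier ?N" for A B
    proof -
      have "(\<Sum>l\<in>I. A p l * B l q) = (\<Sum>l\<in>P. A p l * B l q)" for p q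
        by (rule sum.mono_neutral_left) (use that finite_P I_P in \<open>auto simp: N.carrier_mat\<close>)
      then show ?thesis by simp
    qed
  qed (use car in auto)
  then show ?thesis using car by (simp add: alg_iso_def bij_betw_def)
qed

theorem basic_algebra_mat:
  fixes A :: "('k::field, 'a, 's) module_scheme" and B :: "('k, 'b, 't) module_scheme"
  assumes "k_algebra A" "f \<in> alg_iso A (mat :: ('k, _) module)" "is_basic_algebra A B"
  shows "alg_iso (mat_alg I blk par) B \<noteq> {}"
proof -
  obtain g where "g \<in> alg_iso (corner_alg (mat :: ('k, _) module) (\<lambda>p q. if p = q \<and> p \<in> I then 1 else 0)) B"
    using basic_algebra_corner_iso[OF basic_idempotents_mat assms(1) alg_iso_inv[OF assms(1,2)] assms(3)]
    unfolding rep_idempotent by blast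
  then show ?thesis using alg_iso_comp[OF corner_mat] by blast
qed

end

section \<open>A spanning set of \<open>Qu\<^sub>q(sl\<^sub>2)\<close>\<close>

lemma (in k_algebra) q_commute_pow:
  assumes "x \<in> carrier A" "y \<in> carrier A" "x \<otimes> y = c \<odot> (y \<otimes> x)"
  shows "x \<otimes> y [^] (k::nat) = (c ^ k) \<odot> (y [^] k \<otimes> x)"
proof (induction k)
  case (Suc k)
  have "x \<otimes> y [^] Suc k = (x \<otimes> y [^] k) \<otimes> y" using assms by (simp add: m_assoc)
  also have "\<dots> = (c ^ k) \<odot> (y [^] k \<otimes> (x \<otimes> y))"
    using Suc assms by (simp add: smult_mult_left m_assoc)
  also have "\<dots> = (c ^ Suc k) \<odot> (y [^] Suc k \<otimes> x)"
    using assms by (simp add: smult_mult_right m_assoc mult.commute)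
  finally show ?case .
qed (use assms in simp)

lemma (in monoid) mult_pow_comm:
  assumes "x \<in> carrier G"
  shows "x \<otimes> x [^] (k::nat) = x [^] k \<otimes> x"
    and "z \<in> carrier G \<Longrightarrow> x \<otimes> (x [^] k \<otimes> z) = x [^] k \<otimes> (x \<otimes> z)"
proof -
  show *: "x \<otimes> x [^] k = x [^] k \<otimes> x" using nat_pow_Suc2[OF assms, of k] by simp
  show "x \<otimes> (x [^] k \<otimes> z) = x [^] k \<otimes> (x \<otimes> z)" if "z \<in> carrier G"
    using assms that by (simp add: m_assoc[symmetric] *)
qed

lemma (in monoid) pow_mod_order:
  assumes "x \<in> carrier G" "x [^] n = \<one>" shows "x [^] (c::nat) = x [^] (c mod n)"
proof -
  have "x [^] c = x [^] (n * (c div n) + c mod n)" by simp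
  also have "\<dots> = (x [^] n) [^] (c div n) \<otimes> x [^] (c mod n)"
    using assms(1) by (simp only: nat_pow_mult nat_pow_pow nat_pow_closed)
  finally show ?thesis using assms by simp
qed

text \<open>The relations for four abstract elements, so that monomials can be reordered without
  mentioning words or cosets.\<close>

locale qu_algebra = k_algebra A for A :: "('k::field, 'a, 'r) module_scheme" (structure) +
  fixes n :: nat and q :: 'k and K Kh E F :: 'a
  assumes n_pos: "0 < n" and q_nonzero: "q \<noteq> 0"
    and gens_closed [simp]: "K \<in> carrier A" "Kh \<in> carrier A" "E \<in> carrier A" "F \<in> carrier A"
    and K_pow: "K [^] n = \<one>" and Kh_pow: "Kh [^] n = (K [^] (n - 1)) [^] (2::nat)"
    and K_Kh: "K \<otimes> Kh = Kh \<otimes> K"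
    and K_E: "K \<otimes> E = q ^ n \<odot> (E \<otimes> K)" and K_F: "K \<otimes> F = inverse (q ^ n) \<odot> (F \<otimes> K)"
    and Kh_E: "Kh \<otimes> E = (q ^ n * inverse (q ^ 2)) \<odot> (E \<otimes> Kh)"
    and Kh_F: "Kh \<otimes> F = (inverse (q ^ n) * q ^ 2) \<odot> (F \<otimes> Kh)"
    and E_pow: "E [^] (n ^ 2) = \<zero>" and F_pow: "F [^] (n ^ 2) = \<zero>"
    and F_E: "F \<otimes> E \<ominus> inverse q \<odot> (E \<otimes> F) = \<one> \<ominus> K [^] (n - 1) \<otimes> Kh"
begin

definition mon :: "nat \<Rightarrow> nat \<Rightarrow> nat \<Rightarrow> nat \<Rightarrow> 'a" where
  "mon c d a b = K [^] c \<otimes> (Kh [^] d \<otimes> (F [^] a \<otimes> E [^] b))"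

text \<open>Left multiplication raises exponents, so stability is shown for the span of all ordered
  monomials; the exponents are cut down afterwards, in \<open>mon_small\<close>.\<close>

definition mons where "mons = {mon c d a b | c d a b. True}"
definition small_mons where
  "small_mons = (\<lambda>(c, d, a, b). mon c d a b) ` ({..<n} \<times> {..<n} \<times> {..<n^2} \<times> {..<n^2})"

lemma mon_closed [simp]: "mon c d a b \<in> carrier A"
  by (simp add: mon_def)

lemma mons_carrier: "mons \<subseteq> carrier A"
  by (auto simp: mons_def)

lemma mon_span: "mon c d a b \<in> k_span A mons"
  by (rule k_span.base) (auto simp: mons_def)

lemma flip: "x \<in> carrier A \<Longrightarrow> y \<in> carrier A \<Longrightarrow> x \<otimes> y = c \<odot> (y \<otimes> x) \<Longrightarrow> c \<noteq> 0 \<Longrightarrow> y \<otimes> x = inverse c \<odot> (x \<otimes> y)"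
  by simp

lemma left_mult_pow:
  assumes "x \<in> carrier A" "y \<in> carrier A" "z \<in> carrier A" "x \<otimes> y = c \<odot> (y \<otimes> x)"
  shows "x \<otimes> (y [^] (k::nat) \<otimes> z) = (c ^ k) \<odot> (y [^] k \<otimes> (x \<otimes> z))"
proof -
  have "x \<otimes> (y [^] k \<otimes> z) = (x \<otimes> y [^] k) \<otimes> z" using assms by (simp add: m_assoc)
  also have "\<dots> = (c ^ k) \<odot> (y [^] k \<otimes> x \<otimes> z)"
    unfolding q_commute_pow[OF assms(1,2,4)] using assms by (simp add: smult_mult_left)
  finally show ?thesis using assms by (simp add: m_assoc)
qed

lemma K_mon: "K \<otimes> mon c d a b = mon (Suc c) d a b"
  unfolding mon_def by (simp add: m_assoc[symmetric] nat_pow_Suc2[symmetric] del: nat_pow_Suc)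

lemma Kh_mon: "Kh \<otimes> mon c d a b = mon c (Suc d) a b"
proof -
  have "Kh \<otimes> K = 1 \<odot> (K \<otimes> Kh)" by (simp add: K_Kh)
  from left_mult_pow[OF _ _ _ this, of "Kh [^] d \<otimes> (F [^] a \<otimes> E [^] b)" c] show ?thesis
    unfolding mon_def by (simp add: mult_pow_comm m_assoc)
qed

lemma F_mon: "\<exists>s. F \<otimes> mon c d a b = s \<odot> mon c d (Suc a) b"
proof -
  have 1: "F \<otimes> K = inverse (inverse (q ^ n)) \<odot> (K \<otimes> F)" by (rule flip) (use K_F q_nonzero in auto)
  have 2: "F \<otimes> Kh = inverse (inverse (q ^ n) * q ^ 2) \<odot> (Kh \<otimes> F)" by (rule flip) (use Kh_F q_nonzero in auto)
  show ?thesis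
    unfolding mon_def
    by (subst left_mult_pow[OF _ _ _ 1], simp_all, subst left_mult_pow[OF _ _ _ 2], simp_all)
      (auto simp: smult_mult_right mult_pow_comm m_assoc)
qed

lemma span_left_closed:
  assumes "x \<in> k_span A mons" shows "K \<otimes> x \<in> k_span A mons" "Kh \<otimes> x \<in> k_span A mons" "F \<otimes> x \<in> k_span A mons"
proof -
  have lin: "lin_map A A (\<lambda>y. g \<otimes> y)" if "g \<in> carrier A" for g
    by (rule lin_mapI) (use that in \<open>auto simp: r_distr smult_mult_right\<close>)
  note l = lin_map_k_span[OF k_space_axioms k_space_axioms lin mons_carrier _ assms]
  have g: "K \<otimes> y \<in> k_span A mons \<and> Kh \<otimes> y \<in> k_span A mons \<and> F \<otimes> y \<in> k_span A mons" if y: "y \<in> mons" for y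
  proof -
    obtain c d a b where "y = mon c d a b" using y by (auto simp: mons_def)
    then show ?thesis using F_mon[of c d a b] k_span.scale[OF mon_span] by (auto simp: K_mon Kh_mon mon_span)
  qed
  then show "K \<otimes> x \<in> k_span A mons" "Kh \<otimes> x \<in> k_span A mons" "F \<otimes> x \<in> k_span A mons"
    by (intro l; simp)+
qed

lemma span_pow_closed: "x \<in> k_span A mons \<Longrightarrow> K [^] (c::nat) \<otimes> x \<in> k_span A mons"
  "x \<in> k_span A mons \<Longrightarrow> Kh [^] (c::nat) \<otimes> x \<in> k_span A mons"
proof -
  assume x: "x \<in> k_span A mons"
  have xc: "x \<in> carrier A" using k_span_closed[OF mons_carrier x] .
  show "K [^] c \<otimes> x \<in> k_span A mons"
  proof (induction c)
    case (Suc c)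
    then show ?case using span_left_closed(1)[OF Suc] xc by (simp add: mult_pow_comm m_assoc)
  qed (use x xc in simp)
  show "Kh [^] c \<otimes> x \<in> k_span A mons"
  proof (induction c)
    case (Suc c)
    then show ?case using span_left_closed(2)[OF Suc] xc by (simp add: mult_pow_comm m_assoc)
  qed (use x xc in simp)
qed

lemma E_F: "E \<otimes> F = q \<odot> (F \<otimes> E) \<oplus> ((- q) \<odot> \<one> \<oplus> q \<odot> (K [^] (n - 1) \<otimes> Kh))"
proof -
  let ?u = "K [^] (n - 1) \<otimes> Kh"
  have "F \<otimes> E \<oplus> (- inverse q) \<odot> (E \<otimes> F) = \<one> \<oplus> (- 1) \<odot> ?u"
    using F_E by (simp add: a_minus_def flip: scale_minus_one)
  then have "q \<odot> (F \<otimes> E \<oplus> (- inverse q) \<odot> (E \<otimes> F)) = q \<odot> (\<one> \<oplus> (- 1) \<odot> ?u)" by simp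
  then have e: "q \<odot> (F \<otimes> E) \<oplus> (- 1) \<odot> (E \<otimes> F) = q \<odot> \<one> \<oplus> (- q) \<odot> ?u"
    using q_nonzero by (simp add: scale_add_right)
  have "q \<odot> (F \<otimes> E) \<oplus> ((- q) \<odot> \<one> \<oplus> q \<odot> ?u) = q \<odot> (F \<otimes> E) \<oplus> (- 1) \<odot> (q \<odot> \<one> \<oplus> (- q) \<odot> ?u)"
    by (simp add: scale_add_right)
  also have "\<dots> = q \<odot> (F \<otimes> E) \<oplus> ((- q) \<odot> (F \<otimes> E) \<oplus> E \<otimes> F)"
    unfolding e[symmetric] by (simp add: scale_add_right)
  also have "\<dots> = (q \<odot> (F \<otimes> E) \<oplus> (- q) \<odot> (F \<otimes> E)) \<oplus> E \<otimes> F" by (simp add: a_assoc)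
  also have "\<dots> = E \<otimes> F" by (simp flip: scale_add_left)
  finally show ?thesis by simp
qed

text \<open>In each step \<open>E\<close> passes one \<open>F\<close>. The two correction terms
  involve only \<open>F^a E^b\<close> and its left multiple by \<open>K^(n-1) Kh\<close>, and the
  span is already stable under left multiplication by \<open>F\<close>, \<open>K\<close> and
  \<open>Kh\<close>.\<close>

lemma E_F_pow_span: "E \<otimes> (F [^] (a::nat) \<otimes> E [^] (b::nat)) \<in> k_span A mons"
proof (induction a)
  case 0
  have "E \<otimes> (F [^] (0::nat) \<otimes> E [^] b) = mon 0 0 0 (Suc b)"
    by (simp add: mon_def mult_pow_comm)
  then show ?case using mon_span by simp
next
  case (Suc a)
  let ?x = "F [^] a \<otimes> E [^] b" and ?u = "K [^] (n - 1) \<otimes> Kh"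
  have x: "?x \<in> k_span A mons" using mon_span[of 0 0 a b] by (simp add: mon_def)
  have "E \<otimes> (F [^] Suc a \<otimes> E [^] b) = E \<otimes> F \<otimes> ?x"
    by (simp add: mult_pow_comm m_assoc)
  also have "\<dots> = q \<odot> (F \<otimes> (E \<otimes> ?x)) \<oplus> ((- q) \<odot> ?x \<oplus> q \<odot> (K [^] (n - 1) \<otimes> (Kh \<otimes> ?x)))"
    unfolding E_F by (simp add: l_distr smult_mult_left m_assoc)
  also have "\<dots> \<in> k_span A mons"
    by (intro k_span.add k_span.scale span_left_closed span_pow_closed Suc x)
  finally show ?case .
qed

lemma E_mon: "E \<otimes> mon c d a b \<in> k_span A mons"
proof -
  have 1: "E \<otimes> K = inverse (q ^ n) \<odot> (K \<otimes> E)" by (rule flip) (use K_E q_nonzero in auto)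
  have 2: "E \<otimes> Kh = inverse (q ^ n * inverse (q ^ 2)) \<odot> (Kh \<otimes> E)" by (rule flip) (use Kh_E q_nonzero in auto)
  have "K [^] c \<otimes> (Kh [^] d \<otimes> (E \<otimes> (F [^] a \<otimes> E [^] b))) \<in> k_span A mons"
    by (intro span_pow_closed E_F_pow_span)
  then show ?thesis unfolding mon_def
    by (subst left_mult_pow[OF _ _ _ 1], simp_all, subst left_mult_pow[OF _ _ _ 2], simp_all)
      (auto simp: smult_mult_right intro: k_span.scale)
qed

lemma mon_small: "mon c d a b \<in> k_span A small_mons"
proof (cases "a < n ^ 2 \<and> b < n ^ 2")
  case True
  have com: "Kh \<otimes> K = 1 \<odot> (K \<otimes> Kh)" by (simp add: K_Kh)
  let ?y = "F [^] a \<otimes> E [^] b"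
  \<comment> \<open>Every full \<open>n\<close>-th power of \<open>Kh\<close> is traded for a power
    of \<open>K\<close> through \<open>Kh_pow\<close>; then the exponent of \<open>K\<close> is
    reduced modulo \<open>n\<close>.\<close>
  have "Kh [^] d = Kh [^] (n * (d div n) + d mod n)" by simp
  also have "\<dots> = (Kh [^] n) [^] (d div n) \<otimes> Kh [^] (d mod n)"
    by (simp only: nat_pow_mult nat_pow_pow nat_pow_closed gens_closed)
  also have "(Kh [^] n) [^] (d div n) = K [^] ((n - 1) * 2 * (d div n))"
    by (simp only: Kh_pow nat_pow_pow gens_closed)
  finally have "mon c d a b = mon (c + (n - 1) * 2 * (d div n)) (d mod n) a b"
    by (simp add: mon_def m_assoc[symmetric] nat_pow_mult)
  also have "\<dots> = mon ((c + (n - 1) * 2 * (d div n)) mod n) (d mod n) a b"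
    unfolding mon_def by (subst pow_mod_order[OF gens_closed(1) K_pow]) (rule refl)
  also have "\<dots> \<in> small_mons"
    unfolding small_mons_def
    by (rule image_eqI[of _ _ "((c + (n - 1) * 2 * (d div n)) mod n, d mod n, a, b)"]) (use True n_pos in auto)
  finally show ?thesis by (rule k_span.base)
next
  case False
  have "x [^] a = \<zero>" if "x [^] (n ^ 2) = \<zero>" "x \<in> carrier A" "n ^ 2 \<le> a" for x and a :: nat
    using nat_pow_mult[of x "n ^ 2" "a - n ^ 2"] that by simp
  then have "F [^] a \<otimes> E [^] b = \<zero>" using False E_pow F_pow by (auto simp: not_less)
  then show ?thesis by (simp add: mon_def k_span.zero)
qed

lemma small_mons_span:
  assumes "alg_generates A {K, Kh, E, F}" shows "carrier A \<subseteq> k_span A small_mons"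
proof (rule alg_generates_span[OF assms])
  have s: "x \<in> k_span A small_mons" if "x \<in> k_span A mons" for x
    by (rule k_span_subset[OF that]) (auto simp: mons_def mon_small)
  show "\<one> \<in> k_span A small_mons" using mon_small[of 0 0 0 0] by (simp add: mon_def)
  fix g x assume g: "g \<in> {K, Kh, E, F}" and x: "x \<in> small_mons"
  then obtain c d a b where x: "x = mon c d a b" by (auto simp: small_mons_def)
  have "g \<otimes> x \<in> k_span A mons" unfolding x
    using g by (auto intro: E_mon span_left_closed mon_span)
  then show "g \<otimes> x \<in> k_span A small_mons" by (rule s)
qed (auto simp: small_mons_def)

lemma card_small_mons: "card small_mons \<le> n ^ 2 * (n ^ 2 * n ^ 2)"
proof -
  have "card small_mons \<le> card ({..<n} \<times> {..<n} \<times> {..<n^2} \<times> {..<n^2})"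
    unfolding small_mons_def by (rule card_image_le) auto
  then show ?thesis by (simp add: card_cartesian_product power2_eq_square mult.assoc)
qed

lemma finite_small_mons: "finite small_mons" and small_mons_carrier: "small_mons \<subseteq> carrier A"
  by (auto simp: small_mons_def)

end

lemma
  fixes n :: nat and q :: "'k::field"
  defines "cl \<equiv> quot_class free_alg (qu_rels n q)"
  assumes "0 < n" "q \<noteq> 0"
  shows qu_algebra_Qu: "qu_algebra (Qu_sl2 n q) n q (cl (free_gen Qu_kappa)) (cl (free_gen Qu_kappa_hat))
      (cl (free_gen Qu_E)) (cl (free_gen Qu_F))"
    and Qu_generates: "alg_generates (Qu_sl2 n q) {cl (free_gen Qu_kappa), cl (free_gen Qu_kappa_hat),
      cl (free_gen Qu_E), cl (free_gen Qu_F)}"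
proof -
  interpret F: k_algebra "free_alg :: ('k, qu_gen list \<Rightarrow>\<^sub>0 'k) module" by (rule k_algebra_free_alg)
  have alg: "k_algebra (Qu_sl2 n q)" unfolding Qu_sl2_def by (rule k_algebra_quot_free)
  interpret A: k_algebra "Qu_sl2 n q" by (rule alg)
  have hom: "cl \<in> alg_hom free_alg (Qu_sl2 n q)"
    unfolding cl_def Qu_sl2_def by (rule quot_class_free_hom)
  note h = alg_hom_mult[OF hom] alg_hom_smult[OF hom] alg_hom_one[OF hom] alg_hom_closed[OF hom]
    lin_map_zero[OF F.k_space_axioms A.k_space_axioms alg_hom_lin[OF hom]]
    alg_hom_pow[OF F.k_algebra_axioms alg hom] lin_map_minus[OF F.k_space_axioms A.k_space_axioms alg_hom_lin[OF hom]]
  have UNIV: "(UNIV :: qu_gen set) = {Qu_kappa, Qu_kappa_hat, Qu_E, Qu_F}" by (auto intro: qu_gen.exhaust)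
  have "range (\<lambda>z. cl (free_gen z)) = {cl (free_gen Qu_kappa), cl (free_gen Qu_kappa_hat), cl (free_gen Qu_E), cl (free_gen Qu_F)}"
    unfolding UNIV by simp
  then show "alg_generates (Qu_sl2 n q) {cl (free_gen Qu_kappa), cl (free_gen Qu_kappa_hat),
      cl (free_gen Qu_E), cl (free_gen Qu_F)}"
    using alg_generates_quot_free[of "qu_rels n q"] by (simp add: Qu_sl2_def cl_def)
  have "cl l = cl r" if "(l, r) \<in> qu_rels n q" for l r
    using that unfolding cl_def by (rule quot_class_free_rel)
  then have r: "\<forall>(l, r)\<in>qu_rels n q. cl l = cl r" by blast
  show "qu_algebra (Qu_sl2 n q) n q (cl (free_gen Qu_kappa)) (cl (free_gen Qu_kappa_hat))
      (cl (free_gen Qu_E)) (cl (free_gen Qu_F))"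
    by (intro qu_algebra.intro alg qu_algebra_axioms.intro assms)
      (use r in \<open>unfold qu_rels_def Let_def, simp_all add: h\<close>)
qed

section \<open>The matrix model of \<open>Qu\<^sub>q(sl\<^sub>2)\<close>\<close>

lemma (in supermatrix) diag_pow:
  "sh (\<lambda>p. p) f [^]\<^bsub>mat :: ('k::field, _) module\<^esub> (k::nat) = sh (\<lambda>p. p) (\<lambda>p. f p ^ k)"
proof -
  have "((\<lambda>p. p) ^^ j) = (\<lambda>p :: 'p. p)" for j by (induction j) auto
  then show ?thesis by (subst sh_pow) auto
qed

text \<open>A power of a weighted shift multiplies the weights met along an orbit, and two of them
  with product zero annihilate the whole product.\<close>

lemma (in supermatrix) sh_nilpotent:
  assumes "\<And>p. p \<in> P \<Longrightarrow> \<sigma> p \<in> P"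
    "\<And>p. p \<in> P \<Longrightarrow> \<exists>i<k. \<exists>j<k. i \<noteq> j \<and> f ((\<sigma> ^^ i) p) * f ((\<sigma> ^^ j) p) = 0"
  shows "sh \<sigma> f [^]\<^bsub>mat :: ('k::field, _) module\<^esub> (k::nat) = \<zero>\<^bsub>mat\<^esub>"
proof -
  have "(\<Prod>j<k. f ((\<sigma> ^^ j) p)) = 0" if p: "p \<in> P" for p
  proof -
    obtain i j where ij: "i < k" "j < k" "i \<noteq> j" "f ((\<sigma> ^^ i) p) * f ((\<sigma> ^^ j) p) = 0" using assms(2)[OF p] by blast
    let ?g = "\<lambda>j. f ((\<sigma> ^^ j) p)"
    have "(\<Prod>j<k. ?g j) = ?g i * (?g j * prod ?g ({..<k} - {i} - {j}))"
      using ij prod.remove[of "{..<k}" i ?g] prod.remove[of "{..<k} - {i}" j ?g] by auto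
    then show ?thesis using ij(4) by (simp add: mult.assoc[symmetric])
  qed
  note prod0 = this
  have "sh \<sigma> f [^]\<^bsub>mat :: ('k, _) module\<^esub> k = sh (\<sigma> ^^ k) (\<lambda>p. \<Prod>j<k. f ((\<sigma> ^^ j) p))"
    by (rule sh_pow) (rule assms(1))
  also have "\<dots> = sh (\<sigma> ^^ k) (\<lambda>p. 0)" by (rule sh_cong) (auto simp: prod0)
  also have "\<dots> = \<zero>\<^bsub>mat\<^esub>" by (rule sh_zero[symmetric])
  finally show ?thesis .
qed

section \<open>Powers of the root of unity\<close>

locale qu_root =
  fixes n :: nat and q :: "'k::field_char_0"
  assumes n_pos: "0 < n" and four_dvd: "4 dvd n" and prim: "primitive_root_of_unity (n ^ 2) q"
begin

definition N :: nat where "N = n ^ 2"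

lemma N_16: obtains k where "N = 16 * k" "0 < k"
proof -
  obtain m where "n = 4 * m" using four_dvd by blast
  then have "N = 16 * m ^ 2" "0 < m ^ 2" unfolding N_def using n_pos by (simp_all add: power2_eq_square)
  then show ?thesis using that by blast
qed

lemma N_pos: "0 < N" and N_even: "2 * (N div 2) = N" and N_ge: "16 \<le> N"
proof -
  obtain k where "N = 16 * k" "0 < k" by (rule N_16)
  then show "0 < N" "2 * (N div 2) = N" "16 \<le> N" by auto
qed

lemma q_N: "q ^ N = 1" and q_nonzero: "q \<noteq> 0"
proof -
  show *: "q ^ N = 1" using prim by (simp add: primitive_root_of_unity_def N_def)
  show "q \<noteq> 0"
  proof
    assume "q = 0"
    then have "q ^ N = 0" using N_pos by (simp add: zero_power)
    then show False using * by simp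
  qed
qed

lemma powi_add: "q powi (a + b) = q powi a * q powi b"
  by (rule power_int_add) (simp add: q_nonzero)

lemma powi_pow: "(q powi a) ^ k = q powi (a * int k)"
  by (induction k) (simp_all add: distrib_left powi_add mult.commute)

lemma powi_one_iff: "q powi z = 1 \<longleftrightarrow> int N dvd z"
proof -
  have "q powi z = q powi (int N * (z div int N) + z mod int N)" by simp
  also have "\<dots> = q powi (z mod int N)"
  proof -
    have "q powi (int N * (z div int N)) = 1" unfolding power_int_mult by (simp add: q_N)
    then show ?thesis unfolding powi_add by simp
  qed
  also have "\<dots> = q ^ nat (z mod int N)" using N_pos by (simp add: power_int_def)
  also have "\<dots> = 1 \<longleftrightarrow> nat (z mod int N) = 0"
  proof -
    have "nat (z mod int N) < N" using N_pos by (simp add: nat_less_iff)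
    moreover have "q ^ j \<noteq> 1" if "0 < j" "j < N" for j
      using prim that by (simp add: primitive_root_of_unity_def N_def)
    ultimately show ?thesis by (cases "nat (z mod int N) = 0") (simp, blast)
  qed
  also have "\<dots> \<longleftrightarrow> int N dvd z"
  proof -
    have "0 \<le> z mod int N" using N_pos by simp
    then show ?thesis by (auto simp: dvd_eq_mod_eq_0)
  qed
  finally show ?thesis .
qed

lemma powi_eq_iff: "q powi a = q powi b \<longleftrightarrow> int N dvd a - b"
proof -
  have "q powi a = q powi b \<longleftrightarrow> q powi (a - b) = 1" using q_nonzero by (simp add: power_int_diff)
  then show ?thesis by (simp add: powi_one_iff)
qed

lemma dvd_small: "int N dvd z \<Longrightarrow> \<bar>z\<bar> < int N \<Longrightarrow> z = 0"
  using dvd_imp_le_int[of z "int N"] by (cases "z = 0") auto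

lemma q_neq_one: "q \<noteq> 1"
proof
  assume "q = 1"
  then have "int N dvd 1" using powi_one_iff[of 1] by simp
  then have "(1::int) = 0" by (rule dvd_small) (use N_ge in simp)
  then show False by simp
qed

section \<open>Positions, weights and the four representing matrices\<close>

definition pos :: "(nat \<times> nat) set" where "pos = {..<N div 2} \<times> {..<N}"

text \<open>The block \<open>b\<close> contains the simple modules of dimensions \<open>hb b\<close> and \<open>N - hb b\<close>; the
  sign \<open>(-1)\<^sup>b\<close> distinguishes the two blocks with the same dimensions.\<close>

definition hb :: "nat \<Rightarrow> nat" where "hb b = 2 * (b div 2) + 1"
definition par :: "nat \<times> nat \<Rightarrow> bool" where "par = (\<lambda>(b, i). i < hb b)"
text \<open>One step of \<open>E\<close> raises this by 1 modulo \<open>N\<close>; \<kappa> then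
  picks up \<open>q^n\<close> and the hatted generator \<open>q^(n-2)\<close>, which explains the
  exponents in \<open>kap\<close> and \<open>hat\<close>.\<close>

definition wt :: "nat \<times> nat \<Rightarrow> int" where "wt = (\<lambda>(b, i). int (b div 2) - int i)"
definition kap :: "nat \<times> nat \<Rightarrow> 'k" where "kap p = (- 1) ^ fst p * q powi (int n * wt p)"
definition hat :: "nat \<times> nat \<Rightarrow> 'k" where "hat p = (- 1) ^ fst p * q powi ((int n - 2) * wt p)"
definition nxt :: "nat \<times> nat \<Rightarrow> nat \<times> nat" where "nxt = (\<lambda>(b, i). (b, (i + 1) mod N))"
text \<open>Adding \<open>N - 1\<close> is subtraction of 1 modulo \<open>N\<close> within the
  natural numbers.\<close>

definition prv :: "nat \<times> nat \<Rightarrow> nat \<times> nat" where "prv = (\<lambda>(b, i). (b, (i + (N - 1)) mod N))"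
text \<open>The constant term of \<open>FE\<close> at position \<open>i\<close>: the solution of the
  recursion \<open>cc_rec\<close> that starts at 0.\<close>

definition cc :: "nat \<Rightarrow> nat \<Rightarrow> 'k" where
  "cc b i = - (q / (q - 1)) * (q ^ i - 1) * (1 - q powi (int i - int (hb b)))"
definition ff :: "nat \<times> nat \<Rightarrow> 'k bidual" where
  "ff = (\<lambda>(b, i). if Suc i = N \<or> Suc i = hb b then dx else 1)"
text \<open>Chosen so that \<open>ff * ee\<close> is the value \<open>vv\<close> at the next
  position. Where \<open>cc\<close> vanishes only \<open>q^(i+1) xy\<close> is left, and it factors
  as \<open>x\<close> in \<open>ff\<close> times a multiple of \<open>y\<close>; at the end of the
  cycle the factor is \<open>q^N = 1\<close>.\<close>

definition ee :: "nat \<times> nat \<Rightarrow> 'k bidual" where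
  "ee = (\<lambda>(b, i). if Suc i = N then dy else if Suc i = hb b then scal (q ^ hb b) * dy
     else scal (cc b (Suc i)) + scal (q ^ Suc i) * (dx * dy))"
definition vv :: "nat \<times> nat \<Rightarrow> 'k bidual" where
  "vv = (\<lambda>(b, i). scal (cc b i) + scal (q ^ i) * (dx * dy))"

sublocale SM: supermatrix pos fst par
  by unfold_locales (simp add: pos_def)

declare SM.mat_simps [simp del]

lemma posE: assumes "p \<in> pos" obtains b i where "p = (b, i)" "b < N div 2" "i < N"
  using assms by (auto simp: pos_def)

lemma hb_less: "b < N div 2 \<Longrightarrow> hb b < N div 2"
proof -
  assume b: "b < N div 2"
  obtain k where "N = 16 * k" by (rule N_16)
  then show ?thesis using b by (simp add: hb_def) presburger
qed

lemma half_less: "b < N div 2 \<Longrightarrow> b div 2 < N div 4"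
proof -
  assume b: "b < N div 2"
  obtain k where "N = 16 * k" by (rule N_16)
  then show ?thesis using b by simp
qed

lemma nxt_pos: "p \<in> pos \<Longrightarrow> nxt p \<in> pos" and prv_pos: "p \<in> pos \<Longrightarrow> prv p \<in> pos"
  using N_pos by (auto simp: pos_def nxt_def prv_def)

lemma prv_eq: "i < N \<Longrightarrow> prv (b, i) = (b, if i = 0 then N - 1 else i - 1)"
proof -
  assume i: "i < N"
  have "(i + (N - 1)) mod N = i - 1" if "i \<noteq> 0"
  proof -
    have "i + (N - 1) = (i - 1) + N" using that i by simp
    then have "(i + (N - 1)) mod N = ((i - 1) + N) mod N" by (rule arg_cong)
    then show ?thesis using i by (simp only: mod_add_self2) simp
  qed
  note * = this
  show ?thesis
  proof (cases "i = 0")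
    case False
    show ?thesis unfolding prv_def prod.case *[OF False] using False by simp
  qed (use i in \<open>simp add: prv_def\<close>)
qed

lemma nxt_eq: "i < N \<Longrightarrow> nxt (b, i) = (b, if Suc i = N then 0 else Suc i)"
  by (auto simp: nxt_def)

lemma nxt_prv: "p \<in> pos \<Longrightarrow> nxt (prv p) = p" and prv_nxt: "p \<in> pos \<Longrightarrow> prv (nxt p) = p"
  using N_pos by (auto elim!: posE simp: prv_eq nxt_eq)

lemma cc_N: "cc b N = 0" "cc b 0 = 0" "cc b (hb b) = 0"
  by (simp_all add: cc_def q_N)

lemma cc_rec: "cc b (Suc i) = q * cc b i - q * (1 - q powi (2 * int i - 2 * int (b div 2)))"
proof -
  let ?X = "q ^ i" and ?Z = "q powi (int i - int (hb b))"
  have 1: "q powi (int (Suc i) - int (hb b)) = q * ?Z"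
  proof -
    have "int (Suc i) - int (hb b) = 1 + (int i - int (hb b))" by simp
    then show ?thesis by (simp only: powi_add power_int_1_right)
  qed
  \<comment> \<open>This is where \<open>hb b = 2 (b div 2) + 1\<close> enters: it makes
    \<open>2i - 2(b div 2)\<close> equal to \<open>i + 1 + (i - hb b)\<close>, so the inhomogeneous
    term factors through \<open>?X\<close> and \<open>?Z\<close>.\<close>
  have 2: "q powi (2 * int i - 2 * int (b div 2)) = ?X * q * ?Z"
  proof -
    have "2 * int i - 2 * int (b div 2) = int i + 1 + (int i - int (hb b))" by (simp add: hb_def)
    then show ?thesis by (simp only: powi_add power_int_1_right power_int_of_nat)
  qed
  show ?thesis unfolding cc_def 1 2 using q_neq_one by (simp add: field_simps)
qed

lemma cc_zero_iff: "cc b i = 0 \<longleftrightarrow> int N dvd int i \<or> int N dvd int i - int (hb b)"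
  using powi_one_iff[of "int i"] powi_one_iff[of "int i - int (hb b)"] q_nonzero q_neq_one
  by (auto simp: cc_def)

lemma ff_ee:
  assumes "i < N" shows "ff (b, i) * ee (b, i) = scal (cc b (Suc i)) + scal (q ^ Suc i) * (dx * dy)"
proof (cases "Suc i = N")
  case True
  then show ?thesis using cc_N(1)[of b] q_N by (simp add: ff_def ee_def bidual_eq_iff)
next
  case False
  show ?thesis
  proof (cases "Suc i = hb b")
    case e: True
    then show ?thesis using cc_N(3)[of b] False unfolding e by (simp add: ff_def ee_def bidual_eq_iff e)
  qed (use False in \<open>simp add: ff_def ee_def\<close>)
qed

lemma ff_ee_prv: "p \<in> pos \<Longrightarrow> ff (prv p) * ee (prv p) = vv p"
proof (elim posE)
  fix b i assume p: "p = (b, i)" "b < N div 2" "i < N"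
  show ?thesis
  proof (cases "i = 0")
    case True
    \<comment> \<open>The cycle closes up here: \<open>cc b N\<close> and \<open>cc b 0\<close> are
      both 0, and \<open>q^N = 1\<close>.\<close>
    then have "ff (prv p) * ee (prv p) = scal (cc b N) + scal (q ^ N) * (dx * dy)"
      using ff_ee[of "N - 1" b] p N_pos by (simp add: prv_eq)
    then show ?thesis using True p by (simp add: cc_N q_N vv_def)
  next
    case False
    then show ?thesis using ff_ee[of "i - 1" b] p by (simp add: prv_eq vv_def)
  qed
qed

lemma par_nxt: "b < N div 2 \<Longrightarrow> i < N \<Longrightarrow> par (nxt (b, i)) = par (b, i) \<longleftrightarrow> \<not> (Suc i = N \<or> Suc i = hb b)"
  using hb_less[of b] N_even by (auto simp: nxt_eq par_def hb_def)

lemma ff_entry: "p \<in> pos \<Longrightarrow> ff p \<in> SM.W (nxt p) p"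
proof (elim posE)
  fix b i assume p: "p = (b, i)" "b < N div 2" "i < N"
  then show ?thesis using par_nxt[of b i] by (auto simp: ff_def entry_def nxt_eq)
qed

lemma ee_entry: "p \<in> pos \<Longrightarrow> ee p \<in> SM.W p (nxt p)"
proof (elim posE)
  fix b i assume p: "p = (b, i)" "b < N div 2" "i < N"
  then show ?thesis using par_nxt[of b i] by (auto simp: ee_def entry_def nxt_eq)
qed

definition "mK = SM.sh (\<lambda>p. p) (\<lambda>p. scal (kap p))"
definition "mKh = SM.sh (\<lambda>p. p) (\<lambda>p. scal (hat p))"
definition "mF = SM.sh nxt ff"
definition "mE = SM.sh prv (\<lambda>p. ee (prv p))"

abbreviation "MM \<equiv> SM.mat :: ('k, _) module"

lemma model_carrier: "mK \<in> carrier MM" "mKh \<in> carrier MM" "mF \<in> carrier MM" "mE \<in> carrier MM"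
proof -
  show "mE \<in> carrier MM" unfolding mE_def
  proof (rule SM.sh_mem)
    show "ee (prv p) \<in> SM.W (prv p) p" if "p \<in> pos" for p
      using ee_entry[OF prv_pos[OF that]] nxt_prv[OF that] by simp
  qed (rule prv_pos)
  show "mF \<in> carrier MM" unfolding mF_def by (rule SM.sh_mem) (auto intro: nxt_pos ff_entry)
qed (auto simp: mK_def mKh_def intro!: SM.sh_mem)

text \<open>Passing from position 0 back to \<open>N - 1\<close> changes the weight by
  \<open>1 - N\<close> instead of 1; the congruence suffices because \<open>q^N = 1\<close>.\<close>

lemma wt_prv: "p \<in> pos \<Longrightarrow> int N dvd wt (prv p) - (wt p + 1)"
  by (elim posE) (auto simp: prv_eq wt_def of_nat_diff)

lemma powi_cong: "int N dvd a - b \<Longrightarrow> q powi (c * a) = q powi (c * b)"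
  unfolding powi_eq_iff by (simp add: right_diff_distrib[symmetric])

lemma fst_nxt: "fst (nxt p) = fst p" "fst (prv p) = fst p"
  by (simp_all add: nxt_def prv_def split: prod.splits)

lemma q_n2: "q powi (int n - 2) = q ^ n * inverse (q ^ 2)"
  using q_nonzero by (simp add: power_int_diff divide_inverse)

lemma kap_prv: "p \<in> pos \<Longrightarrow> kap (prv p) = q ^ n * kap p"
  using powi_cong[OF wt_prv, of p "int n"] q_nonzero
  by (simp add: kap_def fst_nxt distrib_left power_int_add)

lemma hat_prv: "p \<in> pos \<Longrightarrow> hat (prv p) = q ^ n * inverse (q ^ 2) * hat p"
  using powi_cong[OF wt_prv, of p "int n - 2"] q_nonzero
  by (simp add: hat_def fst_nxt distrib_left power_int_add q_n2)

lemma kap_nxt: "p \<in> pos \<Longrightarrow> kap (nxt p) = inverse (q ^ n) * kap p"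
  using kap_prv[OF nxt_pos, of p] q_nonzero by (simp add: prv_nxt)

lemma hat_nxt: "p \<in> pos \<Longrightarrow> hat (nxt p) = inverse (q ^ n) * q ^ 2 * hat p"
  using hat_prv[OF nxt_pos, of p] q_nonzero by (simp add: prv_nxt field_simps)

lemma even_n: "even n"
  using four_dvd by auto

lemma kap_pow: "kap p ^ n = 1"
proof -
  have "(q powi (int n * wt p)) ^ n = 1"
    unfolding powi_pow powi_one_iff by (simp add: N_def power2_eq_square)
  moreover have "((- 1 :: 'k) ^ fst p) ^ n = ((- 1) ^ n) ^ fst p"
    by (simp add: power_mult[symmetric] mult.commute)
  ultimately show ?thesis using even_n by (simp add: kap_def power_mult_distrib)
qed

lemma kap_nonzero: "kap p \<noteq> 0"
  using q_nonzero by (simp add: kap_def)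

text \<open>The sign cancels in the quotient, so \<open>\<kappa>^(-1)\<close> times the hatted
  generator acts by \<open>q^(-2 wt)\<close>, as the relation between \<open>F\<close> and
  \<open>E\<close> requires.\<close>

lemma hat_kap: "hat p = kap p * q powi (- 2 * wt p)"
proof -
  have "(int n - 2) * wt p = int n * wt p + - 2 * wt p" by (simp add: algebra_simps)
  then show ?thesis by (simp only: hat_def kap_def powi_add mult.assoc)
qed

lemma kap_inverse: "kap p ^ (n - 1) * kap p = 1"
  using kap_pow[of p] n_pos by (metis Suc_diff_1 power_Suc2)

lemma hat_pow: "hat p ^ n = (kap p ^ (n - 1)) ^ 2"
proof -
  have "kap p ^ (n - 1) = inverse (kap p)" using kap_inverse[of p] by (metis inverse_unique mult.commute)
  moreover have "(q powi (- 2 * wt p)) ^ n = inverse (kap p) ^ 2"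
  proof -
    have "((- 1 :: 'k) ^ fst p) ^ 2 = ((- 1) ^ 2) ^ fst p"
      by (simp only: power_mult[symmetric] mult.commute)
    then have "kap p ^ 2 = q powi (int n * wt p * int 2)"
      unfolding kap_def power_mult_distrib powi_pow by simp
    then have "inverse (kap p) ^ 2 = q powi (- (int n * wt p * int 2))"
      by (simp only: power_inverse power_int_minus)
    moreover have "- (int n * wt p * int 2) = - 2 * wt p * int n" by simp
    ultimately show ?thesis by (simp only: powi_pow)
  qed
  ultimately show ?thesis by (simp add: hat_kap power_mult_distrib kap_pow)
qed

lemma funpow_nxt: "i < N \<Longrightarrow> (nxt ^^ j) (b, i) = (b, (i + j) mod N)"
  by (induction j) (auto simp: nxt_def mod_simps)

lemma funpow_prv: "i < N \<Longrightarrow> (prv ^^ j) (b, i) = (b, (i + j * (N - 1)) mod N)"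
proof (induction j)
  case (Suc j)
  define M where "M = N - 1"
  have "((i + j * M) mod N + M) mod N = (i + Suc j * M) mod N" by (simp add: mod_simps ac_simps)
  moreover have "(prv ^^ Suc j) (b, i) = prv (b, (i + j * M) mod N)"
    by (simp only: funpow.simps o_apply Suc.IH[OF Suc.prems] M_def)
  ultimately show ?case by (simp only: prv_def prod.case M_def)
qed simp

lemma nxt_reaches: assumes "i < N" "t < N" shows "\<exists>j<N. (nxt ^^ j) (b, i) = (b, t)"
proof (cases "i \<le> t")
  case True
  then show ?thesis using assms by (intro exI[of _ "t - i"]) (auto simp: funpow_nxt)
next
  case False
  then have "(i + (N + t - i)) mod N = t" using assms by simp
  then show ?thesis using assms False by (intro exI[of _ "N + t - i"]) (auto simp: funpow_nxt)
qed

text \<open>The additional \<open>prv\<close> matches the weight \<open>ee (prv p)\<close> in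
  \<open>mE\<close>, whose index is the target of the step.\<close>

lemma prv_reaches: assumes "i < N" "t < N" shows "\<exists>j<N. prv ((prv ^^ j) (b, i)) = (b, t)"
proof (cases "t < i")
  case True
  obtain e M where "i = t + Suc e" "N = Suc M"
    using True N_pos by (metis less_iff_Suc_add add_Suc_right gr0_implies_Suc)
  then have "i + Suc (i - 1 - t) * (N - 1) = t + (i - t) * N" by simp
  then have "(prv ^^ Suc (i - 1 - t)) (b, i) = (b, t)"
    using assms by (simp only: funpow_prv[OF assms(1)]) simp
  then show ?thesis using True assms by (intro exI[of _ "i - 1 - t"]) auto
next
  case False
  then obtain d where d: "t = i + d" by (metis le_add_diff_inverse not_less)
  obtain g where "N = d + Suc g"
    using assms d by (metis add.commute add_lessD1 less_iff_Suc_add add_Suc_right)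
  then have "i + Suc (N - 1 - d) * (N - 1) = t + (N - d - 1) * N" unfolding d by (simp add: algebra_simps)
  then have "(prv ^^ Suc (N - 1 - d)) (b, i) = (b, t)"
    using assms by (simp only: funpow_prv[OF assms(1)]) simp
  then show ?thesis using False assms by (intro exI[of _ "N - 1 - d"]) auto
qed

text \<open>A run of \<open>N\<close> steps visits the whole cycle and so crosses both parity
  changes, collecting \<open>x\<close> twice. For \<open>mE\<close> the same happens with
  \<open>y\<close>.\<close>

lemma mF_pow: "mF [^]\<^bsub>MM\<^esub> (n ^ 2) = \<zero>\<^bsub>MM\<^esub>"
  unfolding mF_def N_def[symmetric]
proof (rule SM.sh_nilpotent)
  fix p assume "p \<in> pos"
  then obtain b i where p: "p = (b, i)" "b < N div 2" "i < N" by (rule posE)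
  have h: "hb b < N" "hb b - 1 < N" using hb_less[OF p(2)] by auto
  obtain j1 where j1: "j1 < N" "(nxt ^^ j1) p = (b, N - 1)" using nxt_reaches[OF p(3), of "N - 1" b] p N_pos by auto
  obtain j2 where j2: "j2 < N" "(nxt ^^ j2) p = (b, hb b - 1)" using nxt_reaches[OF p(3) h(2), of b] p by auto
  have "j1 \<noteq> j2" using j1 j2 h hb_def[of b] by auto
  then show "\<exists>i<N. \<exists>j<N. i \<noteq> j \<and> ff ((nxt ^^ i) p) * ff ((nxt ^^ j) p) = 0"
    using j1 j2 N_pos by (intro exI[of _ j1] exI[of _ j2] conjI) (auto simp: ff_def hb_def)
qed (rule nxt_pos)

lemma mE_pow: "mE [^]\<^bsub>MM\<^esub> (n ^ 2) = \<zero>\<^bsub>MM\<^esub>"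
  unfolding mE_def N_def[symmetric]
proof (rule SM.sh_nilpotent)
  fix p assume "p \<in> pos"
  then obtain b i where p: "p = (b, i)" "b < N div 2" "i < N" by (rule posE)
  have h: "hb b < N" "hb b - 1 < N" using hb_less[OF p(2)] by auto
  obtain j1 where j1: "j1 < N" "prv ((prv ^^ j1) p) = (b, N - 1)" using prv_reaches[OF p(3), of "N - 1" b] p N_pos by auto
  obtain j2 where j2: "j2 < N" "prv ((prv ^^ j2) p) = (b, hb b - 1)" using prv_reaches[OF p(3) h(2), of b] p by auto
  have "j1 \<noteq> j2" using j1 j2 h hb_def[of b] by auto
  moreover have "ee (b, N - 1) * ee (b, hb b - 1) = 0"
    using N_pos h by (auto simp: ee_def hb_def bidual_eq_iff)
  ultimately show "\<exists>i<N. \<exists>j<N. i \<noteq> j \<and> ee (prv ((prv ^^ i) p)) * ee (prv ((prv ^^ j) p)) = 0"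
    using j1 j2 by (intro exI[of _ j1] exI[of _ j2] conjI) simp_all
qed (rule prv_pos)

end

lemma scal_power: "scal (a ^ k) = scal a ^ k"
  by (induction k) (simp_all add: scal_simps)

text \<open>Turns surjectivity of a homomorphism into the statement that its image contains
  generators of the target.\<close>

lemma alg_hom_image_subalgebra:
  assumes "k_algebra A" "f \<in> alg_hom A B" shows "k_subalgebra B (f ` carrier A)"
proof -
  interpret A: k_algebra A by fact
  note f = alg_hom_closed[OF assms(2)] alg_hom_add[OF assms(2), symmetric] alg_hom_mult[OF assms(2), symmetric]
    alg_hom_smult[OF assms(2), symmetric] alg_hom_one[OF assms(2), symmetric]
  show ?thesis unfolding k_subalgebra_def by (auto simp: f)
qed

section \<open>Relations, separation and generation in the model\<close>

context qu_root
begin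

lemma sh_comp:
  "SM.sh \<sigma> f \<otimes>\<^bsub>MM\<^esub> SM.sh (\<lambda>p. p) g = SM.sh \<sigma> (\<lambda>p. f p * g p)"
  "SM.sh \<sigma> f \<otimes>\<^bsub>MM\<^esub> SM.sh nxt g = SM.sh (\<lambda>p. \<sigma> (nxt p)) (\<lambda>p. f (nxt p) * g p)"
  "SM.sh \<sigma> f \<otimes>\<^bsub>MM\<^esub> SM.sh prv g = SM.sh (\<lambda>p. \<sigma> (prv p)) (\<lambda>p. f (prv p) * g p)"
  by (rule SM.sh_mult; simp add: nxt_pos prv_pos)+

lemma mF_mE: "mF \<otimes>\<^bsub>MM\<^esub> mE = SM.sh (\<lambda>p. p) vv"
  unfolding mF_def mE_def sh_comp by (rule SM.sh_cong) (simp_all add: nxt_prv ff_ee_prv)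

lemma mE_mF: "mE \<otimes>\<^bsub>MM\<^esub> mF = SM.sh (\<lambda>p. p) (\<lambda>p. ee p * ff p)"
  unfolding mF_def mE_def sh_comp by (rule SM.sh_cong) (simp_all add: prv_nxt)

lemma vv_entry: "vv p \<in> SM.W p p"
  by (cases p) (simp add: vv_def entry_def)

lemma u_diag: "mK [^]\<^bsub>MM\<^esub> (n - 1) \<otimes>\<^bsub>MM\<^esub> mKh = SM.sh (\<lambda>p. p) (\<lambda>p. scal (q powi (- 2 * wt p)))"
  unfolding mK_def mKh_def SM.diag_pow sh_comp
proof (rule SM.sh_cong)
  fix p
  have "scal (kap p) ^ (n - 1) * scal (hat p) = scal (kap p ^ (n - 1) * kap p * q powi (- 2 * wt p))"
    by (simp only: hat_kap scal_simps(4) scal_power mult.assoc)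
  then show "scal (kap p) ^ (n - 1) * scal (hat p) = scal (q powi (- 2 * wt p))"
    by (simp only: kap_inverse mult_1_left)
qed (rule refl)

text \<open>Both sides are diagonal. The \<open>xy\<close> parts on the left cancel because
  \<open>q^i = q^(-1) q^(i+1)\<close>, and the constant parts are the recursion
  \<open>cc_rec\<close>.\<close>

lemma model_F_E: "mF \<otimes>\<^bsub>MM\<^esub> mE \<ominus>\<^bsub>MM\<^esub> inverse q \<odot>\<^bsub>MM\<^esub> (mE \<otimes>\<^bsub>MM\<^esub> mF) = \<one>\<^bsub>MM\<^esub> \<ominus>\<^bsub>MM\<^esub> mK [^]\<^bsub>MM\<^esub> (n - 1) \<otimes>\<^bsub>MM\<^esub> mKh"
proof -
  have c: "mF \<otimes>\<^bsub>MM\<^esub> mE \<in> carrier MM" "inverse q \<odot>\<^bsub>MM\<^esub> (mE \<otimes>\<^bsub>MM\<^esub> mF) \<in> carrier MM" "\<one>\<^bsub>MM\<^esub> \<in> carrier MM"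
    "mK [^]\<^bsub>MM\<^esub> (n - 1) \<otimes>\<^bsub>MM\<^esub> mKh \<in> carrier MM"
    using model_carrier by (auto intro!: SM.M.m_closed SM.M.nat_pow_closed SM.M.one_closed SM.M.scale_closed)
  note c' = c[unfolded mF_mE mE_mF u_diag SM.sh_one SM.sh_smult]
  have p: "vv p - scal (inverse q) * (ee p * ff p) = 1 - scal (q powi (- 2 * wt p))" if pp: "p \<in> pos" for p
  proof -
    obtain b i where b: "p = (b, i)" "i < N" using pp by (elim posE) simp
    have w: "- 2 * wt p = 2 * int i - 2 * int (b div 2)" by (simp add: wt_def b)
    have "ee p * ff p = scal (cc b (Suc i)) + scal (q ^ Suc i) * (dx * dy)"
      using ff_ee[OF b(2), of b] b(1) by (simp add: mult.commute)
    moreover have "cc b i - inverse q * cc b (Suc i) = 1 - q powi (- 2 * wt p)"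
      unfolding w cc_rec using q_nonzero by (simp add: field_simps)
    ultimately show ?thesis using q_nonzero b(1) by (simp add: vv_def bidual_eq_iff)
  qed
  show ?thesis unfolding mF_mE mE_mF u_diag SM.sh_one SM.sh_smult SM.sh_minus[OF c'(1,2)] SM.sh_minus[OF c'(3,4)]
    by (rule SM.sh_cong) (simp_all add: p)
qed

lemma model_relations:
  "mK [^]\<^bsub>MM\<^esub> n = \<one>\<^bsub>MM\<^esub>" "mKh [^]\<^bsub>MM\<^esub> n = (mK [^]\<^bsub>MM\<^esub> (n - 1)) [^]\<^bsub>MM\<^esub> (2::nat)"
  "mK \<otimes>\<^bsub>MM\<^esub> mKh = mKh \<otimes>\<^bsub>MM\<^esub> mK"
  "mK \<otimes>\<^bsub>MM\<^esub> mE = q ^ n \<odot>\<^bsub>MM\<^esub> (mE \<otimes>\<^bsub>MM\<^esub> mK)" "mK \<otimes>\<^bsub>MM\<^esub> mF = inverse (q ^ n) \<odot>\<^bsub>MM\<^esub> (mF \<otimes>\<^bsub>MM\<^esub> mK)"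
  "mKh \<otimes>\<^bsub>MM\<^esub> mE = (q ^ n * inverse (q ^ 2)) \<odot>\<^bsub>MM\<^esub> (mE \<otimes>\<^bsub>MM\<^esub> mKh)"
  "mKh \<otimes>\<^bsub>MM\<^esub> mF = (inverse (q ^ n) * q ^ 2) \<odot>\<^bsub>MM\<^esub> (mF \<otimes>\<^bsub>MM\<^esub> mKh)"
proof -
  note d = mK_def mKh_def mE_def mF_def
  show "mK [^]\<^bsub>MM\<^esub> n = \<one>\<^bsub>MM\<^esub>" unfolding d SM.diag_pow SM.sh_one
    by (rule SM.sh_cong) (simp_all add: kap_pow scal_simps flip: scal_power)
  show "mKh [^]\<^bsub>MM\<^esub> n = (mK [^]\<^bsub>MM\<^esub> (n - 1)) [^]\<^bsub>MM\<^esub> (2::nat)" unfolding d SM.diag_pow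
    by (rule SM.sh_cong) (simp_all add: hat_pow flip: scal_power)
  show "mK \<otimes>\<^bsub>MM\<^esub> mKh = mKh \<otimes>\<^bsub>MM\<^esub> mK" unfolding d sh_comp
    by (simp only: mult.commute)
  show "mK \<otimes>\<^bsub>MM\<^esub> mE = q ^ n \<odot>\<^bsub>MM\<^esub> (mE \<otimes>\<^bsub>MM\<^esub> mK)" unfolding d sh_comp SM.sh_smult
    by (rule SM.sh_cong)
      (simp_all only: kap_prv scal_simps(4) mult_ac)
  show "mK \<otimes>\<^bsub>MM\<^esub> mF = inverse (q ^ n) \<odot>\<^bsub>MM\<^esub> (mF \<otimes>\<^bsub>MM\<^esub> mK)" unfolding d sh_comp SM.sh_smult
    by (rule SM.sh_cong)
      (simp_all only: kap_nxt scal_simps(4) mult_ac)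
  show "mKh \<otimes>\<^bsub>MM\<^esub> mE = (q ^ n * inverse (q ^ 2)) \<odot>\<^bsub>MM\<^esub> (mE \<otimes>\<^bsub>MM\<^esub> mKh)" unfolding d sh_comp SM.sh_smult
    by (rule SM.sh_cong)
      (simp_all only: hat_prv scal_simps(4) mult_ac)
  show "mKh \<otimes>\<^bsub>MM\<^esub> mF = (inverse (q ^ n) * q ^ 2) \<odot>\<^bsub>MM\<^esub> (mF \<otimes>\<^bsub>MM\<^esub> mKh)" unfolding d sh_comp SM.sh_smult
    by (rule SM.sh_cong)
      (simp_all only: hat_nxt scal_simps(4) mult_ac)
qed

text \<open>The quotient of the two diagonal generators fixes twice the weight modulo
  \<open>N\<close>, and \<kappa> then fixes the sign, that is the parity of the block index. The
  constant term of \<open>FE\<close> settles the remaining ambiguity: the numbers \<open>q^i\<close>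
  and \<open>q^(i - hb b)\<close> have the same sum and product at both positions, so they form the
  same pair.\<close>

lemma separation:
  assumes "p \<in> pos" "p' \<in> pos" "kap p = kap p'" "hat p = hat p'" "c1 (vv p) = c1 (vv p')"
  shows "p = p'"
proof -
  obtain b i where p: "p = (b, i)" "b < N div 2" "i < N" using assms(1) by (rule posE)
  obtain b' i' where p': "p' = (b', i')" "b' < N div 2" "i' < N" using assms(2) by (rule posE)
  define s s' where "s = int (b div 2)" and "s' = int (b' div 2)"
  have s: "0 \<le> s" "0 \<le> s'" "4 * s < int N" "4 * s' < int N"
    using half_less[OF p(2)] half_less[OF p'(2)] by (auto simp: s_def s'_def)
  have w: "wt p = s - int i" "wt p' = s' - int i'" by (simp_all add: wt_def p p' s_def s'_def)
  have "q powi (- 2 * wt p) = q powi (- 2 * wt p')"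
    using assms(3,4) kap_nonzero[of p'] unfolding hat_kap[of p] hat_kap[of p'] by simp
  then have W: "int N dvd - 2 * wt p - - 2 * wt p'" by (simp only: powi_eq_iff)
  \<comment> \<open>As \<open>n = 2h\<close>, the difference of the exponents of \<open>q\<close> in
    \<open>kap\<close> is \<open>-h\<close> times a number divisible by \<open>N\<close>; only the
    signs can still differ, and they must agree.\<close>
  have "even (b + b')"
  proof -
    obtain h where h: "n = 2 * h" using even_n by blast
    obtain t where "- 2 * wt p - - 2 * wt p' = int N * t" using W by blast
    then have "int n * wt p - int n * wt p' = int N * (- int h * t)" using h by (simp add: algebra_simps)
    then have "q powi (int n * wt p) = q powi (int n * wt p')" unfolding powi_eq_iff by (metis dvd_triv_left)
    then have "(- 1 :: 'k) ^ b = (- 1) ^ b'" using assms(3) q_nonzero by (simp add: kap_def p p')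
    then show ?thesis by (cases "even b"; cases "even b'") auto
  qed
  let ?X = "q ^ i" and ?Z = "q powi (int i - int (hb b))" and ?X' = "q ^ i'" and ?Z' = "q powi (int i' - int (hb b'))"
  have XZ: "?X * ?Z = ?X' * ?Z'"
  proof -
    have "?X * ?Z = q powi (int i + (int i - int (hb b)))" "?X' * ?Z' = q powi (int i' + (int i' - int (hb b')))"
      by (simp_all only: powi_add power_int_of_nat)
    moreover have "int N dvd (int i + (int i - int (hb b))) - (int i' + (int i' - int (hb b')))"
      using W by (simp add: w hb_def s_def s'_def algebra_simps)
    ultimately show ?thesis using powi_eq_iff by metis
  qed
  have "cc b i = cc b' i'" using assms(5) by (simp add: vv_def p p')
  moreover have "q / (q - 1) \<noteq> 0" using q_nonzero q_neq_one by simp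
  ultimately have "(?X - 1) * (1 - ?Z) = (?X' - 1) * (1 - ?Z')"
    unfolding cc_def by (metis (no_types) mult.assoc mult_cancel_left neg_equal_0_iff_equal)
  then have S: "?X + ?Z = ?X' + ?Z'" using XZ by (simp add: algebra_simps)
  \<comment> \<open>Both \<open>?X\<close> and \<open>?Z\<close> are roots of the quadratic
    polynomial with roots \<open>?X'\<close> and \<open>?Z'\<close>, which has the same
    coefficients.\<close>
  have "(?X - ?X') * (?X - ?Z') = ?X * ?X - ?X * (?X' + ?Z') + ?X' * ?Z'" by (simp add: algebra_simps)
  also have "\<dots> = 0" unfolding S[symmetric] XZ[symmetric] by (simp add: algebra_simps)
  finally consider "?X = ?X'" | "?X = ?Z'" by auto
  then show ?thesis
  proof cases
    case 1
    then have "q powi int i = q powi int i'" by simp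
    then have "int N dvd int i - int i'" unfolding powi_eq_iff .
    then have i: "i = i'" using dvd_small[of "int i - int i'"] p(3) p'(3) by auto
    then have "int N dvd 2 * (s' - s)" using W by (simp add: w algebra_simps)
    then have "s = s'" using dvd_small[of "2 * (s' - s)"] s by auto
    then have "b div 2 = b' div 2" by (simp add: s_def s'_def)
    then have "b = b'" using \<open>even (b + b')\<close> by presburger
    then show ?thesis using i p p' by simp
  next
    case 2
    then have "q powi int i = ?Z'" by simp
    then have "int N dvd int i - (int i' - int (hb b'))" unfolding powi_eq_iff .
    then have "int N dvd int i - int i' + 2 * s' + 1" by (simp add: hb_def s'_def algebra_simps)
    \<comment> \<open>If the pair were exchanged, eliminating \<open>i\<close> and \<open>i'\<close>
      with \<open>W\<close> would make \<open>N\<close> divide \<open>2(s + s' + 1)\<close>, a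
      number strictly between 0 and \<open>N\<close>.\<close>
    then have "int N dvd 2 * (int i - int i' + 2 * s' + 1) - (- 2 * wt p - - 2 * wt p')"
      using W by (metis dvd_diff dvd_mult)
    also have "2 * (int i - int i' + 2 * s' + 1) - (- 2 * wt p - - 2 * wt p') = 2 * (s + s' + 1)"
      by (simp add: w algebra_simps)
    finally have "2 * (s + s' + 1) = 0"
    proof (rule dvd_small)
      show "\<bar>2 * (s + s' + 1)\<bar> < int N"
      proof -
        obtain k where "N = 16 * k" by (rule N_16)
        then show ?thesis using s by simp
      qed
    qed
    then show ?thesis using s by simp
  qed
qed

text \<open>Once the diagonal units are available, \<open>F\<close> and \<open>E\<close> break up
  into single entries joining neighbours. Within a parity segment these entries are invertible and
  link all positions; at the two ends of the segments they yield \<open>x\<close> and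
  \<open>y\<close>.\<close>

lemma model_generates:
  assumes Y: "k_subalgebra MM Y" and gens: "mK \<in> Y" "mKh \<in> Y" "mF \<in> Y" "mE \<in> Y"
  shows "carrier MM \<subseteq> Y"
proof -
  interpret Y: supermatrix_subalgebra pos fst par Y by unfold_locales (rule Y)
  have vvY: "SM.sh (\<lambda>p. p) vv \<in> Y" using Y.Y_closed(2)[OF gens(3,4)] by (simp only: mF_mE)
  have diag: "munit p p r \<in> Y" if p: "p \<in> pos" and r: "r \<in> SM.W p p" for p r
  proof (rule Y.diagonal_munit[OF p _ vvY vv_entry _ r])
    show "cxy (vv p) \<noteq> 0" using q_nonzero by (cases p) (simp add: vv_def)
    fix p' assume "p' \<in> pos" "p' \<noteq> p"
    then consider "kap p \<noteq> kap p'" | "hat p \<noteq> hat p'" | "c1 (vv p) \<noteq> c1 (vv p')" using separation[OF p] by metis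
    then show "\<exists>d. SM.sh (\<lambda>p. p) d \<in> Y \<and> (\<forall>a\<in>pos. d a \<in> SM.W a a) \<and> c1 (d p) \<noteq> c1 (d p')"
    proof cases
      case 1
      then show ?thesis using gens(1) unfolding mK_def by (intro exI[of _ "\<lambda>p. scal (kap p)"]) simp
    next
      case 2
      then show ?thesis using gens(2) unfolding mKh_def by (intro exI[of _ "\<lambda>p. scal (hat p)"]) simp
    next
      case 3
      then show ?thesis using vvY vv_entry by (intro exI[of _ vv]) simp
    qed
  qed
  have one: "munit p p 1 \<in> Y" if "p \<in> pos" for p using diag[OF that] by simp
  have Fe: "munit (nxt p) p (ff p) \<in> Y" if p: "p \<in> pos" for p
    using Y.munit_Y(4)[OF p gens(3)[unfolded mF_def] one[OF p]] by simp
  have Ee: "munit p (nxt p) (ee p) \<in> Y" if p: "p \<in> pos" for p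
    using Y.munit_Y(4)[OF nxt_pos[OF p] gens(4)[unfolded mE_def] one[OF nxt_pos[OF p]]] by (simp add: prv_nxt[OF p])
  have in_pos: "(b, i) \<in> pos" if "b < N div 2" "i < N" for b i using that by (simp add: pos_def)
  have step: "munit (b, Suc i) (b, i) 1 \<in> Y \<and> munit (b, i) (b, Suc i) 1 \<in> Y"
    if b: "b < N div 2" and i: "Suc i < N" "Suc i \<noteq> hb b" for b i
  proof -
    have p: "(b, i) \<in> pos" "(b, Suc i) \<in> pos" "nxt (b, i) = (b, Suc i)" using b i by (auto simp: in_pos nxt_eq)
    have up: "munit (b, Suc i) (b, i) 1 \<in> Y" using Fe[OF p(1)] i p(3) by (simp add: ff_def)
    let ?c = "cc b (Suc i)"
    have c: "?c \<noteq> 0"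
    proof
      assume "?c = 0"
      then consider "int N dvd int (Suc i)" | "int N dvd int (Suc i) - int (hb b)" unfolding cc_zero_iff by blast
      then show False
      proof cases
        case 1
        then show False using dvd_small[of "int (Suc i)"] i by auto
      next
        case 2
        then have "int (Suc i) - int (hb b) = 0" by (rule dvd_small) (use i hb_less[OF b] in auto)
        then show False using i by simp
      qed
    qed
    \<comment> \<open>The inverse of the weight \<open>c + q^(i+1) xy\<close> of \<open>E\<close>,
      available because \<open>c\<close> is nonzero away from the segment ends.\<close>
    let ?r = "Bidual (inverse ?c) 0 0 (- (q ^ Suc i) * inverse ?c ^ 2)"
    have "?r \<in> SM.W (b, Suc i) (b, Suc i)" by (simp add: entry_def)
    then have "munit (b, i) (b, Suc i) (ee (b, i) * ?r) \<in> Y"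
      using Y.munit_Y(1)[OF p(2) _ diag[OF p(2)], of "(b, i)" "ee (b, i)" ?r] Ee[OF p(1)] p(3) by simp
    moreover have "ee (b, i) * ?r = 1" using i c by (simp add: ee_def bidual_eq_iff power2_eq_square)
    ultimately show ?thesis using up by simp
  qed
  have chain: "munit (b, i + d) (b, i) 1 \<in> Y \<and> munit (b, i) (b, i + d) 1 \<in> Y"
    if "b < N div 2" "i + d < N" "i < hb b \<longleftrightarrow> i + d < hb b" for b i d
    using that
  proof (induction d)
    case 0
    then show ?case using one in_pos by simp
  next
    case (Suc d)
    have d: "i + d < N" "i < hb b \<longleftrightarrow> i + d < hb b" "Suc (i + d) \<noteq> hb b" using Suc.prems by auto
    note IH = Suc.IH[OF Suc.prems(1) d(1,2)]
    have st: "munit (b, Suc (i + d)) (b, i + d) 1 \<in> Y \<and> munit (b, i + d) (b, Suc (i + d)) 1 \<in> Y"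
      by (rule step) (use Suc.prems d in auto)
    have p: "(b, i + d) \<in> pos" using in_pos Suc.prems(1) d(1) by simp
    show ?case
      using Y.munit_Y(1)[OF p, of "(b, Suc (i + d))" 1 "(b, i)" 1] Y.munit_Y(1)[OF p, of "(b, i)" 1 "(b, Suc (i + d))" 1] IH st
      by simp
  qed
  have same: "munit (b, i) (b, j) 1 \<in> Y" if "b < N div 2" "i < N" "j < N" "i < hb b \<longleftrightarrow> j < hb b" for b i j
    using chain[of b i "j - i"] chain[of b j "i - j"] that by (cases "i \<le> j") auto
  have join: "munit (b, i) (b, j) r \<in> Y"
    if "b < N div 2" "i < N" "j < N" "k < N" "l < N" "i < hb b \<longleftrightarrow> k < hb b" "j < hb b \<longleftrightarrow> l < hb b"
      "munit (b, k) (b, l) r \<in> Y" for b i j k l r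
  proof -
    have "munit (b, i) (b, l) (1 * r) \<in> Y"
      using Y.munit_Y(1)[OF in_pos same, of b k i] that by blast
    then have "munit (b, i) (b, j) (1 * r * 1) \<in> Y"
      using Y.munit_Y(1)[OF in_pos _ same, of b l "(b, i)" "1 * r" j] that by blast
    then show ?thesis by simp
  qed
  have cross: "munit (b, i) (b, j) dx \<in> Y \<and> munit (b, i) (b, j) dy \<in> Y \<and> munit (b, j) (b, i) dx \<in> Y \<and> munit (b, j) (b, i) dy \<in> Y"
    if b: "b < N div 2" and ij: "i < hb b" "j < N" "\<not> j < hb b" for b i j
  proof -
    have h: "0 < hb b" "hb b < N" "hb b - 1 < N" "Suc (hb b - 1) = hb b" "i < N" "hb b \<noteq> N" "N - 1 < N" "\<not> N - 1 < hb b"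
      using hb_less[OF b] ij by (auto simp: hb_def)
    have p: "(b, hb b - 1) \<in> pos" "(b, N - 1) \<in> pos" using in_pos b h by auto
    have nx: "nxt (b, hb b - 1) = (b, hb b)" "nxt (b, N - 1) = (b, 0)" using h by (auto simp: nxt_eq)
    \<comment> \<open>Each combination of direction and variable occurs once: \<open>F\<close> gives
      \<open>x\<close> and \<open>E\<close> gives \<open>y\<close>, in opposite directions at each
      parity change, and the two changes run in opposite senses between the segments.
      \<open>join\<close> then moves the end points freely.\<close>
    have e: "munit (b, hb b) (b, hb b - 1) dx \<in> Y" "munit (b, 0) (b, N - 1) dx \<in> Y"
      "munit (b, hb b - 1) (b, hb b) (scal (q ^ hb b) * dy) \<in> Y" "munit (b, N - 1) (b, 0) dy \<in> Y"
      using Fe[OF p(1)] Fe[OF p(2)] Ee[OF p(1)] Ee[OF p(2)] h unfolding nx by (simp_all add: ff_def ee_def)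
    have "munit (b, hb b - 1) (b, hb b) (scal (inverse (q ^ hb b)) * (scal (q ^ hb b) * dy)) \<in> Y"
      by (rule Y.munit_Y(3)[OF e(3)])
    moreover have "scal (inverse (q ^ hb b)) * (scal (q ^ hb b) * dy) = dy"
      using q_nonzero by (simp add: bidual_eq_iff)
    ultimately have e3: "munit (b, hb b - 1) (b, hb b) dy \<in> Y" by simp
    show ?thesis
      using join[OF b _ _ _ _ _ _ e(2), of i j] join[OF b _ _ _ _ _ _ e3, of i j]
        join[OF b _ _ _ _ _ _ e(1), of j i] join[OF b _ _ _ _ _ _ e(4), of j i] h ij by simp
  qed
  show ?thesis
  proof (rule Y.all_munits[OF diag])
    fix p p' assume p: "p \<in> pos" "p' \<in> pos" "fst p = fst p'"
    obtain b i where b: "p = (b, i)" "b < N div 2" "i < N" using p(1) by (rule posE)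
    obtain b' j where b': "p' = (b', j)" "j < N" using p(2) by (rule posE)
    have bb: "b' = b" using p(3) b b' by simp
    show "munit p p' 1 \<in> Y" if "par p = par p'" using same[OF b(2,3) b'(2)] that by (simp add: par_def b b' bb)
    show "munit p p' dx \<in> Y \<and> munit p p' dy \<in> Y" if "par p \<noteq> par p'"
      using cross[OF b(2), of i j] cross[OF b(2), of j i] b b' that by (auto simp: par_def bb)
  qed
qed

text \<open>There are \<open>N/2\<close> blocks with \<open>N^2\<close> entries of two coordinates
  each, which is exactly the bound \<open>N^3\<close> for the spanning monomials.\<close>

lemma card_coord_set: "card SM.coord_set = n ^ 2 * (n ^ 2 * n ^ 2)"
proof -
  let ?f = "\<lambda>((b, i), j, t). ((b, i), (b, j), t)"
  have "SM.coord_set = ?f ` (pos \<times> {..<N} \<times> (UNIV :: bool set))"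
    unfolding SM.coord_set_def by (auto simp: pos_def image_iff)
  moreover have "inj_on ?f (pos \<times> {..<N} \<times> (UNIV :: bool set))" by (rule inj_onI) auto
  ultimately have "card SM.coord_set = card (pos \<times> {..<N} \<times> (UNIV :: bool set))" by (simp add: card_image)
  also have "\<dots> = (2 * (N div 2)) * (N * N)" by (simp add: card_cartesian_product pos_def)
  finally show ?thesis unfolding N_even by (simp add: N_def)
qed

theorem Qu_iso_mat: "\<exists>f. f \<in> alg_iso (Qu_sl2 n q) MM"
proof -
  let ?\<phi> = "\<lambda>z. case z of Qu_kappa \<Rightarrow> mK | Qu_kappa_hat \<Rightarrow> mKh | Qu_E \<Rightarrow> mE | Qu_F \<Rightarrow> mF"
  have c: "?\<phi> z \<in> carrier MM" for z by (cases z) (auto simp: model_carrier)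
  interpret F: k_algebra "free_alg :: ('k, qu_gen list \<Rightarrow>\<^sub>0 'k) module" by (rule k_algebra_free_alg)
  have hom: "free_eval MM ?\<phi> \<in> alg_hom free_alg MM" by (rule free_eval_hom[OF SM.k_algebra_mat c])
  note h = alg_hom_mult[OF hom] alg_hom_smult[OF hom] alg_hom_one[OF hom]
    lin_map_zero[OF F.k_space_axioms SM.M.k_space_axioms alg_hom_lin[OF hom]]
    lin_map_minus[OF F.k_space_axioms SM.M.k_space_axioms alg_hom_lin[OF hom]]
    alg_hom_pow[OF F.k_algebra_axioms SM.k_algebra_mat hom] free_eval_gen[OF SM.k_algebra_mat c]
  have r: "free_eval MM ?\<phi> l = free_eval MM ?\<phi> r" if "(l, r) \<in> qu_rels n q" for l r
    using that unfolding qu_rels_def Let_def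
    by (auto simp: h model_relations[simplified] model_F_E[simplified] mE_pow mF_pow)
  let ?f = "quot_lift MM (word_val MM ?\<phi>)"
  have f: "?f \<in> alg_hom (Qu_sl2 n q) MM" unfolding Qu_sl2_def
    by (rule quot_lift_free[OF SM.k_algebra_mat c r])
  have fg: "?f (quot_class free_alg (qu_rels n q) (free_gen z)) = ?\<phi> z" for z
    by (rule quot_lift_free(2)[OF SM.k_algebra_mat c r])
  note Q = qu_algebra_Qu[OF n_pos q_nonzero] Qu_generates[OF n_pos q_nonzero]
  interpret Q: qu_algebra "Qu_sl2 n q" n q "quot_class free_alg (qu_rels n q) (free_gen Qu_kappa)"
    "quot_class free_alg (qu_rels n q) (free_gen Qu_kappa_hat)"
    "quot_class free_alg (qu_rels n q) (free_gen Qu_E)" "quot_class free_alg (qu_rels n q) (free_gen Qu_F)"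
    by (rule Q)
  have "carrier MM \<subseteq> ?f ` carrier (Qu_sl2 n q)"
  proof (rule model_generates[OF alg_hom_image_subalgebra[OF Q.k_algebra_axioms f]])
    show "mK \<in> ?f ` carrier (Qu_sl2 n q)" using fg[of Qu_kappa] by (intro image_eqI[OF _ Q.gens_closed(1)]) simp
    show "mKh \<in> ?f ` carrier (Qu_sl2 n q)" using fg[of Qu_kappa_hat] by (intro image_eqI[OF _ Q.gens_closed(2)]) simp
    show "mF \<in> ?f ` carrier (Qu_sl2 n q)" using fg[of Qu_F] by (intro image_eqI[OF _ Q.gens_closed(4)]) simp
    show "mE \<in> ?f ` carrier (Qu_sl2 n q)" using fg[of Qu_E] by (intro image_eqI[OF _ Q.gens_closed(3)]) simp
  qed
  then have "?f \<in> alg_iso (Qu_sl2 n q) MM"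
    by (rule SM.surj_imp_alg_iso[OF Q.k_algebra_axioms f _ Q.finite_small_mons Q.small_mons_carrier
          Q.small_mons_span[OF Q(2)]]) (simp only: card_coord_set Q.card_small_mons)
  then show ?thesis by blast
qed

text \<open>The first positions of the two parity segments of each block.\<close>

definition reps :: "(nat \<times> nat) set" where "reps = (\<lambda>b. (b, 0)) ` {..<N div 2} \<union> (\<lambda>b. (b, hb b)) ` {..<N div 2}"

sublocale RP: supermatrix_reps pos fst par reps
proof
  show "reps \<subseteq> pos" using hb_less N_pos by (fastforce simp: reps_def pos_def)
  show "\<exists>i\<in>reps. fst i = fst p \<and> par i = par p" if p: "p \<in> pos" for p
  proof -
    obtain b i where b: "p = (b, i)" "b < N div 2" using p by (rule posE)
    then show ?thesis
      by (intro bexI[of _ "(b, if par p then 0 else hb b)"]) (auto simp: reps_def par_def hb_def)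
  qed
  show "i = j" if "i \<in> reps" "j \<in> reps" "fst i = fst j" "par i = par j" for i j
    using that by (auto simp: reps_def par_def hb_def)
qed

theorem basic_algebra_Qu:
  assumes "is_basic_algebra (Qu_sl2 n q) B"
  shows "alg_iso (mat_alg reps fst par) B \<noteq> {}"
proof -
  obtain f where "f \<in> alg_iso (Qu_sl2 n q) MM" using Qu_iso_mat by blast
  moreover have "k_algebra (Qu_sl2 n q)" unfolding Qu_sl2_def by (rule k_algebra_quot_free)
  ultimately show ?thesis using RP.basic_algebra_mat assms by blast
qed

end

section \<open>The basic algebra as a tensor product\<close>

declare One_nat_def [simp del]

section \<open>Spanning sets of tensor products and of the book algebra\<close>

lemma card_three_bools: "card (UNIV :: (bool \<times> bool \<times> bool) set) = 8"
  by (simp only: UNIV_Times_UNIV[symmetric] card_cartesian_product card_UNIV_bool)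

lemma monoid_alg_span:
  "carrier (monoid_alg G) \<subseteq> k_span (monoid_alg G :: ('k::field, _) module) ((\<lambda>z. Poly_Mapping.single z 1) ` carrier G)"
proof
  fix u :: "'a \<Rightarrow>\<^sub>0 'k" assume "u \<in> carrier (monoid_alg G)"
  then have "Poly_Mapping.keys u \<subseteq> carrier G" by (simp add: monoid_alg_simps)
  then show "u \<in> k_span (monoid_alg G) ((\<lambda>z. Poly_Mapping.single z 1) ` carrier G)"
  proof (induction u rule: poly_mapping_keys_induct)
    case zero
    show ?case using k_span.zero[of "monoid_alg G :: ('k, _) module"] by (simp add: monoid_alg_simps)
  next
    case (single x c)
    then have "c \<odot>\<^bsub>monoid_alg G\<^esub> Poly_Mapping.single x 1
        \<in> k_span (monoid_alg G) ((\<lambda>z. Poly_Mapping.single z 1) ` carrier G)"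
      by (intro k_span.scale k_span.base) auto
    then show ?case by (simp add: monoid_alg_simps)
  next
    case (add u v)
    then show ?case using k_span.add[of u "monoid_alg G" _ v] by (simp add: monoid_alg_simps)
  qed
qed

lemma (in alg_pair) tensor_span:
  assumes X: "X \<subseteq> carrier A" "carrier A \<subseteq> k_span A X" and Y: "Y \<subseteq> carrier B" "carrier B \<subseteq> k_span B Y"
  shows "carrier T \<subseteq> k_span T ((\<lambda>(x, y). t x y) ` (X \<times> Y))"
proof
  fix u assume "u \<in> carrier T"
  then show "u \<in> k_span T ((\<lambda>(x, y). t x y) ` (X \<times> Y))"
  proof (induction u rule: tensor_induct)
    case (pure a b)
    note l = pure_bilinear[unfolded bilinear_map_def]
    have tx: "t x b \<in> k_span T ((\<lambda>(x, y). t x y) ` (X \<times> Y))" if x: "x \<in> X" for x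
    proof (rule lin_map_k_span[OF B.k_space_axioms T.k_space_axioms _ Y(1)])
      show "lin_map B T (t x)" using l x X(1) by blast
      show "t x y \<in> k_span T ((\<lambda>(x, y). t x y) ` (X \<times> Y))" if "y \<in> Y" for y
        using x that by (intro k_span.base) auto
    qed (use Y(2) pure in blast)
    show ?case
      by (rule lin_map_k_span[OF A.k_space_axioms T.k_space_axioms _ X(1) tx]) (use l X(2) pure in blast)+
  qed (rule k_span.add)
qed

definition book_mon :: "bool \<Rightarrow> bool \<Rightarrow> bool \<Rightarrow> (book_gen list \<Rightarrow>\<^sub>0 'k::field) set" where
  "book_mon a b c = (let H = book_alg (-1) 2 1 in (if a then book_gens Book_x else \<one>\<^bsub>H\<^esub>) \<otimes>\<^bsub>H\<^esub>
     ((if b then book_gens Book_y else \<one>\<^bsub>H\<^esub>) \<otimes>\<^bsub>H\<^esub> (if c then book_gens Book_g else \<one>\<^bsub>H\<^esub>)))"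

definition book_mons :: "(book_gen list \<Rightarrow>\<^sub>0 'k::field) set set" where
  "book_mons = (\<lambda>(a, b, c). book_mon a b c) ` UNIV"

lemma book_span:
  "book_mons \<subseteq> carrier (book_alg (-1) 2 1 :: ('k::field, _) module)"
  "carrier (book_alg (-1) 2 1) \<subseteq> k_span (book_alg (-1) 2 1 :: ('k::field, _) module) book_mons"
proof -
  let ?H = "book_alg (-1) 2 1 :: ('k::field, _) module"
  interpret H: k_algebra ?H by (rule k_algebra_book)
  let ?x = "book_gens Book_x :: (book_gen list \<Rightarrow>\<^sub>0 'k::field) set" and ?y = "book_gens Book_y :: (book_gen list \<Rightarrow>\<^sub>0 'k::field) set"
    and ?g = "book_gens Book_g :: (book_gen list \<Rightarrow>\<^sub>0 'k::field) set"
  obtain x y g where xyg: "x = ?x" "y = ?y" "g = ?g" by blast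
  note c = book_carrier[where 'k = 'k, folded xyg] and r = book_relations[where 'k = 'k, folded xyg]
  have m: "book_mon a b d = (if a then x else \<one>\<^bsub>?H\<^esub>) \<otimes>\<^bsub>?H\<^esub> ((if b then y else \<one>\<^bsub>?H\<^esub>) \<otimes>\<^bsub>?H\<^esub> (if d then g else \<one>\<^bsub>?H\<^esub>))" for a b d
    by (simp only: book_mon_def Let_def xyg)
  have mc: "book_mon a b d \<in> carrier ?H" for a b d unfolding m using c by simp
  then show X: "book_mons \<subseteq> carrier ?H" by (auto simp: book_mons_def)
  have in_span: "book_mon a b d \<in> k_span ?H book_mons" for a b d
    by (rule k_span.base) (auto simp: book_mons_def)
  have r': "x \<otimes>\<^bsub>?H\<^esub> (x \<otimes>\<^bsub>?H\<^esub> z) = \<zero>\<^bsub>?H\<^esub>" "y \<otimes>\<^bsub>?H\<^esub> (y \<otimes>\<^bsub>?H\<^esub> z) = \<zero>\<^bsub>?H\<^esub>" "g \<otimes>\<^bsub>?H\<^esub> (g \<otimes>\<^bsub>?H\<^esub> z) = z"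
    "g \<otimes>\<^bsub>?H\<^esub> (x \<otimes>\<^bsub>?H\<^esub> z) = (- 1) \<odot>\<^bsub>?H\<^esub> (x \<otimes>\<^bsub>?H\<^esub> (g \<otimes>\<^bsub>?H\<^esub> z))"
    "g \<otimes>\<^bsub>?H\<^esub> (y \<otimes>\<^bsub>?H\<^esub> z) = (- 1) \<odot>\<^bsub>?H\<^esub> (y \<otimes>\<^bsub>?H\<^esub> (g \<otimes>\<^bsub>?H\<^esub> z))"
    "y \<otimes>\<^bsub>?H\<^esub> (x \<otimes>\<^bsub>?H\<^esub> z) = x \<otimes>\<^bsub>?H\<^esub> (y \<otimes>\<^bsub>?H\<^esub> z)" if z: "z \<in> carrier ?H" for z
    using z c by (simp_all add: H.m_assoc[symmetric] r H.smult_mult_left)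
  have px: "x \<otimes>\<^bsub>?H\<^esub> book_mon a b d = (if a then \<zero>\<^bsub>?H\<^esub> else book_mon True b d)" for a b d
    unfolding m using c r' by simp
  have py: "y \<otimes>\<^bsub>?H\<^esub> book_mon a b d = (if b then \<zero>\<^bsub>?H\<^esub> else book_mon a True d)" for a b d
    unfolding m using c r' by (cases a; cases b) simp_all
  \<comment> \<open>Moving \<open>g\<close> to the right past \<open>x^a y^b\<close> costs one sign
    per letter, so the signs cancel when \<open>a = b\<close>.\<close>
  have pg: "g \<otimes>\<^bsub>?H\<^esub> book_mon a b d = (if a = b then 1 else - 1) \<odot>\<^bsub>?H\<^esub> book_mon a b (\<not> d)" for a b d
    unfolding m using c r r' by (cases a; cases b; cases d) (simp_all add: H.smult_mult_left H.smult_mult_right H.smult_assoc1[symmetric])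
  show "carrier ?H \<subseteq> k_span ?H book_mons"
  proof (rule H.alg_generates_span[OF book_generates X])
    have "\<one>\<^bsub>?H\<^esub> = book_mon False False False" by (simp add: m)
    then show "\<one>\<^bsub>?H\<^esub> \<in> k_span ?H book_mons" using in_span by simp
    fix u v assume u: "u \<in> {?x, ?y, ?g}" and "v \<in> (book_mons :: (book_gen list \<Rightarrow>\<^sub>0 'k::field) set set)"
    then obtain a b d where v: "v = book_mon a b d" by (auto simp: book_mons_def)
    show "u \<otimes>\<^bsub>?H\<^esub> v \<in> k_span ?H book_mons"
      using u unfolding v xyg[symmetric]
      by (auto simp: px py pg intro!: in_span k_span.zero k_span.scale)
  qed
qed

lemma (in supermatrix) block_scalar_central:
  assumes M: "M \<in> carrier mat"
  shows "sh (\<lambda>p. p) (\<lambda>p. scal (f (blk p))) \<otimes>\<^bsub>mat\<^esub> M = M \<otimes>\<^bsub>mat\<^esub> sh (\<lambda>p. p) (\<lambda>p. scal (f (blk p)))"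
proof (intro ext)
  fix a b
  let ?D = "sh (\<lambda>p. p) (\<lambda>p. scal (f (blk p)))"
  have "(?D \<otimes>\<^bsub>mat\<^esub> M) a b = (\<Sum>l\<in>P. if l = a then scal (f (blk a)) * M a b else 0)"
    unfolding mat_simps by (rule sum.cong) (auto simp: shift_mat_def)
  also have "\<dots> = scal (f (blk a)) * M a b"
    using M finite_P by (auto simp: carrier_mat)
  finally have 1: "(?D \<otimes>\<^bsub>mat\<^esub> M) a b = scal (f (blk a)) * M a b" .
  have "(M \<otimes>\<^bsub>mat\<^esub> ?D) a b = (\<Sum>l\<in>P. if l = b then M a b * scal (f (blk b)) else 0)"
    unfolding mat_simps by (rule sum.cong) (auto simp: shift_mat_def)
  also have "\<dots> = M a b * scal (f (blk b))"
    using M finite_P by (auto simp: carrier_mat)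
  finally have 2: "(M \<otimes>\<^bsub>mat\<^esub> ?D) a b = M a b * scal (f (blk b))" .
  have "M a b = 0" if "blk a \<noteq> blk b"
  proof (cases "a \<in> P \<and> b \<in> P")
    case True
    then have "M a b \<in> W a b" using M by (simp add: carrier_mat)
    then show ?thesis using that by (simp add: entry_def)
  qed (use M in \<open>auto simp: carrier_mat\<close>)
  then show "(?D \<otimes>\<^bsub>mat\<^esub> M) a b = (M \<otimes>\<^bsub>mat\<^esub> ?D) a b"
    unfolding 1 2 by (cases "blk a = blk b") (auto simp: mult.commute)
qed

section \<open>Generators of the basic algebra\<close>

context qu_root
begin

sublocale RR: supermatrix reps fst par
  by unfold_locales (simp add: reps_def)

declare RR.mat_simps [simp del]

abbreviation "BB \<equiv> RR.mat :: ('k, _) module"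

definition swap :: "nat \<times> nat \<Rightarrow> nat \<times> nat" where
  "swap = (\<lambda>(b, i). (b, if i = 0 then hb b else 0))"

lemma repsE:
  assumes "p \<in> reps" obtains b where "p = (b, 0)" "b < N div 2" "par p" "swap p = (b, hb b)"
  | b where "p = (b, hb b)" "b < N div 2" "\<not> par p" "swap p = (b, 0)"
  using assms by (auto simp: reps_def par_def swap_def hb_def)

lemma swap_reps: "p \<in> reps \<Longrightarrow> swap p \<in> reps" "p \<in> reps \<Longrightarrow> swap (swap p) = p"
  "p \<in> reps \<Longrightarrow> par (swap p) = (\<not> par p)" "fst (swap p) = fst p"
  by (auto simp: reps_def par_def swap_def hb_def split: prod.splits)

definition "bX = RR.sh swap (\<lambda>p. dx)"
definition "bY = RR.sh swap (\<lambda>p. dy)"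
definition "bG = RR.sh (\<lambda>p. p) (\<lambda>p. scal (if par p then 1 else - 1))"
text \<open>Block \<open>b\<close> receives the scalar \<open>(q^2)^(z b)\<close>. As
  \<open>q^2\<close> is a primitive root of order \<open>N/2\<close>, the blocks correspond to the
  characters of the cyclic group, and this is its Fourier transform.\<close>

definition "bC z = RR.sh (\<lambda>p. p) (\<lambda>p. scal (q powi (2 * z * int (fst p))))"

lemma sh_comp_BB:
  "RR.sh \<sigma> f \<otimes>\<^bsub>BB\<^esub> RR.sh (\<lambda>p. p) g = RR.sh \<sigma> (\<lambda>p. f p * g p)"
  "RR.sh \<sigma> f \<otimes>\<^bsub>BB\<^esub> RR.sh swap g = RR.sh (\<lambda>p. \<sigma> (swap p)) (\<lambda>p. f (swap p) * g p)"
  by (rule RR.sh_mult; simp add: swap_reps)+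

lemma b_carrier: "bX \<in> carrier BB" "bY \<in> carrier BB" "bG \<in> carrier BB" "bC z \<in> carrier BB"
  unfolding bX_def bY_def bG_def bC_def
  by (rule RR.sh_mem; simp add: swap_reps entry_def)+

lemma b_relations:
  "bX \<otimes>\<^bsub>BB\<^esub> bX = \<zero>\<^bsub>BB\<^esub>" "bY \<otimes>\<^bsub>BB\<^esub> bY = \<zero>\<^bsub>BB\<^esub>" "bG \<otimes>\<^bsub>BB\<^esub> bG = \<one>\<^bsub>BB\<^esub>"
  "bG \<otimes>\<^bsub>BB\<^esub> bX = (- 1) \<odot>\<^bsub>BB\<^esub> (bX \<otimes>\<^bsub>BB\<^esub> bG)" "bG \<otimes>\<^bsub>BB\<^esub> bY = (- 1) \<odot>\<^bsub>BB\<^esub> (bY \<otimes>\<^bsub>BB\<^esub> bG)"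
  "bX \<otimes>\<^bsub>BB\<^esub> bY = bY \<otimes>\<^bsub>BB\<^esub> bX"
  unfolding bX_def bY_def bG_def sh_comp_BB RR.sh_smult RR.sh_one
    RR.sh_zero[of "\<lambda>p. swap (swap p)"]
  by (rule RR.sh_cong; simp add: swap_reps bidual_eq_iff)+

lemma bXY: "bX \<otimes>\<^bsub>BB\<^esub> bY = RR.sh (\<lambda>p. p) (\<lambda>p. dx * dy)"
  unfolding bX_def bY_def sh_comp_BB by (rule RR.sh_cong) (simp_all add: swap_reps)

lemma bC_mult: "bC a \<otimes>\<^bsub>BB\<^esub> bC b = bC (a + b)"
  unfolding bC_def sh_comp_BB
  by (rule RR.sh_cong) (simp_all add: distrib_left distrib_right powi_add scal_simps)

lemma bC_zero: "bC 0 = \<one>\<^bsub>BB\<^esub>"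
  unfolding bC_def RR.sh_one by (rule RR.sh_cong) (simp_all add: scal_simps)

lemma bC_cong: assumes "int (N div 2) dvd a - b" shows "bC a = bC b"
  unfolding bC_def
proof (rule RR.sh_cong)
  fix p
  obtain k where "a - b = int (N div 2) * k" using assms by blast
  then have "2 * a * int (fst p) - 2 * b * int (fst p) = int (2 * (N div 2)) * (k * int (fst p))"
    by (simp add: left_diff_distrib[symmetric] right_diff_distrib[symmetric] mult.assoc)
  then have "int N dvd 2 * a * int (fst p) - 2 * b * int (fst p)" unfolding N_even by simp
  then show "scal (q powi (2 * a * int (fst p))) = scal (q powi (2 * b * int (fst p)))"
    by (simp only: powi_eq_iff[THEN iffD2])
qed (rule refl)

lemma bC_central: "M \<in> carrier BB \<Longrightarrow> bC z \<otimes>\<^bsub>BB\<^esub> M = M \<otimes>\<^bsub>BB\<^esub> bC z"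
  unfolding bC_def by (rule RR.block_scalar_central[where f = "\<lambda>b. q powi (2 * z * int b)"])

text \<open>The sign operator separates the two positions of a block, \<open>bC 1\<close> separates
  the blocks, and \<open>bX bY\<close>, which is \<open>xy\<close> at every position, supplies the
  nilpotent element demanded by \<open>diagonal_munit\<close>.\<close>

lemma b_generates:
  assumes Y: "k_subalgebra BB Y" and gens: "bX \<in> Y" "bY \<in> Y" "bG \<in> Y" "bC 1 \<in> Y"
  shows "carrier BB \<subseteq> Y"
proof -
  interpret Y: supermatrix_subalgebra reps fst par Y by unfold_locales (rule Y)
  have diag: "munit p p r \<in> Y" if p: "p \<in> reps" and r: "r \<in> RR.W p p" for p r
  proof (rule Y.diagonal_munit[OF p _ Y.Y_closed(2)[OF gens(1,2), unfolded bXY] _ _ r])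
    fix p' assume p': "p' \<in> reps" "p' \<noteq> p"
    show "\<exists>d. RR.sh (\<lambda>p. p) d \<in> Y \<and> (\<forall>a\<in>reps. d a \<in> RR.W a a) \<and> c1 (d p) \<noteq> c1 (d p')"
    proof (cases "fst p = fst p'")
      case True
      then have "par p \<noteq> par p'" using RP.rep_unique[OF p p'(1)] p'(2) by blast
      then show ?thesis using gens(3) unfolding bG_def
        by (intro exI[of _ "\<lambda>p. scal (if par p then 1 else - 1)"]) (auto simp: entry_def)
    next
      case False
      have "q powi (2 * 1 * int (fst p)) \<noteq> q powi (2 * 1 * int (fst p'))"
      proof
        assume "q powi (2 * 1 * int (fst p)) = q powi (2 * 1 * int (fst p'))"
        then have "int N dvd 2 * 1 * int (fst p) - 2 * 1 * int (fst p')" by (simp only: powi_eq_iff)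
        moreover have "fst p < N div 2" "fst p' < N div 2" using p p' by (auto elim!: repsE)
        ultimately have "2 * 1 * int (fst p) - 2 * 1 * int (fst p') = 0"
          using N_even by (intro dvd_small) auto
        then show False using False by simp
      qed
      then show ?thesis using gens(4) unfolding bC_def
        by (intro exI[of _ "\<lambda>p. scal (q powi (2 * 1 * int (fst p)))"]) (simp add: entry_def)
    qed
  qed (simp_all add: entry_def)
  have one: "munit p p 1 \<in> Y" if "p \<in> reps" for p using diag[OF that] by (simp add: entry_def)
  show ?thesis
  proof (rule Y.all_munits[OF diag])
    fix p p' assume p: "p \<in> reps" "p' \<in> reps" "fst p = fst p'"
    show "munit p p' 1 \<in> Y" if "par p = par p'" using RP.rep_unique[OF p that] one[OF p(1)] by simp
    show "munit p p' dx \<in> Y \<and> munit p p' dy \<in> Y" if "par p \<noteq> par p'"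
    proof -
      \<comment> \<open>A block has one representative of each parity, so two of different parity
        are exchanged by \<open>swap\<close>, along which \<open>bX\<close> and \<open>bY\<close>
        carry \<open>x\<close> and \<open>y\<close>.\<close>
      have s: "p = swap p'"
        by (rule RP.rep_unique) (use p that swap_reps in auto)
      show ?thesis using Y.munit_Y(4)[OF p(2) gens(1)[unfolded bX_def] one[OF p(2)]]
          Y.munit_Y(4)[OF p(2) gens(2)[unfolded bY_def] one[OF p(2)]] by (simp add: s)
    qed
  qed
qed

text \<open>Each block contributes four entries with two coordinates. An inequality is enough, since
  only an upper bound on the spanning set by this dimension is required.\<close>

lemma card_coord_set_reps: "8 * (N div 2) \<le> card RR.coord_set"
proof -
  let ?r = "\<lambda>b s. (b, if s then 0 else hb b)"
  let ?f = "\<lambda>(b, s, s', t). (?r b s, ?r b s', t)"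
  let ?D = "{..<N div 2} \<times> (UNIV :: (bool \<times> bool \<times> bool) set)"
  have "inj_on ?f ?D" by (rule inj_onI) (auto simp: hb_def split: if_splits)
  moreover have "?f ` ?D \<subseteq> RR.coord_set" unfolding RR.coord_set_def by (auto simp: reps_def)
  ultimately have "card ?D \<le> card RR.coord_set" by (rule card_inj_on_le) (rule RR.finite_coord_set)
  then show ?thesis by (simp add: card_cartesian_product card_three_bools)
qed

section \<open>The isomorphism with the tensor product and the Hopf structure\<close>

abbreviation "CG \<equiv> integer_mod_group (N div 2)"

text \<open>The image of the group algebra consists of block scalars and is central, so the
  homomorphisms on the two factors multiply to one on the tensor product. It hits the generators of
  the matrix algebra, and \<open>8 * (N div 2)\<close> products of basis words bound the dimension
  of the source.\<close>

theorem tensor_iso_mat: "\<exists>f. f \<in> alg_iso (tensor_alg (book_alg (-1) 2 1) (monoid_alg CG)) BB"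
proof -
  let ?H = "book_alg (-1) 2 1 :: ('k, _) module" and ?A = "monoid_alg CG :: ('k, _) module"
  interpret CG: group CG by simp
  interpret H: k_algebra ?H by (rule k_algebra_book)
  interpret A: k_algebra ?A by (rule CG.k_algebra_monoid_alg)
  interpret HA: alg_pair ?H ?A by unfold_locales
  have pos: "0 < N div 2" using N_ge by simp
  obtain f where f: "f \<in> alg_hom ?H BB" "f (book_gens Book_x) = bX" "f (book_gens Book_y) = bY" "f (book_gens Book_g) = bG"
    using book_lift_hom[OF RR.k_algebra_mat b_carrier(1-3) b_relations]
      book_lift_gens[OF RR.k_algebra_mat b_carrier(1-3) b_relations] by blast
  let ?c = "lin_ext BB bC"
  have c: "?c \<in> alg_hom ?A BB"
  proof (rule lin_ext_alg_hom[OF RR.k_algebra_mat CG.monoid_axioms])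
    show "bC (x \<otimes>\<^bsub>CG\<^esub> y) = bC x \<otimes>\<^bsub>BB\<^esub> bC y" for x y
      unfolding bC_mult by (rule bC_cong) (simp add: mod_eq_dvd_iff[symmetric])
  qed (simp_all add: b_carrier bC_zero)
  note fs = alg_hom_closed[OF f(1)] alg_hom_add[OF f(1)] alg_hom_mult[OF f(1)] alg_hom_smult[OF f(1)] alg_hom_one[OF f(1)]
  note cs = alg_hom_closed[OF c] alg_hom_add[OF c] alg_hom_mult[OF c] alg_hom_smult[OF c] alg_hom_one[OF c]
  have c_single: "?c (Poly_Mapping.single z 1) = bC z" for z
    by (simp add: RR.M.lin_ext_single b_carrier)
  have central: "?c u \<otimes>\<^bsub>BB\<^esub> M = M \<otimes>\<^bsub>BB\<^esub> ?c u" if M: "M \<in> carrier BB" and u: "u \<in> carrier ?A" for M u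
  proof (rule lin_map_monoid_alg_eq[OF RR.M.k_space_axioms CG.monoid_axioms _ _ _ u])
    show "lin_map ?A BB (\<lambda>u. ?c u \<otimes>\<^bsub>BB\<^esub> M)"
      by (rule lin_mapI) (use M in \<open>simp_all add: cs RR.M.l_distr RR.M.smult_mult_left\<close>)
    show "lin_map ?A BB (\<lambda>u. M \<otimes>\<^bsub>BB\<^esub> ?c u)"
      by (rule lin_mapI) (use M in \<open>simp_all add: cs RR.M.r_distr RR.M.smult_mult_right\<close>)
  qed (simp only: c_single bC_central[OF M])
  let ?\<beta> = "\<lambda>h u. f h \<otimes>\<^bsub>BB\<^esub> ?c u"
  have bil: "bilinear_map ?H ?A BB ?\<beta>"
    by (rule bilinear_mapI)
      (simp_all add: fs cs RR.M.l_distr RR.M.r_distr RR.M.smult_mult_left RR.M.smult_mult_right)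
  let ?F = "tensor_lift BB ?\<beta>"
  have F: "?F \<in> alg_hom HA.T BB"
  proof (rule HA.tensor_lift_hom[OF RR.k_algebra_mat bil])
    fix a u a' u' assume h: "a \<in> carrier ?H" "u \<in> carrier ?A" "a' \<in> carrier ?H" "u' \<in> carrier ?A"
    have "f (a \<otimes>\<^bsub>?H\<^esub> a') \<otimes>\<^bsub>BB\<^esub> ?c (u \<otimes>\<^bsub>?A\<^esub> u') = f a \<otimes>\<^bsub>BB\<^esub> (f a' \<otimes>\<^bsub>BB\<^esub> ?c u) \<otimes>\<^bsub>BB\<^esub> ?c u'"
      using h by (simp add: fs cs RR.M.m_assoc)
    also have "f a' \<otimes>\<^bsub>BB\<^esub> ?c u = ?c u \<otimes>\<^bsub>BB\<^esub> f a'" using h by (simp only: central fs)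
    finally show "f (a \<otimes>\<^bsub>?H\<^esub> a') \<otimes>\<^bsub>BB\<^esub> ?c (u \<otimes>\<^bsub>?A\<^esub> u') = (f a \<otimes>\<^bsub>BB\<^esub> ?c u) \<otimes>\<^bsub>BB\<^esub> (f a' \<otimes>\<^bsub>BB\<^esub> ?c u')"
      using h by (simp add: fs cs RR.M.m_assoc)
  qed (simp add: fs cs)
  note Fp = HA.tensor_lift_pure[OF RR.M.k_space_axioms bil]
  have surj: "carrier BB \<subseteq> ?F ` carrier HA.T"
  proof (rule b_generates[OF alg_hom_image_subalgebra[OF HA.k_algebra_T F]])
    have 1: "f h \<in> ?F ` carrier HA.T" if "h \<in> carrier ?H" for h
      using that by (intro image_eqI[of _ _ "HA.t h \<one>\<^bsub>?A\<^esub>"]) (simp_all add: Fp cs fs)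
    show "bX \<in> ?F ` carrier HA.T" "bY \<in> ?F ` carrier HA.T" "bG \<in> ?F ` carrier HA.T"
      using 1[OF book_carrier(1)] 1[OF book_carrier(2)] 1[OF book_carrier(3)] by (simp_all only: f)
    have "Poly_Mapping.single 1 1 \<in> carrier ?A"
      by (rule single_in_monoid_alg) (use N_ge in \<open>auto simp: carrier_integer_mod_group\<close>)
    then show "bC 1 \<in> ?F ` carrier HA.T"
      by (intro image_eqI[of _ _ "HA.t \<one>\<^bsub>?H\<^esub> (Poly_Mapping.single 1 1)"]) (simp_all add: Fp fs c_single b_carrier)
  qed
  define X where "X = (\<lambda>z. Poly_Mapping.single z (1::'k)) ` carrier CG"
  let ?S = "(\<lambda>(h, u). HA.t h u) ` (book_mons \<times> X)"
  have fin: "finite (book_mons :: (book_gen list \<Rightarrow>\<^sub>0 'k) set set)" "finite X"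
    using pos by (simp_all add: book_mons_def X_def carrier_integer_mod_group)
  have X: "X \<subseteq> carrier ?A" "carrier ?A \<subseteq> k_span ?A X"
    unfolding X_def using monoid_alg_span by (auto intro: single_in_monoid_alg)
  have "card ?S \<le> card ((book_mons :: (book_gen list \<Rightarrow>\<^sub>0 'k) set set) \<times> X)" using fin by (intro card_image_le finite_cartesian_product)
  also have "\<dots> = card (book_mons :: (book_gen list \<Rightarrow>\<^sub>0 'k) set set) * card X" by (rule card_cartesian_product)
  also have "\<dots> \<le> 8 * (N div 2)"
  proof (rule mult_le_mono)
    have "card (book_mons :: (book_gen list \<Rightarrow>\<^sub>0 'k) set set) \<le> card (UNIV :: (bool \<times> bool \<times> bool) set)"
      unfolding book_mons_def by (rule card_image_le) simp
    then show "card (book_mons :: (book_gen list \<Rightarrow>\<^sub>0 'k) set set) \<le> 8" by (simp only: card_three_bools)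
    have "card X \<le> card (carrier CG)" unfolding X_def by (rule card_image_le) (use pos in \<open>simp add: carrier_integer_mod_group\<close>)
    then show "card X \<le> N div 2" using pos by (simp add: carrier_integer_mod_group)
  qed
  also have "\<dots> \<le> card RR.coord_set" by (rule card_coord_set_reps)
  finally have "card ?S \<le> card RR.coord_set" .
  moreover have "finite ?S" using fin by simp
  moreover have "?S \<subseteq> carrier HA.T"
    using HA.pure_closed[OF subsetD[OF book_span(1)] subsetD[OF X(1)]] by auto
  moreover have "carrier HA.T \<subseteq> k_span HA.T ?S" by (rule HA.tensor_span[OF book_span X])
  ultimately have "?F \<in> alg_iso HA.T BB" by (intro RR.surj_imp_alg_iso[OF HA.k_algebra_T F surj])
  then show ?thesis by blast
qed

theorem basic_algebra_hopf:
  assumes "is_basic_algebra (Qu_sl2 n q) B"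
  shows "\<exists>H :: ('k, 'b) hopf. module.truncate H = B \<and> hopf_algebra H \<and>
           hopf_isomorphic H (tensor_hopf (book_hopf (-1) 2 1) (group_hopf CG))"
proof -
  let ?H = "book_hopf (-1) 2 1 :: ('k, _) hopf" and ?A = "group_hopf CG :: ('k, _) hopf"
  interpret CG: group CG by simp
  interpret H: hopf_data ?H by (rule hopf_data_book)
  interpret A: hopf_data ?A by (rule hopf_data_group_hopf) (rule CG.group_axioms)
  interpret P: hopf_pair ?H ?A by unfold_locales
  let ?d = "\<lambda>z. Poly_Mapping.single z (1::'k)"
  let ?X = "{book_gens Book_x, book_gens Book_y, book_gens Book_g} :: (book_gen list \<Rightarrow>\<^sub>0 'k) set set"
  have gH: "alg_generates ?H ?X" unfolding book_hopf_eq using book_generates by simp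
  have gA: "alg_generates ?A (?d ` carrier CG)"
    unfolding group_hopf_def Let_def using alg_generates_monoid_alg[OF CG.monoid_axioms] by simp
  obtain f where f: "f \<in> alg_iso (tensor_alg (book_alg (-1) 2 1) (monoid_alg CG)) BB" using tensor_iso_mat by blast
  obtain g where g: "g \<in> alg_iso BB B" using basic_algebra_Qu[OF assms] by blast
  have "(\<lambda>x. g (f x)) \<in> alg_iso (tensor_alg (book_alg (-1) 2 1) (monoid_alg CG)) B" by (rule alg_iso_comp[OF f g])
  then have iso: "(\<lambda>x. g (f x)) \<in> alg_iso P.K B"
  proof -
    have "tensor_alg ?H ?A = tensor_alg (book_alg (-1) 2 1) (monoid_alg CG)"
      by (simp add: book_hopf_eq group_hopf_def Let_def)
    then show ?thesis unfolding P.tensor_hopf_eq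
      using \<open>(\<lambda>x. g (f x)) \<in> alg_iso (tensor_alg (book_alg (-1) 2 1) (monoid_alg CG)) B\<close>
      by (simp add: alg_iso_def alg_hom_def ring_hom_def)
  qed
  have one: "grouplike ?H \<one>\<^bsub>?H\<^esub>" "grouplike ?A \<one>\<^bsub>?A\<^esub>" by (rule H.grouplike_one A.grouplike_one)+
  show ?thesis
  proof (rule hopf_transport[OF P.hopf_data_tensor P.alg_generates_tensor[OF gH gA] _ _ iso])
    show "k_algebra B" using assms by (simp add: is_basic_algebra_def)
    fix h assume "h \<in> (\<lambda>x. P.p x \<one>\<^bsub>?A\<^esub>) ` ?X \<union> (\<lambda>y. P.p \<one>\<^bsub>?H\<^esub> y) ` ?d ` carrier CG"
    then consider "h = P.p (book_gens Book_x) \<one>\<^bsub>?A\<^esub>" | "h = P.p (book_gens Book_y) \<one>\<^bsub>?A\<^esub>"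
      | "h = P.p (book_gens Book_g) \<one>\<^bsub>?A\<^esub>" | z where "z \<in> carrier CG" "h = P.p \<one>\<^bsub>?H\<^esub> (?d z)" by blast
    then show "grouplike P.K h \<or> (\<exists>a b. skew_primitive P.K a b h)"
    proof cases
      case 1
      then show ?thesis using P.skew_primitive_tensor[OF book_skew(1)] by blast
    next
      case 2
      then show ?thesis using P.skew_primitive_tensor[OF book_skew(2)] by blast
    next
      case 3
      then show ?thesis using P.grouplike_tensor[OF book_grouplike one(2)] by blast
    next
      case 4
      then show ?thesis using P.grouplike_tensor[OF one(1) grouplike_group_hopf[OF CG.group_axioms]] by blast
    qed
  qed
qed

end

theorem proposition2p15:
  fixes n :: nat
    and q :: "'k::{alg_closed_field, field_char_0}"
    and B :: "('k, 'b) module"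
  assumes "0 < n" and "4 dvd n"
    and "primitive_root_of_unity (n ^ 2) q"
    and "is_basic_algebra (Qu_sl2 n q) B"
  shows "\<exists>H :: ('k, 'b) hopf. module.truncate H = B \<and> hopf_algebra H \<and>
           hopf_isomorphic H
             (tensor_hopf (book_hopf (-1) 2 1) (group_hopf (integer_mod_group (n ^ 2 div 2))))"
proof -
  interpret qu_root n q by unfold_locales (rule assms)+
  show ?thesis using basic_algebra_hopf[OF assms(4)] by (simp only: N_def)
qed

end
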